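(* Let $X^0=X$, $X^k$, $v^k$ ($k\ge1$) and, for $m\in\mathbb{N}^\star$, the finite-dimensional truncated system $(X^{0,m},X^{1,m},\dots,X^{m,m})$ be as defined in the context. Set $\bar X^m_t:=\sum_{k=1}^mv_t^kX_t^k$. Then $$\lim_{m\to\infty}\mathbb{E}\Big[\sup_{t\in[0,T]}\big|X_t^{0,m}-\bar X_t^m\big|^2\Big]=0,\qquad\lim_{m\to\infty}\mathbb{E}\big[|X_t^{0,m}-X_t^0|^2\big]=0\quad\text{for all }t\in[0,T].$$
   Context: Fix $T>0$, $d\ge1$, a Polish space $A$. Let $H=W^{1,2}([0,T])$ (real-valued Sobolev functions) with $\langle\mathbf{x},\mathbf{y}\rangle_H=\int_0^T\mathbf{x}\mathbf{y}\,dt+\int_0^T\mathbf{x}'\mathbf{y}'\,dt$; elements are identified with their continuous representatives, and $\mathbf{x}^t$ is the value at $t$. Let $b:[0,T]^2\times\mathbb{R}\times A\to\mathbb{R}$ and $\sigma:[0,T]^2\times\mathbb{R}\times A\to\mathbb{R}^{1\times d}$, written $b_r(s,x,a)$, $\sigma_r(s,x,a)$, be continuous. Standing assumption: $b_r(\cdot,x,a)\in H$ and $\sigma_r(\cdot,x,a)\in\mathcal{L}(\mathbb{R}^d,H)$, and $x\mapsto b_r(\cdot,x,a)$, $x\mapsto\sigma_r(\cdot,x,a)$ are Lipschitz-continuous and of linear growth as $H$-valued, resp. $\mathcal{L}(\mathbb{R}^d,H)$-valued, mappings, uniformly in $(r,a)$. $W$ is a standard $d$-dimensional Brownian motion on $(\Omega,\mathcal{F},\mathbb{P})$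 with natural filtration $\mathbb{F}^W$, and $\alpha$ is a fixed $\mathbb{F}^W$-progressively measurable $A$-valued control. Let $x_0\in\mathbb{R}$ and let $\mathbf{x}\in H$ be the constant function equal to $x_0$. The process $X$ solves the Volterra equation $X_t=x_0+\int_0^tb_r(t,X_r,\alpha_r)dr+\int_0^t\sigma_r(t,X_r,\alpha_r)dW_r$, and the $H$-valued process $\mathbf{X}$ solves $\mathbf{X}_t=\mathbf{x}+\int_0^tb_r(\cdot,\mathbf{X}_r^r,\alpha_r)dr+\int_0^t\sigma_r(\cdot,\mathbf{X}_r^r,\alpha_r)dW_r$, so that $X_t=\mathbf{X}_t^t$. For each $t\in[0,T]$, $v_t\in H$ is the Riesz representative of evaluation at $t$: $\langle v_t,\mathbf{x}\rangle_H=\mathbf{x}^t$ for all $\mathbf{x}\in H$. Let $(e_k)_{k\ge1}$ be an orthonormal basis of $H$, and set $v_t^k:=\langle v_t,e_k\rangle_H$, $X_t^k:=\langle\mathbf{X}_t,e_k\rangle_H$, $x_k:=\langle\mathbf{x},e_k\rangle_H$, $b_t^k(x,a):=\langle b_t(\cdot,x,a),e_k\rangle_H$, $\sigma_t^k(x,a):=\langle\sigma_t(\cdot,x,a),e_k\rangle_H$ (componentwise in $\mathbb{R}^d$); $\partial_tv_t^k$ denotes the derivative of $t\mapsto v_t^k$. Write $X^0:=X$. Then $X_t^0=\sum_{k\ge1}v_t^kX_t^k$ and $X_t^k=x_k+\int_0^tb_r^k(X_r^0,\alpha_r)dr+\int_0^t\sigma_r^k(X_r^0,\alpha_r)dW_r$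 for $k\ge1$. For $m\in\mathbb{N}^\star$, the truncated system is $$X_t^{0,m}=x_0+\int_0^t\Big(\sum_{k=1}^m\partial_tv_r^kX_r^{k,m}+\sum_{k=1}^mv_r^kb_r^k(X_r^{0,m},\alpha_r)\Big)dr+\int_0^t\sum_{k=1}^mv_r^k\sigma_r^k(X_r^{0,m},\alpha_r)dW_r,$$ $$X_t^{k,m}=x_k+\int_0^tb_r^k(X_r^{0,m},\alpha_r)dr+\int_0^t\sigma_r^k(X_r^{0,m},\alpha_r)dW_r,\quad k\in\{1,\dots,m\}.$$ *)

theory Defs
  imports "HOL-Probability.Probability"
begin

section \<open>The Sobolev space $W^{1,2}([0,T])$\<close>

text \<open>
  The derivative in $W^{1,2}$ is the weak one, tested against $C^1_c(0,T)$ as in Brezis,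
  \<^emph>\<open>Functional Analysis, Sobolev Spaces and PDE\<close>, Section 8.2 (testing against
  $C^\infty_c(0,T)$ gives the same notion). It is determined up to a Lebesgue null set.
\<close>

definition weak_deriv :: "real \<Rightarrow> (real \<Rightarrow> real) \<Rightarrow> (real \<Rightarrow> real) \<Rightarrow> bool" where
  "weak_deriv T f g \<longleftrightarrow>
     set_borel_measurable lborel {0..T} g \<and>
     set_integrable lborel {0..T} (\<lambda>t. (g t)\<^sup>2) \<and>
     (\<forall>\<phi>. \<phi> C1_differentiable_on UNIV \<and>
          (\<exists>c d. 0 < c \<and> d < T \<and> (\<forall>t. t \<notin> {c..d} \<longrightarrow> \<phi> t = 0)) \<longrightarrow>
        (LINT t:{0..T}|lborel. f t * deriv \<phi> t) = - (LINT t:{0..T}|lborel. g t * \<phi> t))"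

text \<open>Elements of the Sobolev space are represented by their continuous representatives;
  only the values on \<open>{0..T}\<close> are relevant.\<close>

definition sobolev :: "real \<Rightarrow> (real \<Rightarrow> real) set" where
  "sobolev T = {f. continuous_on {0..T} f \<and> (\<exists>g. weak_deriv T f g)}"

definition wderiv :: "real \<Rightarrow> (real \<Rightarrow> real) \<Rightarrow> real \<Rightarrow> real" where
  "wderiv T f = (SOME g. weak_deriv T f g)"

text \<open>
  Since \<open>T\<close> is a term variable, $H = W^{1,2}([0,T])$ cannot itself be a type. It is given as a
  Hilbert space type \<open>'h\<close> together with the map \<open>val\<close> sending an element of \<open>'h\<close> to the Sobolev
  function it stands for: \<open>val h t\<close> is the value at time \<open>t\<close>. Up to equality on \<open>{0..T}\<close> the map
  is a linear bijection onto \<^term>\<open>sobolev T\<close>, and it carries the inner product of \<open>'h\<close> to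
  $\int_0^T x y\,dt + \int_0^T x' y'\,dt$. As $W^{1,2}([0,T])$ is an infinite-dimensional
  separable Hilbert space for each $T > 0$, any type isometric to $\ell^2$ admits such a map.
\<close>

definition sobolev_model ::
  "real \<Rightarrow> ('h::{real_inner, banach, second_countable_topology} \<Rightarrow> real \<Rightarrow> real) \<Rightarrow> bool" where
  "sobolev_model T val \<longleftrightarrow>
     (\<forall>h. val h \<in> sobolev T) \<and>
     (\<forall>f\<in>sobolev T. \<exists>!h. \<forall>t\<in>{0..T}. val h t = f t) \<and>
     (\<forall>h h'. \<forall>t\<in>{0..T}. val (h + h') t = val h t + val h' t) \<and>
     (\<forall>c h. \<forall>t\<in>{0..T}. val (c *\<^sub>R h) t = c * val h t) \<and>
     (\<forall>h h'. inner h h' =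
        (LINT t:{0..T}|lborel. val h t * val h' t) +
        (LINT t:{0..T}|lborel. wderiv T (val h) t * wderiv T (val h') t))"

definition to_sobolev ::
  "real \<Rightarrow> ('h::{real_inner, banach, second_countable_topology} \<Rightarrow> real \<Rightarrow> real) \<Rightarrow>
    (real \<Rightarrow> real) \<Rightarrow> 'h" where
  "to_sobolev T val f = (THE h. \<forall>t\<in>{0..T}. val h t = f t)"

text \<open>The families $(e_k)$ are indexed by $k \ge 1$.\<close>

definition orthonormal_basis :: "(nat \<Rightarrow> 'h::real_inner) \<Rightarrow> bool" where
  "orthonormal_basis e \<longleftrightarrow>
     (\<forall>j\<ge>1. \<forall>k\<ge>1. inner (e j) (e k) = (if j = k then 1 else 0)) \<and>
     closure (span (e ` {1..})) = UNIV"


section \<open>Brownian motion and its filtration\<close>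

definition natural_sigma ::
  "'w measure \<Rightarrow> (real \<Rightarrow> 'w \<Rightarrow> 'b::topological_space) \<Rightarrow> real \<Rightarrow> 'w measure" where
  "natural_sigma M W t =
     sigma (space M) {W s -` B \<inter> space M | s B. 0 \<le> s \<and> s \<le> t \<and> B \<in> sets borel}"

text \<open>
  The natural filtration is augmented by the null sets, as usual for stochastic integration
  (continuous versions of stochastic integrals are adapted only to the augmented filtration).
\<close>

definition natural_filtration ::
  "'w measure \<Rightarrow> (real \<Rightarrow> 'w \<Rightarrow> 'b::topological_space) \<Rightarrow> real \<Rightarrow> 'w measure" where
  "natural_filtration M W t = sigma (space M) (sets (natural_sigma M W t) \<union> null_sets M)"

definition brownian_motion :: "'w measure \<Rightarrow> (real \<Rightarrow> 'w \<Rightarrow> real ^ 'd) \<Rightarrow> bool" where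
  "brownian_motion M W \<longleftrightarrow>
     prob_space M \<and>
     (\<forall>t\<ge>0. W t \<in> borel_measurable M) \<and>
     (AE \<omega> in M. W 0 \<omega> = 0) \<and>
     (AE \<omega> in M. continuous_on {0..} (\<lambda>t. W t \<omega>)) \<and>
     (\<forall>s t. 0 \<le> s \<and> s < t \<longrightarrow>
        prob_space.indep_set M (sets (natural_sigma M W s))
          {(\<lambda>\<omega>. W t \<omega> - W s \<omega>) -` B \<inter> space M | B. B \<in> sets borel} \<and>
        prob_space.indep_vars M (\<lambda>_. borel) (\<lambda>j \<omega>. (W t \<omega> - W s \<omega>) $ j) UNIV \<and>
        (\<forall>j. distributed M lborel (\<lambda>\<omega>. (W t \<omega> - W s \<omega>) $ j)
               (normal_density 0 (sqrt (t - s)))))"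

definition progressive ::
  "(real \<Rightarrow> 'w measure) \<Rightarrow> real \<Rightarrow> (real \<Rightarrow> 'w \<Rightarrow> 'b::topological_space) \<Rightarrow> bool" where
  "progressive F T Y \<longleftrightarrow>
     (\<forall>t\<in>{0..T}. (\<lambda>(s, \<omega>). Y s \<omega>) \<in>
        borel_measurable (restrict_space borel {0..t} \<Otimes>\<^sub>M F t))"

definition continuous_process ::
  "'w measure \<Rightarrow> (real \<Rightarrow> 'w measure) \<Rightarrow> real \<Rightarrow> (real \<Rightarrow> 'w \<Rightarrow> 'b::topological_space) \<Rightarrow> bool" where
  "continuous_process M F T Y \<longleftrightarrow>
     progressive F T Y \<and> (AE \<omega> in M. continuous_on {0..T} (\<lambda>t. Y t \<omega>))"


section \<open>The Ito integral\<close>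

text \<open>
  The integral is defined for integrands with values in a separable Hilbert space \<open>'h\<close>
  tensored with $\mathbb{R}^d$: an element \<open>S\<close> of \<open>'h ^ 'd\<close> stands for the operator
  $u \mapsto \sum_j u_j S_j$ in $\mathcal{L}(\mathbb{R}^d, H)$, and its norm is the
  Hilbert--Schmidt norm. For \<open>'h = real\<close> this is the row vector space $\mathbb{R}^{1\times d}$.
  Measurability is required columnwise.
\<close>

definition app_op :: "'h::real_normed_vector ^ 'd \<Rightarrow> real ^ 'd \<Rightarrow> 'h" where
  "app_op S u = (\<Sum>j\<in>UNIV. (u $ j) *\<^sub>R (S $ j))"

definition simple_integrand ::
  "(real \<Rightarrow> 'w measure) \<Rightarrow> real \<Rightarrow> nat \<Rightarrow> (nat \<Rightarrow> real) \<Rightarrow>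
    (nat \<Rightarrow> 'w \<Rightarrow> 'h::real_normed_vector ^ 'd) \<Rightarrow> bool" where
  "simple_integrand F T n \<tau> \<xi> \<longleftrightarrow>
     (\<forall>i<n. 0 \<le> \<tau> i \<and> \<tau> i \<le> \<tau> (Suc i) \<and> \<tau> (Suc i) \<le> T) \<and>
     (\<forall>i<n. (\<forall>j. (\<lambda>\<omega>. \<xi> i \<omega> $ j) \<in> borel_measurable (F (\<tau> i))) \<and>
            (\<exists>C. \<forall>\<omega>. norm (\<xi> i \<omega>) \<le> C))"

definition simple_value ::
  "nat \<Rightarrow> (nat \<Rightarrow> real) \<Rightarrow> (nat \<Rightarrow> 'w \<Rightarrow> 'h::real_normed_vector ^ 'd) \<Rightarrow>
    real \<Rightarrow> 'w \<Rightarrow> 'h ^ 'd" where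
  "simple_value n \<tau> \<xi> t \<omega> = (\<Sum>i<n. indicat_real {\<tau> i<..\<tau> (Suc i)} t *\<^sub>R \<xi> i \<omega>)"

definition simple_integral ::
  "(real \<Rightarrow> 'w \<Rightarrow> real ^ 'd) \<Rightarrow> nat \<Rightarrow> (nat \<Rightarrow> real) \<Rightarrow>
    (nat \<Rightarrow> 'w \<Rightarrow> 'h::real_normed_vector ^ 'd) \<Rightarrow> real \<Rightarrow> 'w \<Rightarrow> 'h" where
  "simple_integral W n \<tau> \<xi> t \<omega> =
     (\<Sum>i<n. app_op (\<xi> i \<omega>) (W (min t (\<tau> (Suc i))) \<omega> - W (min t (\<tau> i)) \<omega>))"

definition null_in_prob :: "'w measure \<Rightarrow> (nat \<Rightarrow> 'w \<Rightarrow> real) \<Rightarrow> bool" where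
  "null_in_prob M Z \<longleftrightarrow>
     (\<forall>\<epsilon>>0. (\<lambda>n. measure M {\<omega> \<in> space M. \<epsilon> < Z n \<omega>}) \<longlonglongrightarrow> 0)"

text \<open>
  \<open>ito_integral M F W T \<phi> I\<close>: the process \<open>I\<close> is a continuous version on \<open>{0..T}\<close> of the Ito
  integral $\int_0^\cdot \varphi_r\,dW_r$, for progressively measurable \<open>\<phi>\<close> with
  $\int_0^T \|\varphi_r\|^2 dr < \infty$ almost surely (no moment assumption).
\<close>

definition ito_integral ::
  "'w measure \<Rightarrow> (real \<Rightarrow> 'w measure) \<Rightarrow> (real \<Rightarrow> 'w \<Rightarrow> real ^ 'd) \<Rightarrow> real \<Rightarrow>
    (real \<Rightarrow> 'w \<Rightarrow> 'h::{real_inner, banach, second_countable_topology} ^ 'd) \<Rightarrow>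
    (real \<Rightarrow> 'w \<Rightarrow> 'h) \<Rightarrow> bool" where
  "ito_integral M F W T \<phi> I \<longleftrightarrow>
     (\<forall>j. progressive F T (\<lambda>t \<omega>. \<phi> t \<omega> $ j)) \<and>
     (AE \<omega> in M. set_integrable lborel {0..T} (\<lambda>t. (norm (\<phi> t \<omega>))\<^sup>2)) \<and>
     continuous_process M F T I \<and>
     (\<exists>n \<tau> \<xi>. (\<forall>k. simple_integrand F T (n k) (\<tau> k) (\<xi> k)) \<and>
        null_in_prob M (\<lambda>k \<omega>. LINT t:{0..T}|lborel.
          (norm (simple_value (n k) (\<tau> k) (\<xi> k) t \<omega> - \<phi> t \<omega>))\<^sup>2) \<and>
        (\<forall>t\<in>{0..T}. null_in_prob M (\<lambda>k \<omega>.
          norm (simple_integral W (n k) (\<tau> k) (\<xi> k) t \<omega> - I t \<omega>))))"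

text \<open>
  \<open>ito_process M F W T x \<beta> \<phi> X\<close>: the continuous process \<open>X\<close> satisfies
  $X_t = x + \int_0^t \beta_r\,dr + \int_0^t \varphi_r\,dW_r$ on \<open>{0..T}\<close>; the first
  integral is a Bochner integral.
\<close>

definition ito_process ::
  "'w measure \<Rightarrow> (real \<Rightarrow> 'w measure) \<Rightarrow> (real \<Rightarrow> 'w \<Rightarrow> real ^ 'd) \<Rightarrow> real \<Rightarrow> 'h \<Rightarrow>
    (real \<Rightarrow> 'w \<Rightarrow> 'h) \<Rightarrow> (real \<Rightarrow> 'w \<Rightarrow> 'h ^ 'd) \<Rightarrow>
    (real \<Rightarrow> 'w \<Rightarrow> 'h::{real_inner, banach, second_countable_topology}) \<Rightarrow> bool" where
  "ito_process M F W T x \<beta> \<phi> X \<longleftrightarrow>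
     continuous_process M F T X \<and>
     progressive F T \<beta> \<and>
     (AE \<omega> in M. set_integrable lborel {0..T} (\<lambda>r. \<beta> r \<omega>)) \<and>
     (\<exists>I. ito_integral M F W T \<phi> I \<and>
        (AE \<omega> in M. \<forall>t\<in>{0..T}. X t \<omega> = x + (LINT r:{0..t}|lborel. \<beta> r \<omega>) + I t \<omega>))"


section \<open>The Volterra equation, its lift to $H$ and the truncated system\<close>

text \<open>Coefficients are written \<open>b r s x a\<close> for $b_r(s,x,a)$, where \<open>s\<close> is the variable of the
  Sobolev function.\<close>

definition volterra_solution ::
  "'w measure \<Rightarrow> (real \<Rightarrow> 'w measure) \<Rightarrow> (real \<Rightarrow> 'w \<Rightarrow> real ^ 'd) \<Rightarrow> real \<Rightarrow> real \<Rightarrow>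
    (real \<Rightarrow> real \<Rightarrow> real \<Rightarrow> 'a \<Rightarrow> real) \<Rightarrow> (real \<Rightarrow> real \<Rightarrow> real \<Rightarrow> 'a \<Rightarrow> real ^ 'd) \<Rightarrow>
    (real \<Rightarrow> 'w \<Rightarrow> 'a) \<Rightarrow> (real \<Rightarrow> 'w \<Rightarrow> real) \<Rightarrow> bool" where
  "volterra_solution M F W T x0 b \<sigma> \<alpha> X \<longleftrightarrow>
     continuous_process M F T X \<and>
     (\<forall>t\<in>{0..T}.
        (AE \<omega> in M. set_integrable lborel {0..t} (\<lambda>r. b r t (X r \<omega>) (\<alpha> r \<omega>))) \<and>
        (\<exists>I. ito_integral M F W t (\<lambda>r \<omega>. \<sigma> r t (X r \<omega>) (\<alpha> r \<omega>)) I \<and>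
           (AE \<omega> in M. X t \<omega> =
              x0 + (LINT r:{0..t}|lborel. b r t (X r \<omega>) (\<alpha> r \<omega>)) + I t \<omega>)))"

definition lift_drift ::
  "real \<Rightarrow> ('h::{real_inner, banach, second_countable_topology} \<Rightarrow> real \<Rightarrow> real) \<Rightarrow>
    (real \<Rightarrow> real \<Rightarrow> real \<Rightarrow> 'a \<Rightarrow> real) \<Rightarrow> real \<Rightarrow> real \<Rightarrow> 'a \<Rightarrow> 'h" where
  "lift_drift T val b r x a = to_sobolev T val (\<lambda>s. b r s x a)"

definition lift_vol ::
  "real \<Rightarrow> ('h::{real_inner, banach, second_countable_topology} \<Rightarrow> real \<Rightarrow> real) \<Rightarrow>
    (real \<Rightarrow> real \<Rightarrow> real \<Rightarrow> 'a \<Rightarrow> real ^ 'd) \<Rightarrow> real \<Rightarrow> real \<Rightarrow> 'a \<Rightarrow> 'h ^ 'd" where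
  "lift_vol T val \<sigma> r x a = (\<chi> j. to_sobolev T val (\<lambda>s. \<sigma> r s x a $ j))"

text \<open>Continuity, values in \<open>H\<close>, and Lipschitz continuity and linear growth in \<open>x\<close> uniformly in
  \<open>(r, a)\<close>; \<open>onorm (app_op S)\<close> is the norm of \<open>S\<close> in $\mathcal{L}(\mathbb{R}^d, H)$.\<close>

definition standing_assumption ::
  "real \<Rightarrow> ('h::{real_inner, banach, second_countable_topology} \<Rightarrow> real \<Rightarrow> real) \<Rightarrow>
    (real \<Rightarrow> real \<Rightarrow> real \<Rightarrow> 'a::polish_space \<Rightarrow> real) \<Rightarrow>
    (real \<Rightarrow> real \<Rightarrow> real \<Rightarrow> 'a \<Rightarrow> real ^ 'd) \<Rightarrow> bool" where
  "standing_assumption T val b \<sigma> \<longleftrightarrow>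
     continuous_on ({0..T} \<times> {0..T} \<times> UNIV \<times> UNIV) (\<lambda>(r, s, x, a). b r s x a) \<and>
     continuous_on ({0..T} \<times> {0..T} \<times> UNIV \<times> UNIV) (\<lambda>(r, s, x, a). \<sigma> r s x a) \<and>
     (\<forall>r\<in>{0..T}. \<forall>x a. (\<lambda>s. b r s x a) \<in> sobolev T \<and>
                        (\<forall>j. (\<lambda>s. \<sigma> r s x a $ j) \<in> sobolev T)) \<and>
     (\<exists>L. \<forall>r\<in>{0..T}. \<forall>a x y.
        norm (lift_drift T val b r x a - lift_drift T val b r y a) \<le> L * \<bar>x - y\<bar> \<and>
        onorm (app_op (lift_vol T val \<sigma> r x a - lift_vol T val \<sigma> r y a)) \<le> L * \<bar>x - y\<bar> \<and>
        norm (lift_drift T val b r x a) \<le> L * (1 + \<bar>x\<bar>) \<and>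
        onorm (app_op (lift_vol T val \<sigma> r x a)) \<le> L * (1 + \<bar>x\<bar>))"

text \<open>With \<open>B = lift_drift T val b\<close> and \<open>S = lift_vol T val \<sigma>\<close>, these are $b^k_r(x,a)$ and
  $\sigma^k_r(x,a)$.\<close>

definition drift_coeff ::
  "(real \<Rightarrow> real \<Rightarrow> 'a \<Rightarrow> 'h::real_inner) \<Rightarrow> (nat \<Rightarrow> 'h) \<Rightarrow> nat \<Rightarrow> real \<Rightarrow> real \<Rightarrow> 'a \<Rightarrow> real" where
  "drift_coeff B e k r x a = inner (B r x a) (e k)"

definition vol_coeff ::
  "(real \<Rightarrow> real \<Rightarrow> 'a \<Rightarrow> 'h::real_inner ^ 'd) \<Rightarrow> (nat \<Rightarrow> 'h) \<Rightarrow> nat \<Rightarrow> real \<Rightarrow> real \<Rightarrow> 'a \<Rightarrow>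
    real ^ 'd" where
  "vol_coeff S e k r x a = (\<chi> j. inner (S r x a $ j) (e k))"

text \<open>
  The order-\<open>m\<close> system for \<open>Y 0, Y 1, \<dots>, Y m\<close>, with coefficients \<open>vk k t\<close> for $v^k_t$ and
  initial values \<open>xk k\<close> for $x_k$. The functions $v^k$ belong to $W^{1,2}([0,T])$, so
  $\partial_t v^k$ is the Sobolev derivative, which exists only almost everywhere in \<open>t\<close>.
\<close>

definition truncated_system ::
  "'w measure \<Rightarrow> (real \<Rightarrow> 'w measure) \<Rightarrow> (real \<Rightarrow> 'w \<Rightarrow> real ^ 'd) \<Rightarrow> real \<Rightarrow>
    real \<Rightarrow> (nat \<Rightarrow> real) \<Rightarrow> (nat \<Rightarrow> real \<Rightarrow> real) \<Rightarrow>
    (nat \<Rightarrow> real \<Rightarrow> real \<Rightarrow> 'a \<Rightarrow> real) \<Rightarrow> (nat \<Rightarrow> real \<Rightarrow> real \<Rightarrow> 'a \<Rightarrow> real ^ 'd) \<Rightarrow>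
    (real \<Rightarrow> 'w \<Rightarrow> 'a) \<Rightarrow> nat \<Rightarrow> (nat \<Rightarrow> real \<Rightarrow> 'w \<Rightarrow> real) \<Rightarrow> bool" where
  "truncated_system M F W T x0 xk vk bk \<sigma>k \<alpha> m Y \<longleftrightarrow>
     ito_process M F W T x0
       (\<lambda>r \<omega>. (\<Sum>k=1..m. wderiv T (vk k) r * Y k r \<omega>) +
               (\<Sum>k=1..m. vk k r * bk k r (Y 0 r \<omega>) (\<alpha> r \<omega>)))
       (\<lambda>r \<omega>. \<Sum>k=1..m. vk k r *\<^sub>R \<sigma>k k r (Y 0 r \<omega>) (\<alpha> r \<omega>))
       (Y 0) \<and>
     (\<forall>k\<in>{1..m}. ito_process M F W T (xk k)
       (\<lambda>r \<omega>. bk k r (Y 0 r \<omega>) (\<alpha> r \<omega>))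
       (\<lambda>r \<omega>. \<sigma>k k r (Y 0 r \<omega>) (\<alpha> r \<omega>))
       (Y k))"

end

theory Submission
  imports Defs
begin

text \<open>
  Applying the product rule to each $v^k X^{k,m}$ shows that the truncated system satisfies
  $X^{0,m}_t = c_m + \sum_{k\le m} v^k_t X^{k,m}_t$, where $c_m = x_0 - \sum_{k\le m} v^k_0 x_k$
  tends to $0$. With $Z^k = X^{k,m} - X^k$ and $P_m$ the projection on the span of
  $e_1, \dots, e_m$ this gives
  $X^{0,m}_t - X^0_t = c_m + \sum_{k\le m} v^k_t Z^k_t - \langle v_t, \mathbf{X}_t - P_m \mathbf{X}_t\rangle$.
  The coefficients are Lipschitz and $\|v_t\|$ is bounded, so Bessel's inequality, Doob's
  inequality and Gronwall's lemma bound $\sum_{k\le m} E \sup |Z^k|^2$ by a multiple of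
  $c_m^2 + \int_0^T E \|\mathbf{X}_r - P_m \mathbf{X}_r\|^2 dr$, which tends to $0$ by dominated
  convergence. Both claims follow, because $\bar X^m - X^{0,m} = -c_m - \sum_{k\le m} v^k Z^k$.

  Localisation does not use stopping times. All second moments are first taken with the weight
  $1_{\{\int_0^t \psi_r\,dr \le K\}}$, which is nonincreasing in \<open>t\<close>; it makes every term
  finite in Gronwall's lemma, and monotone convergence removes it afterwards.
\<close>

section \<open>Weak derivatives on an interval\<close>

text \<open>Neither \<open>ito_process\<close> nor \<open>volterra_solution\<close> carries a moment
  assumption, and \<open>ito_integral\<close> identifies the integral only through limits in
  probability at single times. So both the isometry and the maximal inequality are proved for step
  integrands on finite grids, from the independence of Brownian increments, and reach general
  integrands through Fatou's lemma, with constants that do not see the number of times. A supremum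
  over all times is recovered from path continuity. Dimension is the other obstacle: the estimates
  sum squares over the first \<open>m\<close> coordinates before anything is bounded, and Bessel's
  inequality keeps the constants free of \<open>m\<close>. The identity X^0_t = <v_t, XX_t> is not
  among the hypotheses; it is a uniqueness statement, since for fixed \<open>t\<close> the
  difference of the two sides solves an equation whose coefficients are Lipschitz in that difference
  at earlier times. Weak derivatives need their own treatment because the product rule uses
  increments of v^k, while the hypotheses speak only of test functions.\<close>

lemma has_real_derivative_mult_abs:
  "((\<lambda>x::real. x * \<bar>x\<bar>) has_real_derivative 2 * \<bar>x\<bar>) (at x)"
proof (cases "x = 0")
  case True
  have "((\<lambda>h::real. \<bar>h\<bar>) \<longlongrightarrow> 0) (at 0)"
    using tendsto_rabs_zero[OF tendsto_ident_at] by simp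
  then have "((\<lambda>h::real. (h * \<bar>h\<bar>) / h) \<longlongrightarrow> 0) (at 0)"
    by (rule Lim_transform_eventually) (auto simp: eventually_at_filter)
  then show ?thesis unfolding True by (simp add: DERIV_def)
next
  case False
  define c where "c = sgn x"
  have "((\<lambda>x. x * (c * x)) has_real_derivative 2 * \<bar>x\<bar>) (at x)"
    by (auto intro!: derivative_eq_intros simp: c_def abs_sgn)
  moreover have "eventually (\<lambda>y. y * (c * y) = y * \<bar>y\<bar>) (nhds x)"
  proof (cases "0 < x")
    case True
    then show ?thesis
      by (intro eventually_mono[OF eventually_nhds_in_open[of "{0<..}" x]]) (auto simp: c_def)
  next
    case neg: False
    then show ?thesis using False
      by (intro eventually_mono[OF eventually_nhds_in_open[of "{..<0}" x]]) (auto simp: c_def)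
  qed
  ultimately show ?thesis by (subst (asm) DERIV_cong_ev[OF refl _ refl])
qed

text \<open>A continuously differentiable step and its derivative: differences of rescaled ramps are the
  test functions that turn the weak derivative into increments.\<close>

definition ramp :: "real \<Rightarrow> real" where
  "ramp x = x * \<bar>x\<bar> - 2 * ((x - 1/2) * \<bar>x - 1/2\<bar>) + (x - 1) * \<bar>x - 1\<bar> + 1/2"

definition hat :: "real \<Rightarrow> real" where
  "hat x = 2 * \<bar>x\<bar> - 4 * \<bar>x - 1/2\<bar> + 2 * \<bar>x - 1\<bar>"

lemma ramp_deriv: "(ramp has_real_derivative hat x) (at x)"
proof -
  have 1: "((\<lambda>x. (x - a) * \<bar>x - a\<bar>) has_real_derivative 2 * \<bar>x - a\<bar>) (at x)" for a :: real
    using DERIV_shift[of "\<lambda>x::real. x * \<bar>x\<bar>" "2 * \<bar>x - a\<bar>" x "- a"]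
      has_real_derivative_mult_abs[of "x - a"] by simp
  show ?thesis
    unfolding ramp_def[abs_def] hat_def
    by (rule derivative_eq_intros has_real_derivative_mult_abs 1 refl)+ simp
qed

lemma ramp_le_0: "x \<le> 0 \<Longrightarrow> ramp x = 0"
  by (simp add: ramp_def algebra_simps power2_eq_square)

lemma ramp_ge_1: "1 \<le> x \<Longrightarrow> ramp x = 1"
  by (simp add: ramp_def algebra_simps power2_eq_square)

lemma hat_zero: "x \<notin> {0..1} \<Longrightarrow> hat x = 0"
  by (auto simp: hat_def abs_if)

lemma hat_nonneg: "0 \<le> hat x"
  by (auto simp: hat_def abs_if)

lemma continuous_on_hat [continuous_intros]: "continuous_on S hat"
  unfolding hat_def[abs_def] by (intro continuous_intros)

lemma ramp_mono: "x \<le> y \<Longrightarrow> ramp x \<le> ramp y"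
  by (rule DERIV_nonneg_imp_nondecreasing[of x y ramp]) (use ramp_deriv hat_nonneg in blast)+

lemma ramp_bounds: "0 \<le> ramp x" "ramp x \<le> 1"
  using ramp_mono[of "min x 0" x] ramp_mono[of x "max x 1"]
    ramp_le_0[of "min x 0"] ramp_ge_1[of "max x 1"] by auto

lemma hat_borel [measurable]: "hat \<in> borel_measurable borel"
  by (intro borel_measurable_continuous_onI continuous_intros)

lemma ramp_borel [measurable]: "ramp \<in> borel_measurable borel"
  unfolding ramp_def[abs_def] by measurable

text \<open>\<open>hat\<close> is the tent of height 2 over the unit interval, and its mass is the
  total rise of \<open>ramp\<close>. Rescaled to width 1/(n+1) it is an approximate
  identity.\<close>

lemma hat_integral: "has_bochner_integral lborel hat 1"
proof -
  have "has_bochner_integral lborel (\<lambda>x. hat x * indicator {0..1} x) (ramp 1 - ramp 0)"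
    by (rule has_bochner_integral_FTC_Icc_real)
       (use ramp_deriv continuous_on_hat[of UNIV] in \<open>auto simp: continuous_on_eq_continuous_at\<close>)
  moreover have "(\<lambda>x. hat x * indicator {0..1} x) = hat"
    by (rule ext) (metis hat_zero indicator_simps mult.right_neutral mult_zero_left)
  ultimately show ?thesis by (simp add: ramp_le_0 ramp_ge_1)
qed

text \<open>The substitution r = s + x/(n+1) fixes the kernel and moves the rescaling into
  \<open>f\<close>. The integrands then converge by continuity at the interior point
  \<open>s\<close> and are dominated by a multiple of \<open>hat\<close>.\<close>

lemma hat_mollify:
  fixes f :: "real \<Rightarrow> real"
  assumes f: "continuous_on {0..T} f" and s: "0 < s" "s < T"
  shows "(\<lambda>n. LINT r:{0..T}|lborel. f r * (real (Suc n) * hat (real (Suc n) * (r - s)))) \<longlonglongrightarrow> f s"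
proof -
  have fb: "(\<lambda>r. indicator {0..T} r * f r) \<in> borel_measurable borel"
    using set_measurable_continuous_on[OF _ f] by (simp add: set_borel_measurable_def)
  \<comment> \<open>Extension by zero: the affine substitution acts on the whole line, and the
    extended function is bounded everywhere by \<open>C\<close>.\<close>
  define h where "h = (\<lambda>r. indicator {0..T} r * f r)"
  have hb[measurable]: "h \<in> borel_measurable borel" using fb by (simp add: h_def)
  obtain C where "\<forall>r\<in>{0..T}. \<bar>f r\<bar> \<le> C"
    using compact_imp_bounded[OF compact_continuous_image[OF f]] by (auto simp: bounded_iff)
  then have C: "\<And>r. r \<in> {0..T} \<Longrightarrow> \<bar>f r\<bar> \<le> C" by blast
  have C0: "0 \<le> C" using C[of s] s by auto
  have hC: "\<bar>h r\<bar> \<le> C" for r using C[of r] C0 by (auto simp: h_def indicator_def)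
  have eq: "(LINT r:{0..T}|lborel. f r * (real (Suc n) * hat (real (Suc n) * (r - s)))) =
      (LINT x|lborel. h (s + 1 / real (Suc n) * x) * hat x)" for n
  proof -
    have "(LINT r:{0..T}|lborel. f r * (real (Suc n) * hat (real (Suc n) * (r - s)))) =
       (LINT r|lborel. h r * (real (Suc n) * hat (real (Suc n) * (r - s))))"
      unfolding set_lebesgue_integral_def h_def by (simp add: mult_ac)
    also have "\<dots> = \<bar>1 / real (Suc n)\<bar> *\<^sub>R (LINT x|lborel. h (s + 1 / real (Suc n) * x) *
         (real (Suc n) * hat (real (Suc n) * ((s + 1 / real (Suc n) * x) - s))))"
      by (rule lborel_integral_real_affine) simp
    also have "\<dots> = \<bar>1 / real (Suc n)\<bar> *\<^sub>R (LINT x|lborel. real (Suc n) * (h (s + 1 / real (Suc n) * x) * hat x))"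
      by (intro arg_cong2[where f=scaleR] Bochner_Integration.integral_cong refl) (simp del: of_nat_Suc)
    also have "\<dots> = (LINT x|lborel. h (s + 1 / real (Suc n) * x) * hat x)"
      by (simp del: of_nat_Suc)
    finally show ?thesis .
  qed
  have "(\<lambda>n. LINT x|lborel. h (s + 1 / real (Suc n) * x) * hat x) \<longlonglongrightarrow> (LINT x|lborel. f s * hat x)"
  proof (rule integral_dominated_convergence[where w="\<lambda>x. C * hat x"])
    show "integrable lborel (\<lambda>x. C * hat x)"
      using hat_integral by (auto simp: has_bochner_integral_iff)
    have fs: "isCont f s" using continuous_on_interior[OF f, of s] s by simp
    show "AE x in lborel. (\<lambda>n. h (s + 1 / real (Suc n) * x) * hat x) \<longlonglongrightarrow> f s * hat x"
    proof (intro always_eventually allI tendsto_mult tendsto_const)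
      fix x :: real
      have l: "(\<lambda>n. s + 1 / real (Suc n) * x) \<longlonglongrightarrow> s + 0 * x"
        by (intro tendsto_intros LIMSEQ_Suc[OF lim_1_over_n])
      then have l': "(\<lambda>n. s + 1 / real (Suc n) * x) \<longlonglongrightarrow> s" by simp
      have "(\<lambda>n. f (s + 1 / real (Suc n) * x)) \<longlonglongrightarrow> f s"
        using isCont_tendsto_compose[OF fs l'] .
      moreover have "eventually (\<lambda>n. s + 1 / real (Suc n) * x \<in> {0<..<T}) sequentially"
        using topological_tendstoD[OF l', of "{0<..<T}"] s by auto
      then have "eventually (\<lambda>n. f (s + 1 / real (Suc n) * x) = h (s + 1 / real (Suc n) * x)) sequentially"
        by (rule eventually_mono) (auto simp: h_def)
      ultimately show "(\<lambda>n. h (s + 1 / real (Suc n) * x)) \<longlonglongrightarrow> f s"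
        by (rule Lim_transform_eventually)
    qed
    show "AE x in lborel. norm (h (s + 1 / real (Suc n) * x) * hat x) \<le> C * hat x" for n
      using mult_right_mono[OF hC hat_nonneg]
      by (intro always_eventually allI) (simp add: abs_mult hat_nonneg del: of_nat_Suc)
  qed measurable
  then show ?thesis unfolding eq using hat_integral by (simp add: has_bochner_integral_iff)
qed

section \<open>Increments of a function as integrals of its weak derivative\<close>

lemma weak_deriv_integrable:
  assumes "weak_deriv T f g"
  shows "set_integrable lborel {0..T} g"
proof -
  have 1: "set_integrable lborel {0..T} (\<lambda>t. 1 + (g t)\<^sup>2)"
    using assms borel_integrable_atLeastAtMost'[OF continuous_on_const, of 0 T "1::real"]
    by (intro set_integral_add) (auto simp: weak_deriv_def)
  show ?thesis
  proof (rule set_integrable_bound[OF 1])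
    show "set_borel_measurable lborel {0..T} g" using assms by (simp add: weak_deriv_def)
    have "\<bar>y\<bar> \<le> 1 + y\<^sup>2" for y :: real
      using zero_le_power2[of "\<bar>y\<bar> - 1"] zero_le_power2[of y] by (simp add: power2_diff)
    then show "AE x in lborel. x \<in> {0..T} \<longrightarrow> norm (g x) \<le> norm (1 + (g x)\<^sup>2)" by auto
  qed
qed

text \<open>The test function climbs from 0 to 1 just after \<open>s\<close> and descends just after
  \<open>t\<close>. Its derivative is a difference of two approximate identities, which yields
  \<open>f s - f t\<close> in the limit, while the function itself stays bounded by 1 and tends to
  an indicator.\<close>

lemma weak_deriv_interior:
  assumes f: "continuous_on {0..T} f" and g: "weak_deriv T f g" and st: "0 < s" "s < t" "t < T"
  shows "f t - f s = (LINT r:{s<..t}|lborel. g r)"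
proof -
  define \<phi> where "\<phi> = (\<lambda>n r. ramp (real (Suc n) * (r - s)) - ramp (real (Suc n) * (r - t)))"
  define \<phi>' where "\<phi>' = (\<lambda>n r. real (Suc n) * hat (real (Suc n) * (r - s)) - real (Suc n) * hat (real (Suc n) * (r - t)))"
  have d: "(\<phi> n has_real_derivative \<phi>' n r) (at r)" for n r
    unfolding \<phi>_def \<phi>'_def
    by (rule derivative_eq_intros DERIV_chain2[OF ramp_deriv] refl)+ simp
  have d': "deriv (\<phi> n) = \<phi>' n" for n using DERIV_imp_deriv[OF d] by auto
  have c: "continuous_on UNIV (\<phi>' n)" for n
    unfolding \<phi>'_def by (intro continuous_intros continuous_on_compose2[OF continuous_on_hat[of UNIV]]) auto
  have C1: "\<phi> n C1_differentiable_on UNIV" for n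
    unfolding C1_differentiable_on_def using d c has_real_derivative_iff_has_vector_derivative by blast
  have gi: "set_integrable lborel {0..T} g" using weak_deriv_integrable[OF g] .
  have ev: "eventually (\<lambda>n. 1 / real (Suc n) < T - t) sequentially"
    using order_tendstoD(2)[OF LIMSEQ_Suc[OF lim_1_over_n], of "T - t"] st by auto
  \<comment> \<open>The descent ends at t + 1/(n+1), so the support is compact in (0, T) only once
    \<open>n\<close> is large; the weak identity is used eventually.\<close>
  have supp: "\<phi> n r = 0" if "1 / real (Suc n) < T - t" "r \<notin> {s..t + 1 / real (Suc n)}" for n r
  proof (cases "r < s")
    case True then show ?thesis using st by (simp add: \<phi>_def ramp_le_0 mult_nonneg_nonpos)
  next
    case False
    then have r: "r > t + 1 / real (Suc n)" using that by auto
    then have "1 \<le> real (Suc n) * (r - t)" by (simp add: field_simps)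
    moreover have "real (Suc n) * (r - t) \<le> real (Suc n) * (r - s)"
      using st by (intro mult_left_mono) auto
    ultimately have "1 \<le> real (Suc n) * (r - s)" "1 \<le> real (Suc n) * (r - t)" by linarith+
    then show ?thesis by (simp add: \<phi>_def ramp_ge_1 del: of_nat_Suc)
  qed
  have main: "eventually (\<lambda>n. (LINT r:{0..T}|lborel. f r * \<phi>' n r) = - (LINT r:{0..T}|lborel. g r * \<phi> n r)) sequentially"
    using ev
  proof (rule eventually_mono)
    fix n assume n: "1 / real (Suc n) < T - t"
    have "\<exists>c d. 0 < c \<and> d < T \<and> (\<forall>r. r \<notin> {c..d} \<longrightarrow> \<phi> n r = 0)"
      using supp[OF n] st n by (intro exI[of _ s] exI[of _ "t + 1 / real (Suc n)"]) auto
    then show "(LINT r:{0..T}|lborel. f r * \<phi>' n r) = - (LINT r:{0..T}|lborel. g r * \<phi> n r)"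
      using g C1[of n] unfolding weak_deriv_def d'[symmetric] by blast
  qed
  have cm: "set_integrable lborel {0..T} (\<lambda>r. f r * (real (Suc n) * hat (real (Suc n) * (r - x))))" for n x
    by (intro borel_integrable_atLeastAtMost' continuous_intros f continuous_on_compose2[OF continuous_on_hat[of UNIV]]) auto
  have "(LINT r:{0..T}|lborel. f r * \<phi>' n r) =
      (LINT r:{0..T}|lborel. f r * (real (Suc n) * hat (real (Suc n) * (r - s)))) -
      (LINT r:{0..T}|lborel. f r * (real (Suc n) * hat (real (Suc n) * (r - t))))" for n
    unfolding set_integral_diff(2)[OF cm cm, symmetric] by (simp add: \<phi>'_def right_diff_distrib)
  then have l1: "(\<lambda>n. LINT r:{0..T}|lborel. f r * \<phi>' n r) \<longlonglongrightarrow> f s - f t"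
    using tendsto_diff[OF hat_mollify[OF f, of s] hat_mollify[OF f, of t]] st by simp
  have l2: "(\<lambda>n. LINT r:{0..T}|lborel. g r * \<phi> n r) \<longlonglongrightarrow> (LINT r:{s<..t}|lborel. g r)"
    unfolding set_lebesgue_integral_def
  proof (rule integral_dominated_convergence[where w="\<lambda>r. norm (indicator {0..T} r *\<^sub>R g r)"])
    have gm: "(\<lambda>r. indicat_real {0..T} r *\<^sub>R g r) \<in> borel_measurable lborel"
      using gi unfolding set_integrable_def by simp
    have "(\<lambda>r. indicat_real {s<..t} r * (indicat_real {0..T} r *\<^sub>R g r)) \<in> borel_measurable lborel"
      using gm by measurable
    also have "(\<lambda>r. indicat_real {s<..t} r * (indicat_real {0..T} r *\<^sub>R g r)) = (\<lambda>r. indicat_real {s<..t} r *\<^sub>R g r)"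
      using st by (auto simp: fun_eq_iff indicator_def)
    finally show "(\<lambda>r. indicat_real {s<..t} r *\<^sub>R g r) \<in> borel_measurable lborel" .
    have "(\<lambda>r. (indicat_real {0..T} r *\<^sub>R g r) * \<phi> n r) \<in> borel_measurable lborel" for n
      using gm unfolding \<phi>_def by measurable
    then show "(\<lambda>r. indicat_real {0..T} r *\<^sub>R (g r * \<phi> n r)) \<in> borel_measurable lborel" for n
      by (simp add: mult_ac)
    show "integrable lborel (\<lambda>r. norm (indicator {0..T} r *\<^sub>R g r))"
      using gi unfolding set_integrable_def by (rule integrable_norm)
    have "\<bar>\<phi> n r\<bar> \<le> 1" for n r
      using ramp_bounds[of "real (Suc n) * (r - s)"] ramp_bounds[of "real (Suc n) * (r - t)"]
      by (auto simp: \<phi>_def abs_le_iff simp del: of_nat_Suc)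
    then show "AE r in lborel. norm (indicat_real {0..T} r *\<^sub>R (g r * \<phi> n r)) \<le> norm (indicator {0..T} r *\<^sub>R g r)" for n
      by (auto simp: abs_mult indicator_def mult_left_le)
    \<comment> \<open>\<open>ramp\<close> vanishes at 0, so the limit jumps strictly to the right of
      \<open>x\<close>. Hence the limiting indicator is open at \<open>s\<close> and closed at
      \<open>t\<close>.\<close>
    have rl: "(\<lambda>n. ramp (real (Suc n) * (r - x))) \<longlonglongrightarrow> (if x < r then 1 else 0)" for r x
    proof (cases "x < r")
      case True
      have "eventually (\<lambda>n. 1 / real (Suc n) < r - x) sequentially"
        using order_tendstoD(2)[OF LIMSEQ_Suc[OF lim_1_over_n], of "r - x"] True by auto
      then have "eventually (\<lambda>n. ramp (real (Suc n) * (r - x)) = 1) sequentially"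
        by (rule eventually_mono) (intro ramp_ge_1, simp add: field_simps)
      then show ?thesis using True by (simp add: tendsto_eventually)
    next
      case False
      then have "ramp (real (Suc n) * (r - x)) = 0" for n
        by (intro ramp_le_0 mult_nonneg_nonpos) auto
      then show ?thesis using False by simp
    qed
    have "(\<lambda>n. \<phi> n r) \<longlonglongrightarrow> indicator {s<..t} r" for r
      using tendsto_diff[OF rl[of r s] rl[of r t]] st
      by (cases "s < r"; cases "t < r") (auto simp: \<phi>_def indicator_def)
    then have "(\<lambda>n. indicat_real {0..T} r *\<^sub>R (g r * \<phi> n r)) \<longlonglongrightarrow> indicat_real {0..T} r *\<^sub>R (g r * indicator {s<..t} r)" for r
      by (intro tendsto_intros)
    moreover have "indicat_real {0..T} r *\<^sub>R (g r * indicator {s<..t} r) = indicator {s<..t} r *\<^sub>R g r" for r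
      using st by (auto simp: indicator_def)
    ultimately show "AE r in lborel. (\<lambda>n. indicat_real {0..T} r *\<^sub>R (g r * \<phi> n r)) \<longlonglongrightarrow> indicat_real {s<..t} r *\<^sub>R g r"
      by (intro always_eventually allI) metis
  qed
  have "(\<lambda>n. - (LINT r:{0..T}|lborel. g r * \<phi> n r)) \<longlonglongrightarrow> f s - f t"
    using l1 main by (rule Lim_transform_eventually)
  with tendsto_minus[OF l2] have "f s - f t = - (LINT r:{s<..t}|lborel. g r)"
    using LIMSEQ_unique by blast
  then show ?thesis by simp
qed

lemma set_integral_cc_oc:
  fixes g :: "real \<Rightarrow> real"
  shows "(LINT r:{s..t}|lborel. g r) = (LINT r:{s<..t}|lborel. g r)"
  by (rule set_integral_discrete_difference[where X="{s}"]) auto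

lemma set_integral_split:
  fixes g :: "real \<Rightarrow> real"
  assumes "set_integrable lborel {a..c} g" "a \<le> b" "b \<le> c"
  shows "(LINT r:{a..c}|lborel. g r) = (LINT r:{a..b}|lborel. g r) + (LINT r:{b..c}|lborel. g r)"
proof -
  have "{a..c} = {a..b} \<union> {b<..c}" using assms by auto
  moreover have disjoint: "{a..b} \<inter> {b<..c} = {}" by auto
  moreover have "set_integrable lborel {a..b} g" "set_integrable lborel {b<..c} g"
    using assms by (auto intro: set_integrable_subset[OF assms(1)])
  ultimately show ?thesis unfolding set_integral_cc_oc[of b c]
    by (metis (lifting) \<open>{a..c} = {a..b} \<union> {b<..c}\<close> disjoint set_integral_Un)
qed

lemma continuous_on_indefinite_LINT:
  fixes g :: "real \<Rightarrow> real"
  assumes g: "set_integrable lborel {0..T} g"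
  shows "continuous_on {0..T} (\<lambda>t. LINT r:{0..t}|lborel. g r)"
proof -
  have h: "g integrable_on {0..T}" using set_borel_integral_eq_integral(1)[OF g] .
  have "(LINT r:{0..t}|lborel. g r) = integral {0..t} g" if "t \<in> {0..T}" for t
    using that by (intro set_borel_integral_eq_integral(2) set_integrable_subset[OF g]) auto
  then show ?thesis
    using indefinite_integral_continuous_1[OF h] by (subst continuous_on_cong[OF refl]) auto
qed

text \<open>Subtracting the indefinite integral leaves a continuous function that is constant on the
  open interval. The end points 0 and \<open>T\<close>, out of reach of the test functions, follow
  by density.\<close>

lemma weak_deriv_FTC:
  assumes T: "0 < T" and f: "continuous_on {0..T} f" and g: "weak_deriv T f g"
    and st: "0 \<le> s" "s \<le> t" "t \<le> T"
  shows "f t - f s = (LINT r:{s..t}|lborel. g r)"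
proof -
  have gi: "set_integrable lborel {0..T} g" using weak_deriv_integrable[OF g] .
  define G where "G = (\<lambda>t. LINT r:{0..t}|lborel. g r)"
  have G: "G t - G s = (LINT r:{s..t}|lborel. g r)" if "0 \<le> s" "s \<le> t" "t \<le> T" for s t
    using set_integral_split[OF set_integrable_subset[OF gi], of 0 t s] that by (auto simp: G_def)
  define D where "D = (\<lambda>t. f t - G t)"
  have cD: "continuous_on {0..T} D"
    unfolding D_def G_def by (intro continuous_intros f continuous_on_indefinite_LINT gi)
  have D1: "D t = D s" if "0 < s" "s < t" "t < T" for s t
    using weak_deriv_interior[OF f g that] G[of s t] that by (simp add: D_def set_integral_cc_oc)
  have D2: "D t = D (T/2)" if "t \<in> {0<..<T}" for t
  proof (cases t "T/2" rule: linorder_cases)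
    case less then show ?thesis using D1[of t "T/2"] that T by simp
  next
    case greater then show ?thesis using D1[of "T/2" t] that T by simp
  next
    case equal then show ?thesis by (rule arg_cong)
  qed
  have cl: "closure {0<..<T} = {0..T}" using T by simp
  have "D t = D (T/2)" if "t \<in> {0..T}" for t
  proof (rule continuous_constant_on_closure[of "{0<..<T}" D])
    show "continuous_on (closure {0<..<T}) D" unfolding cl by (rule cD)
    show "t \<in> closure {0<..<T}" unfolding cl by (rule that)
  qed (rule D2)
  from this[of t] this[of s] have "D t = D s" using st by simp
  then show ?thesis using G[OF st] by (simp add: D_def)
qed

text \<open>A crude form of the Sobolev embedding: compare \<open>f t\<close> with
  \<open>f r\<close>, average over \<open>r\<close>, and replace each |y| by 1 + y^2. The bound is
  not homogeneous, which is harmless because it is applied to unit vectors and scaled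
  afterwards.\<close>

lemma sobolev_bound:
  assumes T: "0 < T" and f: "continuous_on {0..T} f" and g: "weak_deriv T f g" and t: "t \<in> {0..T}"
  shows "T * \<bar>f t\<bar> \<le> T * (1 + T) + (LINT r:{0..T}|lborel. (f r)\<^sup>2) + T * (LINT r:{0..T}|lborel. (g r)\<^sup>2)"
proof -
  have gi: "set_integrable lborel {0..T} g" using weak_deriv_integrable[OF g] .
  have gi2: "set_integrable lborel {0..T} (\<lambda>r. (g r)\<^sup>2)" using g by (simp add: weak_deriv_def)
  have fi2: "set_integrable lborel {0..T} (\<lambda>r. (f r)\<^sup>2)"
    by (intro borel_integrable_atLeastAtMost' continuous_intros f)
  have ci: "set_integrable lborel {0..T} (\<lambda>r. c)" for c :: real
    by (intro borel_integrable_atLeastAtMost' continuous_intros)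
  have cI: "(LINT r:{0..T}|lborel. c) = T * c" for c :: real
    using T by (subst set_integral_const) auto
  have sq: "\<bar>y\<bar> \<le> 1 + y\<^sup>2" for y :: real
    using zero_le_power2[of "\<bar>y\<bar> - 1"] zero_le_power2[of y] by (simp add: power2_diff)
  define K where "K = T + (LINT r:{0..T}|lborel. (g r)\<^sup>2)"
  have gb: "\<bar>LINT r:{a..b}|lborel. g r\<bar> \<le> K" if "0 \<le> a" "a \<le> b" "b \<le> T" for a b
  proof -
    have sub: "{a..b} \<subseteq> {0..T}" using that by auto
    have "\<bar>LINT r:{a..b}|lborel. g r\<bar> \<le> (LINT r|lborel. \<bar>indicator {a..b} r *\<^sub>R g r\<bar>)"
      unfolding set_lebesgue_integral_def by (rule integral_abs_bound)
    also have "\<dots> \<le> (LINT r:{0..T}|lborel. 1 + (g r)\<^sup>2)"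
      unfolding set_lebesgue_integral_def
    proof (rule integral_mono_AE)
      have "set_integrable lborel {a..b} g" by (rule set_integrable_subset[OF gi _ sub]) simp
      then show "integrable lborel (\<lambda>r. \<bar>indicator {a..b} r *\<^sub>R g r\<bar>)"
        unfolding set_integrable_def by (rule integrable_abs)
      show "integrable lborel (\<lambda>x. indicat_real {0..T} x *\<^sub>R (1 + (g x)\<^sup>2))"
        using set_integral_add(1)[OF ci gi2] by (simp add: set_integrable_def)
      show "AE r in lborel. \<bar>indicator {a..b} r *\<^sub>R g r\<bar> \<le> indicat_real {0..T} r *\<^sub>R (1 + (g r)\<^sup>2)"
        using sub sq by (auto simp: indicator_def)
    qed
    also have "\<dots> = K" by (simp add: set_integral_add(2)[OF ci gi2] cI K_def)
    finally show ?thesis .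
  qed
  have "\<bar>f t\<bar> \<le> (1 + (f r)\<^sup>2) + K" if r: "r \<in> {0..T}" for r
  proof (cases "r \<le> t")
    case True
    then show ?thesis using weak_deriv_FTC[OF T f g, of r t] gb[of r t] r t sq[of "f r"] by auto
  next
    case False
    then show ?thesis using weak_deriv_FTC[OF T f g, of t r] gb[of t r] r t sq[of "f r"] by auto
  qed
  then have "(LINT r:{0..T}|lborel. \<bar>f t\<bar>) \<le> (LINT r:{0..T}|lborel. (1 + (f r)\<^sup>2) + K)"
    by (intro set_integral_mono set_integral_add ci fi2) auto
  also have "\<dots> = T + (LINT r:{0..T}|lborel. (f r)\<^sup>2) + T * K"
    by (simp add: set_integral_add ci fi2 cI)
  finally show ?thesis by (simp add: cI K_def algebra_simps)
qed

text \<open>A bound on the unit sphere suffices, since \<open>val\<close> is homogeneous on [0, T].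
  This is what bounds the Riesz representatives of evaluation uniformly in time.\<close>

lemma sobolev_model_bound:
  fixes val :: "'h::{real_inner, banach, second_countable_topology} \<Rightarrow> real \<Rightarrow> real"
  assumes T: "0 < T" and H: "sobolev_model T val"
  obtains C where "0 \<le> C" "\<And>t h. t \<in> {0..T} \<Longrightarrow> \<bar>val h t\<bar> \<le> C * norm h"
proof -
  \<comment> \<open>With both squared parts of the unit norm at most 1, \<open>sobolev_bound\<close>
    reads T|f t| \<le> T(1 + T) + 1 + T; division by \<open>T\<close> gives this value.\<close>
  define C where "C = 1 + T + 1/T + 1"
  have C0: "0 \<le> C" using T by (simp add: C_def)
  have unit: "\<bar>val h t\<bar> \<le> C" if t: "t \<in> {0..T}" and h: "norm h = 1" for t h
  proof -
    have 1: "continuous_on {0..T} (val h)" "\<exists>g. weak_deriv T (val h) g"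
      using H by (auto simp: sobolev_model_def sobolev_def)
    have 2: "weak_deriv T (val h) (wderiv T (val h))"
      unfolding wderiv_def using 1(2) by (rule someI_ex)
    define a where "a = (LINT r:{0..T}|lborel. (val h r)\<^sup>2)"
    define b where "b = (LINT r:{0..T}|lborel. (wderiv T (val h) r)\<^sup>2)"
    have "inner h h = a + b" using H by (simp add: sobolev_model_def a_def b_def power2_eq_square)
    then have ab: "a + b = 1" using h by (simp add: dot_square_norm)
    have "0 \<le> a" "0 \<le> b" unfolding a_def b_def set_lebesgue_integral_def
      by (auto intro!: Bochner_Integration.integral_nonneg)
    then have "a \<le> 1" "b \<le> 1" using ab by auto
    then have "T * \<bar>val h t\<bar> \<le> T * (1 + T) + 1 + T * 1"
      using sobolev_bound[OF T 1(1) 2 t] mult_left_mono[OF \<open>b \<le> 1\<close>, of T] \<open>a \<le> 1\<close> T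
      unfolding a_def[symmetric] b_def[symmetric] by linarith
    also have "\<dots> = T * C" using T by (simp add: C_def field_simps)
    finally show ?thesis using T by simp
  qed
  have "\<bar>val h t\<bar> \<le> C * norm h" if t: "t \<in> {0..T}" for t h
  proof (cases "h = 0")
    case True
    have "val (0 *\<^sub>R h) t = 0 * val h t" using H t unfolding sobolev_model_def by blast
    then show ?thesis using True by simp
  next
    case False
    have "val ((1 / norm h) *\<^sub>R h) t = 1 / norm h * val h t"
      using H t unfolding sobolev_model_def by blast
    moreover have "\<bar>val ((1 / norm h) *\<^sub>R h) t\<bar> \<le> C" using unit[OF t, of "(1 / norm h) *\<^sub>R h"] False by simp
    ultimately have "\<bar>1 / norm h * val h t\<bar> \<le> C" by simp
    then show ?thesis using False by (simp add: abs_mult divide_le_eq)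
  qed
  with C0 that show ?thesis by blast
qed

section \<open>Riemann-Stieltjes sums\<close>

lemma set_integral_sum_split:
  fixes g :: "real \<Rightarrow> real"
  assumes "set_integrable lborel {s 0..s n} g" "\<And>i. s i \<le> s (Suc i)"
  shows "(LINT r:{s 0..s n}|lborel. g r) = (\<Sum>i<n. LINT r:{s i..s (Suc i)}|lborel. g r)"
  using assms(1)
proof (induction n)
  case 0
  have "(LINT r:{s 0..s 0}|lborel. g r) = 0" unfolding set_integral_cc_oc by (simp add: set_lebesgue_integral_def)
  then show ?case by simp
next
  case (Suc n)
  have m: "s 0 \<le> s n" using lift_Suc_mono_le[of s 0 n] assms(2) by simp
  have "set_integrable lborel {s 0..s n} g"
    by (rule set_integrable_subset[OF Suc.prems]) (use assms(2)[of n] in auto)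
  with Suc.IH set_integral_split[OF Suc.prems m assms(2)] show ?case by simp
qed

lemma set_integral_const_mult_close:
  fixes f b :: "real \<Rightarrow> real"
  assumes b: "set_integrable M A b" and fb: "set_integrable M A (\<lambda>r. f r * b r)"
    and close: "\<And>r. r \<in> A \<Longrightarrow> \<bar>c - f r\<bar> \<le> \<epsilon>"
  shows "\<bar>c * (LINT r:A|M. b r) - (LINT r:A|M. f r * b r)\<bar> \<le> \<epsilon> * (LINT r:A|M. \<bar>b r\<bar>)"
proof -
  have i: "set_integrable M A (\<lambda>r. c * b r - f r * b r)"
    using b fb by (intro set_integral_diff) auto
  have "c * (LINT r:A|M. b r) - (LINT r:A|M. f r * b r) = (LINT r:A|M. c * b r - f r * b r)"
    using b fb by (subst set_integral_diff) auto
  also have "\<bar>LINT r:A|M. c * b r - f r * b r\<bar> \<le> (LINT r|M. \<bar>indicator A r *\<^sub>R (c * b r - f r * b r)\<bar>)"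
    unfolding set_lebesgue_integral_def by (rule integral_abs_bound)
  also have "\<dots> \<le> (LINT r:A|M. \<epsilon> * \<bar>b r\<bar>)"
    unfolding set_lebesgue_integral_def
  proof (rule integral_mono)
    show "integrable M (\<lambda>r. \<bar>indicator A r *\<^sub>R (c * b r - f r * b r)\<bar>)"
      using i unfolding set_integrable_def by (rule integrable_abs)
    have "set_integrable M A (\<lambda>r. \<epsilon> * \<bar>b r\<bar>)"
      using set_integrable_abs[OF b] by simp
    then show "integrable M (\<lambda>x. indicat_real A x *\<^sub>R (\<epsilon> * \<bar>b x\<bar>))"
      by (simp add: set_integrable_def)
    fix r
    show "\<bar>indicator A r *\<^sub>R (c * b r - f r * b r)\<bar> \<le> indicat_real A r *\<^sub>R (\<epsilon> * \<bar>b r\<bar>)"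
    proof (cases "r \<in> A")
      case True
      have "\<bar>c - f r\<bar> * \<bar>b r\<bar> \<le> \<epsilon> * \<bar>b r\<bar>" using close[OF True] by (rule mult_right_mono) simp
      then show ?thesis using True
        unfolding left_diff_distrib[symmetric] by (simp only: abs_mult indicator_simps scaleR_one)
    qed simp
  qed
  also have "\<dots> = \<epsilon> * (LINT r:A|M. \<bar>b r\<bar>)" by (rule set_integral_mult_right)
  finally show ?thesis .
qed

lemma set_integrable_cont_mult:
  fixes f b :: "real \<Rightarrow> real"
  assumes f: "continuous_on {0..t} f" and b: "set_integrable lborel {0..t} b"
  shows "set_integrable lborel {0..t} (\<lambda>r. f r * b r)"
proof -
  obtain C where "\<forall>r\<in>{0..t}. \<bar>f r\<bar> \<le> C"
    using compact_imp_bounded[OF compact_continuous_image[OF f]] by (auto simp: bounded_iff)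
  then have C: "\<And>r. r \<in> {0..t} \<Longrightarrow> \<bar>f r\<bar> \<le> C" by blast
  show ?thesis
  proof (rule set_integrable_bound[of lborel "{0..t}" "\<lambda>r. C * b r"])
    show "set_integrable lborel {0..t} (\<lambda>r. C * b r)" using b by simp
    have "(\<lambda>r. indicator {0..t} r * f r) \<in> borel_measurable lborel"
      using set_measurable_continuous_on[OF _ f] by (simp add: set_borel_measurable_def)
    moreover have "(\<lambda>r. indicator {0..t} r * b r) \<in> borel_measurable lborel"
      using borel_measurable_integrable[OF b[unfolded set_integrable_def]] by simp
    ultimately have "(\<lambda>r. (indicator {0..t} r * f r) * (indicator {0..t} r * b r)) \<in> borel_measurable lborel"
      by (rule borel_measurable_times)
    moreover have "(\<lambda>r. (indicator {0..t} r * f r) * (indicator {0..t} r * b r)) = (\<lambda>r. indicator {0..t} r *\<^sub>R (f r * b r))"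
      by (auto simp: indicator_def)
    ultimately show "set_borel_measurable lborel {0..t} (\<lambda>r. f r * b r)"
      unfolding set_borel_measurable_def by simp
    show "AE x in lborel. x \<in> {0..t} \<longrightarrow> norm (f x * b x) \<le> norm (C * b x)"
    proof (intro always_eventually allI impI)
      fix x assume "x \<in> {0..t}"
      then have "\<bar>f x\<bar> \<le> \<bar>C\<bar>" using C[of x] by simp
      then show "norm (f x * b x) \<le> norm (C * b x)" by (simp add: abs_mult mult_right_mono)
    qed
  qed
qed

text \<open>Freezing \<open>f\<close> at a tag of each cell costs at most its oscillation times the
  integral of |b|, and \<open>f\<close> is uniformly continuous. The tags are arbitrary because
  summation by parts produces left tags for one factor and right tags for the other. The grid has n
  + 1 cells, so that \<open>n = 0\<close> is meaningful.\<close>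

lemma riemann_stieltjes_limit:
  fixes f b :: "real \<Rightarrow> real"
  assumes t: "0 \<le> t" and f: "continuous_on {0..t} f" and b: "set_integrable lborel {0..t} b"
    and p: "\<And>n i. i \<le> n \<Longrightarrow> p n i \<in> {real i * t / real (Suc n)..real (Suc i) * t / real (Suc n)}"
  shows "(\<lambda>n. \<Sum>i<Suc n. f (p n i) * (LINT r:{real i * t / real (Suc n)..real (Suc i) * t / real (Suc n)}|lborel. b r))
    \<longlonglongrightarrow> (LINT r:{0..t}|lborel. f r * b r)"
proof -
  define B where "B = (LINT r:{0..t}|lborel. \<bar>b r\<bar>)"
  have B0: "0 \<le> B" unfolding B_def set_lebesgue_integral_def by (auto intro!: Bochner_Integration.integral_nonneg)
  note fbi = set_integrable_cont_mult[OF f b]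
  show ?thesis
  proof (rule LIMSEQ_I)
    fix \<epsilon> :: real assume e: "0 < \<epsilon>"
    \<comment> \<open>\<open>B + 1\<close> in place of \<open>B\<close>, because \<open>B\<close>
      may vanish and the final inequality is strict.\<close>
    define \<epsilon>' where "\<epsilon>' = \<epsilon> / (B + 1)"
    have e': "0 < \<epsilon>'" using e B0 by (simp add: \<epsilon>'_def)
    have "uniformly_continuous_on {0..t} f" using compact_uniformly_continuous[OF f] by simp
    then obtain \<delta> where d: "0 < \<delta>" "\<And>x y. x \<in> {0..t} \<Longrightarrow> y \<in> {0..t} \<Longrightarrow> dist x y < \<delta> \<Longrightarrow> dist (f x) (f y) < \<epsilon>'"
      using e' unfolding uniformly_continuous_on_def by metis
    have "(\<lambda>n. t * (1 / real (Suc n))) \<longlonglongrightarrow> t * 0"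
      by (intro tendsto_intros LIMSEQ_Suc[OF lim_1_over_n])
    then have "eventually (\<lambda>n. t * (1 / real (Suc n)) < \<delta>) sequentially"
      using order_tendstoD(2)[of _ "t * 0" sequentially \<delta>] d(1) by simp
    then obtain N where N: "\<And>n. n \<ge> N \<Longrightarrow> t * (1 / real (Suc n)) < \<delta>"
      by (auto simp: eventually_sequentially)
    show "\<exists>N. \<forall>n\<ge>N. norm ((\<Sum>i<Suc n. f (p n i) * (LINT r:{real i * t / real (Suc n)..real (Suc i) * t / real (Suc n)}|lborel. b r)) - (LINT r:{0..t}|lborel. f r * b r)) < \<epsilon>"
    proof (intro exI allI impI)
      fix n assume n: "N \<le> n"
      define s where "s = (\<lambda>i. real i * t / real (Suc n))"
      have sm: "s i \<le> s (Suc i)" for i using t by (simp add: s_def divide_right_mono mult_right_mono)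
      have s0: "s 0 = 0" and sn: "s (Suc n) = t" by (simp_all add: s_def)
      have smono: "s i \<le> s j" if "i \<le> j" for i j by (rule lift_Suc_mono_le[of s, OF sm that])
      have sub: "{s i..s (Suc i)} \<subseteq> {0..t}" if "i < Suc n" for i
        using smono[of 0 i] smono[of "Suc i" "Suc n"] that unfolding s0 sn by auto
      have bi: "set_integrable lborel {s i..s (Suc i)} b" if "i < Suc n" for i
        by (rule set_integrable_subset[OF b _ sub[OF that]]) simp
      have fbi': "set_integrable lborel {s i..s (Suc i)} (\<lambda>r. f r * b r)" if "i < Suc n" for i
        by (rule set_integrable_subset[OF fbi _ sub[OF that]]) simp
      have est: "\<bar>f (p n i) * (LINT r:{s i..s (Suc i)}|lborel. b r) - (LINT r:{s i..s (Suc i)}|lborel. f r * b r)\<bar>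
         \<le> \<epsilon>' * (LINT r:{s i..s (Suc i)}|lborel. \<bar>b r\<bar>)" if i: "i < Suc n" for i
      proof (rule set_integral_const_mult_close[OF bi[OF i] fbi'[OF i]])
        fix r assume r: "r \<in> {s i..s (Suc i)}"
        have pi: "p n i \<in> {s i..s (Suc i)}" using p[of i n] i by (simp add: s_def)
        have "s (Suc i) - s i = t * (1 / real (Suc n))"
          unfolding s_def of_nat_Suc[of i] distrib_right add_divide_distrib by simp
        then have w: "s (Suc i) - s i < \<delta>" using N[OF n] by (simp only:)
        have "\<bar>p n i - r\<bar> \<le> s (Suc i) - s i"
          using pi r by (simp only: atLeastAtMost_iff abs_le_iff) (simp add: algebra_simps)
        then have "\<bar>p n i - r\<bar> < \<delta>" using w by (rule order.strict_trans1)
        then show "\<bar>f (p n i) - f r\<bar> \<le> \<epsilon>'"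
          using d(2)[OF subsetD[OF sub[OF i] pi] subsetD[OF sub[OF i] r]] unfolding dist_real_def
          by (rule_tac less_imp_le) (simp only:)
      qed
      define I where "I = (\<lambda>g i. LINT r:{s i..s (Suc i)}|lborel. (g r :: real))"
      have I0: "(\<Sum>i<Suc n. I g i) = (LINT r:{0..t}|lborel. g r)" if "set_integrable lborel {0..t} g" for g
      proof -
        have "set_integrable lborel {s 0..s (Suc n)} g" using that by (simp only: s0 sn)
        from set_integral_sum_split[where s=s and n="Suc n" and g=g, OF this sm] show ?thesis by (simp only: s0 sn I_def)
      qed
      note I1 = I0[OF fbi]
      have I2: "(\<Sum>i<Suc n. I (\<lambda>r. \<bar>b r\<bar>) i) = B"
        unfolding B_def by (rule I0[OF set_integrable_abs[OF b]])
      have "\<bar>(\<Sum>i<Suc n. f (p n i) * I b i) - (\<Sum>i<Suc n. I (\<lambda>r. f r * b r) i)\<bar> \<le> (\<Sum>i<Suc n. \<epsilon>' * I (\<lambda>r. \<bar>b r\<bar>) i)"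
        unfolding sum_subtractf[symmetric]
        by (intro order_trans[OF sum_abs] sum_mono) (simp only: lessThan_iff I_def est)
      also have "\<dots> = \<epsilon>' * B" unfolding sum_distrib_left[symmetric] I2 ..
      also have "\<dots> < \<epsilon>" using e B0 by (simp add: \<epsilon>'_def divide_less_eq distrib_left)
      finally show "norm ((\<Sum>i<Suc n. f (p n i) * (LINT r:{real i * t / real (Suc n)..real (Suc i) * t / real (Suc n)}|lborel. b r)) - (LINT r:{0..t}|lborel. f r * b r)) < \<epsilon>"
        unfolding I1 real_norm_def unfolding I_def s_def .
    qed
  qed
qed

section \<open>Gronwall's lemma and orthonormal expansions\<close>

text \<open>Proved with the supremum weighted by exp(-2ct), for which the integral operator has norm
  at most 1/2; this is the origin of the factor 2 and of the exponent 2c. Absorbing the half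
  requires a finite weighted supremum, which the finiteness of the integral supplies.\<close>

lemma gronwall:
  fixes u :: "real \<Rightarrow> ennreal" and a c :: real
  assumes a: "0 \<le> a" and c: "0 < c"
    and u: "\<And>t. t \<in> {0..T} \<Longrightarrow> u t \<le> ennreal a + ennreal c * (\<integral>\<^sup>+r\<in>{0..t}. u r \<partial>lborel)"
    and fin: "(\<integral>\<^sup>+r\<in>{0..T}. u r \<partial>lborel) < \<infinity>"
    and t: "t \<in> {0..T}"
  shows "u t \<le> ennreal (2 * a * exp (2 * c * T))"
proof -
  define S where "S = (SUP t\<in>{0..T}. ennreal (exp (- (2 * c * t))) * u t)"
  have "S \<le> ennreal a + ennreal c * (\<integral>\<^sup>+r\<in>{0..T}. u r \<partial>lborel)"
    unfolding S_def
  proof (rule SUP_least)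
    fix t assume t: "t \<in> {0..T}"
    have "ennreal (exp (- (2 * c * t))) * u t \<le> 1 * u t"
      using c t by (intro mult_right_mono) (auto simp: ennreal_le_1)
    also have "\<dots> \<le> ennreal a + ennreal c * (\<integral>\<^sup>+r\<in>{0..t}. u r \<partial>lborel)" using u[OF t] by simp
    also have "\<dots> \<le> ennreal a + ennreal c * (\<integral>\<^sup>+r\<in>{0..T}. u r \<partial>lborel)"
      using t by (intro add_left_mono mult_left_mono nn_integral_mono) (auto simp: indicator_def)
    finally show "ennreal (exp (- (2 * c * t))) * u t \<le> ennreal a + ennreal c * (\<integral>\<^sup>+r\<in>{0..T}. u r \<partial>lborel)" .
  qed
  also have "\<dots> < \<infinity>" using fin by (simp add: ennreal_mult_less_top)
  finally have Sfin: "S < \<infinity>" .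
  then obtain s where s: "S = ennreal s" "0 \<le> s" by (cases S) auto
  have us: "u r \<le> ennreal (exp (2 * c * r)) * S" if "r \<in> {0..T}" for r
  proof -
    have "u r = ennreal (exp (2 * c * r)) * (ennreal (exp (- (2 * c * r))) * u r)"
      by (simp add: mult.assoc[symmetric] ennreal_mult[symmetric] exp_minus)
    also have "\<dots> \<le> ennreal (exp (2 * c * r)) * S"
      unfolding S_def using that by (intro mult_left_mono SUP_upper) auto
    finally show ?thesis .
  qed
  have bound: "ennreal (exp (- (2 * c * t))) * u t \<le> ennreal (a + s / 2)" if t: "t \<in> {0..T}" for t
  proof -
    have "(\<integral>\<^sup>+r\<in>{0..t}. u r \<partial>lborel) \<le> (\<integral>\<^sup>+r. S * (ennreal (exp (2 * c * r)) * indicator {0..t} r) \<partial>lborel)"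
      using us t by (intro nn_integral_mono) (auto simp: indicator_def mult.commute)
    also have "\<dots> = S * (\<integral>\<^sup>+r. ennreal (exp (2 * c * r)) * indicator {0..t} r \<partial>lborel)"
      by (rule nn_integral_cmult) measurable
    also have "(\<integral>\<^sup>+r. ennreal (exp (2 * c * r)) * indicator {0..t} r \<partial>lborel) =
        ennreal (exp (2 * c * t) / (2 * c) - exp (2 * c * 0) / (2 * c))"
      using t c by (intro nn_integral_FTC_Icc) (auto intro!: derivative_eq_intros)
    also have "\<dots> \<le> ennreal (exp (2 * c * t) / (2 * c))" using c by (intro ennreal_leI) simp
    finally have 1: "(\<integral>\<^sup>+r\<in>{0..t}. u r \<partial>lborel) \<le> ennreal (s * (exp (2 * c * t) / (2 * c)))"
      using s c by (simp add: ennreal_mult[symmetric] mult_left_mono)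
    have "u t \<le> ennreal a + ennreal c * ennreal (s * (exp (2 * c * t) / (2 * c)))"
      using u[OF t] 1 by (meson add_left_mono mult_left_mono order_trans zero_le)
    also have "\<dots> = ennreal (a + s * exp (2 * c * t) / 2)"
      using a c s by (simp add: ennreal_mult[symmetric] ennreal_plus[symmetric] del: ennreal_plus)
    finally have "ennreal (exp (- (2 * c * t))) * u t \<le> ennreal (exp (- (2 * c * t))) * ennreal (a + s * exp (2 * c * t) / 2)"
      by (rule mult_left_mono) simp
    also have "\<dots> = ennreal (exp (- (2 * c * t)) * (a + s * exp (2 * c * t) / 2))"
      by (rule ennreal_mult[symmetric]) (use a s in auto)
    also have "exp (- (2 * c * t)) * (a + s * exp (2 * c * t) / 2) = exp (- (2 * c * t)) * a + s / 2"
      by (simp add: distrib_left exp_minus)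
    also have "\<dots> \<le> a + s / 2" using a c t by (simp add: mult_left_le_one_le)
    finally show ?thesis by (simp add: ennreal_leI)
  qed
  have "S \<le> ennreal (a + s / 2)" unfolding S_def by (rule SUP_least) (rule bound)
  then have "ennreal s \<le> ennreal (a + s / 2)" by (simp only: s(1))
  then have "s \<le> a + s / 2" by (subst (asm) ennreal_le_iff) (use a s in auto)
  then have "s \<le> 2 * a" by simp
  have "u t \<le> ennreal (exp (2 * c * t)) * S" by (rule us[OF t])
  also have "\<dots> \<le> ennreal (exp (2 * c * T) * (2 * a))"
    using \<open>s \<le> 2 * a\<close> s c t a by (simp add: ennreal_mult[symmetric]) (intro mult_mono; simp)
  finally show ?thesis by (simp add: mult_ac)
qed

text \<open>Cauchy-Schwarz with an \<open>ennreal\<close> on the right: drifts are known to be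
  integrable path by path, and their squares may have infinite integral.\<close>

lemma set_integral_power2_le:
  fixes \<beta> :: "real \<Rightarrow> real"
  assumes t: "0 \<le> t" and b: "set_integrable lborel {0..t} \<beta>"
  shows "ennreal ((LINT r:{0..t}|lborel. \<beta> r)\<^sup>2) \<le> ennreal t * (\<integral>\<^sup>+r\<in>{0..t}. ennreal ((\<beta> r)\<^sup>2) \<partial>lborel)"
proof (cases "t = 0")
  case True
  have "(LINT r:{0..0}|lborel. \<beta> r) = (LINT r:{}|lborel. \<beta> r)"
    by (rule set_integral_discrete_difference[where X="{0}"]) auto
  then show ?thesis using True by (simp add: set_lebesgue_integral_def)
next
  case False
  define h where "h = (\<lambda>r. indicator {0..t} r * \<beta> r)"
  have hi: "integrable lborel h" using b by (simp add: h_def set_integrable_def)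
  have hm[measurable]: "h \<in> borel_measurable lborel" using hi by (rule borel_measurable_integrable)
  have eq: "(\<integral>\<^sup>+r\<in>{0..t}. ennreal ((\<beta> r)\<^sup>2) \<partial>lborel) = (\<integral>\<^sup>+r. ennreal ((h r)\<^sup>2) \<partial>lborel)"
    by (intro nn_integral_cong) (auto simp: h_def indicator_def)
  show ?thesis
  proof (cases "(\<integral>\<^sup>+r. ennreal ((h r)\<^sup>2) \<partial>lborel) = \<infinity>")
    case True
    then show ?thesis using t False unfolding eq by (simp add: ennreal_mult_top)
  next
    case fin: False
    have h2: "integrable lborel (\<lambda>r. (h r)\<^sup>2)"
      using fin by (intro integrableI_nonneg) (auto simp: top.not_eq_extremum)
    define I where "I = (LINT r|lborel. h r)"
    have ci: "integrable lborel (\<lambda>r. (I / t)\<^sup>2 * indicator {0..t} r)"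
      using t by (intro integrable_mult_right integrable_real_indicator) auto
    \<comment> \<open>Nonnegativity of the variance of \<open>h\<close> about its mean
      \<open>I / t\<close> on [0, t].\<close>
    have "0 \<le> (LINT r|lborel. (h r - I / t * indicator {0..t} r)\<^sup>2)" by simp
    also have "(\<lambda>r. (h r - I / t * indicator {0..t} r)\<^sup>2) = (\<lambda>r. (h r)\<^sup>2 - 2 * (I / t) * h r + (I / t)\<^sup>2 * indicator {0..t} r)"
      by (auto simp: h_def indicator_def power2_eq_square algebra_simps)
    also have "(LINT r|lborel. (h r)\<^sup>2 - 2 * (I / t) * h r + (I / t)\<^sup>2 * indicator {0..t} r) = (LINT r|lborel. (h r)\<^sup>2) - 2 * (I / t) * I + (I / t)\<^sup>2 * t"
      using h2 hi ci t by (simp add: I_def)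
    finally have "I\<^sup>2 \<le> t * (LINT r|lborel. (h r)\<^sup>2)"
      using False t by (simp add: power2_eq_square field_simps)
    then have "ennreal (I\<^sup>2) \<le> ennreal t * ennreal (LINT r|lborel. (h r)\<^sup>2)"
      using t by (simp add: ennreal_mult[symmetric])
    also have "ennreal (LINT r|lborel. (h r)\<^sup>2) = (\<integral>\<^sup>+r. ennreal ((h r)\<^sup>2) \<partial>lborel)"
      using h2 by (intro nn_integral_eq_integral[symmetric]) auto
    finally show ?thesis unfolding eq by (simp add: I_def h_def set_lebesgue_integral_def)
  qed
qed

section \<open>Projections along an orthonormal basis\<close>

definition basis_proj :: "(nat \<Rightarrow> 'h::real_inner) \<Rightarrow> nat \<Rightarrow> 'h \<Rightarrow> 'h" where
  "basis_proj e m h = (\<Sum>k=1..m. inner h (e k) *\<^sub>R e k)"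

context
  fixes e :: "nat \<Rightarrow> 'h::real_inner"
  assumes e: "orthonormal_basis e"
begin

lemma inner_basis: "1 \<le> j \<Longrightarrow> 1 \<le> k \<Longrightarrow> inner (e j) (e k) = (if j = k then 1 else 0)"
  using e by (auto simp: orthonormal_basis_def)

lemma basis_proj_inner_basis:
  assumes "k \<in> {1..m}" shows "inner (basis_proj e m h) (e k) = inner h (e k)"
proof -
  have "inner (basis_proj e m h) (e k) = (\<Sum>j=1..m. inner h (e j) * inner (e j) (e k))"
    by (simp add: basis_proj_def inner_sum_left)
  also have "\<dots> = (\<Sum>j=1..m. if j = k then inner h (e k) else 0)"
    using assms by (intro sum.cong) (auto simp: inner_basis)
  also have "\<dots> = inner h (e k)" using assms by simp
  finally show ?thesis .
qed

lemma inner_basis_proj: "inner w (basis_proj e m h) = (\<Sum>k=1..m. inner w (e k) * inner h (e k))"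
  by (simp add: basis_proj_def inner_sum_right mult.commute)

lemma norm_basis_proj: "(norm (basis_proj e m h))\<^sup>2 = (\<Sum>k=1..m. (inner h (e k))\<^sup>2)"
  unfolding power2_norm_eq_inner inner_basis_proj
  by (intro sum.cong) (auto simp: basis_proj_inner_basis power2_eq_square)

lemma basis_proj_pythagoras:
  "(norm h)\<^sup>2 = (norm (h - basis_proj e m h))\<^sup>2 + (norm (basis_proj e m h))\<^sup>2"
proof -
  have "inner (basis_proj e m h) (basis_proj e m h) = inner h (basis_proj e m h)"
    unfolding inner_basis_proj by (intro sum.cong) (auto simp: basis_proj_inner_basis)
  then show ?thesis
    by (simp add: power2_norm_eq_inner inner_diff_left inner_diff_right inner_commute)
qed

lemma bessel: "(\<Sum>k=1..m. (inner h (e k))\<^sup>2) \<le> (norm h)\<^sup>2"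
  unfolding norm_basis_proj[symmetric] basis_proj_pythagoras[of h m] by simp

lemma norm_basis_proj_le: "norm (basis_proj e m h) \<le> norm h"
  by (rule power2_le_imp_le) (use bessel[of h m] in \<open>simp_all only: norm_basis_proj norm_ge_zero\<close>)

lemma norm_diff_basis_proj_le: "norm (h - basis_proj e m h) \<le> norm h"
  by (rule power2_le_imp_le) (simp_all add: basis_proj_pythagoras[of h m])

lemma basis_proj_diff: "basis_proj e m (g - h) = basis_proj e m g - basis_proj e m h"
  by (simp add: basis_proj_def inner_diff_left scaleR_left_diff_distrib sum_subtractf)

text \<open>A finite combination of basis vectors is fixed by every projection of large enough
  order. The span is the dense set on which convergence is immediate.\<close>

lemma basis_proj_span:
  assumes "y \<in> span (e ` {1..})"
  shows "\<exists>N. \<forall>m\<ge>N. basis_proj e m y = y"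
  using assms
proof (induction rule: span_induct_alt)
  case base
  then show ?case by (simp add: basis_proj_def)
next
  case (step c x y)
  from step.hyps obtain k where k: "1 \<le> k" "x = e k" by auto
  from step.IH obtain N where N: "\<And>m. m \<ge> N \<Longrightarrow> basis_proj e m y = y" by blast
  have "basis_proj e m (c *\<^sub>R x + y) = c *\<^sub>R x + y" if m: "m \<ge> max N k" for m
  proof -
    have "basis_proj e m (e k) = (\<Sum>j=1..m. if j = k then e k else 0)"
      unfolding basis_proj_def using k by (intro sum.cong) (auto simp: inner_basis)
    also have "\<dots> = e k" using k m by simp
    finally have "basis_proj e m (e k) = e k" .
    moreover have "basis_proj e m (c *\<^sub>R x + y) = c *\<^sub>R basis_proj e m x + basis_proj e m y"
      by (simp add: basis_proj_def inner_add_left scaleR_left_distrib sum.distrib scaleR_sum_right)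
    ultimately show ?thesis using N[of m] m k by simp
  qed
  then show ?case by blast
qed

text \<open>Convergence on a dense set, carried to its closure because the projections are
  contractions.\<close>

lemma basis_proj_tendsto: "(\<lambda>m. basis_proj e m h) \<longlonglongrightarrow> h"
proof (rule LIMSEQ_I)
  fix r :: real assume r: "0 < r"
  have "h \<in> closure (span (e ` {1..}))" using e by (simp add: orthonormal_basis_def)
  then obtain y where y: "y \<in> span (e ` {1..})" "dist y h < r / 2"
    using r unfolding closure_approachable by (metis half_gt_zero)
  obtain N where N: "\<And>m. m \<ge> N \<Longrightarrow> basis_proj e m y = y" using basis_proj_span[OF y(1)] by blast
  show "\<exists>N. \<forall>m\<ge>N. norm (basis_proj e m h - h) < r"
  proof (intro exI allI impI)
    fix m assume m: "N \<le> m"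
    have "basis_proj e m h - h = basis_proj e m (h - y) + (y - h)"
      by (simp add: basis_proj_diff N[OF m])
    then have "norm (basis_proj e m h - h) \<le> norm (basis_proj e m (h - y)) + norm (y - h)"
      by (simp only: norm_triangle_ineq)
    also have "\<dots> \<le> norm (h - y) + norm (y - h)" using norm_basis_proj_le by simp
    also have "\<dots> < r" using y(2) by (simp add: dist_norm norm_minus_commute)
    finally show "norm (basis_proj e m h - h) < r" .
  qed
qed

text \<open>Cauchy-Schwarz in the coordinates and Bessel for \<open>w\<close>: the constant is free
  of \<open>m\<close>. It controls the sum of the v^k Z^k by the sum of the squares of the
  Z^k.\<close>

lemma basis_sum_power2_le:
  "(\<Sum>k=1..m. inner w (e k) * d k)\<^sup>2 \<le> (norm w)\<^sup>2 * (\<Sum>k=1..m. (d k)\<^sup>2)"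
proof -
  have "(\<Sum>k=1..m. inner w (e k) * d k)\<^sup>2 \<le> (\<Sum>k=1..m. (inner w (e k))\<^sup>2) * (\<Sum>k=1..m. (d k)\<^sup>2)"
    by (rule Cauchy_Schwarz_ineq_sum)
  also have "\<dots> \<le> (norm w)\<^sup>2 * (\<Sum>k=1..m. (d k)\<^sup>2)"
    by (intro mult_right_mono bessel sum_nonneg) simp
  finally show ?thesis .
qed

end

section \<open>Brownian increments and Doob's inequality\<close>

lemma Int_stable_preimages: "Int_stable {X -` A \<inter> S | A. A \<in> sets N}"
proof (rule Int_stableI)
  fix a b assume "a \<in> {X -` A \<inter> S | A. A \<in> sets N}" "b \<in> {X -` A \<inter> S | A. A \<in> sets N}"
  then obtain A B where AB: "A \<in> sets N" "B \<in> sets N" "a = X -` A \<inter> S" "b = X -` B \<inter> S" by blast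
  have "a \<inter> b = X -` (A \<inter> B) \<inter> S" using AB by auto
  then show "a \<inter> b \<in> {X -` A \<inter> S | A. A \<in> sets N}" using sets.Int[OF AB(1,2)] by blast
qed

locale brownian =
  fixes M :: "'w measure" and W :: "real \<Rightarrow> 'w \<Rightarrow> real ^ 'd"
  assumes BM: "brownian_motion M W"
begin

sublocale prob_space M
  using BM by (simp add: brownian_motion_def)

abbreviation F :: "real \<Rightarrow> 'w measure" where "F \<equiv> natural_filtration M W"

lemma W_measurable [measurable]: "0 \<le> t \<Longrightarrow> W t \<in> borel_measurable M"
  using BM by (simp add: brownian_motion_def)

lemma natural_sigma_generators:
  "{W s -` B \<inter> space M | s B. 0 \<le> s \<and> s \<le> t \<and> B \<in> sets borel} \<subseteq> Pow (space M)"
  by auto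

lemma space_natural_sigma [simp]: "space (natural_sigma M W t) = space M"
  unfolding natural_sigma_def by (rule space_measure_of) (rule natural_sigma_generators)

lemma sets_natural_sigma:
  "sets (natural_sigma M W t) = sigma_sets (space M) {W s -` B \<inter> space M | s B. 0 \<le> s \<and> s \<le> t \<and> B \<in> sets borel}"
  unfolding natural_sigma_def by (rule sets_measure_of) (rule natural_sigma_generators)

lemma sets_natural_sigma_subset: "sets (natural_sigma M W t) \<subseteq> sets M"
  unfolding sets_natural_sigma by (rule sets.sigma_sets_subset) (auto intro!: measurable_sets[OF W_measurable])

lemma sets_natural_sigma_mono: "s \<le> t \<Longrightarrow> sets (natural_sigma M W s) \<subseteq> sets (natural_sigma M W t)"
  unfolding sets_natural_sigma by (rule sigma_sets_mono') (force intro: order_trans)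

lemma filtration_generators: "sets (natural_sigma M W t) \<union> null_sets M \<subseteq> Pow (space M)"
  using sets.sets_into_space[of _ M] sets_natural_sigma_subset[of t] by blast

lemma space_F [simp]: "space (F t) = space M"
  unfolding natural_filtration_def by (rule space_measure_of) (rule filtration_generators)

lemma sets_F: "sets (F t) = sigma_sets (space M) (sets (natural_sigma M W t) \<union> null_sets M)"
  unfolding natural_filtration_def by (rule sets_measure_of) (rule filtration_generators)

lemma sets_F_subset: "sets (F t) \<subseteq> sets M"
  unfolding sets_F by (rule sets.sigma_sets_subset) (use sets_natural_sigma_subset in auto)

lemma sets_F_mono: "s \<le> t \<Longrightarrow> sets (F s) \<subseteq> sets (F t)"
  unfolding sets_F by (rule sigma_sets_mono') (use sets_natural_sigma_mono in blast)

lemma measurable_F_mono: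
  assumes "s \<le> t" "f \<in> measurable (F s) N" shows "f \<in> measurable (F t) N"
  using measurable_mono[OF order_refl refl sets_F_mono[OF assms(1)], of N] assms(2) by auto

lemma measurable_F_M:
  assumes "f \<in> measurable (F s) N" shows "f \<in> measurable M N"
  using measurable_mono[OF order_refl refl sets_F_subset, of s N] assms by auto

lemma W_measurable_F: "0 \<le> s \<Longrightarrow> s \<le> t \<Longrightarrow> W s \<in> borel_measurable (F t)"
proof (rule measurableI)
  fix A :: "(real ^ 'd) set" assume s: "0 \<le> s" "s \<le> t" and A: "A \<in> sets borel"
  have "W s -` A \<inter> space M \<in> sets (natural_sigma M W t)"
    unfolding sets_natural_sigma using s A by (intro sigma_sets.Basic) blast
  then show "W s -` A \<inter> space (F t) \<in> sets (F t)"
    unfolding sets_F space_F by (intro sigma_sets.Basic) simp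
qed simp

text \<open>The property passes to complements and countable unions, and a null set agrees almost
  everywhere with the empty set. It reduces questions about the augmented filtration to the raw one,
  for which independence is assumed.\<close>

lemma F_approx:
  assumes "A \<in> sets (F s)"
  shows "\<exists>A'\<in>sets (natural_sigma M W s). AE \<omega> in M. \<omega> \<in> A \<longleftrightarrow> \<omega> \<in> A'"
  using assms unfolding sets_F
proof (induction rule: sigma_sets.induct)
  case (Basic a)
  then show ?case
  proof
    assume "a \<in> null_sets M"
    then have "AE \<omega> in M. \<omega> \<in> a \<longleftrightarrow> \<omega> \<in> {}" using AE_not_in by force
    then show ?thesis by blast
  qed (auto intro!: bexI[of _ a])
next
  case Empty
  then show ?case by (intro bexI[of _ "{}"]) auto
next
  case (Compl a)
  then obtain A' where A': "A' \<in> sets (natural_sigma M W s)" "AE \<omega> in M. \<omega> \<in> a \<longleftrightarrow> \<omega> \<in> A'" by blast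
  have "space M - A' \<in> sets (natural_sigma M W s)"
    using sets.compl_sets[OF A'(1)] by simp
  moreover have "AE \<omega> in M. \<omega> \<in> space M - a \<longleftrightarrow> \<omega> \<in> space M - A'" using A'(2) by auto
  ultimately show ?case by blast
next
  case (Union a)
  then have "\<forall>i. \<exists>A'. A' \<in> sets (natural_sigma M W s) \<and> (AE \<omega> in M. \<omega> \<in> a i \<longleftrightarrow> \<omega> \<in> A')" by blast
  then obtain A' where A': "\<And>i. A' i \<in> sets (natural_sigma M W s)" "\<And>i. AE \<omega> in M. \<omega> \<in> a i \<longleftrightarrow> \<omega> \<in> A' i"
    by metis
  have "(\<Union>i. A' i) \<in> sets (natural_sigma M W s)" using A'(1) by blast
  moreover have "AE \<omega> in M. \<forall>i. \<omega> \<in> a i \<longleftrightarrow> \<omega> \<in> A' i" using A'(2) by (simp add: AE_all_countable)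
  then have "AE \<omega> in M. \<omega> \<in> (\<Union>i. a i) \<longleftrightarrow> \<omega> \<in> (\<Union>i. A' i)" by (rule AE_mp) auto
  ultimately show ?case by blast
qed

text \<open>Replacing an augmented event by its raw version changes no probability, so independence
  survives the augmentation.\<close>

lemma increment_indep_set:
  assumes "0 \<le> s" "s < t"
  shows "indep_set (sets (F s)) {(\<lambda>\<omega>. W t \<omega> - W s \<omega>) -` B \<inter> space M | B. B \<in> sets borel}"
proof -
  have ind: "indep_set (sets (natural_sigma M W s)) {(\<lambda>\<omega>. W t \<omega> - W s \<omega>) -` B \<inter> space M | B. B \<in> sets borel}"
    using BM assms by (simp add: brownian_motion_def)
  show ?thesis
  proof (rule indep_setI)
    show "sets (F s) \<subseteq> events" by (rule sets_F_subset)
    show "{(\<lambda>\<omega>. W t \<omega> - W s \<omega>) -` B \<inter> space M | B. B \<in> sets borel} \<subseteq> events"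
      using ind by (rule indep_setD_ev2)
    fix A B assume A: "A \<in> sets (F s)" and B: "B \<in> {(\<lambda>\<omega>. W t \<omega> - W s \<omega>) -` B \<inter> space M | B. B \<in> sets borel}"
    obtain A' where A': "A' \<in> sets (natural_sigma M W s)" "AE \<omega> in M. \<omega> \<in> A \<longleftrightarrow> \<omega> \<in> A'"
      using F_approx[OF A] by blast
    have ev: "A \<in> events" "A' \<in> events" "B \<in> events"
      using A A'(1) B sets_F_subset sets_natural_sigma_subset indep_setD_ev2[OF ind] by blast+
    have "prob (A \<inter> B) = prob (A' \<inter> B)"
      by (rule measure_eq_AE) (use A'(2) ev in auto)
    also have "\<dots> = prob A' * prob B" using indep_setD[OF ind A'(1) B] .
    also have "prob A' = prob A"
      by (rule measure_eq_AE) (use A'(2) ev in auto)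
    finally show "prob (A \<inter> B) = prob A * prob B" .
  qed
qed

lemma indep_var_increment:
  assumes st: "0 \<le> s" "s < t" and Y: "Y \<in> borel_measurable (F s)" and f: "f \<in> borel_measurable borel"
  shows "indep_var borel (Y :: 'w \<Rightarrow> real) borel (\<lambda>\<omega>. f (W t \<omega> - W s \<omega>) :: real)"
proof -
  have fm: "(\<lambda>\<omega>. f (W t \<omega> - W s \<omega>)) \<in> borel_measurable M"
    using W_measurable[of s] W_measurable[of t] st by (intro measurable_compose[OF _ f]) simp
  have Ym: "Y \<in> borel_measurable M" using measurable_F_M[OF Y] .
  have "indep_set (sigma_sets (space M) {Y -` A \<inter> space M |A. A \<in> sets borel})
      (sigma_sets (space M) {(\<lambda>\<omega>. f (W t \<omega> - W s \<omega>)) -` A \<inter> space M |A. A \<in> sets borel})"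
  proof (rule indep_set_sigma_sets)
    have 1: "{Y -` A \<inter> space M |A. A \<in> sets borel} \<subseteq> sets (F s)"
      using measurable_sets[OF Y] by auto
    have 2: "{(\<lambda>\<omega>. f (W t \<omega> - W s \<omega>)) -` A \<inter> space M |A. A \<in> sets borel}
        \<subseteq> {(\<lambda>\<omega>. W t \<omega> - W s \<omega>) -` B \<inter> space M | B. B \<in> sets borel}"
    proof
      fix C assume "C \<in> {(\<lambda>\<omega>. f (W t \<omega> - W s \<omega>)) -` A \<inter> space M |A. A \<in> sets borel}"
      then obtain A where A: "A \<in> sets borel" "C = (\<lambda>\<omega>. f (W t \<omega> - W s \<omega>)) -` A \<inter> space M" by blast
      have "f -` A \<in> sets borel" using measurable_sets[OF f A(1)] by simp
      moreover have "C = (\<lambda>\<omega>. W t \<omega> - W s \<omega>) -` (f -` A) \<inter> space M" unfolding A(2) by auto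
      ultimately show "C \<in> {(\<lambda>\<omega>. W t \<omega> - W s \<omega>) -` B \<inter> space M | B. B \<in> sets borel}" by blast
    qed
    note ind = increment_indep_set[OF st]
    show "indep_set {Y -` A \<inter> space M |A. A \<in> sets borel} {(\<lambda>\<omega>. f (W t \<omega> - W s \<omega>)) -` A \<inter> space M |A. A \<in> sets borel}"
    proof (rule indep_setI)
      fix A B assume A: "A \<in> {Y -` A \<inter> space M |A. A \<in> sets borel}" and B: "B \<in> {(\<lambda>\<omega>. f (W t \<omega> - W s \<omega>)) -` A \<inter> space M |A. A \<in> sets borel}"
      show "prob (A \<inter> B) = prob A * prob B" by (rule indep_setD[OF ind subsetD[OF 1 A] subsetD[OF 2 B]])
    next
      show "{Y -` A \<inter> space M |A. A \<in> sets borel} \<subseteq> events" by (rule order_trans[OF 1 sets_F_subset])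
      show "{(\<lambda>\<omega>. f (W t \<omega> - W s \<omega>)) -` A \<inter> space M |A. A \<in> sets borel} \<subseteq> events"
        by (rule order_trans[OF 2 indep_setD_ev2[OF ind]])
    qed
    show "Int_stable {Y -` A \<inter> space M |A. A \<in> sets borel}"
      by (rule Int_stable_preimages)
    show "Int_stable {(\<lambda>\<omega>. f (W t \<omega> - W s \<omega>)) -` A \<inter> space M |A. A \<in> sets borel}"
      by (rule Int_stable_preimages)
  qed
  then show ?thesis unfolding indep_var_eq using fm Ym by simp
qed

definition dW :: "real \<Rightarrow> real \<Rightarrow> 'd \<Rightarrow> 'w \<Rightarrow> real" where
  "dW s t j \<omega> = (W t \<omega> - W s \<omega>) $ j"

lemma dW_distributed:
  assumes "0 \<le> s" "s < t"
  shows "distributed M lborel (dW s t j) (normal_density 0 (sqrt (t - s)))"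
  using BM assms by (simp add: brownian_motion_def dW_def[abs_def])

lemma dW_moments:
  assumes st: "0 \<le> s" "s < t"
  shows "integrable M (dW s t j)" "expectation (dW s t j) = 0"
    "integrable M (\<lambda>\<omega>. (dW s t j \<omega>)\<^sup>2)" "expectation (\<lambda>\<omega>. (dW s t j \<omega>)\<^sup>2) = t - s"
proof -
  note D = dW_distributed[OF st, of j]
  have pos: "0 < sqrt (t - s)" using st by simp
  show e: "expectation (dW s t j) = 0"
    using normal_distributed_expectation[OF pos D] .
  show "integrable M (dW s t j)"
    using distributed_integrable[OF D, of "\<lambda>x. x"] integrable_normal_moment_nz_1[OF pos, of 0] by simp
  have "integrable lborel (\<lambda>x. normal_density 0 (sqrt (t - s)) x * (x - 0) ^ 2)"
    by (rule integrable_normal_moment[OF pos])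
  then show "integrable M (\<lambda>\<omega>. (dW s t j \<omega>)\<^sup>2)"
    using distributed_integrable[OF D, of "\<lambda>x. x\<^sup>2"] by simp
  have "variance (dW s t j) = (sqrt (t - s))\<^sup>2"
    using normal_distributed_variance[OF pos D] .
  then show "expectation (\<lambda>\<omega>. (dW s t j \<omega>)\<^sup>2) = t - s" using e st by simp
qed

lemma dW_cross:
  assumes st: "0 \<le> s" "s < t" and ij: "i \<noteq> j"
  shows "integrable M (\<lambda>\<omega>. dW s t i \<omega> * dW s t j \<omega>)" "expectation (\<lambda>\<omega>. dW s t i \<omega> * dW s t j \<omega>) = 0"
proof -
  have iv: "indep_vars (\<lambda>_. borel) (\<lambda>j \<omega>. (W t \<omega> - W s \<omega>) $ j) UNIV"
    using BM st by (simp add: brownian_motion_def)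
  then have iv2: "indep_vars (\<lambda>_. borel) (dW s t) {i, j}"
    unfolding dW_def[abs_def] by (rule indep_vars_subset) simp
  note m = dW_moments[OF st]
  show "integrable M (\<lambda>\<omega>. dW s t i \<omega> * dW s t j \<omega>)"
    using indep_vars_integrable[OF _ iv2 m(1)] ij by simp
  show "expectation (\<lambda>\<omega>. dW s t i \<omega> * dW s t j \<omega>) = 0"
    using indep_vars_lebesgue_integral[OF _ iv2 m(1)] m(2) ij by simp
qed

text \<open>Independence factorises the expectation and the increment is centred; this is the
  martingale property in the form used below.\<close>

lemma increment_zero_mean:
  assumes st: "0 \<le> s" "s < t" and Y: "Y \<in> borel_measurable (F s)" "integrable M Y"
  shows "integrable M (\<lambda>\<omega>. Y \<omega> * dW s t j \<omega>)" "expectation (\<lambda>\<omega>. Y \<omega> * dW s t j \<omega>) = 0"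
proof -
  have iv: "indep_var borel Y borel (dW s t j)"
    using indep_var_increment[OF st Y(1), of "\<lambda>x. x $ j"] by (simp add: dW_def[abs_def])
  note m = dW_moments[OF st]
  show "integrable M (\<lambda>\<omega>. Y \<omega> * dW s t j \<omega>)" by (rule indep_var_integrable[OF iv Y(2) m(1)])
  show "expectation (\<lambda>\<omega>. Y \<omega> * dW s t j \<omega>) = 0"
    using indep_var_lebesgue_integral[OF iv Y(2) m(1)] m(2) by simp
qed

text \<open>With \<open>Y\<close> a product of two components of an integrand this is one step of
  the Ito isometry. The off-diagonal terms vanish because distinct components of an increment are
  independent and centred.\<close>

lemma increment_covariance:
  assumes st: "0 \<le> s" "s < t" and Y: "Y \<in> borel_measurable (F s)" "integrable M Y"
  shows "integrable M (\<lambda>\<omega>. Y \<omega> * (dW s t i \<omega> * dW s t j \<omega>))"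
    "expectation (\<lambda>\<omega>. Y \<omega> * (dW s t i \<omega> * dW s t j \<omega>)) = (if i = j then (t - s) * expectation Y else 0)"
proof -
  have iv: "indep_var borel Y borel (\<lambda>\<omega>. dW s t i \<omega> * dW s t j \<omega>)"
    using indep_var_increment[OF st Y(1), of "\<lambda>x. x $ i * x $ j"] by (simp add: dW_def[abs_def])
  have m: "integrable M (\<lambda>\<omega>. dW s t i \<omega> * dW s t j \<omega>)"
    "expectation (\<lambda>\<omega>. dW s t i \<omega> * dW s t j \<omega>) = (if i = j then t - s else 0)"
    using dW_moments(3,4)[OF st, of i] dW_cross[OF st, of i j] by (auto simp: power2_eq_square)
  show "integrable M (\<lambda>\<omega>. Y \<omega> * (dW s t i \<omega> * dW s t j \<omega>))" by (rule indep_var_integrable[OF iv Y(2) m(1)])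
  show "expectation (\<lambda>\<omega>. Y \<omega> * (dW s t i \<omega> * dW s t j \<omega>)) = (if i = j then (t - s) * expectation Y else 0)"
    using indep_var_lebesgue_integral[OF iv Y(2) m(1)] m(2) by auto
qed

end

text \<open>A recursion instead of a maximum over a set of indices: both the pathwise inequality and
  adaptedness are inductions on \<open>n\<close>.\<close>

primrec run_max :: "(nat \<Rightarrow> real) \<Rightarrow> nat \<Rightarrow> real" where
  "run_max f 0 = \<bar>f 0\<bar>"
| "run_max f (Suc n) = max (run_max f n) \<bar>f (Suc n)\<bar>"

lemma run_max_ge: "j \<le> n \<Longrightarrow> \<bar>f j\<bar> \<le> run_max f n"
  by (induction n) (auto simp: le_Suc_eq max.coboundedI1 max.coboundedI2)

lemma run_max_nonneg: "0 \<le> run_max f n"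
  using run_max_ge[of 0 n f] by simp

lemma run_max_le_sum: "run_max f n \<le> (\<Sum>k\<le>n. \<bar>f k\<bar>)"
proof (induction n)
  case (Suc n)
  have "0 \<le> (\<Sum>k\<le>n. \<bar>f k\<bar>)" by (rule sum_nonneg) simp
  with Suc show ?case by simp
qed simp

text \<open>The pathwise form of Doob's inequality: the subtracted sum is a discrete stochastic integral,
  so it vanishes in expectation along a martingale.\<close>

lemma pathwise_doob:
  assumes f0: "f 0 = 0"
  shows "(run_max f n)\<^sup>2 \<le> 4 * (f n)\<^sup>2 - 4 * (\<Sum>k<n. run_max f k * sgn (f k) * (f (Suc k) - f k))"
proof -
  define H where "H = (\<lambda>n. \<Sum>k<n. run_max f k * (\<bar>f (Suc k)\<bar> - \<bar>f k\<bar>))"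
  \<comment> \<open>In continuous time the integral of the running maximum m against |f| equals m|f|
    - m^2/2, since m grows only while it equals |f|. In discrete time a jump of the maximum leaves a
    square of the favourable sign.\<close>
  have 1: "H n \<le> run_max f n * \<bar>f n\<bar> - (run_max f n)\<^sup>2 / 2"
  proof (induction n)
    case 0
    then show ?case by (simp add: H_def f0)
  next
    case (Suc n)
    have "H (Suc n) \<le> run_max f n * \<bar>f (Suc n)\<bar> - (run_max f n)\<^sup>2 / 2"
      using Suc by (simp add: H_def algebra_simps)
    also have "\<dots> \<le> run_max f (Suc n) * \<bar>f (Suc n)\<bar> - (run_max f (Suc n))\<^sup>2 / 2"
    proof (cases "\<bar>f (Suc n)\<bar> \<le> run_max f n")
      case True
      then show ?thesis by (simp add: max_def)
    next
      case False
      have "0 \<le> (\<bar>f (Suc n)\<bar> - run_max f n)\<^sup>2" by simp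
      then have "2 * (run_max f n * \<bar>f (Suc n)\<bar>) \<le> (run_max f n)\<^sup>2 + \<bar>f (Suc n)\<bar>\<^sup>2"
        unfolding power2_diff by (simp add: mult.commute)
      moreover have "run_max f (Suc n) = \<bar>f (Suc n)\<bar>" using False by simp
      ultimately show ?thesis by (simp add: power2_eq_square)
    qed
    finally show ?case .
  qed
  \<comment> \<open>Convexity of the absolute value, with slope \<open>sgn (f k)\<close> at
    \<open>f k\<close>.\<close>
  have 2: "(\<Sum>k<n. run_max f k * sgn (f k) * (f (Suc k) - f k)) \<le> H n"
    unfolding H_def
  proof (rule sum_mono)
    fix k
    have "sgn (f k) * f (Suc k) \<le> \<bar>f (Suc k)\<bar>" by (auto simp: sgn_if)
    moreover have "sgn (f k) * f k = \<bar>f k\<bar>" by (simp add: abs_sgn mult.commute)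
    ultimately have "sgn (f k) * (f (Suc k) - f k) \<le> \<bar>f (Suc k)\<bar> - \<bar>f k\<bar>" by (simp add: right_diff_distrib)
    then show "run_max f k * sgn (f k) * (f (Suc k) - f k) \<le> run_max f k * (\<bar>f (Suc k)\<bar> - \<bar>f k\<bar>)"
      unfolding mult.assoc by (rule mult_left_mono) (rule run_max_nonneg)
  qed
  \<comment> \<open>Young's inequality in the form that absorbs half of the squared maximum; this
    produces the constant 4.\<close>
  have "0 \<le> (run_max f n - 2 * \<bar>f n\<bar>)\<^sup>2" by simp
  then have "4 * (run_max f n * \<bar>f n\<bar>) \<le> (run_max f n)\<^sup>2 + 4 * (f n)\<^sup>2"
    unfolding power2_diff by (simp add: power_mult_distrib mult.commute mult.left_commute)
  then show ?thesis using 1 2 by linarith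
qed

section \<open>Isometry and maximal inequality for discrete stochastic integrals\<close>

context brownian
begin

definition disc_int :: "(nat \<Rightarrow> real) \<Rightarrow> (nat \<Rightarrow> 'w \<Rightarrow> real ^ 'd) \<Rightarrow> nat \<Rightarrow> 'w \<Rightarrow> real" where
  "disc_int s \<eta> n \<omega> = (\<Sum>i<n. inner (\<eta> i \<omega>) (W (s (Suc i)) \<omega> - W (s i) \<omega>))"

lemma disc_int_Suc:
  "disc_int s \<eta> (Suc n) \<omega> = disc_int s \<eta> n \<omega> + (\<Sum>j\<in>UNIV. \<eta> n \<omega> $ j * dW (s n) (s (Suc n)) j \<omega>)"
  by (simp add: disc_int_def inner_vec_def dW_def)

context
  fixes s :: "nat \<Rightarrow> real" and \<eta> :: "nat \<Rightarrow> 'w \<Rightarrow> real ^ 'd" and N :: nat and C :: real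
  assumes s0: "0 \<le> s 0" and s_less: "\<And>i. i < N \<Longrightarrow> s i < s (Suc i)"
    and \<eta>_meas: "\<And>i. i < N \<Longrightarrow> \<eta> i \<in> borel_measurable (F (s i))"
    and \<eta>_bdd: "\<And>i \<omega>. i < N \<Longrightarrow> norm (\<eta> i \<omega>) \<le> C"
begin

lemma grid_mono: "i \<le> j \<Longrightarrow> j \<le> N \<Longrightarrow> s i \<le> s j"
proof (induction j)
  case (Suc j)
  then show ?case using s_less[of j] by (cases "i = Suc j") auto
qed simp

lemma grid_nonneg: "i \<le> N \<Longrightarrow> 0 \<le> s i"
  using grid_mono[of 0 i] s0 by simp

lemma \<eta>_comp_meas: "i < N \<Longrightarrow> (\<lambda>\<omega>. \<eta> i \<omega> $ j) \<in> borel_measurable (F (s i))"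
  by (rule measurable_compose[OF \<eta>_meas borel_measurable_nth])

lemma \<eta>_comp_bdd: "i < N \<Longrightarrow> \<bar>\<eta> i \<omega> $ j\<bar> \<le> C"
  using \<eta>_bdd[of i \<omega>] component_le_norm_cart[of "\<eta> i \<omega>" j] by simp

lemma C_nonneg: "i < N \<Longrightarrow> 0 \<le> C"
  using \<eta>_bdd[of i undefined] norm_ge_zero order_trans by blast

lemma disc_int_meas: "n \<le> N \<Longrightarrow> disc_int s \<eta> n \<in> borel_measurable (F (s n))"
proof (induction n)
  case 0
  then show ?case by (simp add: disc_int_def[abs_def])
next
  case (Suc n)
  have 1: "disc_int s \<eta> n \<in> borel_measurable (F (s (Suc n)))"
    using Suc s_less[of n] by (intro measurable_F_mono[of "s n" "s (Suc n)"]) auto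
  have 2: "\<eta> n \<in> borel_measurable (F (s (Suc n)))"
    using Suc s_less[of n] \<eta>_meas[of n] by (intro measurable_F_mono[of "s n" "s (Suc n)"]) auto
  have 3: "W (s (Suc n)) \<in> borel_measurable (F (s (Suc n)))" "W (s n) \<in> borel_measurable (F (s (Suc n)))"
    using Suc s_less[of n] grid_nonneg[of n] by (auto intro!: W_measurable_F)
  have "disc_int s \<eta> (Suc n) = (\<lambda>\<omega>. disc_int s \<eta> n \<omega> + inner (\<eta> n \<omega>) (W (s (Suc n)) \<omega> - W (s n) \<omega>))"
    by (auto simp: disc_int_def)
  then show ?case using 1 2 3 by (simp add: borel_measurable_add borel_measurable_inner borel_measurable_diff)
qed

lemma bounded_mult_integrable:
  assumes i: "i < N" and Y: "Y \<in> borel_measurable (F (s i))" "integrable M Y"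
  shows "(\<lambda>\<omega>. Y \<omega> * \<eta> i \<omega> $ j) \<in> borel_measurable (F (s i))" "integrable M (\<lambda>\<omega>. Y \<omega> * \<eta> i \<omega> $ j)"
proof -
  show m: "(\<lambda>\<omega>. Y \<omega> * \<eta> i \<omega> $ j) \<in> borel_measurable (F (s i))"
    using Y(1) \<eta>_comp_meas[OF i] by (rule borel_measurable_times)
  show "integrable M (\<lambda>\<omega>. Y \<omega> * \<eta> i \<omega> $ j)"
  proof (rule Bochner_Integration.integrable_bound[of M "\<lambda>\<omega>. C * \<bar>Y \<omega>\<bar>"])
    show "integrable M (\<lambda>\<omega>. C * \<bar>Y \<omega>\<bar>)" using Y by simp
    show "AE x in M. norm (Y x * \<eta> i x $ j) \<le> norm (C * \<bar>Y x\<bar>)"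
    proof (intro always_eventually allI)
      fix x
      have "\<bar>Y x\<bar> * \<bar>\<eta> i x $ j\<bar> \<le> \<bar>Y x\<bar> * C" by (intro mult_left_mono \<eta>_comp_bdd i) simp
      then show "norm (Y x * \<eta> i x $ j) \<le> norm (C * \<bar>Y x\<bar>)"
        using C_nonneg[OF i] by (simp add: abs_mult mult.commute)
    qed
  qed (rule measurable_F_M[OF m])
qed

text \<open>The discrete Ito isometry, by induction on the number of increments: expanding the
  square leaves a term linear in the newest increment, which has mean zero, and a quadratic one, of
  which only the diagonal survives. Square integrability runs along in the induction because the
  linear term relies on it.\<close>

lemma disc_int_square:
  assumes "n \<le> N"
  shows "integrable M (\<lambda>\<omega>. (disc_int s \<eta> n \<omega>)\<^sup>2) \<and>
    expectation (\<lambda>\<omega>. (disc_int s \<eta> n \<omega>)\<^sup>2) = (\<Sum>i<n. (s (Suc i) - s i) * expectation (\<lambda>\<omega>. (norm (\<eta> i \<omega>))\<^sup>2))"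
  using assms
proof (induction n)
  case 0
  then show ?case by (simp add: disc_int_def)
next
  case (Suc n)
  then have n: "n < N" by simp
  have st: "0 \<le> s n" "s n < s (Suc n)" using grid_nonneg s_less n by auto
  let ?X = "disc_int s \<eta> n"
  let ?d = "dW (s n) (s (Suc n))"
  have Xm: "?X \<in> borel_measurable (F (s n))" using disc_int_meas n by simp
  have X2: "integrable M (\<lambda>\<omega>. (?X \<omega>)\<^sup>2)" using Suc n by simp
  have X1: "integrable M ?X" using square_integrable_imp_integrable[OF measurable_F_M[OF Xm] X2] .
  have eq: "(disc_int s \<eta> (Suc n) \<omega>)\<^sup>2 = (?X \<omega>)\<^sup>2 + 2 * (\<Sum>j\<in>UNIV. (?X \<omega> * \<eta> n \<omega> $ j) * ?d j \<omega>) +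
      (\<Sum>j\<in>UNIV. \<Sum>k\<in>UNIV. (\<eta> n \<omega> $ j * \<eta> n \<omega> $ k) * (?d j \<omega> * ?d k \<omega>))" for \<omega>
  proof -
    have "(\<Sum>j\<in>UNIV. \<eta> n \<omega> $ j * ?d j \<omega>)\<^sup>2 = (\<Sum>j\<in>UNIV. \<Sum>k\<in>UNIV. (\<eta> n \<omega> $ j * \<eta> n \<omega> $ k) * (?d j \<omega> * ?d k \<omega>))"
      unfolding power2_eq_square sum_product by (intro sum.cong refl) (simp add: mult_ac)
    then show ?thesis unfolding disc_int_Suc power2_sum by (simp add: sum_distrib_left mult_ac)
  qed
  note A = increment_zero_mean[OF st bounded_mult_integrable[OF n Xm X1]]
  have em: "(\<lambda>\<omega>. \<eta> n \<omega> $ j) \<in> borel_measurable (F (s n))" for j by (rule \<eta>_comp_meas[OF n])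
  have ei: "integrable M (\<lambda>\<omega>. \<eta> n \<omega> $ j)" for j
    using measurable_F_M[OF em] \<eta>_comp_bdd[OF n] by (intro integrable_const_bound[of _ C]) auto
  note B = increment_covariance[OF st bounded_mult_integrable[OF n em ei]]
  have nrm: "(norm (\<eta> n \<omega>))\<^sup>2 = (\<Sum>j\<in>UNIV. \<eta> n \<omega> $ j * \<eta> n \<omega> $ j)" for \<omega>
    by (simp add: power2_norm_eq_inner inner_vec_def)
  have "expectation (\<lambda>\<omega>. (disc_int s \<eta> (Suc n) \<omega>)\<^sup>2) = expectation (\<lambda>\<omega>. (?X \<omega>)\<^sup>2) +
     (\<Sum>j\<in>UNIV. \<Sum>k\<in>UNIV. if j = k then (s (Suc n) - s n) * expectation (\<lambda>\<omega>. \<eta> n \<omega> $ j * \<eta> n \<omega> $ k) else 0)"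
    unfolding eq using X2 A B by (simp add: Bochner_Integration.integral_sum)
  also have "(\<Sum>j\<in>UNIV. \<Sum>k\<in>UNIV. if j = k then (s (Suc n) - s n) * expectation (\<lambda>\<omega>. \<eta> n \<omega> $ j * \<eta> n \<omega> $ k) else 0)
     = (s (Suc n) - s n) * expectation (\<lambda>\<omega>. (norm (\<eta> n \<omega>))\<^sup>2)"
    unfolding nrm using bounded_mult_integrable(2)[OF n em ei]
    by (simp add: sum.delta Bochner_Integration.integral_sum sum_distrib_left)
  finally show ?case
    using Suc n X2 A(1) B(1) unfolding eq by (auto intro!: Bochner_Integration.integrable_add integrable_mult_right Bochner_Integration.integrable_sum)
qed

lemma run_max_meas: "n \<le> N \<Longrightarrow> (\<lambda>\<omega>. run_max (\<lambda>k. disc_int s \<eta> k \<omega>) n) \<in> borel_measurable (F (s n))"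
proof (induction n)
  case 0
  then show ?case by (simp add: disc_int_def)
next
  case (Suc n)
  have "(\<lambda>\<omega>. run_max (\<lambda>k. disc_int s \<eta> k \<omega>) n) \<in> borel_measurable (F (s (Suc n)))"
    using Suc s_less[of n] by (intro measurable_F_mono[of "s n" "s (Suc n)"]) auto
  then show ?case using disc_int_meas[OF Suc.prems] by (simp add: borel_measurable_max)
qed

lemma disc_int_integrable: "n \<le> N \<Longrightarrow> integrable M (disc_int s \<eta> n)"
  using square_integrable_imp_integrable[OF measurable_F_M[OF disc_int_meas]] disc_int_square by blast

lemma run_max_integrable: "n \<le> N \<Longrightarrow> integrable M (\<lambda>\<omega>. run_max (\<lambda>k. disc_int s \<eta> k \<omega>) n)"
proof (rule Bochner_Integration.integrable_bound[of M "\<lambda>\<omega>. \<Sum>k\<le>n. \<bar>disc_int s \<eta> k \<omega>\<bar>"])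
  assume n: "n \<le> N"
  show "integrable M (\<lambda>\<omega>. \<Sum>k\<le>n. \<bar>disc_int s \<eta> k \<omega>\<bar>)"
    using n disc_int_integrable by (intro Bochner_Integration.integrable_sum integrable_abs) auto
  show "AE x in M. norm (run_max (\<lambda>k. disc_int s \<eta> k x) n) \<le> norm (\<Sum>k\<le>n. \<bar>disc_int s \<eta> k x\<bar>)"
    using run_max_le_sum[of "\<lambda>k. disc_int s \<eta> k _" n] run_max_nonneg[of "\<lambda>k. disc_int s \<eta> k _" n]
    by (intro always_eventually allI) (simp add: sum_nonneg)
qed (rule measurable_F_M[OF run_max_meas])

text \<open>Expectation of \<open>pathwise_doob\<close>: the running maximum and the sign are known
  at the left end of each cell, so every summand of the subtracted sum has mean zero. The remaining
  term is evaluated by the isometry.\<close>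

lemma discrete_doob:
  "(\<integral>\<^sup>+\<omega>. ennreal ((run_max (\<lambda>k. disc_int s \<eta> k \<omega>) N)\<^sup>2) \<partial>M)
     \<le> 4 * (\<integral>\<^sup>+\<omega>. ennreal (\<Sum>i<N. (s (Suc i) - s i) * (norm (\<eta> i \<omega>))\<^sup>2) \<partial>M)"
proof -
  let ?m = "\<lambda>n \<omega>. run_max (\<lambda>k. disc_int s \<eta> k \<omega>) n"
  let ?f = "\<lambda>n \<omega>. disc_int s \<eta> n \<omega>"
  define Z where "Z = (\<lambda>k \<omega>. ?m k \<omega> * sgn (?f k \<omega>) * (?f (Suc k) \<omega> - ?f k \<omega>))"
  have Z: "integrable M (Z k)" "expectation (Z k) = 0" if k: "k < N" for k
  proof -
    have st: "0 \<le> s k" "s k < s (Suc k)" using grid_nonneg s_less k by auto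
    let ?Y = "\<lambda>\<omega>. ?m k \<omega> * sgn (?f k \<omega>)"
    have Ym: "?Y \<in> borel_measurable (F (s k))"
      using run_max_meas[of k] k
      by (intro borel_measurable_times measurable_compose[OF disc_int_meas borel_measurable_sgn]) auto
    have Yi: "integrable M ?Y"
    proof (rule Bochner_Integration.integrable_bound[OF run_max_integrable])
      show "AE x in M. norm (?m k x * sgn (?f k x)) \<le> norm (?m k x)"
        by (intro always_eventually allI) (auto simp: abs_mult sgn_if)
    qed (use k measurable_F_M[OF Ym] in auto)
    note A = increment_zero_mean[OF st bounded_mult_integrable[OF k Ym Yi]]
    have eq: "Z k = (\<lambda>\<omega>. \<Sum>j\<in>UNIV. (?Y \<omega> * \<eta> k \<omega> $ j) * dW (s k) (s (Suc k)) j \<omega>)"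
      by (rule ext) (simp add: Z_def disc_int_Suc sum_distrib_left mult_ac)
    show "integrable M (Z k)" "expectation (Z k) = 0"
      unfolding eq using A by (simp_all add: Bochner_Integration.integral_sum)
  qed
  define R where "R = (\<lambda>\<omega>. 4 * (?f N \<omega>)\<^sup>2 - 4 * (\<Sum>k<N. Z k \<omega>))"
  have R: "(?m N \<omega>)\<^sup>2 \<le> R \<omega>" for \<omega>
    unfolding R_def Z_def by (rule pathwise_doob) (simp add: disc_int_def)
  note sq = disc_int_square[OF order_refl]
  have zi: "integrable M (\<lambda>\<omega>. \<Sum>k<N. Z k \<omega>)" using Z by (intro Bochner_Integration.integrable_sum) auto
  have Ri: "integrable M R" unfolding R_def
    using sq zi by (intro Bochner_Integration.integrable_diff integrable_mult_right) auto
  have "expectation R = 4 * expectation (\<lambda>\<omega>. (?f N \<omega>)\<^sup>2) - 4 * expectation (\<lambda>\<omega>. \<Sum>k<N. Z k \<omega>)"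
    unfolding R_def using sq zi by (subst Bochner_Integration.integral_diff) auto
  also have "expectation (\<lambda>\<omega>. \<Sum>k<N. Z k \<omega>) = 0"
    using Z by (subst Bochner_Integration.integral_sum) auto
  also have "4 * expectation (\<lambda>\<omega>. (?f N \<omega>)\<^sup>2) - 4 * 0 = 4 * (\<Sum>i<N. (s (Suc i) - s i) * expectation (\<lambda>\<omega>. (norm (\<eta> i \<omega>))\<^sup>2))"
    using sq by simp
  finally have ER: "expectation R = 4 * (\<Sum>i<N. (s (Suc i) - s i) * expectation (\<lambda>\<omega>. (norm (\<eta> i \<omega>))\<^sup>2))" .
  have ni: "integrable M (\<lambda>\<omega>. (norm (\<eta> i \<omega>))\<^sup>2)" if "i < N" for i
  proof (rule integrable_const_bound[of _ "C\<^sup>2"])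
    show "AE x in M. norm ((norm (\<eta> i x))\<^sup>2) \<le> C\<^sup>2"
      using \<eta>_bdd[OF that] by (intro always_eventually allI) (simp add: power_mono)
    show "(\<lambda>\<omega>. (norm (\<eta> i \<omega>))\<^sup>2) \<in> borel_measurable M"
      using measurable_F_M[OF \<eta>_meas[OF that]] by measurable
  qed
  have pos: "0 \<le> (\<Sum>i<N. (s (Suc i) - s i) * (norm (\<eta> i \<omega>))\<^sup>2)" for \<omega>
    using s_less by (intro sum_nonneg mult_nonneg_nonneg) (auto simp: less_imp_le)
  have "(\<integral>\<^sup>+\<omega>. ennreal ((?m N \<omega>)\<^sup>2) \<partial>M) \<le> (\<integral>\<^sup>+\<omega>. ennreal (R \<omega>) \<partial>M)"
    using R by (intro nn_integral_mono ennreal_leI)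
  also have "\<dots> = ennreal (expectation R)"
    using Ri R by (intro nn_integral_eq_integral) (auto intro!: always_eventually order_trans[OF zero_le_power2])
  also have "expectation R = 4 * expectation (\<lambda>\<omega>. \<Sum>i<N. (s (Suc i) - s i) * (norm (\<eta> i \<omega>))\<^sup>2)"
    unfolding ER using ni by (subst Bochner_Integration.integral_sum) auto
  also have "ennreal \<dots> = 4 * ennreal (expectation (\<lambda>\<omega>. \<Sum>i<N. (s (Suc i) - s i) * (norm (\<eta> i \<omega>))\<^sup>2))"
    by (subst ennreal_mult) (auto intro!: Bochner_Integration.integral_nonneg pos)
  also have "ennreal (expectation (\<lambda>\<omega>. \<Sum>i<N. (s (Suc i) - s i) * (norm (\<eta> i \<omega>))\<^sup>2)) =
     (\<integral>\<^sup>+\<omega>. ennreal (\<Sum>i<N. (s (Suc i) - s i) * (norm (\<eta> i \<omega>))\<^sup>2) \<partial>M)"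
    using ni pos by (intro nn_integral_eq_integral[symmetric] Bochner_Integration.integrable_sum) auto
  finally show ?thesis .
qed

end

end

section \<open>Progressive processes and localisation\<close>

text \<open>Values in \<open>ennreal\<close> keep it defined and monotone in time along every path;
  finiteness is only available almost surely.\<close>

definition energy :: "(real \<Rightarrow> 'w \<Rightarrow> ennreal) \<Rightarrow> real \<Rightarrow> 'w \<Rightarrow> ennreal" where
  "energy \<psi> t \<omega> = (\<integral>\<^sup>+r\<in>{0..t}. \<psi> r \<omega> \<partial>lborel)"

lemma energy_mono: "s \<le> t \<Longrightarrow> energy \<psi> s \<omega> \<le> energy \<psi> t \<omega>"
  unfolding energy_def by (intro nn_integral_mono mult_left_mono) (auto simp: indicator_def)

text \<open>The level is an \<open>ennreal\<close> so that \<open>K = \<top>\<close> recovers the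
  ungated statements. Monotonicity in time lets the value at \<open>t\<close> be moved inside
  integrals over earlier times.\<close>

definition gate :: "ennreal \<Rightarrow> (real \<Rightarrow> 'w \<Rightarrow> ennreal) \<Rightarrow> real \<Rightarrow> 'w \<Rightarrow> ennreal" where
  "gate K \<psi> t \<omega> = (if energy \<psi> t \<omega> \<le> K then 1 else 0)"

lemma gate_mono: "s \<le> t \<Longrightarrow> gate K \<psi> t \<omega> \<le> gate K \<psi> s \<omega>"
  using energy_mono[of s t \<psi> \<omega>] by (auto simp: gate_def)

lemma gate_top [simp]: "gate \<top> \<psi> t \<omega> = 1"
  by (simp add: gate_def)

lemma gate_le_1: "gate K \<psi> t \<omega> \<le> 1"
  by (simp add: gate_def)

lemma progressive_compose:
  assumes "progressive G T Y" "f \<in> borel_measurable borel"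
  shows "progressive G T (\<lambda>t \<omega>. f (Y t \<omega>))"
  unfolding progressive_def
proof
  fix t assume "t \<in> {0..T}"
  then have "(\<lambda>(s, \<omega>). Y s \<omega>) \<in> borel_measurable (restrict_space borel {0..t} \<Otimes>\<^sub>M G t)"
    using assms(1) by (simp add: progressive_def)
  from measurable_compose[OF this assms(2)]
  show "(\<lambda>(s, \<omega>). f (Y s \<omega>)) \<in> borel_measurable (restrict_space borel {0..t} \<Otimes>\<^sub>M G t)"
    by (simp add: split_beta')
qed

lemma progressive_mono: "progressive G T Y \<Longrightarrow> S \<le> T \<Longrightarrow> progressive G S Y"
  by (simp add: progressive_def)

lemma progressive_add:
  fixes Y Z :: "real \<Rightarrow> 'w \<Rightarrow> 'b::{second_countable_topology, topological_monoid_add}"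
  assumes "progressive G T Y" "progressive G T Z"
  shows "progressive G T (\<lambda>t \<omega>. Y t \<omega> + Z t \<omega>)"
  using assms unfolding progressive_def split_beta' by (auto intro!: borel_measurable_add)

lemma progressive_diff:
  fixes Y Z :: "real \<Rightarrow> 'w \<Rightarrow> 'b::{second_countable_topology, real_normed_vector}"
  assumes "progressive G T Y" "progressive G T Z"
  shows "progressive G T (\<lambda>t \<omega>. Y t \<omega> - Z t \<omega>)"
  using assms unfolding progressive_def split_beta' by (auto intro!: borel_measurable_diff)

lemma progressive_scaleR:
  fixes Z :: "real \<Rightarrow> 'w \<Rightarrow> 'b::{second_countable_topology, real_normed_vector}"
  assumes "progressive G T Y" "progressive G T Z"
  shows "progressive G T (\<lambda>t \<omega>. Y t \<omega> *\<^sub>R Z t \<omega>)"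
  using assms unfolding progressive_def split_beta' by (auto intro!: borel_measurable_scaleR)

lemma progressive_mult_ennreal:
  fixes Y Z :: "real \<Rightarrow> 'w \<Rightarrow> ennreal"
  assumes "progressive G T Y" "progressive G T Z"
  shows "progressive G T (\<lambda>t \<omega>. Y t \<omega> * Z t \<omega>)"
  using assms unfolding progressive_def split_beta' by (auto intro!: borel_measurable_times_ennreal)

lemma progressive_const: "progressive G T (\<lambda>t \<omega>. c)"
  by (simp add: progressive_def)

lemma progressive_sum:
  fixes Y :: "'i \<Rightarrow> real \<Rightarrow> 'w \<Rightarrow> 'b::{second_countable_topology, topological_comm_monoid_add}"
  assumes "\<And>i. i \<in> A \<Longrightarrow> progressive G T (Y i)"
  shows "progressive G T (\<lambda>t \<omega>. \<Sum>i\<in>A. Y i t \<omega>)"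
  using assms by (induction A rule: infinite_finite_induct) (auto intro: progressive_add progressive_const)

lemma progressive_det:
  fixes f :: "real \<Rightarrow> 'b::topological_space"
  assumes "continuous_on {0..T} f"
  shows "progressive G T (\<lambda>t \<omega>. f t)"
  unfolding progressive_def
proof
  fix t assume "t \<in> {0..T}"
  then have "continuous_on {0..t} f" using assms by (auto intro: continuous_on_subset)
  then have "f \<in> borel_measurable (restrict_space borel {0..t})"
    by (rule borel_measurable_continuous_on_restrict)
  from measurable_compose[OF measurable_fst this]
  show "(\<lambda>(s, \<omega>). f s) \<in> borel_measurable (restrict_space borel {0..t} \<Otimes>\<^sub>M G t)"
    by (simp add: split_beta')
qed

lemma progressive_vec:
  fixes Y :: "real \<Rightarrow> 'w \<Rightarrow> real ^ 'd"
  assumes "\<And>j. progressive G T (\<lambda>t \<omega>. Y t \<omega> $ j)"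
  shows "progressive G T Y"
  unfolding progressive_def
proof
  fix t assume t: "t \<in> {0..T}"
  show "(\<lambda>(s, \<omega>). Y s \<omega>) \<in> borel_measurable (restrict_space borel {0..t} \<Otimes>\<^sub>M G t)"
  proof (rule borel_measurable_euclidean_space[THEN iffD2], rule ballI)
    fix i :: "real ^ 'd" assume "i \<in> Basis"
    then obtain j where "i = axis j 1" by (auto simp: Basis_vec_def)
    then show "(\<lambda>x. (case x of (s, \<omega>) \<Rightarrow> Y s \<omega>) \<bullet> i) \<in> borel_measurable (restrict_space borel {0..t} \<Otimes>\<^sub>M G t)"
      using assms[of j] t by (simp add: progressive_def split_beta' inner_axis)
  qed
qed

text \<open>Clamping the time variable extends a process from [0, t] to the whole line without
  changing it on [0, t], so that integrals over \<open>lborel\<close> fall under Tonelli's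
  theorem.\<close>

lemma clamp_pair_measurable:
  "(\<lambda>(s, \<omega>). (max 0 (min t s), \<omega>)) \<in> measurable (borel \<Otimes>\<^sub>M N) (restrict_space borel {0..t::real} \<Otimes>\<^sub>M N)" if "0 \<le> t"
proof -
  have "(\<lambda>s. max 0 (min t s)) \<in> measurable borel (restrict_space borel {0..t})"
    using that by (intro measurable_restrict_space2) auto
  then show ?thesis unfolding split_beta' by (intro measurable_Pair measurable_compose[OF measurable_fst]) auto
qed

lemma progressive_joint:
  assumes "progressive G T Y" "t \<in> {0..T}"
  shows "(\<lambda>(s, \<omega>). Y (max 0 (min t s)) \<omega>) \<in> borel_measurable (borel \<Otimes>\<^sub>M G t)"
proof -
  have "(\<lambda>(s, \<omega>). Y s \<omega>) \<in> borel_measurable (restrict_space borel {0..t} \<Otimes>\<^sub>M G t)"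
    using assms by (simp add: progressive_def)
  from measurable_compose[OF clamp_pair_measurable this] assms(2) show ?thesis
    by (simp add: split_beta')
qed

text \<open>The integral of a jointly measurable nonnegative function is measurable in its
  parameters, here the upper limit and the sample point. For upper limits up to \<open>t\<close>
  only the sigma-algebra at \<open>t\<close> enters.\<close>

lemma progressive_energy:
  assumes \<psi>: "progressive G T \<psi>"
  shows "progressive G T (energy \<psi>)"
  unfolding progressive_def
proof
  fix t assume t: "t \<in> {0..T}"
  note j[measurable] = progressive_joint[OF \<psi> t]
  let ?R = "restrict_space borel {0..t} \<Otimes>\<^sub>M G t"
  have [measurable]: "(\<lambda>p. fst (fst p)) \<in> borel_measurable (?R \<Otimes>\<^sub>M lborel)"
    by (rule measurable_compose[OF measurable_compose[OF measurable_fst measurable_fst]])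
       (simp add: measurable_restrict_space1)
  have 1: "(\<lambda>p. (snd p, snd (fst p))) \<in> measurable (?R \<Otimes>\<^sub>M lborel) (borel \<Otimes>\<^sub>M G t)"
    by (intro measurable_Pair) (auto intro!: measurable_compose[OF measurable_fst measurable_snd] measurable_compose[OF measurable_snd])
  have 2: "(\<lambda>p. \<psi> (max 0 (min t (snd p))) (snd (fst p))) \<in> borel_measurable (?R \<Otimes>\<^sub>M lborel)"
    using measurable_compose[OF 1 j] by simp
  have 3: "(\<lambda>p. indicator {0..fst (fst p)} (snd p) :: ennreal) \<in> borel_measurable (?R \<Otimes>\<^sub>M lborel)"
    unfolding indicator_def atLeastAtMost_iff by measurable
  have 4: "\<psi> (max 0 (min t r)) \<omega> * indicator {0..s} r = \<psi> r \<omega> * indicator {0..s} r" if "s \<le> t" for r s \<omega>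
    using that by (cases "r \<in> {0..s}") (auto simp: min_absorb2 max_absorb2)
  have "(\<lambda>x. \<integral>\<^sup>+ r. \<psi> (max 0 (min t r)) (snd x) * indicator {0..fst x} r \<partial>lborel) \<in> borel_measurable ?R"
    by (rule lborel.borel_measurable_nn_integral) (use borel_measurable_times_ennreal[OF 2 3] in \<open>simp add: split_beta'\<close>)
  also have "?this \<longleftrightarrow> (\<lambda>(s, \<omega>). energy \<psi> s \<omega>) \<in> borel_measurable ?R"
    unfolding energy_def split_beta'
    by (intro measurable_cong nn_integral_cong) (auto simp: space_pair_measure space_restrict_space 4)
  finally show "(\<lambda>(s, \<omega>). energy \<psi> s \<omega>) \<in> borel_measurable ?R" .
qed

lemma progressive_gate:
  assumes "progressive G T \<psi>"
  shows "progressive G T (gate K \<psi>)"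
proof -
  have "(\<lambda>x::ennreal. if x \<le> K then 1 else 0 :: ennreal) \<in> borel_measurable borel" by measurable
  from progressive_compose[OF progressive_energy[OF assms] this] show ?thesis
    by (simp add: gate_def[abs_def])
qed

lemma progressive_section:
  assumes "progressive G T Y" "t \<in> {0..T}"
  shows "Y t \<in> borel_measurable (G t)"
proof -
  have "(\<lambda>\<omega>. (t, \<omega>)) \<in> measurable (G t) (restrict_space borel {0..t} \<Otimes>\<^sub>M G t)"
    using assms(2) by (intro measurable_Pair1') (simp add: space_restrict_space)
  from measurable_compose[OF this, of "\<lambda>(s, \<omega>). Y s \<omega>" borel] assms show ?thesis
    by (simp add: progressive_def)
qed

lemma energy_measurable:
  "progressive G T \<psi> \<Longrightarrow> t \<in> {0..T} \<Longrightarrow> energy \<psi> t \<in> borel_measurable (G t)"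
  using progressive_section[OF progressive_energy] .

lemma progressive_path:
  assumes "progressive G T Y" "0 \<le> T" "\<omega> \<in> space (G T)"
  shows "(\<lambda>s. Y (max 0 (min T s)) \<omega>) \<in> borel_measurable borel"
proof -
  have "(\<lambda>s. (s, \<omega>)) \<in> measurable borel (borel \<Otimes>\<^sub>M G T)"
    using assms(3) by (intro measurable_Pair2')
  from measurable_compose[OF this progressive_joint[OF assms(1)]] assms(2) show ?thesis by simp
qed

text \<open>Sorting makes consecutive elements adjacent. This is the passage from an unordered set
  of jump times to a grid that starts at 0.\<close>

lemma finite_grid:
  fixes P :: "real set"
  assumes P: "finite P" "0 \<in> P" "P \<subseteq> {0..T}"
  obtains N s where "s 0 = 0" "\<And>i. i < N \<Longrightarrow> s i < s (Suc i)" "s ` {..N} = P"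
    "\<And>i. i < N \<Longrightarrow> P \<inter> {s i<..<s (Suc i)} = {}"
proof -
  define l where "l = sorted_list_of_set P"
  define s where "s = nth l"
  define N where "N = length l - 1"
  have set: "set l = P" using P by (simp add: l_def)
  have len: "length l = Suc N" using P(1,2) card_gt_0_iff[of P] by (auto simp: N_def l_def)
  have srt: "sorted_wrt (<) l" by (simp add: l_def)
  have mono: "s i < s j" if "i < j" "j \<le> N" for i j
    using sorted_wrt_nth_less[OF srt, of i j] that len by (simp add: s_def)
  have img: "s ` {..N} = P"
    unfolding set[symmetric] set_conv_nth len s_def by (auto simp: less_Suc_eq_le)
  have "s 0 = 0"
  proof -
    obtain i where i: "i \<le> N" "s i = 0" using img P(2) by (metis atMost_iff imageE)
    have "s 0 \<in> P" using img by auto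
    then have "0 \<le> s 0" using P(3) by auto
    then show ?thesis using mono[of 0 i] i by (cases "i = 0") auto
  qed
  moreover have "P \<inter> {s i<..<s (Suc i)} = {}" if "i < N" for i
  proof (rule ccontr)
    assume "P \<inter> {s i<..<s (Suc i)} \<noteq> {}"
    then obtain j where j: "j \<le> N" "s i < s j" "s j < s (Suc i)" unfolding img[symmetric] by auto
    have "\<not> j \<le> i" using mono[of j i] j(2) that by (cases "j = i") auto
    moreover have "\<not> Suc i \<le> j" using mono[of "Suc i" j] j that by (cases "j = Suc i") auto
    ultimately show False by simp
  qed
  ultimately show ?thesis using mono img by (intro that[of s N]) auto
qed

section \<open>Step integrands together with their stochastic integrals\<close>

context brownian
begin

text \<open>\<open>J\<close> is the stochastic integral of the step process \<open>\<eta>\<close>, whose jump times lie in \<open>P\<close>.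
  Stated for all intervals that avoid \<open>P\<close>, the condition is stable under refinement, which makes sums
  of step processes easy.\<close>

definition step_on :: "real set \<Rightarrow> (real \<Rightarrow> 'w \<Rightarrow> real ^ 'd) \<Rightarrow> (real \<Rightarrow> 'w \<Rightarrow> real) \<Rightarrow> bool" where
  "step_on P \<eta> J \<longleftrightarrow> (\<forall>s u. 0 \<le> s \<longrightarrow> s < u \<longrightarrow> P \<inter> {s<..<u} = {} \<longrightarrow>
     (\<forall>r. s < r \<longrightarrow> r \<le> u \<longrightarrow> \<eta> r = \<eta> u) \<and> \<eta> u \<in> borel_measurable (F s) \<and>
     (\<forall>\<omega>. J u \<omega> - J s \<omega> = inner (\<eta> u \<omega>) (W u \<omega> - W s \<omega>)))"

definition step_integrand :: "(real \<Rightarrow> 'w \<Rightarrow> real ^ 'd) \<Rightarrow> (real \<Rightarrow> 'w \<Rightarrow> real) \<Rightarrow> bool" where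
  "step_integrand \<eta> J \<longleftrightarrow>
     (\<exists>C P. (\<forall>r \<omega>. norm (\<eta> r \<omega>) \<le> C) \<and> (\<forall>\<omega>. J 0 \<omega> = 0) \<and> finite P \<and> step_on P \<eta> J)"

lemma step_onD:
  assumes "step_on P \<eta> J" "0 \<le> s" "s < u" "P \<inter> {s<..<u} = {}"
  shows "s < r \<Longrightarrow> r \<le> u \<Longrightarrow> \<eta> r = \<eta> u" "\<eta> u \<in> borel_measurable (F s)"
    "J u \<omega> - J s \<omega> = inner (\<eta> u \<omega>) (W u \<omega> - W s \<omega>)"
proof -
  note * = assms(1)[unfolded step_on_def, THEN spec, THEN spec, THEN mp, THEN mp, THEN mp, OF assms(2-4)]
  show "s < r \<Longrightarrow> r \<le> u \<Longrightarrow> \<eta> r = \<eta> u" by (rule conjunct1[OF *, rule_format])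
  show "\<eta> u \<in> borel_measurable (F s)" by (rule conjunct1[OF conjunct2[OF *]])
  show "J u \<omega> - J s \<omega> = inner (\<eta> u \<omega>) (W u \<omega> - W s \<omega>)" by (rule conjunct2[OF conjunct2[OF *], rule_format])
qed

lemma step_integrandI:
  assumes "\<And>r \<omega>. norm (\<eta> r \<omega>) \<le> C" "\<And>\<omega>. J 0 \<omega> = 0" "finite P"
    "\<And>s u r. 0 \<le> s \<Longrightarrow> s < u \<Longrightarrow> P \<inter> {s<..<u} = {} \<Longrightarrow> s < r \<Longrightarrow> r \<le> u \<Longrightarrow> \<eta> r = \<eta> u"
    "\<And>s u. 0 \<le> s \<Longrightarrow> s < u \<Longrightarrow> P \<inter> {s<..<u} = {} \<Longrightarrow> \<eta> u \<in> borel_measurable (F s)"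
    "\<And>s u \<omega>. 0 \<le> s \<Longrightarrow> s < u \<Longrightarrow> P \<inter> {s<..<u} = {} \<Longrightarrow> J u \<omega> - J s \<omega> = inner (\<eta> u \<omega>) (W u \<omega> - W s \<omega>)"
  shows "step_integrand \<eta> J"
proof -
  have "step_on P \<eta> J" unfolding step_on_def
  proof (intro allI impI conjI)
    fix s u assume su: "0 \<le> s" "s < u" "P \<inter> {s<..<u} = {}"
    show "\<eta> r = \<eta> u" if "s < r" "r \<le> u" for r by (rule assms(4)[OF su that])
    show "\<eta> u \<in> borel_measurable (F s)" by (rule assms(5)[OF su])
    show "J u \<omega> - J s \<omega> = inner (\<eta> u \<omega>) (W u \<omega> - W s \<omega>)" for \<omega> by (rule assms(6)[OF su])
  qed
  then show ?thesis unfolding step_integrand_def by (intro exI[of _ C] exI[of _ P]) (simp add: assms(1-3))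
qed

lemma step_integrandE:
  assumes "step_integrand \<eta> J"
  obtains C P where "\<forall>r \<omega>. norm (\<eta> r \<omega>) \<le> C" "\<forall>\<omega>. J 0 \<omega> = 0" "finite P" "step_on P \<eta> J"
  using assms unfolding step_integrand_def by (elim exE conjE) (rule that)

lemma step_interval:
  assumes ab: "0 \<le> a" "a \<le> b" and \<xi>: "\<xi> \<in> borel_measurable (F a)" and C: "\<And>\<omega>. norm (\<xi> \<omega>) \<le> C"
  shows "step_integrand (\<lambda>r \<omega>. indicator {a<..b} r *\<^sub>R \<xi> \<omega>)
    (\<lambda>t \<omega>. inner (\<xi> \<omega>) (W (min t b) \<omega> - W (min t a) \<omega>))"
proof (rule step_integrandI[where C="C" and P="{a, b}"])
  show "norm (indicat_real {a<..b} r *\<^sub>R \<xi> \<omega>) \<le> C" for r \<omega>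
    using C[of \<omega>] order_trans[OF norm_ge_zero C[of \<omega>]] by (auto simp: indicator_def)
  show "inner (\<xi> \<omega>) (W (min 0 b) \<omega> - W (min 0 a) \<omega>) = 0" for \<omega> using ab by simp
  fix s u assume su: "0 \<le> s" "s < u" "{a, b} \<inter> {s<..<u} = {}"
  \<comment> \<open>An interval whose interior avoids \<open>a\<close> and \<open>b\<close> lies on
    one side of each, so the indicator is constant on its half-open version.\<close>
  have cs: "a \<le> s \<or> u \<le> a" "b \<le> s \<or> u \<le> b" using su by auto
  show "(\<lambda>\<omega>. indicat_real {a<..b} r *\<^sub>R \<xi> \<omega>) = (\<lambda>\<omega>. indicat_real {a<..b} u *\<^sub>R \<xi> \<omega>)" if "s < r" "r \<le> u" for r
    using cs that by (auto simp: indicator_def)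
  show "(\<lambda>\<omega>. indicat_real {a<..b} u *\<^sub>R \<xi> \<omega>) \<in> borel_measurable (F s)"
  proof (cases "u \<in> {a<..b}")
    case True
    then have "a \<le> s" using cs by auto
    then show ?thesis using True measurable_F_mono[OF _ \<xi>] by simp
  qed simp
  show "inner (\<xi> \<omega>) (W (min u b) \<omega> - W (min u a) \<omega>) - inner (\<xi> \<omega>) (W (min s b) \<omega> - W (min s a) \<omega>)
    = inner (indicat_real {a<..b} u *\<^sub>R \<xi> \<omega>) (W u \<omega> - W s \<omega>)" for \<omega>
    using cs su(2) ab by (auto simp: indicator_def min_def inner_diff_right)
qed simp

lemma step_zero: "step_integrand (\<lambda>_ _. 0) (\<lambda>_ _. 0)"
  by (rule step_integrandI[where C=0 and P="{}"]) auto

lemma step_add: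
  assumes "step_integrand \<eta> J" "step_integrand \<eta>' J'"
  shows "step_integrand (\<lambda>r \<omega>. \<eta> r \<omega> + \<eta>' r \<omega>) (\<lambda>t \<omega>. J t \<omega> + J' t \<omega>)"
proof -
  obtain C P where 1: "\<forall>r \<omega>. norm (\<eta> r \<omega>) \<le> C" "\<forall>\<omega>. J 0 \<omega> = 0" "finite P" "step_on P \<eta> J"
    by (rule step_integrandE[OF assms(1)])
  obtain C' P' where 2: "\<forall>r \<omega>. norm (\<eta>' r \<omega>) \<le> C'" "\<forall>\<omega>. J' 0 \<omega> = 0" "finite P'" "step_on P' \<eta>' J'"
    by (rule step_integrandE[OF assms(2)])
  show ?thesis
  proof (rule step_integrandI[where C="C + C'" and P="P \<union> P'"])
    show "norm (\<eta> r \<omega> + \<eta>' r \<omega>) \<le> C + C'" for r \<omega>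
      using 1(1) 2(1) by (intro norm_triangle_mono) auto
    fix s u assume su: "0 \<le> s" "s < u" "(P \<union> P') \<inter> {s<..<u} = {}"
    then have e: "P \<inter> {s<..<u} = {}" "P' \<inter> {s<..<u} = {}" by (simp_all only: Int_Un_distrib2 Un_empty)
    show "(\<lambda>\<omega>. \<eta> r \<omega> + \<eta>' r \<omega>) = (\<lambda>\<omega>. \<eta> u \<omega> + \<eta>' u \<omega>)" if "s < r" "r \<le> u" for r
      by (simp only: step_onD(1)[OF 1(4) su(1,2) e(1) that] step_onD(1)[OF 2(4) su(1,2) e(2) that])
    show "(\<lambda>\<omega>. \<eta> u \<omega> + \<eta>' u \<omega>) \<in> borel_measurable (F s)"
      by (rule borel_measurable_add[OF step_onD(2)[OF 1(4) su(1,2) e(1)] step_onD(2)[OF 2(4) su(1,2) e(2)]])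
    show "J u \<omega> + J' u \<omega> - (J s \<omega> + J' s \<omega>) = inner (\<eta> u \<omega> + \<eta>' u \<omega>) (W u \<omega> - W s \<omega>)" for \<omega>
      using step_onD(3)[OF 1(4) su(1,2) e(1), of \<omega>] step_onD(3)[OF 2(4) su(1,2) e(2), of \<omega>] by (simp add: inner_add_left)
  qed (simp_all add: 1(2,3) 2(2,3))
qed

lemma step_sum:
  assumes "finite A" "\<And>i. i \<in> A \<Longrightarrow> step_integrand (\<eta> i) (J i)"
  shows "step_integrand (\<lambda>r \<omega>. \<Sum>i\<in>A. \<eta> i r \<omega>) (\<lambda>t \<omega>. \<Sum>i\<in>A. J i t \<omega>)"
  using assms by (induction A rule: finite_induct) (auto intro: step_zero step_add)

lemma step_restrict:
  assumes st: "step_integrand \<eta> J" and ab: "0 \<le> a" "a \<le> b"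
  shows "step_integrand (\<lambda>r \<omega>. (c * indicator {a<..b} r) *\<^sub>R \<eta> r \<omega>) (\<lambda>t \<omega>. c * (J (min t b) \<omega> - J (min t a) \<omega>))"
proof -
  obtain C P where 1: "\<forall>r \<omega>. norm (\<eta> r \<omega>) \<le> C" "\<forall>\<omega>. J 0 \<omega> = 0" "finite P" "step_on P \<eta> J"
    by (rule step_integrandE[OF st])
  show ?thesis
  proof (rule step_integrandI[where C="\<bar>c\<bar> * C" and P="P \<union> {a, b}"])
    show "norm ((c * indicat_real {a<..b} r) *\<^sub>R \<eta> r \<omega>) \<le> \<bar>c\<bar> * C" for r \<omega>
    proof -
      have c: "norm (\<eta> r \<omega>) \<le> C" using 1(1) by simp
      have "0 \<le> C" using order_trans[OF norm_ge_zero c] .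
      then show ?thesis using c by (auto simp: indicator_def intro: mult_left_mono)
    qed
    show "c * (J (min 0 b) \<omega> - J (min 0 a) \<omega>) = 0" for \<omega> using ab by simp
    fix s u assume su: "0 \<le> s" "s < u" "(P \<union> {a, b}) \<inter> {s<..<u} = {}"
    then have e: "P \<inter> {s<..<u} = {}" and e': "{a, b} \<inter> {s<..<u} = {}"
      by (simp_all only: Int_Un_distrib2 Un_empty)
    from e' have cs: "a \<le> s \<or> u \<le> a" "b \<le> s \<or> u \<le> b" by auto
    show "(\<lambda>\<omega>. (c * indicat_real {a<..b} r) *\<^sub>R \<eta> r \<omega>) = (\<lambda>\<omega>. (c * indicat_real {a<..b} u) *\<^sub>R \<eta> u \<omega>)" if "s < r" "r \<le> u" for r
    proof -
      have "indicat_real {a<..b} r = indicat_real {a<..b} u" using cs that by (auto simp: indicator_def)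
      then show ?thesis by (simp only: step_onD(1)[OF 1(4) su(1,2) e that])
    qed
    show "(\<lambda>\<omega>. (c * indicat_real {a<..b} u) *\<^sub>R \<eta> u \<omega>) \<in> borel_measurable (F s)"
      by (intro borel_measurable_scaleR borel_measurable_const step_onD(2)[OF 1(4) su(1,2) e])
    show "c * (J (min u b) \<omega> - J (min u a) \<omega>) - c * (J (min s b) \<omega> - J (min s a) \<omega>)
      = inner ((c * indicat_real {a<..b} u) *\<^sub>R \<eta> u \<omega>) (W u \<omega> - W s \<omega>)" for \<omega>
      using cs su(2) ab step_onD(3)[OF 1(4) su(1,2) e, of \<omega>, symmetric]
      by (auto simp: indicator_def min_def right_diff_distrib)
  qed (simp_all add: 1(3))
qed

lemma step_scale:
  assumes st: "step_integrand \<eta> J"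
  shows "step_integrand (\<lambda>r \<omega>. c *\<^sub>R \<eta> r \<omega>) (\<lambda>t \<omega>. c * J t \<omega>)"
proof -
  obtain C P where 1: "\<forall>r \<omega>. norm (\<eta> r \<omega>) \<le> C" "\<forall>\<omega>. J 0 \<omega> = 0" "finite P" "step_on P \<eta> J"
    by (rule step_integrandE[OF st])
  show ?thesis
  proof (rule step_integrandI[where C="\<bar>c\<bar> * C" and P=P])
    fix s u assume su: "0 \<le> s" "s < u" "P \<inter> {s<..<u} = {}"
    show "(\<lambda>\<omega>. c *\<^sub>R \<eta> r \<omega>) = (\<lambda>\<omega>. c *\<^sub>R \<eta> u \<omega>)" if "s < r" "r \<le> u" for r
      by (simp only: step_onD(1)[OF 1(4) su that])
    show "(\<lambda>\<omega>. c *\<^sub>R \<eta> u \<omega>) \<in> borel_measurable (F s)"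
      by (intro borel_measurable_scaleR borel_measurable_const step_onD(2)[OF 1(4) su])
    show "c * J u \<omega> - c * J s \<omega> = inner (c *\<^sub>R \<eta> u \<omega>) (W u \<omega> - W s \<omega>)" for \<omega>
      unfolding right_diff_distrib[symmetric] step_onD(3)[OF 1(4) su] by simp
  next
    show "norm (c *\<^sub>R \<eta> r \<omega>) \<le> \<bar>c\<bar> * C" for r \<omega> using 1(1) by (simp add: mult_left_mono)
  qed (simp_all add: 1(2,3))
qed

end

section \<open>Ito integrals along finitely many times\<close>

text \<open>The row vector representing u \<mapsto> <S u, h>, that is, the adjoint of
  \<open>S\<close> applied to \<open>h\<close>. Pairing with \<open>h\<close> reduces Hilbert-valued
  integrals to real ones.\<close>

definition coord :: "'h::real_inner \<Rightarrow> 'h ^ 'd \<Rightarrow> real ^ 'd" where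
  "coord h S = (\<chi> j. inner (S $ j) h)"

lemma power2_norm_vec: "(norm (x :: 'h::real_normed_vector ^ 'd))\<^sup>2 = (\<Sum>j\<in>UNIV. (norm (x $ j))\<^sup>2)"
  by (simp add: norm_vec_def L2_set_def sum_nonneg)

lemma coord_sum: "coord h (\<Sum>i\<in>A. S i) = (\<Sum>i\<in>A. coord h (S i))"
  by (simp add: coord_def vec_eq_iff inner_sum_left)

lemma coord_diff: "coord h (S - S') = coord h S - coord h S'"
  by (simp add: coord_def vec_eq_iff inner_diff_left)

lemma coord_scaleR: "coord h (c *\<^sub>R S) = c *\<^sub>R coord h S"
  by (simp add: coord_def vec_eq_iff)

lemma power2_norm_coord_le: "(norm (coord h S))\<^sup>2 \<le> (norm h)\<^sup>2 * (norm S)\<^sup>2"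
proof -
  have "(inner (S $ j) h)\<^sup>2 \<le> (norm h)\<^sup>2 * (norm (S $ j))\<^sup>2" for j
    using Cauchy_Schwarz_ineq[of "S $ j" h] by (simp add: power2_norm_eq_inner mult.commute)
  then show ?thesis
    unfolding power2_norm_vec sum_distrib_left by (intro sum_mono) (simp add: coord_def)
qed

lemma inner_coord: "inner (coord h S) u = inner (app_op S u) h"
  by (simp add: coord_def app_op_def inner_vec_def inner_sum_left mult.commute)

text \<open>The cells are disjoint and exhaust the half-open interval up to \<open>s j\<close>. The
  nonnegativity of \<open>s j\<close> runs along in the induction because splitting the indicator
  uses it.\<close>

lemma grid_step_sum:
  fixes f :: "real \<Rightarrow> 'b::real_vector"
  assumes "s 0 = 0" "\<And>i. i < N \<Longrightarrow> s i < s (Suc i)"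
    and const: "\<And>i r. i < N \<Longrightarrow> s i < r \<Longrightarrow> r \<le> s (Suc i) \<Longrightarrow> f r = f (s (Suc i))"
    and "j \<le> N"
  shows "indicat_real {0<..s j} r *\<^sub>R f r = (\<Sum>i<j. indicat_real {s i<..s (Suc i)} r *\<^sub>R f (s (Suc i)))"
    and "0 \<le> s j"
  using \<open>j \<le> N\<close>
proof (induction j)
  case 0
  { case 1 then show ?case by (simp add: assms(1)) }
  { case 2 then show ?case by (simp add: assms(1)) }
next
  case (Suc j)
  { case 1
    then have j: "j < N" by simp
    have sj: "0 \<le> s j" "s j < s (Suc j)" using Suc.IH(2) assms(2)[of j] j by auto
    have "indicat_real {0<..s (Suc j)} r *\<^sub>R f r = indicat_real {0<..s j} r *\<^sub>R f r + indicat_real {s j<..s (Suc j)} r *\<^sub>R f r"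
      using sj by (auto simp: indicator_def)
    also have "indicat_real {s j<..s (Suc j)} r *\<^sub>R f r = indicat_real {s j<..s (Suc j)} r *\<^sub>R f (s (Suc j))"
    proof (cases "r \<in> {s j<..s (Suc j)}")
      case True
      then have "f r = f (s (Suc j))" by (intro const[OF j]) auto
      then show ?thesis by (rule arg_cong)
    qed simp
    also have "indicat_real {0<..s j} r *\<^sub>R f r = (\<Sum>i<j. indicat_real {s i<..s (Suc i)} r *\<^sub>R f (s (Suc i)))"
      using Suc.IH(1) j by simp
    finally show ?case by simp }
  { case 2 then show ?case using Suc.IH(2) assms(2)[of j] by simp }
qed

text \<open>For each \<open>k\<close> an index is chosen at which all the finitely many exceedance
  probabilities lie below (1/2)^k; Borel-Cantelli does the rest. The common choice is the point,
  since all approximations must converge along the same indices.\<close>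

lemma (in prob_space) null_in_prob_subseq:
  assumes A: "finite A" and Z: "\<And>i. i \<in> A \<Longrightarrow> null_in_prob M (Z i)"
    and m: "\<And>i k. i \<in> A \<Longrightarrow> Z i k \<in> borel_measurable M"
  obtains r :: "nat \<Rightarrow> nat" where "AE \<omega> in M. \<forall>i\<in>A. eventually (\<lambda>k. Z i (r k) \<omega> \<le> (1/2)^k) sequentially"
proof -
  have "\<exists>n. \<forall>i\<in>A. prob {\<omega> \<in> space M. (1/2)^k < Z i n \<omega>} < (1/2)^k" for k
  proof -
    have "\<forall>i\<in>A. eventually (\<lambda>n. prob {\<omega> \<in> space M. (1/2)^k < Z i n \<omega>} < (1/2)^k) sequentially"
    proof
      fix i assume "i \<in> A"
      then have "(\<lambda>n. prob {\<omega> \<in> space M. (1/2)^k < Z i n \<omega>}) \<longlonglongrightarrow> 0"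
        using Z[of i] unfolding null_in_prob_def by simp
      then show "eventually (\<lambda>n. prob {\<omega> \<in> space M. (1/2)^k < Z i n \<omega>} < (1/2)^k) sequentially"
        by (rule order_tendstoD) simp
    qed
    then have "eventually (\<lambda>n. \<forall>i\<in>A. prob {\<omega> \<in> space M. (1/2)^k < Z i n \<omega>} < (1/2)^k) sequentially"
      using A by (intro eventually_ball_finite)
    then show ?thesis by (auto simp: eventually_sequentially)
  qed
  then obtain r where r: "\<And>k i. i \<in> A \<Longrightarrow> prob {\<omega> \<in> space M. (1/2)^k < Z i (r k) \<omega>} < (1/2)^k"
    by metis
  have "AE \<omega> in M. eventually (\<lambda>k. Z i (r k) \<omega> \<le> (1/2)^k) sequentially" if i: "i \<in> A" for i
  proof -
    have ev: "{\<omega> \<in> space M. (1/2)^k < Z i (r k) \<omega>} \<in> events" for k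
      using m[OF i, of "r k"] by measurable
    have "AE \<omega> in M. eventually (\<lambda>k. \<omega> \<in> space M - {\<omega> \<in> space M. (1/2)^k < Z i (r k) \<omega>}) sequentially"
    proof (rule borel_cantelli_AE1[OF ev])
      show "summable (\<lambda>k. prob {\<omega> \<in> space M. (1/2)^k < Z i (r k) \<omega>})"
        by (rule summable_comparison_test'[of "\<lambda>k. (1/2::real)^k" 0])
           (use r[OF i] in \<open>auto intro: less_imp_le\<close>)
    qed (simp add: emeasure_eq_measure)
    then show ?thesis by (rule AE_mp) (auto intro!: AE_I2 elim!: eventually_mono)
  qed
  then have "AE \<omega> in M. \<forall>i\<in>A. eventually (\<lambda>k. Z i (r k) \<omega> \<le> (1/2)^k) sequentially"
    using A by (simp add: AE_finite_all)
  then show ?thesis by (rule that)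
qed

section \<open>Approximation of Ito integrals by step integrands\<close>

context brownian
begin

lemma simple_step:
  fixes \<xi> :: "nat \<Rightarrow> 'w \<Rightarrow> 'h::{real_inner, banach, second_countable_topology} ^ 'd"
  assumes "simple_integrand F T n \<tau> \<xi>"
  shows "step_integrand (\<lambda>r \<omega>. coord h (simple_value n \<tau> \<xi> r \<omega>)) (\<lambda>t \<omega>. inner (simple_integral W n \<tau> \<xi> t \<omega>) h)"
proof -
  have "step_integrand (\<lambda>r \<omega>. \<Sum>i<n. indicator {\<tau> i<..\<tau> (Suc i)} r *\<^sub>R coord h (\<xi> i \<omega>))
    (\<lambda>t \<omega>. \<Sum>i<n. inner (coord h (\<xi> i \<omega>)) (W (min t (\<tau> (Suc i))) \<omega> - W (min t (\<tau> i)) \<omega>))"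
  proof (rule step_sum)
    fix i assume i: "i \<in> {..<n}"
    then have \<tau>: "0 \<le> \<tau> i" "\<tau> i \<le> \<tau> (Suc i)" using assms by (auto simp: simple_integrand_def)
    have m: "(\<lambda>\<omega>. \<xi> i \<omega> $ j) \<in> borel_measurable (F (\<tau> i))" for j
      using assms i by (auto simp: simple_integrand_def)
    obtain C where C: "\<forall>\<omega>. norm (\<xi> i \<omega>) \<le> C" using assms i by (auto simp: simple_integrand_def)
    show "step_integrand (\<lambda>r \<omega>. indicator {\<tau> i<..\<tau> (Suc i)} r *\<^sub>R coord h (\<xi> i \<omega>))
       (\<lambda>t \<omega>. inner (coord h (\<xi> i \<omega>)) (W (min t (\<tau> (Suc i))) \<omega> - W (min t (\<tau> i)) \<omega>))"
    proof (rule step_interval[OF \<tau>])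
      show "(\<lambda>\<omega>. coord h (\<xi> i \<omega>)) \<in> borel_measurable (F (\<tau> i))"
      proof (rule borel_measurable_euclidean_space[THEN iffD2], rule ballI)
        fix b :: "real ^ 'd" assume "b \<in> Basis"
        then obtain j where "b = axis j 1" by (auto simp: Basis_vec_def)
        then have "(\<lambda>x. coord h (\<xi> i x) \<bullet> b) = (\<lambda>x. inner (\<xi> i x $ j) h)"
          by (simp add: inner_axis coord_def)
        then show "(\<lambda>x. coord h (\<xi> i x) \<bullet> b) \<in> borel_measurable (F (\<tau> i))"
          using borel_measurable_inner[OF m borel_measurable_const] by simp
      qed
      fix \<omega>
      have "(norm (coord h (\<xi> i \<omega>)))\<^sup>2 \<le> (norm h * norm (\<xi> i \<omega>))\<^sup>2"
        using power2_norm_coord_le by (simp add: power_mult_distrib)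
      then have "norm (coord h (\<xi> i \<omega>)) \<le> norm h * norm (\<xi> i \<omega>)" by (rule power2_le_imp_le) simp
      also have "\<dots> \<le> norm h * C" using C by (intro mult_left_mono) auto
      finally show "norm (coord h (\<xi> i \<omega>)) \<le> norm h * C" .
    qed
  qed simp
  then show ?thesis
    by (simp add: simple_value_def simple_integral_def coord_sum coord_scaleR inner_coord inner_sum_left)
qed

lemma progressive_jointM:
  assumes "progressive F T Y" "0 \<le> T"
  shows "(\<lambda>(s, \<omega>). Y (max 0 (min T s)) \<omega>) \<in> borel_measurable (borel \<Otimes>\<^sub>M M)"
proof -
  have "(\<lambda>\<omega>. \<omega>) \<in> measurable M (F T)"
    by (rule measurable_F_M[of _ T]) simp
  from measurable_compose[OF measurable_snd this]
  have "(\<lambda>p. (fst p, snd p)) \<in> measurable (borel \<Otimes>\<^sub>M M) (borel \<Otimes>\<^sub>M F T)"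
    by (intro measurable_Pair measurable_fst)
  from measurable_compose[OF this progressive_joint[OF assms(1)]] assms(2) show ?thesis
    by (simp add: split_beta')
qed

text \<open>The integral is only identified at the times in \<open>Q\<close>. For finite \<open>Q\<close> a subsequence turns the
  convergence in probability of \<^const>\<open>ito_integral\<close> into almost sure convergence, and the
  estimates below do not depend on \<open>Q\<close>.\<close>

definition ito_approx :: "real \<Rightarrow> real set \<Rightarrow> (real \<Rightarrow> 'w \<Rightarrow> real ^ 'd) \<Rightarrow> (real \<Rightarrow> 'w \<Rightarrow> real) \<Rightarrow> bool" where
  "ito_approx T Q \<phi> I \<longleftrightarrow> (\<exists>\<eta> J. (\<forall>k::nat. step_integrand (\<eta> k) (J k)) \<and>
     (AE \<omega> in M. (\<lambda>k. \<integral>\<^sup>+r\<in>{0..T}. ennreal ((norm (\<eta> k r \<omega> - \<phi> r \<omega>))\<^sup>2) \<partial>lborel) \<longlonglongrightarrow> 0 \<and>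
        (\<forall>t\<in>Q. (\<lambda>k. J k t \<omega>) \<longlonglongrightarrow> I t \<omega>)))"

text \<open>Pairing with \<open>h\<close> turns simple integrands into real step integrands and
  multiplies energies by at most the squared norm of \<open>h\<close>. The energy distance and the
  errors at the times in \<open>Q\<close> form one finite family vanishing in probability, so one
  choice of indices serves all of them.\<close>

lemma ito_integral_approx:
  fixes \<phi> :: "real \<Rightarrow> 'w \<Rightarrow> 'h::{real_inner, banach, second_countable_topology} ^ 'd"
  assumes I: "ito_integral M F W T \<phi> I" and Q: "finite Q" "Q \<subseteq> {0..T}" and T: "0 \<le> T"
  shows "ito_approx T Q (\<lambda>r \<omega>. coord h (\<phi> r \<omega>)) (\<lambda>t \<omega>. inner (I t \<omega>) h)"
proof -
  obtain n \<tau> \<xi> where sim': "\<forall>k. simple_integrand F T (n k) (\<tau> k) (\<xi> k)"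
    and n0: "null_in_prob M (\<lambda>k \<omega>. LINT t:{0..T}|lborel. (norm (simple_value (n k) (\<tau> k) (\<xi> k) t \<omega> - \<phi> t \<omega>))\<^sup>2)"
    and nt: "\<forall>t\<in>{0..T}. null_in_prob M (\<lambda>k \<omega>. norm (simple_integral W (n k) (\<tau> k) (\<xi> k) t \<omega> - I t \<omega>))"
    using I unfolding ito_integral_def by (elim conjE exE) (rule that)
  note sim = sim'[rule_format]
  have prog: "progressive F T (\<lambda>t \<omega>. \<phi> t \<omega> $ j)" for j using I by (simp add: ito_integral_def)
  have fin: "AE \<omega> in M. set_integrable lborel {0..T} (\<lambda>t. (norm (\<phi> t \<omega>))\<^sup>2)" using I by (simp add: ito_integral_def)
  have Iprog: "progressive F T I" using I by (simp add: ito_integral_def continuous_process_def)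
  let ?c = "\<lambda>r. max 0 (min T r)"
  define sv where "sv = (\<lambda>k. simple_value (n k) (\<tau> k) (\<xi> k))"
  define si where "si = (\<lambda>k. simple_integral W (n k) (\<tau> k) (\<xi> k))"
  \<comment> \<open>The squared distance, written columnwise and with clamped time: progressive
    measurability of \<phi> is available column by column.\<close>
  define D where "D = (\<lambda>k p. \<Sum>j\<in>UNIV. (norm (sv k (?c (fst p)) (snd p) $ j - \<phi> (?c (fst p)) (snd p) $ j))\<^sup>2)"
  have \<xi>m: "(\<lambda>\<omega>. \<xi> k i \<omega> $ j) \<in> borel_measurable M" if "i < n k" for k i j
    using sim[of k] that measurable_F_M unfolding simple_integrand_def by blast
  have \<phi>m: "(\<lambda>p. \<phi> (?c (fst p)) (snd p) $ j) \<in> borel_measurable (borel \<Otimes>\<^sub>M M)" for j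
    using progressive_jointM[OF prog T] by (simp add: split_beta')
  have svm: "(\<lambda>p. sv k (?c (fst p)) (snd p) $ j) \<in> borel_measurable (borel \<Otimes>\<^sub>M M)" for k j
  proof -
    have "(\<lambda>p. \<Sum>i<n k. indicat_real {\<tau> k i<..\<tau> k (Suc i)} (?c (fst p)) *\<^sub>R \<xi> k i (snd p) $ j) \<in> borel_measurable (borel \<Otimes>\<^sub>M M)"
    proof (intro borel_measurable_sum borel_measurable_scaleR)
      fix i assume "i \<in> {..<n k}"
      then show "(\<lambda>p. \<xi> k i (snd p) $ j) \<in> borel_measurable (borel \<Otimes>\<^sub>M M)"
        using \<xi>m by (intro measurable_compose[OF measurable_snd]) auto
      have "(\<lambda>r. indicat_real {\<tau> k i<..\<tau> k (Suc i)} (?c r)) \<in> borel_measurable borel"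
        unfolding indicator_def greaterThanAtMost_iff by measurable
      then show "(\<lambda>p. indicat_real {\<tau> k i<..\<tau> k (Suc i)} (?c (fst p))) \<in> borel_measurable (borel \<Otimes>\<^sub>M M)"
        by (rule measurable_compose[OF measurable_fst])
    qed
    then show ?thesis by (simp add: sv_def simple_value_def)
  qed
  have Dm[measurable]: "D k \<in> borel_measurable (borel \<Otimes>\<^sub>M M)" for k
    unfolding D_def
    by (intro borel_measurable_sum borel_measurable_power borel_measurable_diff
        measurable_compose[OF _ borel_measurable_norm] svm \<phi>m)
  have Deq: "indicator {0..T} r *\<^sub>R (norm (sv k r \<omega> - \<phi> r \<omega>))\<^sup>2 = indicator {0..T} r *\<^sub>R D k (r, \<omega>)" for k r \<omega>
    by (cases "r \<in> {0..T}") (simp_all add: D_def power2_norm_vec min_absorb2 max_absorb2)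
  \<comment> \<open>\<open>None\<close> indexes the energy distance and \<open>Some t\<close> the
    error at time \<open>t\<close>, which makes them one family for
    \<open>null_in_prob_subseq\<close>.\<close>
  define Z where "Z = (\<lambda>i k \<omega>. case i of None \<Rightarrow> LINT t:{0..T}|lborel. (norm (sv k t \<omega> - \<phi> t \<omega>))\<^sup>2
     | Some t \<Rightarrow> norm (si k t \<omega> - I t \<omega>))"
  have ZNone: "Z None k = (\<lambda>\<omega>. LINT r|lborel. indicator {0..T} r *\<^sub>R D k (r, \<omega>))" for k
    by (simp only: Z_def set_lebesgue_integral_def Deq option.case)
  define A where "A = insert None (Some ` Q)"
  have Zm: "Z i k \<in> borel_measurable M" if "i \<in> A" for i k
  proof (cases i)
    case None
    have "(\<lambda>\<omega>. LINT r|lborel. indicator {0..T} r *\<^sub>R D k (r, \<omega>)) \<in> borel_measurable M"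
    proof (rule lborel.borel_measurable_lebesgue_integral)
      have "(\<lambda>p. D k (snd p, fst p)) \<in> borel_measurable (M \<Otimes>\<^sub>M lborel)"
        by (intro measurable_compose[OF _ Dm] measurable_Pair) auto
      then show "(\<lambda>(\<omega>, r). indicat_real {0..T} r *\<^sub>R D k (r, \<omega>)) \<in> borel_measurable (M \<Otimes>\<^sub>M lborel)"
        unfolding split_beta' by (intro borel_measurable_scaleR) auto
    qed
    then show ?thesis unfolding None ZNone .
  next
    case (Some t)
    then have t: "t \<in> Q" using that by (auto simp: A_def)
    then have t': "t \<in> {0..T}" using Q by auto
    have "I t \<in> borel_measurable M" using measurable_F_M[OF progressive_section[OF Iprog t']] .
    moreover have "si k t \<in> borel_measurable M"
      unfolding si_def simple_integral_def[abs_def] app_op_def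
    proof (intro borel_measurable_sum borel_measurable_scaleR)
      fix i j assume i: "i \<in> {..<n k}"
      have \<tau>: "0 \<le> \<tau> k i" "\<tau> k i \<le> \<tau> k (Suc i)" using sim[of k] i unfolding simple_integrand_def by auto
      show "(\<lambda>x. \<xi> k i x $ j) \<in> borel_measurable M" using \<xi>m i by simp
      have "(\<lambda>x. W (min t (\<tau> k (Suc i))) x - W (min t (\<tau> k i)) x) \<in> borel_measurable M"
        using \<tau> t' by (intro borel_measurable_diff W_measurable) auto
      then show "(\<lambda>x. (W (min t (\<tau> k (Suc i))) x - W (min t (\<tau> k i)) x) $ j) \<in> borel_measurable M"
        by (rule measurable_compose[OF _ borel_measurable_nth])
    qed
    ultimately show ?thesis using Some by (simp add: Z_def)
  qed
  have Zn: "null_in_prob M (Z i)" if "i \<in> A" for i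
    using that n0 nt Q(2) by (auto simp: A_def Z_def sv_def si_def)
  obtain r where r: "AE \<omega> in M. \<forall>i\<in>A. eventually (\<lambda>k. Z i (r k) \<omega> \<le> (1/2)^k) sequentially"
    by (rule null_in_prob_subseq[of A Z]) (use Zn Zm Q in \<open>auto simp: A_def\<close>)
  have half: "(\<lambda>k. (1/2::real)^k) \<longlonglongrightarrow> 0" by (rule LIMSEQ_realpow_zero) auto
  have "AE \<omega> in M. (\<lambda>k. \<integral>\<^sup>+t\<in>{0..T}. ennreal ((norm (coord h (sv (r k) t \<omega>) - coord h (\<phi> t \<omega>)))\<^sup>2) \<partial>lborel) \<longlonglongrightarrow> 0 \<and>
        (\<forall>t\<in>Q. (\<lambda>k. inner (si (r k) t \<omega>) h) \<longlonglongrightarrow> inner (I t \<omega>) h)"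
    using r fin AE_space
  proof eventually_elim
    case (elim \<omega>)
    have Zlim: "(\<lambda>k. Z i (r k) \<omega>) \<longlonglongrightarrow> 0" if "i \<in> A" for i
    proof (rule tendsto_sandwich[OF _ _ tendsto_const half])
      show "eventually (\<lambda>k. Z i (r k) \<omega> \<le> (1/2)^k) sequentially" using elim(1) that by blast
      show "eventually (\<lambda>k. 0 \<le> Z i (r k) \<omega>) sequentially"
        by (auto simp: Z_def set_lebesgue_integral_def split: option.split intro!: always_eventually Bochner_Integration.integral_nonneg)
    qed
    have Dpath: "(\<lambda>t. D k (t, \<omega>)) \<in> borel_measurable borel" for k
      using measurable_compose[OF measurable_Pair2'[OF elim(3), of borel] Dm] by simp
    have est: "(\<integral>\<^sup>+t\<in>{0..T}. ennreal ((norm (coord h (sv k t \<omega>) - coord h (\<phi> t \<omega>)))\<^sup>2) \<partial>lborel)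
       \<le> ennreal ((norm h)\<^sup>2 * Z None k \<omega>)" for k
    proof -
      have svb: "\<exists>C. \<forall>t. norm (sv k t \<omega>) \<le> C"
      proof -
        have "norm (sv k t \<omega>) \<le> (\<Sum>i<n k. norm (\<xi> k i \<omega>))" for t
          unfolding sv_def simple_value_def
          by (rule sum_norm_le) (auto simp: indicator_def)
        then show ?thesis by blast
      qed
      then obtain C where C: "\<And>t. norm (sv k t \<omega>) \<le> C" by blast
      \<comment> \<open>The Bochner integral of a non-integrable function is 0, so a small value of
        \<open>Z None\<close> says nothing by itself. On this path integrability holds: the simple
        integrand is bounded in time and \<phi> is square integrable.\<close>
      have int: "integrable lborel (\<lambda>t. indicator {0..T} t *\<^sub>R D k (t, \<omega>))"
      proof (rule Bochner_Integration.integrable_bound)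
        have "set_integrable lborel {0..T} (\<lambda>t. 2 * C\<^sup>2 + 2 * (norm (\<phi> t \<omega>))\<^sup>2)"
          using elim(2) by (intro set_integral_add(1) borel_integrable_atLeastAtMost'[OF continuous_on_const]) simp_all
        then show "integrable lborel (\<lambda>t. indicator {0..T} t *\<^sub>R (2 * C\<^sup>2 + 2 * (norm (\<phi> t \<omega>))\<^sup>2))"
          by (simp add: set_integrable_def)
        show "(\<lambda>t. indicator {0..T} t *\<^sub>R D k (t, \<omega>)) \<in> borel_measurable lborel"
          using Dpath[of k] by measurable
        have "(norm (sv k t \<omega> - \<phi> t \<omega>))\<^sup>2 \<le> 2 * C\<^sup>2 + 2 * (norm (\<phi> t \<omega>))\<^sup>2" for t
        proof -
          have "(norm (sv k t \<omega> - \<phi> t \<omega>))\<^sup>2 \<le> (C + norm (\<phi> t \<omega>))\<^sup>2"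
            using norm_triangle_ineq4[of "sv k t \<omega>" "\<phi> t \<omega>"] C[of t] by (intro power_mono) auto
          also have "\<dots> \<le> 2 * C\<^sup>2 + 2 * (norm (\<phi> t \<omega>))\<^sup>2"
            using zero_le_power2[of "C - norm (\<phi> t \<omega>)"] by (simp add: power2_sum power2_diff)
          finally show ?thesis .
        qed
        then show "AE t in lborel. norm (indicator {0..T} t *\<^sub>R D k (t, \<omega>)) \<le> norm (indicator {0..T} t *\<^sub>R (2 * C\<^sup>2 + 2 * (norm (\<phi> t \<omega>))\<^sup>2))"
          unfolding Deq[symmetric] by (intro always_eventually allI) (auto simp: indicator_def)
      qed
      have "(\<integral>\<^sup>+t\<in>{0..T}. ennreal ((norm (coord h (sv k t \<omega>) - coord h (\<phi> t \<omega>)))\<^sup>2) \<partial>lborel)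
        \<le> (\<integral>\<^sup>+t. ennreal ((norm h)\<^sup>2 * (indicator {0..T} t *\<^sub>R D k (t, \<omega>))) \<partial>lborel)"
        unfolding Deq[symmetric] coord_diff[symmetric]
        by (intro nn_integral_mono) (auto simp: indicator_def power2_norm_coord_le intro!: ennreal_leI)
      also have "\<dots> = ennreal (LINT t|lborel. (norm h)\<^sup>2 * (indicator {0..T} t *\<^sub>R D k (t, \<omega>)))"
      proof (rule nn_integral_eq_integral)
        show "integrable lborel (\<lambda>t. (norm h)\<^sup>2 * (indicator {0..T} t *\<^sub>R D k (t, \<omega>)))" using int by (rule integrable_mult_right)
        show "AE t in lborel. 0 \<le> (norm h)\<^sup>2 * (indicator {0..T} t *\<^sub>R D k (t, \<omega>))"
          unfolding Deq[symmetric] by (intro always_eventually allI) simp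
      qed
      also have "(LINT t|lborel. (norm h)\<^sup>2 * (indicator {0..T} t *\<^sub>R D k (t, \<omega>))) = (norm h)\<^sup>2 * Z None k \<omega>"
        by (simp add: ZNone)
      finally show ?thesis .
    qed
    have "(\<lambda>k. \<integral>\<^sup>+t\<in>{0..T}. ennreal ((norm (coord h (sv (r k) t \<omega>) - coord h (\<phi> t \<omega>)))\<^sup>2) \<partial>lborel) \<longlonglongrightarrow> 0"
    proof (rule tendsto_sandwich[OF _ _ tendsto_const])
      show "eventually (\<lambda>k. (\<integral>\<^sup>+t\<in>{0..T}. ennreal ((norm (coord h (sv (r k) t \<omega>) - coord h (\<phi> t \<omega>)))\<^sup>2) \<partial>lborel) \<le> ennreal ((norm h)\<^sup>2 * Z None (r k) \<omega>)) sequentially"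
        using est by (intro always_eventually allI)
      have "(\<lambda>k. ennreal ((norm h)\<^sup>2 * Z None (r k) \<omega>)) \<longlonglongrightarrow> ennreal ((norm h)\<^sup>2 * 0)"
        by (intro tendsto_ennrealI tendsto_mult tendsto_const Zlim) (simp add: A_def)
      then show "(\<lambda>k. ennreal ((norm h)\<^sup>2 * Z None (r k) \<omega>)) \<longlonglongrightarrow> 0" by simp
    qed simp
    moreover have "(\<lambda>k. inner (si (r k) t \<omega>) h) \<longlonglongrightarrow> inner (I t \<omega>) h" if "t \<in> Q" for t
    proof -
      have "(\<lambda>k. norm (si (r k) t \<omega> - I t \<omega>)) \<longlonglongrightarrow> 0"
        using Zlim[of "Some t"] that by (simp add: A_def Z_def)
      then have "(\<lambda>k. si (r k) t \<omega>) \<longlonglongrightarrow> I t \<omega>" by (simp add: tendsto_norm_zero_iff LIM_zero_iff)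
      then show ?thesis by (intro tendsto_inner tendsto_const)
    qed
    ultimately show ?case by blast
  qed
  moreover have "step_integrand (\<lambda>t \<omega>. coord h (sv (r k) t \<omega>)) (\<lambda>t \<omega>. inner (si (r k) t \<omega>) h)" for k
    unfolding sv_def si_def by (rule simple_step[OF sim])
  ultimately show ?thesis unfolding ito_approx_def
    by (intro exI[of _ "\<lambda>k t \<omega>. coord h (sv (r k) t \<omega>)"] exI[of _ "\<lambda>k t \<omega>. inner (si (r k) t \<omega>) h"]) simp
qed


text \<open>\<open>X\<close> is the running maximum of the discrete integral whose summands are switched off at the first
  grid time at which the gate is closed or the energy of \<open>\<eta>\<close> exceeds the bound. The switch is read at
  the left end point of a grid interval, to stay adapted, but the energy must be controlled at its
  right end point: this is why the energy of \<open>\<eta>\<close> up to \<open>u\<close> is compared with that of \<open>f\<close> up to an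
  earlier time \<open>s\<close>.\<close>

lemma stopped_step:
  assumes st: "step_integrand \<eta> J" and T: "0 \<le> T" and Q: "finite Q" "Q \<subseteq> {0..T}"
    and f: "progressive F T f" and \<psi>: "progressive F T \<psi>" and \<delta>: "0 < \<delta>"
  shows "\<exists>X. X \<in> borel_measurable M \<and>
    (\<integral>\<^sup>+\<omega>. ennreal ((X \<omega> :: real)\<^sup>2) \<partial>M) \<le> 4 * (\<integral>\<^sup>+\<omega>. 2 * (\<integral>\<^sup>+r\<in>{0..T}. gate K \<psi> r \<omega> * f r \<omega> \<partial>lborel) + \<epsilon> \<partial>M) \<and>
    (\<forall>\<omega>. \<forall>t\<in>Q. gate K \<psi> t \<omega> \<noteq> 0 \<longrightarrow>
       (\<forall>s u. 0 \<le> s \<longrightarrow> s < u \<longrightarrow> u \<le> T \<longrightarrow> u - s \<le> \<delta> \<longrightarrow>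
         energy (\<lambda>r \<omega>. ennreal ((norm (\<eta> r \<omega>))\<^sup>2)) u \<omega> \<le> 2 * energy f s \<omega> + \<epsilon>) \<longrightarrow> \<bar>J t \<omega>\<bar> \<le> X \<omega>)"
proof -
  obtain C P where st': "\<forall>r \<omega>. norm (\<eta> r \<omega>) \<le> C" "\<forall>\<omega>. J 0 \<omega> = 0" "finite P" "step_on P \<eta> J"
    by (rule step_integrandE[OF st])
  have C0: "0 \<le> C" using st'(1) norm_ge_zero order_trans by blast
  \<comment> \<open>Multiples of \<delta>, enough of them to cover [0, T]. As grid points they keep
    every cell no longer than \<delta>, as the energy comparison presupposes.\<close>
  define mesh where "mesh = (\<lambda>i. real i * \<delta>) ` {..nat \<lceil>T / \<delta>\<rceil>}"
  \<comment> \<open>\<open>Q\<close> belongs to the grid, so that the running maximum over grid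
    points sees every time in \<open>Q\<close>.\<close>
  define P' where "P' = (P \<union> mesh) \<inter> {0..T} \<union> Q \<union> {0, T}"
  have P': "finite P'" "0 \<in> P'" "P' \<subseteq> {0..T}"
    using st'(3) Q T by (auto simp: P'_def mesh_def)
  obtain N s where s0: "s 0 = 0" and s_less: "\<And>i. i < N \<Longrightarrow> s i < s (Suc i)" and img: "s ` {..N} = P'"
    and gap: "\<And>i. i < N \<Longrightarrow> P' \<inter> {s i<..<s (Suc i)} = {}"
    by (rule finite_grid[OF P'], rule that, assumption+)
  have s_in: "s i \<in> {0..T}" if "i \<le> N" for i
  proof -
    have "s i \<in> P'" unfolding img[symmetric] using that by (intro imageI) simp
    then show ?thesis using P'(3) by blast
  qed
  have s_mono: "s i \<le> s j" if "i \<le> j" "j \<le> N" for i j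
    using that
  proof (induction j)
    case (Suc j)
    then show ?case using s_less[of j] by (cases "i = Suc j") auto
  qed simp
  have gapP: "P \<inter> {s i<..<s (Suc i)} = {}" and gapm: "mesh \<inter> {s i<..<s (Suc i)} = {}" if i: "i < N" for i
  proof -
    have "{s i<..<s (Suc i)} \<subseteq> {0..T}" using s_in[of i] s_in[of "Suc i"] i by auto
    then have *: "x \<notin> {s i<..<s (Suc i)}" if "x \<in> P \<union> mesh" for x
      using gap[OF i] that unfolding P'_def by blast
    show "P \<inter> {s i<..<s (Suc i)} = {}" "mesh \<inter> {s i<..<s (Suc i)} = {}" using * by blast+
  qed
  have fine: "s (Suc i) - s i \<le> \<delta>" if i: "i < N" for i
  proof (rule ccontr)
    assume "\<not> s (Suc i) - s i \<le> \<delta>"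
    then have big: "s i + \<delta> < s (Suc i)" by simp
    have si: "0 \<le> s i" "s (Suc i) \<le> T" using s_in[of i] s_in[of "Suc i"] i by auto
    \<comment> \<open>The first multiple of \<delta> strictly above \<open>s i\<close>; in a cell
      longer than \<delta> it would be an interior point.\<close>
    define j where "j = Suc (nat \<lfloor>s i / \<delta>\<rfloor>)"
    have fl: "real (nat \<lfloor>s i / \<delta>\<rfloor>) = of_int \<lfloor>s i / \<delta>\<rfloor>" using si \<delta> by simp
    have "s i / \<delta> < real j" "real j \<le> s i / \<delta> + 1" unfolding j_def of_nat_Suc fl by linarith+
    then have j1: "s i < real j * \<delta>" "real j * \<delta> \<le> s i + \<delta>"
      using \<delta> by (simp_all add: divide_less_eq) (simp add: field_simps)
    then have "real j * \<delta> \<in> {s i<..<s (Suc i)}" using big by simp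
    moreover have "real j \<le> T / \<delta>" using j1 big si \<delta> by (simp add: le_divide_eq)
    then have "j \<le> nat \<lceil>T / \<delta>\<rceil>" by linarith
    then have "real j * \<delta> \<in> mesh" unfolding mesh_def by (intro imageI) simp
    ultimately show False using gapm[OF i] by blast
  qed
  define h where "h = (\<lambda>i. \<eta> (s (Suc i)))"
  have s_nonneg: "0 \<le> s i" if "i \<le> N" for i using s_in[OF that] by simp
  have const: "\<eta> r = \<eta> (s (Suc i))" if "i < N" "s i < r" "r \<le> s (Suc i)" for i r
    by (rule step_onD(1)[OF st'(4) s_nonneg[OF less_imp_le[OF that(1)]] s_less[OF that(1)] gapP[OF that(1)] that(2,3)])
  have hm: "h i \<in> borel_measurable (F (s i))" if "i < N" for i
    using step_onD(2)[OF st'(4) s_nonneg s_less gapP] that by (simp add: h_def)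
  have hC: "norm (h i \<omega>) \<le> C" for i \<omega> using st'(1) by (simp add: h_def)
  have Jd: "J (s j) \<omega> = disc_int s h j \<omega>" if "j \<le> N" for j \<omega>
    using that
  proof (induction j)
    case 0
    then show ?case using st'(2) by (simp add: disc_int_def s0)
  next
    case (Suc j)
    have "J (s (Suc j)) \<omega> - J (s j) \<omega> = inner (h j \<omega>) (W (s (Suc j)) \<omega> - W (s j) \<omega>)"
      using step_onD(3)[OF st'(4) s_nonneg s_less gapP, of j] Suc.prems by (simp add: h_def)
    with Suc show ?case by (simp add: disc_int_def)
  qed
  define E where "E = (\<lambda>j \<omega>. ennreal (\<Sum>i<j. (s (Suc i) - s i) * (norm (h i \<omega>))\<^sup>2))"
  have pos: "0 \<le> (s (Suc i) - s i) * (norm (h i \<omega>))\<^sup>2" if "i < N" for i \<omega>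
    using s_less[OF that] by simp
  have E_energy: "E j \<omega> = energy (\<lambda>r \<omega>. ennreal ((norm (\<eta> r \<omega>))\<^sup>2)) (s j) \<omega>" if j: "j \<le> N" for j \<omega>
  proof -
    have "energy (\<lambda>r \<omega>. ennreal ((norm (\<eta> r \<omega>))\<^sup>2)) (s j) \<omega> =
      (\<integral>\<^sup>+r. (\<Sum>i<j. ennreal ((norm (h i \<omega>))\<^sup>2) * indicator {s i<..s (Suc i)} r) \<partial>lborel)"
      unfolding energy_def
    proof (rule nn_integral_cong_AE)
      have "AE r in lborel. r \<noteq> (0::real)" by (rule AE_lborel_singleton)
      then show "AE r in lborel. ennreal ((norm (\<eta> r \<omega>))\<^sup>2) * indicator {0..s j} r
         = (\<Sum>i<j. ennreal ((norm (h i \<omega>))\<^sup>2) * indicator {s i<..s (Suc i)} r)"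
      proof (rule AE_mp, intro always_eventually allI impI)
        fix r :: real assume r: "r \<noteq> 0"
        have c: "(norm (\<eta> r' \<omega>))\<^sup>2 = (norm (\<eta> (s (Suc i)) \<omega>))\<^sup>2" if "i < N" "s i < r'" "r' \<le> s (Suc i)" for i r'
          by (simp only: const[OF that])
        have "ennreal ((norm (\<eta> r \<omega>))\<^sup>2) * indicator {0..s j} r = ennreal (indicat_real {0<..s j} r *\<^sub>R (norm (\<eta> r \<omega>))\<^sup>2)"
          using r by (auto simp: indicator_def)
        also have "indicat_real {0<..s j} r *\<^sub>R (norm (\<eta> r \<omega>))\<^sup>2 = (\<Sum>i<j. indicat_real {s i<..s (Suc i)} r *\<^sub>R (norm (h i \<omega>))\<^sup>2)"
          unfolding h_def by (rule grid_step_sum(1)[where s=s and N=N and f="\<lambda>r. (norm (\<eta> r \<omega>))\<^sup>2", OF s0 s_less c j])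
        also have "ennreal \<dots> = (\<Sum>i<j. ennreal (indicat_real {s i<..s (Suc i)} r *\<^sub>R (norm (h i \<omega>))\<^sup>2))"
          by (rule sum_ennreal[symmetric]) simp
        also have "\<dots> = (\<Sum>i<j. ennreal ((norm (h i \<omega>))\<^sup>2) * indicator {s i<..s (Suc i)} r)"
          by (intro sum.cong) (auto simp: indicator_def)
        finally show "ennreal ((norm (\<eta> r \<omega>))\<^sup>2) * indicator {0..s j} r
         = (\<Sum>i<j. ennreal ((norm (h i \<omega>))\<^sup>2) * indicator {s i<..s (Suc i)} r)" .
      qed
    qed
    also have "\<dots> = (\<Sum>i<j. ennreal ((norm (h i \<omega>))\<^sup>2) * emeasure lborel {s i<..s (Suc i)})"
      by (subst nn_integral_sum) (auto simp: nn_integral_cmult_indicator)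
    also have "\<dots> = (\<Sum>i<j. ennreal ((s (Suc i) - s i) * (norm (h i \<omega>))\<^sup>2))"
    proof (rule sum.cong[OF refl])
      fix i assume "i \<in> {..<j}"
      then have "s i < s (Suc i)" using j s_less by simp
      then show "ennreal ((norm (h i \<omega>))\<^sup>2) * emeasure lborel {s i<..s (Suc i)} = ennreal ((s (Suc i) - s i) * (norm (h i \<omega>))\<^sup>2)"
        by (simp add: ennreal_mult[symmetric] mult.commute)
    qed
    also have "\<dots> = E j \<omega>" unfolding E_def by (rule sum_ennreal) (use pos j in auto)
    finally show ?thesis by simp
  qed
  \<comment> \<open>Known at time \<open>s i\<close>: the energy of the step process up to
    \<open>s (Suc i)\<close> involves only \<open>h 0\<close>, ..., \<open>h i\<close>, and
    \<open>h i\<close> is already measurable at the left end of its cell.\<close>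
  define good where "good = (\<lambda>i \<omega>. energy \<psi> (s i) \<omega> \<le> K \<and> E (Suc i) \<omega> \<le> 2 * energy f (s i) \<omega> + \<epsilon>)"
  \<comment> \<open>All earlier cells must be good as well, so an integrand that has been switched
    off stays off.\<close>
  define H where "H = (\<lambda>i \<omega>. \<forall>j\<in>{..i}. good j \<omega>)"
  have Hm: "{\<omega> \<in> space (F (s i)). H i \<omega>} \<in> sets (F (s i))" if i: "i < N" for i
  proof -
    have "{\<omega> \<in> space (F (s i)). good j \<omega>} \<in> sets (F (s i))" if j: "j \<le> i" for j
    proof -
      have jN: "j < N" using i j by simp
      have 1: "energy \<psi> (s j) \<in> borel_measurable (F (s j))" "energy f (s j) \<in> borel_measurable (F (s j))"
        using energy_measurable[OF \<psi> s_in] energy_measurable[OF f s_in] jN by auto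
      have 2: "E (Suc j) \<in> borel_measurable (F (s j))"
        unfolding E_def
      proof (intro measurable_compose[OF _ measurable_ennreal] borel_measurable_sum borel_measurable_times borel_measurable_power borel_measurable_const)
        fix i' assume "i' \<in> {..<Suc j}"
        then have "h i' \<in> borel_measurable (F (s j))"
          using jN s_mono[of i' j] by (intro measurable_F_mono[OF _ hm]) auto
        then show "(\<lambda>x. norm (h i' x)) \<in> borel_measurable (F (s j))" by (rule measurable_compose[OF _ borel_measurable_norm])
      qed
      have "{\<omega> \<in> space (F (s j)). good j \<omega>} \<in> sets (F (s j))"
        unfolding good_def using 1 2 by measurable
      then show ?thesis using sets_F_mono[OF s_mono[of j i]] i j by auto
    qed
    then have "(\<Inter>j\<in>{..i}. {\<omega> \<in> space (F (s i)). good j \<omega>}) \<in> sets (F (s i))"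
      by (intro sets.finite_INT) auto
    also have "(\<Inter>j\<in>{..i}. {\<omega> \<in> space (F (s i)). good j \<omega>}) = {\<omega> \<in> space (F (s i)). H i \<omega>}"
      by (auto simp: H_def)
    finally show ?thesis .
  qed
  define g where "g = (\<lambda>i \<omega>. if H i \<omega> then h i \<omega> else 0)"
  have gm: "g i \<in> borel_measurable (F (s i))" if "i < N" for i
    unfolding g_def by (rule measurable_If[OF hm[OF that] measurable_const Hm[OF that]]) simp
  have gC: "norm (g i \<omega>) \<le> C" for i \<omega> using hC C0 by (simp add: g_def)
  define X where "X = (\<lambda>\<omega>. run_max (\<lambda>k. disc_int s g k \<omega>) N)"
  define G where "G = (\<lambda>\<omega>. \<integral>\<^sup>+r\<in>{0..T}. gate K \<psi> r \<omega> * f r \<omega> \<partial>lborel)"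
  \<comment> \<open>The last cell that is still on decides: its switch bounds the accumulated energy
    by that of \<open>f\<close> up to \<open>s n\<close>, and up to that time the gate of \<psi> is
    open, so the weight can be inserted.\<close>
  have Gb: "ennreal (\<Sum>i<n. (s (Suc i) - s i) * (norm (g i \<omega>))\<^sup>2) \<le> 2 * G \<omega> + \<epsilon>" if "n \<le> N" for n \<omega>
    using that
  proof (induction n)
    case (Suc n)
    show ?case
    proof (cases "H n \<omega>")
      case True
      then have "H i \<omega>" if "i \<le> n" for i using that by (auto simp: H_def)
      then have "ennreal (\<Sum>i<Suc n. (s (Suc i) - s i) * (norm (g i \<omega>))\<^sup>2) = E (Suc n) \<omega>"
        unfolding E_def by (intro arg_cong[where f=ennreal] sum.cong refl) (simp add: g_def less_Suc_eq_le)
      also have "\<dots> \<le> 2 * energy f (s n) \<omega> + \<epsilon>" using True by (simp add: H_def good_def)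
      also have "energy f (s n) \<omega> \<le> G \<omega>"
        unfolding energy_def G_def
      proof (rule nn_integral_mono)
        fix r
        show "f r \<omega> * indicator {0..s n} r \<le> gate K \<psi> r \<omega> * f r \<omega> * indicator {0..T} r"
        proof (cases "r \<in> {0..s n}")
          case r: True
          have "energy \<psi> r \<omega> \<le> energy \<psi> (s n) \<omega>" using r by (intro energy_mono) simp
          also have "\<dots> \<le> K" using True by (simp add: H_def good_def)
          finally have "gate K \<psi> r \<omega> = 1" by (simp add: gate_def)
          then show ?thesis using r s_in[of n] Suc.prems by simp
        qed simp
      qed
      finally show ?thesis by (simp add: add_right_mono mult_left_mono)
    next
      case False
      then show ?thesis using Suc by (simp add: g_def)
    qed
  qed simp
  have Xm: "X \<in> borel_measurable M"
    unfolding X_def by (rule measurable_F_M[OF run_max_meas[of s N g, OF _ s_less gm gC order_refl]]) (simp add: s0)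
  have XE: "(\<integral>\<^sup>+\<omega>. ennreal ((X \<omega>)\<^sup>2) \<partial>M) \<le> 4 * (\<integral>\<^sup>+\<omega>. 2 * G \<omega> + \<epsilon> \<partial>M)"
  proof -
    have "(\<integral>\<^sup>+\<omega>. ennreal ((X \<omega>)\<^sup>2) \<partial>M) \<le> 4 * (\<integral>\<^sup>+\<omega>. ennreal (\<Sum>i<N. (s (Suc i) - s i) * (norm (g i \<omega>))\<^sup>2) \<partial>M)"
      unfolding X_def by (rule discrete_doob[of s N g C]) (use s0 s_less gm gC in auto)
    also have "\<dots> \<le> 4 * (\<integral>\<^sup>+\<omega>. 2 * G \<omega> + \<epsilon> \<partial>M)"
      by (intro mult_left_mono nn_integral_mono Gb) auto
    finally show ?thesis .
  qed
  have XJ: "\<bar>J t \<omega>\<bar> \<le> X \<omega>" if t: "t \<in> Q" and gt: "gate K \<psi> t \<omega> \<noteq> 0"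
    and hyp: "\<And>s u. 0 \<le> s \<Longrightarrow> s < u \<Longrightarrow> u \<le> T \<Longrightarrow> u - s \<le> \<delta> \<Longrightarrow>
         energy (\<lambda>r \<omega>. ennreal ((norm (\<eta> r \<omega>))\<^sup>2)) u \<omega> \<le> 2 * energy f s \<omega> + \<epsilon>" for \<omega> t
  proof -
    have "t \<in> s ` {..N}" unfolding img P'_def using t by blast
    then obtain j where j: "j \<le> N" "t = s j" by auto
    have gd: "good i \<omega>" if i: "i < j" for i
    proof -
      have iN: "i < N" using i j by simp
      have "energy \<psi> (s i) \<omega> \<le> energy \<psi> t \<omega>" unfolding j(2) using s_mono[of i j] i j by (intro energy_mono) simp
      also have "\<dots> \<le> K" using gt by (auto simp: gate_def split: if_splits)
      finally have "energy \<psi> (s i) \<omega> \<le> K" .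
      moreover have "E (Suc i) \<omega> \<le> 2 * energy f (s i) \<omega> + \<epsilon>"
        using E_energy[of "Suc i" \<omega>] iN hyp[OF s_nonneg[of i] s_less[OF iN] _ fine[OF iN]] s_in[of "Suc i"] by simp
      ultimately show ?thesis by (simp add: good_def)
    qed
    \<comment> \<open>Every cell before \<open>t\<close> is good, so nothing has been switched off
      by then.\<close>
    have "disc_int s g j \<omega> = disc_int s h j \<omega>"
      unfolding disc_int_def by (intro sum.cong refl) (use gd in \<open>auto simp: g_def H_def\<close>)
    then have "J t \<omega> = disc_int s g j \<omega>" using Jd[OF j(1)] j(2) by simp
    then show ?thesis using run_max_ge[OF j(1), of "\<lambda>k. disc_int s g k \<omega>"] by (simp add: X_def)
  qed
  show ?thesis
  proof (rule exI[of _ X], intro conjI Xm XE[unfolded G_def], intro allI ballI impI)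
    fix \<omega> t assume t: "t \<in> Q" "gate K \<psi> t \<omega> \<noteq> 0"
      and h: "\<forall>s u. 0 \<le> s \<longrightarrow> s < u \<longrightarrow> u \<le> T \<longrightarrow> u - s \<le> \<delta> \<longrightarrow>
         energy (\<lambda>r \<omega>. ennreal ((norm (\<eta> r \<omega>))\<^sup>2)) u \<omega> \<le> 2 * energy f s \<omega> + \<epsilon>"
    show "\<bar>J t \<omega>\<bar> \<le> X \<omega>"
      by (rule XJ[OF t h[THEN spec, THEN spec, THEN mp, THEN mp, THEN mp, THEN mp]])
  qed
qed

lemma energy_eq_LINT:
  assumes "set_integrable lborel {0..T} (\<lambda>r. (norm (\<phi> r \<omega>))\<^sup>2)" "t \<le> T"
  shows "energy (\<lambda>r \<omega>. ennreal ((norm (\<phi> r \<omega>))\<^sup>2)) t \<omega> = ennreal (LINT r:{0..t}|lborel. (norm (\<phi> r \<omega>))\<^sup>2)"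
proof -
  have i: "set_integrable lborel {0..t} (\<lambda>r. (norm (\<phi> r \<omega>))\<^sup>2)"
    by (rule set_integrable_subset[OF assms(1)]) (use assms(2) in auto)
  have "energy (\<lambda>r \<omega>. ennreal ((norm (\<phi> r \<omega>))\<^sup>2)) t \<omega> = (\<integral>\<^sup>+r. ennreal (indicator {0..t} r *\<^sub>R (norm (\<phi> r \<omega>))\<^sup>2) \<partial>lborel)"
    unfolding energy_def by (intro nn_integral_cong) (auto simp: indicator_def)
  also have "\<dots> = ennreal (LINT r|lborel. indicator {0..t} r *\<^sub>R (norm (\<phi> r \<omega>))\<^sup>2)"
    using i unfolding set_integrable_def by (intro nn_integral_eq_integral) auto
  finally show ?thesis by (simp add: set_lebesgue_integral_def)
qed

lemma progressive_energy_finite: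
  fixes \<phi> :: "real \<Rightarrow> 'w \<Rightarrow> 'b::{real_normed_vector, second_countable_topology}"
  assumes \<phi>: "progressive F T \<phi>" and T: "0 \<le> T" and \<omega>: "\<omega> \<in> space M"
    and fin: "energy (\<lambda>r \<omega>. ennreal ((norm (\<phi> r \<omega>))\<^sup>2)) T \<omega> < \<infinity>"
  shows "set_integrable lborel {0..T} (\<lambda>r. (norm (\<phi> r \<omega>))\<^sup>2)"
  unfolding set_integrable_def
proof (rule integrableI_nonneg)
  have p: "(\<lambda>s. \<phi> (max 0 (min T s)) \<omega>) \<in> borel_measurable borel"
    using progressive_path[OF \<phi> T] \<omega> by simp
  have "(\<lambda>s. indicator {0..T} s *\<^sub>R (norm (\<phi> (max 0 (min T s)) \<omega>))\<^sup>2) \<in> borel_measurable lborel"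
    using p by measurable
  also have "(\<lambda>s. indicator {0..T} s *\<^sub>R (norm (\<phi> (max 0 (min T s)) \<omega>))\<^sup>2) = (\<lambda>s. indicator {0..T} s *\<^sub>R (norm (\<phi> s \<omega>))\<^sup>2)"
    by (auto simp: indicator_def min_absorb2 max_absorb2)
  finally show "(\<lambda>s. indicator {0..T} s *\<^sub>R (norm (\<phi> s \<omega>))\<^sup>2) \<in> borel_measurable lborel" .
  have "(\<integral>\<^sup>+r. ennreal (indicator {0..T} r *\<^sub>R (norm (\<phi> r \<omega>))\<^sup>2) \<partial>lborel) = energy (\<lambda>r \<omega>. ennreal ((norm (\<phi> r \<omega>))\<^sup>2)) T \<omega>"
    unfolding energy_def by (intro nn_integral_cong) (auto simp: indicator_def)
  then show "(\<integral>\<^sup>+r. ennreal (indicator {0..T} r *\<^sub>R (norm (\<phi> r \<omega>))\<^sup>2) \<partial>lborel) < \<infinity>" using fin by simp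
qed auto

lemma step_path_measurable:
  assumes st: "step_integrand \<eta> J" and T: "0 \<le> T"
  shows "(\<lambda>r. indicat_real {0<..T} r *\<^sub>R \<eta> r \<omega>) \<in> borel_measurable borel"
proof -
  obtain C P where st': "finite P" "step_on P \<eta> J"
    by (rule step_integrandE[OF st])
  define P' where "P' = P \<inter> {0..T} \<union> {0, T}"
  have P': "finite P'" "0 \<in> P'" "P' \<subseteq> {0..T}" using st'(1) T by (auto simp: P'_def)
  obtain N s where s0: "s 0 = 0" and s_less: "\<And>i. i < N \<Longrightarrow> s i < s (Suc i)" and img: "s ` {..N} = P'"
    and gap: "\<And>i. i < N \<Longrightarrow> P' \<inter> {s i<..<s (Suc i)} = {}"
    by (rule finite_grid[OF P'], rule that, assumption+)
  have s_in: "s i \<in> {0..T}" if "i \<le> N" for i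
  proof -
    have "s i \<in> P'" unfolding img[symmetric] using that by (intro imageI) simp
    then show ?thesis using P'(3) by blast
  qed
  have const: "\<eta> r \<omega> = \<eta> (s (Suc i)) \<omega>" if i: "i < N" and r: "s i < r" "r \<le> s (Suc i)" for i r
  proof -
    have "{s i<..<s (Suc i)} \<subseteq> {0..T}" using s_in[of i] s_in[of "Suc i"] i by auto
    then have "P \<inter> {s i<..<s (Suc i)} = {}" using gap[OF i] unfolding P'_def by blast
    from step_onD(1)[OF st'(2) _ s_less[OF i] this r] s_in[of i] i show ?thesis by simp
  qed
  have "T \<in> s ` {..N}" unfolding img P'_def by simp
  then obtain j where j: "j \<le> N" "T = s j" by auto
  have "indicat_real {0<..T} r *\<^sub>R \<eta> r \<omega> = (\<Sum>i<j. indicat_real {s i<..s (Suc i)} r *\<^sub>R \<eta> (s (Suc i)) \<omega>)" for r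
    unfolding j(2) by (rule grid_step_sum(1)[where s=s and N=N and f="\<lambda>r. \<eta> r \<omega>", OF s0 s_less const j(1)])
  then have eq: "(\<lambda>r. indicat_real {0<..T} r *\<^sub>R \<eta> r \<omega>) = (\<lambda>r. \<Sum>i<j. indicat_real {s i<..s (Suc i)} r *\<^sub>R \<eta> (s (Suc i)) \<omega>)"
    by (rule ext)
  show ?thesis unfolding eq
    by (intro borel_measurable_sum borel_measurable_scaleR borel_measurable_indicator borel_measurable_const) simp
qed

text \<open>Doob's inequality for the gated integral, from \<open>stopped_step\<close> on grids with
  cells of length at most 1/(k+1) and Fatou's lemma. The constant 8 is Doob's 4 times the 2 lost in
  comparing the energy of a step process with that of \<phi>. The right-hand side may be
  infinite.\<close>

lemma ito_maximal:
  fixes \<phi> :: "real \<Rightarrow> 'w \<Rightarrow> real ^ 'd"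
  assumes T: "0 \<le> T" and Q: "finite Q" "Q \<subseteq> {0..T}" and ap: "ito_approx T Q \<phi> I"
    and \<phi>: "progressive F T \<phi>" and \<psi>: "progressive F T \<psi>"
    and fin: "AE \<omega> in M. energy (\<lambda>r \<omega>. ennreal ((norm (\<phi> r \<omega>))\<^sup>2)) T \<omega> < \<infinity>"
  shows "(\<integral>\<^sup>+\<omega>. (SUP t\<in>Q. gate K \<psi> t \<omega> * ennreal ((I t \<omega>)\<^sup>2)) \<partial>M)
    \<le> 8 * (\<integral>\<^sup>+\<omega>. (\<integral>\<^sup>+r\<in>{0..T}. gate K \<psi> r \<omega> * ennreal ((norm (\<phi> r \<omega>))\<^sup>2) \<partial>lborel) \<partial>M)"
proof -
  define f where "f = (\<lambda>r \<omega>. ennreal ((norm (\<phi> r \<omega>))\<^sup>2))"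
  have f: "progressive F T f"
    unfolding f_def by (rule progressive_compose[OF \<phi>]) measurable
  obtain \<eta> J where st: "\<And>k::nat. step_integrand (\<eta> k) (J k)"
    and lim: "AE \<omega> in M. (\<lambda>k. \<integral>\<^sup>+r\<in>{0..T}. ennreal ((norm (\<eta> k r \<omega> - \<phi> r \<omega>))\<^sup>2) \<partial>lborel) \<longlonglongrightarrow> 0 \<and>
        (\<forall>t\<in>Q. (\<lambda>k. J k t \<omega>) \<longlonglongrightarrow> I t \<omega>)"
    using ap unfolding ito_approx_def by auto
  define G where "G = (\<lambda>\<omega>. \<integral>\<^sup>+r\<in>{0..T}. gate K \<psi> r \<omega> * f r \<omega> \<partial>lborel)"
  have "G = energy (\<lambda>r \<omega>. gate K \<psi> r \<omega> * f r \<omega>) T" by (simp add: G_def energy_def fun_eq_iff)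
  then have Gm: "G \<in> borel_measurable M"
    using measurable_F_M[OF energy_measurable[OF progressive_mult_ennreal[OF progressive_gate[OF \<psi>] f]]] T by simp
  have main: "(\<integral>\<^sup>+\<omega>. (SUP t\<in>Q. gate K \<psi> t \<omega> * ennreal ((I t \<omega>)\<^sup>2)) \<partial>M) \<le> 8 * (\<integral>\<^sup>+\<omega>. G \<omega> \<partial>M) + ennreal \<epsilon>"
    if \<epsilon>0: "0 < \<epsilon>" for \<epsilon> :: real
  proof -
    \<comment> \<open>The additive error in \<open>stopped_step\<close> is multiplied by 4.\<close>
    define \<epsilon>' where "\<epsilon>' = \<epsilon> / 4"
    have e': "0 < \<epsilon>'" using \<epsilon>0 by (simp add: \<epsilon>'_def)
    have "\<exists>X. X \<in> borel_measurable M \<and>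
      (\<integral>\<^sup>+\<omega>. ennreal ((X \<omega>)\<^sup>2) \<partial>M) \<le> 4 * (\<integral>\<^sup>+\<omega>. 2 * G \<omega> + ennreal \<epsilon>' \<partial>M) \<and>
      (\<forall>\<omega>. \<forall>t\<in>Q. gate K \<psi> t \<omega> \<noteq> 0 \<longrightarrow>
       (\<forall>s u. 0 \<le> s \<longrightarrow> s < u \<longrightarrow> u \<le> T \<longrightarrow> u - s \<le> 1 / real (Suc k) \<longrightarrow>
         energy (\<lambda>r \<omega>. ennreal ((norm (\<eta> k r \<omega>))\<^sup>2)) u \<omega> \<le> 2 * energy f s \<omega> + ennreal \<epsilon>') \<longrightarrow> \<bar>J k t \<omega>\<bar> \<le> X \<omega>)" for k
      unfolding G_def by (rule stopped_step[OF st[of k] T Q f \<psi>]) simp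
    then obtain X where Xm: "\<And>k. X k \<in> borel_measurable M"
      and XE: "\<And>k. (\<integral>\<^sup>+\<omega>. ennreal ((X k \<omega>)\<^sup>2) \<partial>M) \<le> 4 * (\<integral>\<^sup>+\<omega>. 2 * G \<omega> + ennreal \<epsilon>' \<partial>M)"
      and XJ: "\<And>k. \<forall>\<omega>. \<forall>t\<in>Q. gate K \<psi> t \<omega> \<noteq> 0 \<longrightarrow>
       (\<forall>s u. 0 \<le> s \<longrightarrow> s < u \<longrightarrow> u \<le> T \<longrightarrow> u - s \<le> 1 / real (Suc k) \<longrightarrow>
         energy (\<lambda>r \<omega>. ennreal ((norm (\<eta> k r \<omega>))\<^sup>2)) u \<omega> \<le> 2 * energy f s \<omega> + ennreal \<epsilon>') \<longrightarrow> \<bar>J k t \<omega>\<bar> \<le> X k \<omega>"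
      by metis
    have "AE \<omega> in M. (SUP t\<in>Q. gate K \<psi> t \<omega> * ennreal ((I t \<omega>)\<^sup>2)) \<le> liminf (\<lambda>k. ennreal ((X k \<omega>)\<^sup>2))"
      using lim fin AE_space
    proof eventually_elim
      case (elim \<omega>)
      have si: "set_integrable lborel {0..T} (\<lambda>r. (norm (\<phi> r \<omega>))\<^sup>2)"
        by (rule progressive_energy_finite[OF \<phi> T elim(3,2)])
      define e where "e = (\<lambda>t. LINT r:{0..t}|lborel. (norm (\<phi> r \<omega>))\<^sup>2)"
      have e_eq: "energy f t \<omega> = ennreal (e t)" if "t \<le> T" for t
        unfolding f_def e_def by (rule energy_eq_LINT[where \<phi>=\<phi> and \<omega>=\<omega>, OF si that])
      have e0: "0 \<le> e t" for t unfolding e_def set_lebesgue_integral_def by (intro Bochner_Integration.integral_nonneg) simp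
      have "continuous_on {0..T} e" unfolding e_def by (rule continuous_on_indefinite_LINT[OF si])
      then have "uniformly_continuous_on {0..T} e" using compact_uniformly_continuous by auto
      \<comment> \<open>Uniform continuity of the energy of \<phi> pays for the lag between
        \<open>s\<close> and \<open>u\<close>. One quarter of the tolerance goes to this lag, one
        quarter to the distance of the step process, and both are doubled in the comparison of
        squares.\<close>
      then obtain \<delta> where \<delta>: "0 < \<delta>" "\<And>x y. x \<in> {0..T} \<Longrightarrow> y \<in> {0..T} \<Longrightarrow> dist x y < \<delta> \<Longrightarrow> dist (e x) (e y) < \<epsilon>' / 4"
        using e' unfolding uniformly_continuous_on_def by (metis divide_pos_pos zero_less_numeral)
      define d where "d = (\<lambda>k. \<integral>\<^sup>+r\<in>{0..T}. ennreal ((norm (\<eta> k r \<omega> - \<phi> r \<omega>))\<^sup>2) \<partial>lborel)"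
      have "eventually (\<lambda>k. d k < ennreal (\<epsilon>' / 4)) sequentially"
        using elim(1) e' unfolding d_def by (intro order_tendstoD(2)[of _ 0]) auto
      moreover have "eventually (\<lambda>k. 1 / real (Suc k) < \<delta>) sequentially"
        using order_tendstoD(2)[OF LIMSEQ_Suc[OF lim_1_over_n], of \<delta>] \<delta>(1) by auto
      ultimately have ev: "eventually (\<lambda>k. \<forall>s u. 0 \<le> s \<longrightarrow> s < u \<longrightarrow> u \<le> T \<longrightarrow> u - s \<le> 1 / real (Suc k) \<longrightarrow>
         energy (\<lambda>r \<omega>. ennreal ((norm (\<eta> k r \<omega>))\<^sup>2)) u \<omega> \<le> 2 * energy f s \<omega> + ennreal \<epsilon>') sequentially"
      proof eventually_elim
        case (elim k)
        show ?case
        proof (intro allI impI)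
          fix s u assume su: "0 \<le> s" "s < u" "u \<le> T" "u - s \<le> 1 / real (Suc k)"
          have pm: "(\<lambda>r. indicat_real {0<..u} r *\<^sub>R \<phi> (max 0 (min T r)) \<omega>) \<in> borel_measurable borel"
            using progressive_path[OF \<phi> T] \<open>\<omega> \<in> space M\<close> by (intro borel_measurable_scaleR) auto
          define p where "p = (\<lambda>r. indicat_real {0<..u} r *\<^sub>R \<phi> r \<omega>)"
          define q where "q = (\<lambda>r. indicat_real {0<..u} r *\<^sub>R \<eta> k r \<omega>)"
          have "(\<lambda>r. indicat_real {0<..u} r *\<^sub>R \<phi> (max 0 (min T r)) \<omega>) = p"
            unfolding p_def
          proof (rule ext)
            fix r show "indicat_real {0<..u} r *\<^sub>R \<phi> (max 0 (min T r)) \<omega> = indicat_real {0<..u} r *\<^sub>R \<phi> r \<omega>"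
              using su by (cases "r \<in> {0<..u}") (auto simp: min_absorb2 max_absorb2)
          qed
          with pm have p1[measurable]: "p \<in> borel_measurable borel" by simp
          have p2[measurable]: "q \<in> borel_measurable borel"
            unfolding q_def using step_path_measurable[OF st, of u] su by simp
          have sq: "(norm y)\<^sup>2 \<le> 2 * (norm x)\<^sup>2 + 2 * (norm (y - x))\<^sup>2" for x y :: "real ^ 'd"
          proof -
            have "norm y \<le> norm x + norm (y - x)" using norm_triangle_ineq[of x "y - x"] by simp
            then have "(norm y)\<^sup>2 \<le> (norm x + norm (y - x))\<^sup>2" by (intro power_mono) auto
            also have "\<dots> \<le> 2 * (norm x)\<^sup>2 + 2 * (norm (y - x))\<^sup>2"
              using zero_le_power2[of "norm x - norm (y - x)"] by (simp add: power2_sum power2_diff)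
            finally show ?thesis .
          qed
          have "energy (\<lambda>r \<omega>. ennreal ((norm (\<eta> k r \<omega>))\<^sup>2)) u \<omega> = (\<integral>\<^sup>+r. ennreal ((norm (q r))\<^sup>2) \<partial>lborel)"
            unfolding energy_def q_def using AE_lborel_singleton[of 0]
            by (intro nn_integral_cong_AE) (auto simp: indicator_def)
          also have "\<dots> \<le> (\<integral>\<^sup>+r. 2 * ennreal ((norm (p r))\<^sup>2) + 2 * ennreal ((norm (q r - p r))\<^sup>2) \<partial>lborel)"
          proof (rule nn_integral_mono)
            fix r
            have "ennreal ((norm (q r))\<^sup>2) \<le> ennreal (2 * (norm (p r))\<^sup>2 + 2 * (norm (q r - p r))\<^sup>2)"
              by (intro ennreal_leI sq)
            also have "\<dots> = 2 * ennreal ((norm (p r))\<^sup>2) + 2 * ennreal ((norm (q r - p r))\<^sup>2)"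
              by (simp add: ennreal_plus ennreal_mult)
            finally show "ennreal ((norm (q r))\<^sup>2) \<le> 2 * ennreal ((norm (p r))\<^sup>2) + 2 * ennreal ((norm (q r - p r))\<^sup>2)" .
          qed
          also have "\<dots> = 2 * (\<integral>\<^sup>+r. ennreal ((norm (p r))\<^sup>2) \<partial>lborel) + 2 * (\<integral>\<^sup>+r. ennreal ((norm (q r - p r))\<^sup>2) \<partial>lborel)"
            by (simp add: nn_integral_add nn_integral_cmult)
          also have "(\<integral>\<^sup>+r. ennreal ((norm (p r))\<^sup>2) \<partial>lborel) \<le> energy f u \<omega>"
            unfolding energy_def f_def p_def by (intro nn_integral_mono) (auto simp: indicator_def)
          also have "(\<integral>\<^sup>+r. ennreal ((norm (q r - p r))\<^sup>2) \<partial>lborel) \<le> d k"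
            unfolding d_def p_def q_def using su by (intro nn_integral_mono) (auto simp: indicator_def)
          also have "d k \<le> ennreal (\<epsilon>' / 4)" using elim(1) by simp
          also have "energy f u \<omega> \<le> ennreal (e s + \<epsilon>' / 4)"
          proof -
            have "dist u s < \<delta>" using su elim(2) by (simp add: dist_real_def)
            then have "dist (e u) (e s) < \<epsilon>' / 4" using \<delta>(2)[of u s] su by simp
            then have "e u \<le> e s + \<epsilon>' / 4" unfolding dist_real_def by linarith
            then show ?thesis using e_eq[of u] su by (simp add: ennreal_leI del: ennreal_plus)
          qed
          finally have "energy (\<lambda>r \<omega>. ennreal ((norm (\<eta> k r \<omega>))\<^sup>2)) u \<omega> \<le> 2 * ennreal (e s + \<epsilon>' / 4) + 2 * ennreal (\<epsilon>' / 4)"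
            by (simp add: add_mono mult_left_mono)
          also have "\<dots> = 2 * energy f s \<omega> + ennreal \<epsilon>'"
          proof -
            have e2: "2 * ennreal x = ennreal (2 * x)" if "0 \<le> x" for x
              using that by (simp add: ennreal_mult)
            have "2 * ennreal (e s + \<epsilon>' / 4) + 2 * ennreal (\<epsilon>' / 4) = ennreal (2 * (e s + \<epsilon>' / 4)) + ennreal (2 * (\<epsilon>' / 4))"
              by (intro arg_cong2[where f="(+)"] e2) (use e0[of s] e' in auto)
            also have "\<dots> = ennreal (2 * (e s + \<epsilon>' / 4) + 2 * (\<epsilon>' / 4))"
              by (rule ennreal_plus[symmetric]) (use e0[of s] e' in auto)
            also have "2 * (e s + \<epsilon>' / 4) + 2 * (\<epsilon>' / 4) = 2 * e s + \<epsilon>'" by simp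
            also have "ennreal (2 * e s + \<epsilon>') = ennreal (2 * e s) + ennreal \<epsilon>'"
              by (rule ennreal_plus) (use e0[of s] e' in auto)
            also have "ennreal (2 * e s) = 2 * energy f s \<omega>"
              using e2[OF e0[of s]] e_eq[of s] su by simp
            finally show ?thesis .
          qed
          finally show "energy (\<lambda>r \<omega>. ennreal ((norm (\<eta> k r \<omega>))\<^sup>2)) u \<omega> \<le> 2 * energy f s \<omega> + ennreal \<epsilon>'" .
        qed
      qed
      show ?case
      proof (rule SUP_least)
        fix t assume t: "t \<in> Q"
        show "gate K \<psi> t \<omega> * ennreal ((I t \<omega>)\<^sup>2) \<le> liminf (\<lambda>k. ennreal ((X k \<omega>)\<^sup>2))"
        proof (cases "gate K \<psi> t \<omega> = 0")
          case False
          have "(\<lambda>k. ennreal ((J k t \<omega>)\<^sup>2)) \<longlonglongrightarrow> ennreal ((I t \<omega>)\<^sup>2)"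
            using elim(1) t by (intro tendsto_ennrealI tendsto_power) blast
          then have "ennreal ((I t \<omega>)\<^sup>2) = liminf (\<lambda>k. ennreal ((J k t \<omega>)\<^sup>2))"
            by (intro lim_imp_Liminf[symmetric]) auto
          also have "\<dots> \<le> liminf (\<lambda>k. ennreal ((X k \<omega>)\<^sup>2))"
          proof (rule Liminf_mono)
            show "eventually (\<lambda>k. ennreal ((J k t \<omega>)\<^sup>2) \<le> ennreal ((X k \<omega>)\<^sup>2)) sequentially"
              using ev
            proof eventually_elim
              case (elim k)
              have "\<bar>J k t \<omega>\<bar> \<le> X k \<omega>" using XJ[of k, THEN spec, of \<omega>, THEN bspec, OF t, THEN mp, OF False, THEN mp, OF elim] .
              then have "\<bar>J k t \<omega>\<bar>\<^sup>2 \<le> (X k \<omega>)\<^sup>2" by (intro power_mono) auto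
              then show ?case by (intro ennreal_leI) simp
            qed
          qed
          finally show ?thesis by (simp add: gate_def)
        qed simp
      qed
    qed
    then have "(\<integral>\<^sup>+\<omega>. (SUP t\<in>Q. gate K \<psi> t \<omega> * ennreal ((I t \<omega>)\<^sup>2)) \<partial>M) \<le> (\<integral>\<^sup>+\<omega>. liminf (\<lambda>k. ennreal ((X k \<omega>)\<^sup>2)) \<partial>M)"
      by (rule nn_integral_mono_AE)
    also have "\<dots> \<le> liminf (\<lambda>k. \<integral>\<^sup>+\<omega>. ennreal ((X k \<omega>)\<^sup>2) \<partial>M)"
      using Xm by (intro nn_integral_liminf) measurable
    also have "\<dots> \<le> liminf (\<lambda>k::nat. 4 * (\<integral>\<^sup>+\<omega>. 2 * G \<omega> + ennreal \<epsilon>' \<partial>M))"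
      using XE by (intro Liminf_mono always_eventually allI)
    also have "\<dots> = 4 * (\<integral>\<^sup>+\<omega>. 2 * G \<omega> + ennreal \<epsilon>' \<partial>M)" by (simp add: Liminf_const)
    also have "(\<integral>\<^sup>+\<omega>. 2 * G \<omega> + ennreal \<epsilon>' \<partial>M) = 2 * (\<integral>\<^sup>+\<omega>. G \<omega> \<partial>M) + ennreal \<epsilon>'"
      using Gm by (simp add: nn_integral_add nn_integral_cmult emeasure_space_1)
    also have "4 * (2 * (\<integral>\<^sup>+\<omega>. G \<omega> \<partial>M) + ennreal \<epsilon>') = 8 * (\<integral>\<^sup>+\<omega>. G \<omega> \<partial>M) + ennreal \<epsilon>"
    proof -
      have "4 * ennreal \<epsilon>' = ennreal \<epsilon>" using \<epsilon>0 by (simp add: \<epsilon>'_def ennreal_mult[symmetric] flip: ennreal_numeral)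
      then show ?thesis by (simp add: distrib_left mult.assoc[symmetric])
    qed
    finally show ?thesis .
  qed
  have "(\<integral>\<^sup>+\<omega>. (SUP t\<in>Q. gate K \<psi> t \<omega> * ennreal ((I t \<omega>)\<^sup>2)) \<partial>M) \<le> 8 * (\<integral>\<^sup>+\<omega>. G \<omega> \<partial>M)"
    by (rule ennreal_le_epsilon) (rule main)
  then show ?thesis by (simp add: G_def f_def)
qed

end

text \<open>Measurability of one path on [0, T]. Drifts enter \<open>real_ito\<close> only through
  almost surely integrable paths, so the rules for energies are phrased path by path.\<close>

definition path_meas :: "real \<Rightarrow> (real \<Rightarrow> 'w \<Rightarrow> ennreal) \<Rightarrow> 'w \<Rightarrow> bool" where
  "path_meas T f \<omega> \<longleftrightarrow> (\<lambda>r. f r \<omega> * indicator {0..T} r) \<in> borel_measurable lborel"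

lemma path_meas_mult:
  assumes "path_meas T f \<omega>" "path_meas T g \<omega>"
  shows "path_meas T (\<lambda>r \<omega>. f r \<omega> * g r \<omega>) \<omega>"
proof -
  have "(\<lambda>r. (f r \<omega> * indicator {0..T} r) * (g r \<omega> * indicator {0..T} r)) \<in> borel_measurable lborel"
    using assms unfolding path_meas_def by (rule borel_measurable_times_ennreal)
  also have "(\<lambda>r. (f r \<omega> * indicator {0..T} r) * (g r \<omega> * indicator {0..T} r)) = (\<lambda>r. f r \<omega> * g r \<omega> * indicator {0..T} r)"
    by (auto simp: indicator_def)
  finally show ?thesis by (simp add: path_meas_def)
qed

lemma energy_sum:
  assumes "\<And>k. k \<in> A \<Longrightarrow> path_meas T (f k) \<omega>"
  shows "energy (\<lambda>r \<omega>. \<Sum>k\<in>A. f k r \<omega>) T \<omega> = (\<Sum>k\<in>A. energy (f k) T \<omega>)"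
  unfolding energy_def sum_distrib_right using assms by (intro nn_integral_sum) (simp add: path_meas_def)

lemma energy_add:
  assumes "path_meas T f \<omega>" "path_meas T g \<omega>"
  shows "energy (\<lambda>r \<omega>. f r \<omega> + g r \<omega>) T \<omega> = energy f T \<omega> + energy g T \<omega>"
  unfolding energy_def distrib_right using assms by (intro nn_integral_add) (simp_all add: path_meas_def)

lemma energy_cmult:
  assumes "path_meas T f \<omega>"
  shows "energy (\<lambda>r \<omega>. c * f r \<omega>) T \<omega> = c * energy f T \<omega>"
  unfolding energy_def mult.assoc using assms by (intro nn_integral_cmult) (simp add: path_meas_def)

lemma energy_mono_fun:
  assumes "\<And>r. r \<in> {0..T} \<Longrightarrow> f r \<omega> \<le> g r \<omega>"
  shows "energy f T \<omega> \<le> energy g T \<omega>"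
  unfolding energy_def using assms by (intro nn_integral_mono) (auto simp: indicator_def)

lemma progressive_borel:
  fixes f :: "real \<Rightarrow> 'b::topological_space"
  assumes "f \<in> borel_measurable borel"
  shows "progressive G T (\<lambda>t \<omega>. f t)"
  unfolding progressive_def
proof
  fix t assume "t \<in> {0..T}"
  have "f \<in> borel_measurable (restrict_space borel {0..t})"
    by (rule measurable_restrict_space1[OF assms])
  from measurable_compose[OF measurable_fst this]
  show "(\<lambda>(s, \<omega>). f s) \<in> borel_measurable (restrict_space borel {0..t} \<Otimes>\<^sub>M G t)"
    by (simp add: split_beta')
qed

text \<open>The gate is open on an initial piece of [0, T] with supremum \<tau>, and at each open
  time the energy is at most \<open>K\<close>. As the energy can become infinite right after an open
  time, \<tau> is approached from the left by monotone convergence; the point \<tau> itself is a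
  null set.\<close>

lemma energy_gate_le:
  assumes m: "path_meas T \<psi> \<omega>"
  shows "energy (\<lambda>r \<omega>. gate K \<psi> r \<omega> * \<psi> r \<omega>) T \<omega> \<le> K"
proof -
  define S where "S = {r \<in> {0..T}. energy \<psi> r \<omega> \<le> K}"
  show ?thesis
  proof (cases "S = {}")
    case True
    have "energy (\<lambda>r \<omega>. gate K \<psi> r \<omega> * \<psi> r \<omega>) T \<omega> \<le> energy (\<lambda>r \<omega>. 0) T \<omega>"
      using True by (intro energy_mono_fun) (auto simp: S_def gate_def)
    then show ?thesis by (simp add: energy_def)
  next
    case False
    have bdd: "bdd_above S" by (rule bdd_aboveI[of _ T]) (simp add: S_def)
    define \<tau> where "\<tau> = Sup S"
    have le: "r \<le> \<tau>" if "r \<in> S" for r unfolding \<tau>_def using that bdd by (rule cSup_upper)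
    have \<tau>T: "\<tau> \<le> T" unfolding \<tau>_def using False by (intro cSup_least) (auto simp: S_def)
    define f where "f = (\<lambda>n r. \<psi> r \<omega> * indicator {0..\<tau> - 1 / real (Suc n)} r)"
    have fm: "f n \<in> borel_measurable lborel" for n
    proof -
      have "(\<lambda>r. (\<psi> r \<omega> * indicator {0..T} r) * indicator {0..\<tau> - 1 / real (Suc n)} r) \<in> borel_measurable lborel"
        by (rule borel_measurable_times_ennreal[OF m[unfolded path_meas_def]]) simp
      also have "(\<lambda>r. (\<psi> r \<omega> * indicator {0..T} r) * indicator {0..\<tau> - 1 / real (Suc n)} r) = f n"
      proof (rule ext)
        fix r
        have "\<tau> - 1 / real (Suc n) \<le> T" using \<tau>T by (smt (verit) divide_nonneg_nonneg of_nat_0_le_iff)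
        then show "(\<psi> r \<omega> * indicator {0..T} r) * indicator {0..\<tau> - 1 / real (Suc n)} r = f n r"
          unfolding f_def by (cases "r \<in> {0..\<tau> - 1 / real (Suc n)}") auto
      qed
      finally show ?thesis .
    qed
    have fi: "(\<integral>\<^sup>+r. f n r \<partial>lborel) \<le> K" for n
    proof -
      have "\<tau> - 1 / real (Suc n) < \<tau>" by simp
      then obtain s where s: "s \<in> S" "\<tau> - 1 / real (Suc n) < s"
        unfolding \<tau>_def using less_cSup_iff[OF False bdd] by metis
      have "(\<integral>\<^sup>+r. f n r \<partial>lborel) \<le> energy \<psi> s \<omega>"
        unfolding f_def energy_def using s(2) by (intro nn_integral_mono) (auto simp: indicator_def)
      also have "\<dots> \<le> K" using s(1) by (simp add: S_def)
      finally show ?thesis .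
    qed
    have inc: "incseq f"
    proof (intro incseq_SucI le_funI)
      fix n r
      have "1 / real (Suc (Suc n)) \<le> 1 / real (Suc n)" by (intro divide_left_mono) auto
      then have "{0..\<tau> - 1 / real (Suc n)} \<subseteq> {0..\<tau> - 1 / real (Suc (Suc n))}" by auto
      then show "f n r \<le> f (Suc n) r" unfolding f_def by (intro mult_left_mono) (auto simp: indicator_def)
    qed
    have "energy (\<lambda>r \<omega>. gate K \<psi> r \<omega> * \<psi> r \<omega>) T \<omega> \<le> (\<integral>\<^sup>+r. (SUP n. f n r) \<partial>lborel)"
      unfolding energy_def
    proof (rule nn_integral_mono_AE)
      have "AE r in lborel. r \<noteq> \<tau>" by (rule AE_lborel_singleton)
      then show "AE r in lborel. gate K \<psi> r \<omega> * \<psi> r \<omega> * indicator {0..T} r \<le> (SUP n. f n r)"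
      proof (rule AE_mp, intro always_eventually allI impI)
        fix r assume r: "r \<noteq> \<tau>"
        show "gate K \<psi> r \<omega> * \<psi> r \<omega> * indicator {0..T} r \<le> (SUP n. f n r)"
        proof (cases "r \<in> S")
          case True
          then have "r < \<tau>" using le[OF True] r by simp
          then obtain n where "1 / real (Suc n) < \<tau> - r"
            using nat_approx_posE[of "\<tau> - r"] by auto
          then have "f n r = \<psi> r \<omega>" using True by (simp add: f_def S_def)
          then have "gate K \<psi> r \<omega> * \<psi> r \<omega> * indicator {0..T} r \<le> f n r"
            by (auto simp: gate_def indicator_def)
          also have "\<dots> \<le> (SUP n. f n r)" by (rule SUP_upper) simp
          finally show ?thesis .
        next
          case False
          then show ?thesis by (auto simp: S_def gate_def indicator_def)
        qed
      qed
    qed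
    also have "\<dots> = (SUP n. \<integral>\<^sup>+r. f n r \<partial>lborel)"
      by (rule nn_integral_monotone_convergence_SUP[OF inc fm])
    also have "\<dots> \<le> K" by (rule SUP_least) (rule fi)
    finally show ?thesis .
  qed
qed

section \<open>Expected energies and Gronwall's lemma for gated processes\<close>

context brownian
begin

lemma progressive_path_meas:
  assumes "progressive F T f" "0 \<le> T" "\<omega> \<in> space M"
  shows "path_meas T f \<omega>"
proof -
  have "(\<lambda>r. f (max 0 (min T r)) \<omega> * indicator {0..T} r) \<in> borel_measurable lborel"
    using progressive_path[OF assms(1,2)] assms(3) by (intro borel_measurable_times_ennreal) auto
  also have "(\<lambda>r. f (max 0 (min T r)) \<omega> * indicator {0..T} r) = (\<lambda>r. f r \<omega> * indicator {0..T} r)"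
  proof (rule ext)
    fix r show "f (max 0 (min T r)) \<omega> * indicator {0..T} r = f r \<omega> * indicator {0..T} r"
      by (cases "r \<in> {0..T}") (auto simp: min_absorb2 max_absorb2)
  qed
  finally show ?thesis by (simp add: path_meas_def)
qed

lemma energy_measurableM: "progressive F T f \<Longrightarrow> 0 \<le> T \<Longrightarrow> energy f T \<in> borel_measurable M"
  using measurable_F_M[OF energy_measurable] by simp

lemma fubini_energy:
  assumes f: "progressive F T f" and t: "t \<in> {0..T}"
  shows "(\<integral>\<^sup>+\<omega>. energy f t \<omega> \<partial>M) = (\<integral>\<^sup>+r\<in>{0..t}. (\<integral>\<^sup>+\<omega>. f r \<omega> \<partial>M) \<partial>lborel)"
proof -
  interpret P: pair_sigma_finite lborel M ..
  let ?g = "\<lambda>r \<omega>. f (max 0 (min T r)) \<omega> * indicator {0..t} r"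
  have eq: "?g r \<omega> = f r \<omega> * indicator {0..t} r" for r \<omega>
    using t by (cases "r \<in> {0..t}") (auto simp: min_absorb2 max_absorb2)
  have "(\<lambda>p. f (max 0 (min T (fst p))) (snd p)) \<in> borel_measurable (borel \<Otimes>\<^sub>M M)"
    using progressive_jointM[OF f] t by (simp add: split_beta')
  moreover have "(\<lambda>p. indicator {0..t} (fst p) :: ennreal) \<in> borel_measurable (borel \<Otimes>\<^sub>M M)"
    by (rule measurable_compose[OF measurable_fst]) simp
  ultimately have m: "(\<lambda>p. ?g (fst p) (snd p)) \<in> borel_measurable (borel \<Otimes>\<^sub>M M)"
    by (rule borel_measurable_times_ennreal)
  have "sets (borel \<Otimes>\<^sub>M M) = sets (lborel \<Otimes>\<^sub>M M)" by (intro sets_pair_measure_cong) auto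
  then have m': "(\<lambda>(r, \<omega>). ?g r \<omega>) \<in> borel_measurable (lborel \<Otimes>\<^sub>M M)"
    using m unfolding split_beta' by (simp cong: measurable_cong_sets)
  have "(\<integral>\<^sup>+\<omega>. energy f t \<omega> \<partial>M) = (\<integral>\<^sup>+\<omega>. \<integral>\<^sup>+r. ?g r \<omega> \<partial>lborel \<partial>M)"
    unfolding eq energy_def ..
  also have "\<dots> = (\<integral>\<^sup>+r. \<integral>\<^sup>+\<omega>. ?g r \<omega> \<partial>M \<partial>lborel)"
    by (rule P.Fubini'[OF m'])
  also have "\<dots> = (\<integral>\<^sup>+r\<in>{0..t}. (\<integral>\<^sup>+\<omega>. f r \<omega> \<partial>M) \<partial>lborel)"
    unfolding eq by (intro nn_integral_cong) (auto simp: indicator_def)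
  finally show ?thesis .
qed

text \<open>\<delta> is gated by its own energy, so its gated energy is at most \<open>N\<close>,
  which is the finiteness that \<open>gronwall\<close> asks for. The resulting bound does not
  contain \<open>N\<close>, and the gate of almost every path is open for large
  \<open>N\<close>.\<close>

lemma gated_gronwall:
  assumes \<delta>: "progressive F T \<delta>" and T: "0 \<le> T" and a: "0 \<le> a" and c: "0 < c"
    and fin: "AE \<omega> in M. energy \<delta> T \<omega> < \<infinity>"
    and est: "\<And>(N::nat) t. t \<in> {0..T} \<Longrightarrow> (\<integral>\<^sup>+\<omega>. gate (of_nat N) \<delta> t \<omega> * \<delta> t \<omega> \<partial>M)
       \<le> ennreal a + ennreal c * (\<integral>\<^sup>+\<omega>. energy (\<lambda>r \<omega>. gate (of_nat N) \<delta> r \<omega> * \<delta> r \<omega>) t \<omega> \<partial>M)"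
    and t: "t \<in> {0..T}"
  shows "(\<integral>\<^sup>+\<omega>. \<delta> t \<omega> \<partial>M) \<le> ennreal (2 * a * exp (2 * c * T))"
proof -
  have gp: "progressive F T (\<lambda>r \<omega>. gate K \<delta> r \<omega> * \<delta> r \<omega>)" for K
    by (rule progressive_mult_ennreal[OF progressive_gate[OF \<delta>] \<delta>])
  have bound: "(\<integral>\<^sup>+\<omega>. gate (of_nat N) \<delta> t \<omega> * \<delta> t \<omega> \<partial>M) \<le> ennreal (2 * a * exp (2 * c * T))" for N :: nat
  proof (rule gronwall[where u="\<lambda>t. \<integral>\<^sup>+\<omega>. gate (of_nat N) \<delta> t \<omega> * \<delta> t \<omega> \<partial>M", OF a c _ _ t])
    fix t assume t: "t \<in> {0..T}"
    show "(\<integral>\<^sup>+\<omega>. gate (of_nat N) \<delta> t \<omega> * \<delta> t \<omega> \<partial>M) \<le> ennreal a + ennreal c * (\<integral>\<^sup>+r\<in>{0..t}. (\<integral>\<^sup>+\<omega>. gate (of_nat N) \<delta> r \<omega> * \<delta> r \<omega> \<partial>M) \<partial>lborel)"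
      using est[OF t, of N] fubini_energy[OF gp t, of "of_nat N"] by simp
  next
    have "(\<integral>\<^sup>+r\<in>{0..T}. (\<integral>\<^sup>+\<omega>. gate (of_nat N) \<delta> r \<omega> * \<delta> r \<omega> \<partial>M) \<partial>lborel) =
       (\<integral>\<^sup>+\<omega>. energy (\<lambda>r \<omega>. gate (of_nat N) \<delta> r \<omega> * \<delta> r \<omega>) T \<omega> \<partial>M)"
      using fubini_energy[OF gp, of T "of_nat N"] T by simp
    also have "\<dots> \<le> (\<integral>\<^sup>+\<omega>. of_nat N \<partial>M)"
    proof (rule nn_integral_mono)
      fix \<omega> assume "\<omega> \<in> space M"
      show "energy (\<lambda>r \<omega>. gate (of_nat N) \<delta> r \<omega> * \<delta> r \<omega>) T \<omega> \<le> of_nat N"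
        by (rule energy_gate_le[OF progressive_path_meas[OF \<delta> T \<open>\<omega> \<in> space M\<close>]])
    qed
    also have "\<dots> < \<infinity>" by (simp add: emeasure_space_1 ennreal_of_nat_eq_real_of_nat)
    finally show "(\<integral>\<^sup>+r\<in>{0..T}. (\<integral>\<^sup>+\<omega>. gate (of_nat N) \<delta> r \<omega> * \<delta> r \<omega> \<partial>M) \<partial>lborel) < \<infinity>" .
  qed
  have "(\<integral>\<^sup>+\<omega>. \<delta> t \<omega> \<partial>M) \<le> (\<integral>\<^sup>+\<omega>. (SUP N::nat. gate (of_nat N) \<delta> t \<omega> * \<delta> t \<omega>) \<partial>M)"
  proof (rule nn_integral_mono_AE)
    show "AE \<omega> in M. \<delta> t \<omega> \<le> (SUP N::nat. gate (of_nat N) \<delta> t \<omega> * \<delta> t \<omega>)"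
      using fin
    proof eventually_elim
      case (elim \<omega>)
      have "energy \<delta> t \<omega> < \<top>" using energy_mono[of t T \<delta> \<omega>] t elim by (auto intro: le_less_trans)
      then obtain N :: nat where "energy \<delta> t \<omega> < of_nat N" using ennreal_Ex_less_of_nat by blast
      then have "gate (of_nat N) \<delta> t \<omega> * \<delta> t \<omega> = \<delta> t \<omega>" by (simp add: gate_def)
      then have "\<delta> t \<omega> \<le> gate (of_nat N) \<delta> t \<omega> * \<delta> t \<omega>" by simp
      also have "\<dots> \<le> (SUP N::nat. gate (of_nat N) \<delta> t \<omega> * \<delta> t \<omega>)" by (rule SUP_upper) simp
      finally show ?case .
    qed
  qed
  also have "\<dots> = (SUP N::nat. \<integral>\<^sup>+\<omega>. gate (of_nat N) \<delta> t \<omega> * \<delta> t \<omega> \<partial>M)"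
  proof (rule nn_integral_monotone_convergence_SUP)
    show "incseq (\<lambda>(N::nat) \<omega>. gate (of_nat N) \<delta> t \<omega> * \<delta> t \<omega>)"
    proof (intro incseq_SucI le_funI mult_right_mono)
      fix N :: nat and \<omega>
      have "(of_nat N :: ennreal) \<le> of_nat (Suc N)" by (simp add: ennreal_of_nat_eq_real_of_nat ennreal_leI)
      then show "gate (of_nat N) \<delta> t \<omega> \<le> gate (of_nat (Suc N)) \<delta> t \<omega>"
        by (auto simp: gate_def simp del: of_nat_Suc intro: order_trans)
    qed simp
    show "(\<lambda>\<omega>. gate (of_nat N) \<delta> t \<omega> * \<delta> t \<omega>) \<in> borel_measurable M" for N :: nat
      using measurable_F_M[OF progressive_section[OF gp t]] .
  qed
  also have "\<dots> \<le> ennreal (2 * a * exp (2 * c * T))" by (rule SUP_least) (rule bound)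
  finally show ?thesis .
qed

section \<open>Linear operations on approximable integrals\<close>

lemma ito_approx_subset: "ito_approx T Q \<phi> I \<Longrightarrow> S \<le> T \<Longrightarrow> Q' \<subseteq> Q \<Longrightarrow> ito_approx S Q' \<phi> I"
proof -
  assume ap: "ito_approx T Q \<phi> I" and S: "S \<le> T" and Q': "Q' \<subseteq> Q"
  obtain \<eta> J where st: "\<forall>k::nat. step_integrand (\<eta> k) (J k)"
    and lim: "AE \<omega> in M. (\<lambda>k. \<integral>\<^sup>+r\<in>{0..T}. ennreal ((norm (\<eta> k r \<omega> - \<phi> r \<omega>))\<^sup>2) \<partial>lborel) \<longlonglongrightarrow> 0 \<and>
        (\<forall>t\<in>Q. (\<lambda>k. J k t \<omega>) \<longlonglongrightarrow> I t \<omega>)"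
    using ap unfolding ito_approx_def by auto
  have "AE \<omega> in M. (\<lambda>k. \<integral>\<^sup>+r\<in>{0..S}. ennreal ((norm (\<eta> k r \<omega> - \<phi> r \<omega>))\<^sup>2) \<partial>lborel) \<longlonglongrightarrow> 0 \<and>
        (\<forall>t\<in>Q'. (\<lambda>k. J k t \<omega>) \<longlonglongrightarrow> I t \<omega>)"
    using lim
  proof eventually_elim
    case (elim \<omega>)
    have "(\<lambda>k. \<integral>\<^sup>+r\<in>{0..S}. ennreal ((norm (\<eta> k r \<omega> - \<phi> r \<omega>))\<^sup>2) \<partial>lborel) \<longlonglongrightarrow> 0"
      by (rule tendsto_sandwich[OF _ _ tendsto_const conjunct1[OF elim]])
         (use S in \<open>auto intro!: always_eventually nn_integral_mono simp: indicator_def\<close>)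
    then show ?case using elim Q' by blast
  qed
  then show ?thesis unfolding ito_approx_def using st by blast
qed

text \<open>\<open>step_on\<close> constrains a step integrand only on half-open cells: its value at
  time 0 is arbitrary, and \<open>step_path_measurable\<close> speaks of the half-open interval. The
  time 0 is discarded as a null set.\<close>

lemma nn_integral_power2_half_open:
  fixes y :: "real \<Rightarrow> 'b::real_normed_vector"
  shows "(\<integral>\<^sup>+r\<in>{0..T}. ennreal ((norm (y r))\<^sup>2) \<partial>lborel) = (\<integral>\<^sup>+r. ennreal ((norm (indicat_real {0<..T} r *\<^sub>R y r))\<^sup>2) \<partial>lborel)"
proof (rule nn_integral_cong_AE)
  have "AE r in lborel. r \<noteq> (0::real)" by (rule AE_lborel_singleton)
  then show "AE r in lborel. ennreal ((norm (y r))\<^sup>2) * indicator {0..T} r = ennreal ((norm (indicat_real {0<..T} r *\<^sub>R y r))\<^sup>2)"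
  proof eventually_elim
    case (elim r)
    then show ?case by (auto simp: indicator_def)
  qed
qed

lemma progressive_path_ind:
  fixes \<phi> :: "real \<Rightarrow> 'w \<Rightarrow> real ^ 'd"
  assumes "progressive F T \<phi>" "0 \<le> T" "\<omega> \<in> space M"
  shows "(\<lambda>r. indicat_real {0<..T} r *\<^sub>R \<phi> r \<omega>) \<in> borel_measurable borel"
proof -
  have "(\<lambda>r. indicat_real {0<..T} r *\<^sub>R \<phi> (max 0 (min T r)) \<omega>) \<in> borel_measurable borel"
    using progressive_path[OF assms(1,2)] assms(3) by (intro borel_measurable_scaleR) auto
  also have "(\<lambda>r. indicat_real {0<..T} r *\<^sub>R \<phi> (max 0 (min T r)) \<omega>) = (\<lambda>r. indicat_real {0<..T} r *\<^sub>R \<phi> r \<omega>)"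
  proof (rule ext)
    fix r show "indicat_real {0<..T} r *\<^sub>R \<phi> (max 0 (min T r)) \<omega> = indicat_real {0<..T} r *\<^sub>R \<phi> r \<omega>"
      by (cases "r \<in> {0<..T}") (auto simp: min_absorb2 max_absorb2)
  qed
  finally show ?thesis .
qed

lemma ito_approx_add:
  assumes 1: "ito_approx T Q \<phi> I" "progressive F T \<phi>" and 2: "ito_approx T Q \<phi>' I'" "progressive F T \<phi>'" and T: "0 \<le> T"
  shows "ito_approx T Q (\<lambda>r \<omega>. \<phi> r \<omega> + \<phi>' r \<omega>) (\<lambda>t \<omega>. I t \<omega> + I' t \<omega>)"
proof -
  obtain \<eta> J where st: "\<And>k::nat. step_integrand (\<eta> k) (J k)"
    and lim: "AE \<omega> in M. (\<lambda>k. \<integral>\<^sup>+r\<in>{0..T}. ennreal ((norm (\<eta> k r \<omega> - \<phi> r \<omega>))\<^sup>2) \<partial>lborel) \<longlonglongrightarrow> 0 \<and>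
        (\<forall>t\<in>Q. (\<lambda>k. J k t \<omega>) \<longlonglongrightarrow> I t \<omega>)"
    using 1(1) unfolding ito_approx_def by auto
  obtain \<eta>' J' where st': "\<And>k::nat. step_integrand (\<eta>' k) (J' k)"
    and lim': "AE \<omega> in M. (\<lambda>k. \<integral>\<^sup>+r\<in>{0..T}. ennreal ((norm (\<eta>' k r \<omega> - \<phi>' r \<omega>))\<^sup>2) \<partial>lborel) \<longlonglongrightarrow> 0 \<and>
        (\<forall>t\<in>Q. (\<lambda>k. J' k t \<omega>) \<longlonglongrightarrow> I' t \<omega>)"
    using 2(1) unfolding ito_approx_def by auto
  have "AE \<omega> in M. (\<lambda>k. \<integral>\<^sup>+r\<in>{0..T}. ennreal ((norm (\<eta> k r \<omega> + \<eta>' k r \<omega> - (\<phi> r \<omega> + \<phi>' r \<omega>)))\<^sup>2) \<partial>lborel) \<longlonglongrightarrow> 0 \<and>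
        (\<forall>t\<in>Q. (\<lambda>k. J k t \<omega> + J' k t \<omega>) \<longlonglongrightarrow> I t \<omega> + I' t \<omega>)"
    using lim lim' AE_space
  proof eventually_elim
    case (elim \<omega>)
    define p where "p = (\<lambda>k r. indicat_real {0<..T} r *\<^sub>R (\<eta> k r \<omega> - \<phi> r \<omega>))"
    define p' where "p' = (\<lambda>k r. indicat_real {0<..T} r *\<^sub>R (\<eta>' k r \<omega> - \<phi>' r \<omega>))"
    have [measurable]: "p k \<in> borel_measurable borel" "p' k \<in> borel_measurable borel" for k
      unfolding p_def p'_def scaleR_diff_right
      using step_path_measurable[OF st T] step_path_measurable[OF st' T] progressive_path_ind[OF 1(2) T elim(3)] progressive_path_ind[OF 2(2) T elim(3)]
      by (auto intro!: borel_measurable_diff)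
    have le: "(\<integral>\<^sup>+r\<in>{0..T}. ennreal ((norm (\<eta> k r \<omega> + \<eta>' k r \<omega> - (\<phi> r \<omega> + \<phi>' r \<omega>)))\<^sup>2) \<partial>lborel)
      \<le> 2 * (\<integral>\<^sup>+r. ennreal ((norm (p k r))\<^sup>2) \<partial>lborel) + 2 * (\<integral>\<^sup>+r. ennreal ((norm (p' k r))\<^sup>2) \<partial>lborel)" for k
    proof -
      have "(\<integral>\<^sup>+r\<in>{0..T}. ennreal ((norm (\<eta> k r \<omega> + \<eta>' k r \<omega> - (\<phi> r \<omega> + \<phi>' r \<omega>)))\<^sup>2) \<partial>lborel)
        \<le> (\<integral>\<^sup>+r. 2 * ennreal ((norm (p k r))\<^sup>2) + 2 * ennreal ((norm (p' k r))\<^sup>2) \<partial>lborel)"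
        unfolding nn_integral_power2_half_open
      proof (rule nn_integral_mono)
        fix r
        have "indicat_real {0<..T} r *\<^sub>R (\<eta> k r \<omega> + \<eta>' k r \<omega> - (\<phi> r \<omega> + \<phi>' r \<omega>)) = p k r + p' k r"
          by (simp only: p_def p'_def add_diff_add scaleR_right_distrib)
        then have "ennreal ((norm (indicat_real {0<..T} r *\<^sub>R (\<eta> k r \<omega> + \<eta>' k r \<omega> - (\<phi> r \<omega> + \<phi>' r \<omega>))))\<^sup>2) = ennreal ((norm (p k r + p' k r))\<^sup>2)"
          by simp
        also have "\<dots> \<le> ennreal (2 * (norm (p k r))\<^sup>2 + 2 * (norm (p' k r))\<^sup>2)"
        proof (rule ennreal_leI)
          have "(norm (p k r + p' k r))\<^sup>2 \<le> (norm (p k r) + norm (p' k r))\<^sup>2" by (intro power_mono norm_triangle_ineq) auto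
          also have "\<dots> \<le> 2 * (norm (p k r))\<^sup>2 + 2 * (norm (p' k r))\<^sup>2"
            using zero_le_power2[of "norm (p k r) - norm (p' k r)"] by (simp add: power2_sum power2_diff)
          finally show "(norm (p k r + p' k r))\<^sup>2 \<le> 2 * (norm (p k r))\<^sup>2 + 2 * (norm (p' k r))\<^sup>2" .
        qed
        also have "\<dots> = 2 * ennreal ((norm (p k r))\<^sup>2) + 2 * ennreal ((norm (p' k r))\<^sup>2)"
          by (simp add: ennreal_plus ennreal_mult)
        finally show "ennreal ((norm (indicat_real {0<..T} r *\<^sub>R (\<eta> k r \<omega> + \<eta>' k r \<omega> - (\<phi> r \<omega> + \<phi>' r \<omega>))))\<^sup>2)
          \<le> 2 * ennreal ((norm (p k r))\<^sup>2) + 2 * ennreal ((norm (p' k r))\<^sup>2)" .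
      qed
      also have "\<dots> = 2 * (\<integral>\<^sup>+r. ennreal ((norm (p k r))\<^sup>2) \<partial>lborel) + 2 * (\<integral>\<^sup>+r. ennreal ((norm (p' k r))\<^sup>2) \<partial>lborel)"
        by (simp add: nn_integral_add nn_integral_cmult)
      finally show ?thesis .
    qed
    have l: "(\<lambda>k. \<integral>\<^sup>+r. ennreal ((norm (p k r))\<^sup>2) \<partial>lborel) \<longlonglongrightarrow> 0" "(\<lambda>k. \<integral>\<^sup>+r. ennreal ((norm (p' k r))\<^sup>2) \<partial>lborel) \<longlonglongrightarrow> 0"
      using elim(1,2) unfolding p_def p'_def nn_integral_power2_half_open by simp_all
    have "(\<lambda>k. 2 * (\<integral>\<^sup>+r. ennreal ((norm (p k r))\<^sup>2) \<partial>lborel) + 2 * (\<integral>\<^sup>+r. ennreal ((norm (p' k r))\<^sup>2) \<partial>lborel)) \<longlonglongrightarrow> 2 * 0 + 2 * 0"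
      by (intro tendsto_add ennreal_tendsto_cmult l) auto
    then have lim0: "(\<lambda>k. 2 * (\<integral>\<^sup>+r. ennreal ((norm (p k r))\<^sup>2) \<partial>lborel) + 2 * (\<integral>\<^sup>+r. ennreal ((norm (p' k r))\<^sup>2) \<partial>lborel)) \<longlonglongrightarrow> 0" by simp
    have "(\<lambda>k. \<integral>\<^sup>+r\<in>{0..T}. ennreal ((norm (\<eta> k r \<omega> + \<eta>' k r \<omega> - (\<phi> r \<omega> + \<phi>' r \<omega>)))\<^sup>2) \<partial>lborel) \<longlonglongrightarrow> 0"
      by (rule tendsto_sandwich[OF _ _ tendsto_const lim0]) (use le in auto)
    moreover have "(\<lambda>k. J k t \<omega> + J' k t \<omega>) \<longlonglongrightarrow> I t \<omega> + I' t \<omega>" if "t \<in> Q" for t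
      using elim(1,2) that by (intro tendsto_add) auto
    ultimately show ?case by blast
  qed
  moreover have "\<forall>k. step_integrand (\<lambda>r \<omega>. \<eta> k r \<omega> + \<eta>' k r \<omega>) (\<lambda>t \<omega>. J k t \<omega> + J' k t \<omega>)"
    by (intro allI step_add st st')
  ultimately show ?thesis unfolding ito_approx_def
    by (intro exI[of _ "\<lambda>k r \<omega>. \<eta> k r \<omega> + \<eta>' k r \<omega>"] exI[of _ "\<lambda>k t \<omega>. J k t \<omega> + J' k t \<omega>"] conjI)
qed

text \<open>Common core of scaling and of restriction to an interval: a bounded deterministic weight
  acts on integrands, and \<open>L\<close> is the operation it induces on integral processes.
  \<open>L\<close> may look at several times, hence the two sets \<open>Q\<close> and
  \<open>Q'\<close>.\<close>

lemma ito_approx_weight: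
  assumes 1: "ito_approx T Q \<phi> I" "progressive F T \<phi>" and T: "0 \<le> T" and w: "\<And>r. \<bar>w r\<bar> \<le> C"
    and step: "\<And>\<eta> J. step_integrand \<eta> J \<Longrightarrow> step_integrand (\<lambda>r \<omega>. w r *\<^sub>R \<eta> r \<omega>) (\<lambda>t \<omega>. L (\<lambda>s. J s \<omega>) t)"
    and L: "\<And>(x :: nat \<Rightarrow> real \<Rightarrow> real) y t. (\<And>s. s \<in> Q \<Longrightarrow> (\<lambda>k. x k s) \<longlonglongrightarrow> y s) \<Longrightarrow> t \<in> Q' \<Longrightarrow> (\<lambda>k. L (x k) t) \<longlonglongrightarrow> L y t"
  shows "ito_approx T Q' (\<lambda>r \<omega>. w r *\<^sub>R \<phi> r \<omega>) (\<lambda>t \<omega>. L (\<lambda>s. I s \<omega>) t)"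
proof -
  have C0: "0 \<le> C" using order_trans[OF abs_ge_zero w] .
  obtain \<eta> J where st: "\<And>k::nat. step_integrand (\<eta> k) (J k)"
    and lim: "AE \<omega> in M. (\<lambda>k. \<integral>\<^sup>+r\<in>{0..T}. ennreal ((norm (\<eta> k r \<omega> - \<phi> r \<omega>))\<^sup>2) \<partial>lborel) \<longlonglongrightarrow> 0 \<and>
        (\<forall>t\<in>Q. (\<lambda>k. J k t \<omega>) \<longlonglongrightarrow> I t \<omega>)"
    using 1(1) unfolding ito_approx_def by auto
  have "AE \<omega> in M. (\<lambda>k. \<integral>\<^sup>+r\<in>{0..T}. ennreal ((norm (w r *\<^sub>R \<eta> k r \<omega> - w r *\<^sub>R \<phi> r \<omega>))\<^sup>2) \<partial>lborel) \<longlonglongrightarrow> 0 \<and>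
        (\<forall>t\<in>Q'. (\<lambda>k. L (\<lambda>s. J k s \<omega>) t) \<longlonglongrightarrow> L (\<lambda>s. I s \<omega>) t)"
    using lim AE_space
  proof eventually_elim
    case (elim \<omega>)
    define p where "p = (\<lambda>k r. indicat_real {0<..T} r *\<^sub>R (\<eta> k r \<omega> - \<phi> r \<omega>))"
    have [measurable]: "p k \<in> borel_measurable borel" for k
      unfolding p_def scaleR_diff_right
      using step_path_measurable[OF st T] progressive_path_ind[OF 1(2) T elim(2)]
      by (auto intro!: borel_measurable_diff)
    have le: "(\<integral>\<^sup>+r\<in>{0..T}. ennreal ((norm (w r *\<^sub>R \<eta> k r \<omega> - w r *\<^sub>R \<phi> r \<omega>))\<^sup>2) \<partial>lborel)
      \<le> ennreal (C\<^sup>2) * (\<integral>\<^sup>+r. ennreal ((norm (p k r))\<^sup>2) \<partial>lborel)" for k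
    proof -
      have "(\<integral>\<^sup>+r\<in>{0..T}. ennreal ((norm (w r *\<^sub>R \<eta> k r \<omega> - w r *\<^sub>R \<phi> r \<omega>))\<^sup>2) \<partial>lborel)
        \<le> (\<integral>\<^sup>+r. ennreal (C\<^sup>2) * ennreal ((norm (p k r))\<^sup>2) \<partial>lborel)"
        unfolding nn_integral_power2_half_open
      proof (rule nn_integral_mono)
        fix r
        have "indicat_real {0<..T} r *\<^sub>R (w r *\<^sub>R \<eta> k r \<omega> - w r *\<^sub>R \<phi> r \<omega>) = w r *\<^sub>R p k r"
          by (simp add: p_def scaleR_diff_right mult.commute)
        then have "(norm (indicat_real {0<..T} r *\<^sub>R (w r *\<^sub>R \<eta> k r \<omega> - w r *\<^sub>R \<phi> r \<omega>)))\<^sup>2 = \<bar>w r\<bar>\<^sup>2 * (norm (p k r))\<^sup>2"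
          by (simp only: norm_scaleR power_mult_distrib)
        also have "\<dots> \<le> C\<^sup>2 * (norm (p k r))\<^sup>2" using w[of r] by (intro mult_right_mono power_mono) auto
        finally show "ennreal ((norm (indicat_real {0<..T} r *\<^sub>R (w r *\<^sub>R \<eta> k r \<omega> - w r *\<^sub>R \<phi> r \<omega>)))\<^sup>2)
          \<le> ennreal (C\<^sup>2) * ennreal ((norm (p k r))\<^sup>2)"
          by (simp only: ennreal_mult[symmetric] zero_le_power2 ennreal_leI)
      qed
      also have "\<dots> = ennreal (C\<^sup>2) * (\<integral>\<^sup>+r. ennreal ((norm (p k r))\<^sup>2) \<partial>lborel)"
        by (simp add: nn_integral_cmult)
      finally show ?thesis .
    qed
    have l: "(\<lambda>k. \<integral>\<^sup>+r. ennreal ((norm (p k r))\<^sup>2) \<partial>lborel) \<longlonglongrightarrow> 0"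
      using elim(1) unfolding p_def nn_integral_power2_half_open by simp
    have "(\<lambda>k. ennreal (C\<^sup>2) * (\<integral>\<^sup>+r. ennreal ((norm (p k r))\<^sup>2) \<partial>lborel)) \<longlonglongrightarrow> ennreal (C\<^sup>2) * 0"
      by (intro ennreal_tendsto_cmult l) auto
    then have lim0: "(\<lambda>k. ennreal (C\<^sup>2) * (\<integral>\<^sup>+r. ennreal ((norm (p k r))\<^sup>2) \<partial>lborel)) \<longlonglongrightarrow> 0" by simp
    have "(\<lambda>k. \<integral>\<^sup>+r\<in>{0..T}. ennreal ((norm (w r *\<^sub>R \<eta> k r \<omega> - w r *\<^sub>R \<phi> r \<omega>))\<^sup>2) \<partial>lborel) \<longlonglongrightarrow> 0"
      by (rule tendsto_sandwich[OF _ _ tendsto_const lim0]) (use le in auto)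
    moreover have "(\<lambda>k. L (\<lambda>s. J k s \<omega>) t) \<longlonglongrightarrow> L (\<lambda>s. I s \<omega>) t" if "t \<in> Q'" for t
      using elim(1) that by (intro L) auto
    ultimately show ?case by blast
  qed
  then show ?thesis unfolding ito_approx_def
    by (intro exI[of _ "\<lambda>k r \<omega>. w r *\<^sub>R \<eta> k r \<omega>"] exI[of _ "\<lambda>k t \<omega>. L (\<lambda>s. J k s \<omega>) t"])
       (simp add: step st)
qed

lemma ito_approx_restrict:
  assumes "ito_approx T Q \<phi> I" "progressive F T \<phi>" "0 \<le> T" and ab: "0 \<le> a" "a \<le> b"
    and Q': "\<And>t. t \<in> Q' \<Longrightarrow> min t a \<in> Q \<and> min t b \<in> Q"
  shows "ito_approx T Q' (\<lambda>r \<omega>. (c * indicator {a<..b} r) *\<^sub>R \<phi> r \<omega>) (\<lambda>t \<omega>. c * (I (min t b) \<omega> - I (min t a) \<omega>))"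
proof (rule ito_approx_weight[OF assms(1-3), where C="\<bar>c\<bar>" and L="\<lambda>x t. c * (x (min t b) - x (min t a))"])
  show "\<bar>c * indicat_real {a<..b} r\<bar> \<le> \<bar>c\<bar>" for r by (auto simp: indicator_def)
  show "step_integrand (\<lambda>r \<omega>. (c * indicat_real {a<..b} r) *\<^sub>R \<eta> r \<omega>) (\<lambda>t \<omega>. c * (J (min t b) \<omega> - J (min t a) \<omega>))"
    if "step_integrand \<eta> J" for \<eta> J
    by (rule step_restrict[OF that ab])
  fix x :: "nat \<Rightarrow> real \<Rightarrow> real" and y t
  assume lim: "\<And>s. s \<in> Q \<Longrightarrow> (\<lambda>k. x k s) \<longlonglongrightarrow> y s" and t: "t \<in> Q'"
  show "(\<lambda>k. c * (x k (min t b) - x k (min t a))) \<longlonglongrightarrow> c * (y (min t b) - y (min t a))"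
    by (intro tendsto_mult tendsto_const tendsto_diff lim) (simp_all add: Q'[OF t])
qed

lemma ito_approx_scale:
  assumes "ito_approx T Q \<phi> I" "progressive F T \<phi>" "0 \<le> T"
  shows "ito_approx T Q (\<lambda>r \<omega>. c *\<^sub>R \<phi> r \<omega>) (\<lambda>t \<omega>. c * I t \<omega>)"
proof (rule ito_approx_weight[OF assms, where C="\<bar>c\<bar>" and L="\<lambda>x t. c * x t"])
  show "step_integrand (\<lambda>r \<omega>. c *\<^sub>R \<eta> r \<omega>) (\<lambda>t \<omega>. c * J t \<omega>)" if "step_integrand \<eta> J" for \<eta> J
    by (rule step_scale[OF that])
  show "(\<lambda>k. c * x k t) \<longlonglongrightarrow> c * y t" if "\<And>s. s \<in> Q \<Longrightarrow> (\<lambda>k. x k s) \<longlonglongrightarrow> y s" "t \<in> Q" for x :: "nat \<Rightarrow> real \<Rightarrow> real" and y t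
    by (intro tendsto_mult tendsto_const that)
qed simp

lemma ito_approx_diff:
  assumes "ito_approx T Q \<phi> I" "progressive F T \<phi>" "ito_approx T Q \<phi>' I'" "progressive F T \<phi>'" "0 \<le> T"
  shows "ito_approx T Q (\<lambda>r \<omega>. \<phi> r \<omega> - \<phi>' r \<omega>) (\<lambda>t \<omega>. I t \<omega> - I' t \<omega>)"
proof -
  have "progressive F T (\<lambda>r \<omega>. (-1) *\<^sub>R \<phi>' r \<omega>)"
    by (rule progressive_scaleR[OF progressive_const assms(4)])
  from ito_approx_add[OF assms(1,2) ito_approx_scale[OF assms(3-5)] this assms(5)] show ?thesis by simp
qed

lemma ito_approx_zero: "ito_approx T Q (\<lambda>r \<omega>. 0) (\<lambda>t \<omega>. 0)"
  unfolding ito_approx_def by (intro exI[of _ "\<lambda>_ _ _. 0"]) (simp add: step_zero)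

lemma ito_approx_sum:
  assumes "finite A" "0 \<le> T" "\<And>i. i \<in> A \<Longrightarrow> ito_approx T Q (\<phi> i) (I i)" "\<And>i. i \<in> A \<Longrightarrow> progressive F T (\<phi> i)"
  shows "ito_approx T Q (\<lambda>r \<omega>. \<Sum>i\<in>A. \<phi> i r \<omega>) (\<lambda>t \<omega>. \<Sum>i\<in>A. I i t \<omega>)"
  using assms
proof (induction A rule: finite_induct)
  case (insert x A)
  have "ito_approx T Q (\<lambda>r \<omega>. \<phi> x r \<omega> + (\<Sum>i\<in>A. \<phi> i r \<omega>)) (\<lambda>t \<omega>. I x t \<omega> + (\<Sum>i\<in>A. I i t \<omega>))"
  proof (rule ito_approx_add)
    show "ito_approx T Q (\<lambda>r \<omega>. \<Sum>i\<in>A. \<phi> i r \<omega>) (\<lambda>t \<omega>. \<Sum>i\<in>A. I i t \<omega>)"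
      by (rule insert.IH) (simp_all add: insert.prems)
    show "progressive F T (\<lambda>r \<omega>. \<Sum>i\<in>A. \<phi> i r \<omega>)" by (rule progressive_sum) (simp add: insert.prems)
  qed (simp_all add: insert.prems)
  then show ?case using insert.hyps by simp
qed (simp add: ito_approx_zero)


text \<open>An Ito equation read only at the times in \<open>Q\<close>, each up to a null set. This
  is a common form for the coordinates of the lifted equation, for the truncated system, and for the
  Volterra equation, whose coefficients change with the terminal time and which is an Ito equation
  only when read at that time.\<close>

definition real_ito :: "real \<Rightarrow> real set \<Rightarrow> real \<Rightarrow> (real \<Rightarrow> 'w \<Rightarrow> real) \<Rightarrow> (real \<Rightarrow> 'w \<Rightarrow> real ^ 'd) \<Rightarrow> (real \<Rightarrow> 'w \<Rightarrow> real) \<Rightarrow> (real \<Rightarrow> 'w \<Rightarrow> real) \<Rightarrow> bool" where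
  "real_ito T Q z \<beta> \<phi> I Z \<longleftrightarrow> ito_approx T Q \<phi> I \<and> progressive F T \<phi> \<and>
     (AE \<omega> in M. energy (\<lambda>r \<omega>. ennreal ((norm (\<phi> r \<omega>))\<^sup>2)) T \<omega> < \<infinity>) \<and>
     (\<forall>t\<in>Q. I t \<in> borel_measurable M) \<and>
     (AE \<omega> in M. set_integrable lborel {0..T} (\<lambda>r. \<beta> r \<omega>)) \<and>
     (\<forall>t\<in>Q. AE \<omega> in M. Z t \<omega> = z + (LINT r:{0..t}|lborel. \<beta> r \<omega>) + I t \<omega>)"

lemma real_itoD:
  assumes "real_ito T Q z \<beta> \<phi> I Z"
  shows "ito_approx T Q \<phi> I" "progressive F T \<phi>"
    "AE \<omega> in M. energy (\<lambda>r \<omega>. ennreal ((norm (\<phi> r \<omega>))\<^sup>2)) T \<omega> < \<infinity>"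
    "t \<in> Q \<Longrightarrow> I t \<in> borel_measurable M"
    "AE \<omega> in M. set_integrable lborel {0..T} (\<lambda>r. \<beta> r \<omega>)"
    "t \<in> Q \<Longrightarrow> AE \<omega> in M. Z t \<omega> = z + (LINT r:{0..t}|lborel. \<beta> r \<omega>) + I t \<omega>"
  using assms by (simp_all add: real_ito_def)

lemma progressive_coord:
  fixes \<phi> :: "real \<Rightarrow> 'w \<Rightarrow> 'h::{real_inner, banach, second_countable_topology} ^ 'd"
  assumes "\<And>j. progressive F T (\<lambda>t \<omega>. \<phi> t \<omega> $ j)"
  shows "progressive F T (\<lambda>t \<omega>. coord h (\<phi> t \<omega>))"
proof (rule progressive_vec)
  fix j
  have "(\<lambda>x. inner x h) \<in> borel_measurable borel" by measurable
  from progressive_compose[OF assms[of j] this] show "progressive F T (\<lambda>t \<omega>. coord h (\<phi> t \<omega>) $ j)"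
    by (simp add: coord_def)
qed

lemma energy_coord_finite:
  fixes \<phi> :: "real \<Rightarrow> 'w \<Rightarrow> 'h::{real_inner, banach, second_countable_topology} ^ 'd"
  assumes i: "set_integrable lborel {0..T} (\<lambda>t. (norm (\<phi> t \<omega>))\<^sup>2)"
  shows "energy (\<lambda>r \<omega>. ennreal ((norm (coord h (\<phi> r \<omega>)))\<^sup>2)) T \<omega> < \<infinity>"
proof -
  have i2: "integrable lborel (\<lambda>r. indicator {0..T} r *\<^sub>R ((norm h)\<^sup>2 * (norm (\<phi> r \<omega>))\<^sup>2))"
    using set_integrable_mult_right[of "(norm h)\<^sup>2", OF i] by (simp add: set_integrable_def)
  have "energy (\<lambda>r \<omega>. ennreal ((norm (coord h (\<phi> r \<omega>)))\<^sup>2)) T \<omega>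
    \<le> (\<integral>\<^sup>+r. ennreal (indicator {0..T} r *\<^sub>R ((norm h)\<^sup>2 * (norm (\<phi> r \<omega>))\<^sup>2)) \<partial>lborel)"
    unfolding energy_def by (intro nn_integral_mono) (auto simp: indicator_def power2_norm_coord_le intro!: ennreal_leI)
  also have "\<dots> = ennreal (LINT r|lborel. indicator {0..T} r *\<^sub>R ((norm h)\<^sup>2 * (norm (\<phi> r \<omega>))\<^sup>2))"
    by (rule nn_integral_eq_integral[OF i2]) simp
  finally show ?thesis by (simp add: le_less_trans)
qed

lemma real_ito_integral:
  fixes \<phi> :: "real \<Rightarrow> 'w \<Rightarrow> 'h::{real_inner, banach, second_countable_topology} ^ 'd"
  assumes I: "ito_integral M F W T \<phi> I" and T: "0 \<le> T" and Q: "finite Q" "Q \<subseteq> {0..T}"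
    and b: "AE \<omega> in M. set_integrable lborel {0..T} (\<lambda>r. \<beta> r \<omega>)"
    and eq: "\<And>t. t \<in> Q \<Longrightarrow> AE \<omega> in M. Z t \<omega> = z + (LINT r:{0..t}|lborel. \<beta> r \<omega>) + inner (I t \<omega>) h"
  shows "real_ito T Q z \<beta> (\<lambda>r \<omega>. coord h (\<phi> r \<omega>)) (\<lambda>t \<omega>. inner (I t \<omega>) h) Z"
  unfolding real_ito_def
proof (intro conjI ballI)
  show "ito_approx T Q (\<lambda>r \<omega>. coord h (\<phi> r \<omega>)) (\<lambda>t \<omega>. inner (I t \<omega>) h)"
    by (rule ito_integral_approx[OF I Q T])
  show "progressive F T (\<lambda>r \<omega>. coord h (\<phi> r \<omega>))"
    by (rule progressive_coord) (use I in \<open>simp add: ito_integral_def\<close>)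
  have "AE \<omega> in M. set_integrable lborel {0..T} (\<lambda>t. (norm (\<phi> t \<omega>))\<^sup>2)" using I by (simp add: ito_integral_def)
  then show "AE \<omega> in M. energy (\<lambda>r \<omega>. ennreal ((norm (coord h (\<phi> r \<omega>)))\<^sup>2)) T \<omega> < \<infinity>"
    by eventually_elim (rule energy_coord_finite)
  fix t assume t: "t \<in> Q"
  have Ip: "progressive F T I" using I by (simp add: ito_integral_def continuous_process_def)
  have "I t \<in> borel_measurable M" using measurable_F_M[OF progressive_section[OF Ip subsetD[OF Q(2) t]]] .
  then show "(\<lambda>\<omega>. inner (I t \<omega>) h) \<in> borel_measurable M" by (intro borel_measurable_inner) auto
qed (use b eq in auto)

lemma set_integral_inner:
  fixes \<beta> :: "real \<Rightarrow> 'h::{real_inner, banach, second_countable_topology}"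
  assumes "set_integrable lborel A \<beta>"
  shows "set_integrable lborel A (\<lambda>r. inner (\<beta> r) h)" "(LINT r:A|lborel. inner (\<beta> r) h) = inner (LINT r:A|lborel. \<beta> r) h"
proof -
  have i: "integrable lborel (\<lambda>r. indicator A r *\<^sub>R \<beta> r)" using assms by (simp add: set_integrable_def)
  have i': "h \<noteq> 0 \<Longrightarrow> integrable lborel (\<lambda>r. indicator A r *\<^sub>R \<beta> r)" by (rule i)
  show "set_integrable lborel A (\<lambda>r. inner (\<beta> r) h)"
    using integrable_inner_left[OF i'] by (simp add: set_integrable_def)
  show "(LINT r:A|lborel. inner (\<beta> r) h) = inner (LINT r:A|lborel. \<beta> r) h"
    using integral_inner_left[OF i'] by (simp add: set_lebesgue_integral_def)
qed

text \<open>The integral process is chosen before \<open>Q\<close>: in the product rule the set of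
  times changes with the grid while the integral has to remain the same.\<close>

lemma real_ito_process:
  fixes X :: "real \<Rightarrow> 'w \<Rightarrow> 'h::{real_inner, banach, second_countable_topology}"
  assumes X: "ito_process M F W T x \<beta> \<phi> X" and T: "0 \<le> T"
  obtains I where "\<And>Q. finite Q \<Longrightarrow> Q \<subseteq> {0..T} \<Longrightarrow>
    real_ito T Q (inner x h) (\<lambda>r \<omega>. inner (\<beta> r \<omega>) h) (\<lambda>r \<omega>. coord h (\<phi> r \<omega>)) I (\<lambda>t \<omega>. inner (X t \<omega>) h)"
proof -
  have b: "AE \<omega> in M. set_integrable lborel {0..T} (\<lambda>r. \<beta> r \<omega>)" using X by (simp add: ito_process_def)
  obtain I where I: "ito_integral M F W T \<phi> I"
    and eq: "AE \<omega> in M. \<forall>t\<in>{0..T}. X t \<omega> = x + (LINT r:{0..t}|lborel. \<beta> r \<omega>) + I t \<omega>"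
    using X unfolding ito_process_def by auto
  have "real_ito T Q (inner x h) (\<lambda>r \<omega>. inner (\<beta> r \<omega>) h) (\<lambda>r \<omega>. coord h (\<phi> r \<omega>)) (\<lambda>t \<omega>. inner (I t \<omega>) h) (\<lambda>t \<omega>. inner (X t \<omega>) h)"
    if Q: "finite Q" "Q \<subseteq> {0..T}" for Q
  proof (rule real_ito_integral[OF I T Q])
    show "AE \<omega> in M. set_integrable lborel {0..T} (\<lambda>r. inner (\<beta> r \<omega>) h)"
      using b by eventually_elim (rule set_integral_inner)
    fix t assume "t \<in> Q"
    then have t: "t \<in> {0..T}" using Q by blast
    show "AE \<omega> in M. inner (X t \<omega>) h = inner x h + (LINT r:{0..t}|lborel. inner (\<beta> r \<omega>) h) + inner (I t \<omega>) h"
      using b eq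
    proof eventually_elim
      case (elim \<omega>)
      have "set_integrable lborel {0..t} (\<lambda>r. \<beta> r \<omega>)"
        by (rule set_integrable_subset[OF elim(1)]) (use t in auto)
      then show ?case using elim(2) t by (simp add: set_integral_inner inner_add_left)
    qed
  qed
  then show ?thesis by (rule that)
qed

lemma real_ito_diff:
  assumes 1: "real_ito T Q z \<beta> \<phi> I Z" and 2: "real_ito T Q z' \<beta>' \<phi>' I' Z'" and T: "0 \<le> T" and Q: "Q \<subseteq> {0..T}"
  shows "real_ito T Q (z - z') (\<lambda>r \<omega>. \<beta> r \<omega> - \<beta>' r \<omega>) (\<lambda>r \<omega>. \<phi> r \<omega> - \<phi>' r \<omega>) (\<lambda>t \<omega>. I t \<omega> - I' t \<omega>) (\<lambda>t \<omega>. Z t \<omega> - Z' t \<omega>)"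
  unfolding real_ito_def
proof (intro conjI ballI)
  note d1 = real_itoD[OF 1] and d2 = real_itoD[OF 2]
  show "ito_approx T Q (\<lambda>r \<omega>. \<phi> r \<omega> - \<phi>' r \<omega>) (\<lambda>t \<omega>. I t \<omega> - I' t \<omega>)"
    by (rule ito_approx_diff[OF d1(1,2) d2(1,2) T])
  show p: "progressive F T (\<lambda>r \<omega>. \<phi> r \<omega> - \<phi>' r \<omega>)" by (rule progressive_diff[OF d1(2) d2(2)])
  show "AE \<omega> in M. energy (\<lambda>r \<omega>. ennreal ((norm (\<phi> r \<omega> - \<phi>' r \<omega>))\<^sup>2)) T \<omega> < \<infinity>"
    using d1(3) d2(3) AE_space
  proof eventually_elim
    case (elim \<omega>)
    have sq: "progressive F T (\<lambda>r \<omega>. ennreal ((norm (f r \<omega>))\<^sup>2))" if "progressive F T f" for f :: "real \<Rightarrow> 'w \<Rightarrow> real ^ 'd"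
      by (rule progressive_compose[OF that]) measurable
    note pm = progressive_path_meas[OF sq[OF d1(2)] T elim(3)] progressive_path_meas[OF sq[OF d2(2)] T elim(3)]
    have c2: "path_meas T (\<lambda>r \<omega>. 2) \<omega>" by (simp add: path_meas_def)
    have "energy (\<lambda>r \<omega>. ennreal ((norm (\<phi> r \<omega> - \<phi>' r \<omega>))\<^sup>2)) T \<omega>
      \<le> energy (\<lambda>r \<omega>. 2 * ennreal ((norm (\<phi> r \<omega>))\<^sup>2) + 2 * ennreal ((norm (\<phi>' r \<omega>))\<^sup>2)) T \<omega>"
    proof (rule energy_mono_fun)
      fix r
      have "(norm (\<phi> r \<omega> - \<phi>' r \<omega>))\<^sup>2 \<le> (norm (\<phi> r \<omega>) + norm (\<phi>' r \<omega>))\<^sup>2"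
        by (intro power_mono norm_triangle_ineq4) auto
      also have "\<dots> \<le> 2 * (norm (\<phi> r \<omega>))\<^sup>2 + 2 * (norm (\<phi>' r \<omega>))\<^sup>2"
        using zero_le_power2[of "norm (\<phi> r \<omega>) - norm (\<phi>' r \<omega>)"] by (simp add: power2_sum power2_diff)
      finally have "ennreal ((norm (\<phi> r \<omega> - \<phi>' r \<omega>))\<^sup>2) \<le> ennreal (2 * (norm (\<phi> r \<omega>))\<^sup>2 + 2 * (norm (\<phi>' r \<omega>))\<^sup>2)"
        by (rule ennreal_leI)
      then show "ennreal ((norm (\<phi> r \<omega> - \<phi>' r \<omega>))\<^sup>2) \<le> 2 * ennreal ((norm (\<phi> r \<omega>))\<^sup>2) + 2 * ennreal ((norm (\<phi>' r \<omega>))\<^sup>2)"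
        by (simp add: ennreal_plus ennreal_mult)
    qed
    also have "\<dots> = 2 * energy (\<lambda>r \<omega>. ennreal ((norm (\<phi> r \<omega>))\<^sup>2)) T \<omega> + 2 * energy (\<lambda>r \<omega>. ennreal ((norm (\<phi>' r \<omega>))\<^sup>2)) T \<omega>"
      by (simp add: energy_add[OF path_meas_mult[OF c2 pm(1)] path_meas_mult[OF c2 pm(2)]] energy_cmult[OF pm(1)] energy_cmult[OF pm(2)])
    also have "\<dots> < \<infinity>" using elim(1,2) by (simp add: ennreal_mult_less_top)
    finally show ?case .
  qed
  show "AE \<omega> in M. set_integrable lborel {0..T} (\<lambda>r. \<beta> r \<omega> - \<beta>' r \<omega>)"
    using d1(5) d2(5) by eventually_elim (rule set_integral_diff(1))
  fix t assume t: "t \<in> Q"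
  show "(\<lambda>\<omega>. I t \<omega> - I' t \<omega>) \<in> borel_measurable M"
    by (rule borel_measurable_diff[OF d1(4)[OF t] d2(4)[OF t]])
  show "AE \<omega> in M. Z t \<omega> - Z' t \<omega> = z - z' + (LINT r:{0..t}|lborel. \<beta> r \<omega> - \<beta>' r \<omega>) + (I t \<omega> - I' t \<omega>)"
    using d1(5) d2(5) d1(6)[OF t] d2(6)[OF t]
  proof eventually_elim
    case (elim \<omega>)
    have "{0..t} \<subseteq> {0..T}" using t Q by auto
    then have "set_integrable lborel {0..t} (\<lambda>r. \<beta> r \<omega>)" "set_integrable lborel {0..t} (\<lambda>r. \<beta>' r \<omega>)"
      using set_integrable_subset[OF elim(1)] set_integrable_subset[OF elim(2)] by auto
    then show ?case using elim(3,4) by (simp add: set_integral_diff)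
  qed
qed

lemma real_ito_subset:
  assumes 1: "real_ito T Q z \<beta> \<phi> I Z" and S: "S \<le> T" "Q' \<subseteq> Q"
  shows "real_ito S Q' z \<beta> \<phi> I Z"
  unfolding real_ito_def
proof (intro conjI ballI)
  note d1 = real_itoD[OF 1]
  show "ito_approx S Q' \<phi> I" by (rule ito_approx_subset[OF d1(1) S])
  show "progressive F S \<phi>" by (rule progressive_mono[OF d1(2) S(1)])
  show "AE \<omega> in M. energy (\<lambda>r \<omega>. ennreal ((norm (\<phi> r \<omega>))\<^sup>2)) S \<omega> < \<infinity>"
    using d1(3) by eventually_elim (rule le_less_trans[OF energy_mono[OF S(1)]])
  show "AE \<omega> in M. set_integrable lborel {0..S} (\<lambda>r. \<beta> r \<omega>)"
    using d1(5) by eventually_elim (rule set_integrable_subset, use S in auto)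
  fix t assume "t \<in> Q'"
  then have t: "t \<in> Q" using S by blast
  show "I t \<in> borel_measurable M" by (rule d1(4)[OF t])
  show "AE \<omega> in M. Z t \<omega> = z + (LINT r:{0..t}|lborel. \<beta> r \<omega>) + I t \<omega>" by (rule d1(6)[OF t])
qed

section \<open>Second-moment estimates for finitely many Ito processes\<close>

lemma ennreal_sum3_square_le:
  "ennreal ((a + b + c)\<^sup>2) \<le> ennreal (3 * a\<^sup>2) + 3 * ennreal (b\<^sup>2) + 3 * ennreal (c\<^sup>2)"
proof -
  have "(a + b + c)\<^sup>2 \<le> 3 * a\<^sup>2 + 3 * b\<^sup>2 + 3 * c\<^sup>2"
    using zero_le_power2[of "a - b"] zero_le_power2[of "b - c"] zero_le_power2[of "a - c"]
    by (simp add: power2_eq_square algebra_simps)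
  then have "ennreal ((a + b + c)\<^sup>2) \<le> ennreal (3 * a\<^sup>2 + 3 * b\<^sup>2 + 3 * c\<^sup>2)" by (rule ennreal_leI)
  then show ?thesis by (simp add: ennreal_plus ennreal_mult)
qed

text \<open>A gate open at \<open>t\<close> is open at all earlier times, so the weight can be moved
  under the integral, where Cauchy-Schwarz applies.\<close>

lemma gate_drift_le:
  assumes b: "set_integrable lborel {0..T} \<beta>" and t: "t \<in> {0..T}"
  shows "gate K \<psi> t \<omega> * ennreal ((LINT r:{0..t}|lborel. \<beta> r)\<^sup>2)
    \<le> ennreal T * energy (\<lambda>r \<omega>. gate K \<psi> r \<omega> * ennreal ((\<beta> r)\<^sup>2)) T \<omega>"
proof (cases "gate K \<psi> t \<omega> = 0")
  case False
  then have g1: "gate K \<psi> r \<omega> = 1" if "r \<le> t" for r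
    using gate_mono[OF that, of K \<psi> \<omega>] by (auto simp: gate_def split: if_splits)
  have "set_integrable lborel {0..t} \<beta>" by (rule set_integrable_subset[OF b]) (use t in auto)
  then have "ennreal ((LINT r:{0..t}|lborel. \<beta> r)\<^sup>2) \<le> ennreal t * (\<integral>\<^sup>+r\<in>{0..t}. ennreal ((\<beta> r)\<^sup>2) \<partial>lborel)"
    using t by (intro set_integral_power2_le) auto
  also have "\<dots> \<le> ennreal T * energy (\<lambda>r \<omega>. gate K \<psi> r \<omega> * ennreal ((\<beta> r)\<^sup>2)) T \<omega>"
    unfolding energy_def
  proof (rule mult_mono)
    show "(\<integral>\<^sup>+r\<in>{0..t}. ennreal ((\<beta> r)\<^sup>2) \<partial>lborel) \<le> (\<integral>\<^sup>+r\<in>{0..T}. gate K \<psi> r \<omega> * ennreal ((\<beta> r)\<^sup>2) \<partial>lborel)"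
    proof (rule nn_integral_mono)
      fix r show "ennreal ((\<beta> r)\<^sup>2) * indicator {0..t} r \<le> gate K \<psi> r \<omega> * ennreal ((\<beta> r)\<^sup>2) * indicator {0..T} r"
        using t g1[of r] by (cases "r \<in> {0..t}") auto
    qed
  qed (use t in \<open>auto intro: ennreal_leI\<close>)
  finally show ?thesis using g1[of t] by simp
qed simp

text \<open>The square of three terms gives the factor 3, Cauchy-Schwarz for the drift a factor
  \<open>T\<close>, and \<open>ito_maximal\<close> a factor 8, hence 3T + 24. Drifts and
  volatilities are dominated by \<kappa> only after summation over \<open>A\<close>: this leaves
  room for Bessel's inequality and keeps the constant free of the number of processes.\<close>

lemma ito_estimate:
  assumes T: "0 \<le> T" and Q: "finite Q" "Q \<subseteq> {0..T}" and A: "finite A"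
    and Z: "\<And>k. k \<in> A \<Longrightarrow> real_ito T Q (z k) (\<beta> k) (\<phi> k) (I k) (Z k)"
    and \<kappa>: "progressive F T \<kappa>" and \<psi>: "progressive F T \<psi>"
    and b\<kappa>: "AE \<omega> in M. \<forall>r\<in>{0..T}. (\<Sum>k\<in>A. ennreal ((\<beta> k r \<omega>)\<^sup>2)) \<le> \<kappa> r \<omega>"
    and f\<kappa>: "AE \<omega> in M. \<forall>r\<in>{0..T}. (\<Sum>k\<in>A. ennreal ((norm (\<phi> k r \<omega>))\<^sup>2)) \<le> \<kappa> r \<omega>"
  shows "(\<integral>\<^sup>+\<omega>. (\<Sum>k\<in>A. SUP t\<in>Q. gate K \<psi> t \<omega> * ennreal ((Z k t \<omega>)\<^sup>2)) \<partial>M)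
    \<le> ennreal (3 * (\<Sum>k\<in>A. (z k)\<^sup>2)) + ennreal (3 * T + 24) * (\<integral>\<^sup>+\<omega>. energy (\<lambda>r \<omega>. gate K \<psi> r \<omega> * \<kappa> r \<omega>) T \<omega> \<partial>M)"
proof -
  define G where "G = energy (\<lambda>r \<omega>. gate K \<psi> r \<omega> * \<kappa> r \<omega>) T"
  note gp = progressive_gate[OF \<psi>, of K]
  have Gm[measurable]: "G \<in> borel_measurable M"
    unfolding G_def by (rule energy_measurableM[OF progressive_mult_ennreal[OF gp \<kappa>] T])
  define U where "U = (\<lambda>k \<omega>. SUP t\<in>Q. gate K \<psi> t \<omega> * ennreal ((I k t \<omega>)\<^sup>2))"
  have Um: "U k \<in> borel_measurable M" if k: "k \<in> A" for k
    unfolding U_def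
  proof (rule borel_measurable_SUP)
    fix t assume t: "t \<in> Q"
    have "gate K \<psi> t \<in> borel_measurable M"
      by (rule measurable_F_M[OF progressive_section[OF gp subsetD[OF Q(2) t]]])
    moreover have "(\<lambda>\<omega>. ennreal ((I k t \<omega>)\<^sup>2)) \<in> borel_measurable M"
      using real_itoD(4)[OF Z[OF k] t] by measurable
    ultimately show "(\<lambda>\<omega>. gate K \<psi> t \<omega> * ennreal ((I k t \<omega>)\<^sup>2)) \<in> borel_measurable M"
      by (rule borel_measurable_times_ennreal)
  qed (use Q in \<open>simp add: countable_finite\<close>)
  have bi: "AE \<omega> in M. \<forall>k\<in>A. set_integrable lborel {0..T} (\<lambda>r. \<beta> k r \<omega>)"
    using A real_itoD(5)[OF Z] by (simp add: AE_finite_all)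
  have eq: "AE \<omega> in M. \<forall>k\<in>A. \<forall>t\<in>Q. Z k t \<omega> = z k + (LINT r:{0..t}|lborel. \<beta> k r \<omega>) + I k t \<omega>"
    using A Q(1) real_itoD(6)[OF Z] by (simp add: AE_finite_all)
  have path: "AE \<omega> in M. (\<Sum>k\<in>A. SUP t\<in>Q. gate K \<psi> t \<omega> * ennreal ((Z k t \<omega>)\<^sup>2))
      \<le> ennreal (3 * (\<Sum>k\<in>A. (z k)\<^sup>2)) + ennreal (3 * T) * G \<omega> + 3 * (\<Sum>k\<in>A. U k \<omega>)"
    using bi eq b\<kappa> AE_space
  proof eventually_elim
    case (elim \<omega>)
    define b where "b = (\<lambda>k. energy (\<lambda>r \<omega>'. gate K \<psi> r \<omega>' * ennreal ((\<beta> k r \<omega>)\<^sup>2)) T \<omega>)"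
    have k1: "(SUP t\<in>Q. gate K \<psi> t \<omega> * ennreal ((Z k t \<omega>)\<^sup>2)) \<le> ennreal (3 * (z k)\<^sup>2) + ennreal (3 * T) * b k + 3 * U k \<omega>"
      if k: "k \<in> A" for k
    proof (rule SUP_least)
      fix t assume t: "t \<in> Q"
      then have t': "t \<in> {0..T}" using Q by blast
      let ?B = "LINT r:{0..t}|lborel. \<beta> k r \<omega>"
      have "Z k t \<omega> = z k + ?B + I k t \<omega>" using elim(2) k t by blast
      then have "gate K \<psi> t \<omega> * ennreal ((Z k t \<omega>)\<^sup>2)
        \<le> gate K \<psi> t \<omega> * (ennreal (3 * (z k)\<^sup>2) + 3 * ennreal (?B\<^sup>2) + 3 * ennreal ((I k t \<omega>)\<^sup>2))"
        using ennreal_sum3_square_le by (intro mult_left_mono) auto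
      also have "\<dots> = gate K \<psi> t \<omega> * ennreal (3 * (z k)\<^sup>2) + 3 * (gate K \<psi> t \<omega> * ennreal (?B\<^sup>2)) + 3 * (gate K \<psi> t \<omega> * ennreal ((I k t \<omega>)\<^sup>2))"
        by (simp add: distrib_left mult_ac)
      also have "\<dots> \<le> ennreal (3 * (z k)\<^sup>2) + 3 * (ennreal T * b k) + 3 * U k \<omega>"
      proof (intro add_mono mult_left_mono)
        show "gate K \<psi> t \<omega> * ennreal (3 * (z k)\<^sup>2) \<le> ennreal (3 * (z k)\<^sup>2)"
          using mult_right_mono[OF gate_le_1] by fastforce
        show "gate K \<psi> t \<omega> * ennreal (?B\<^sup>2) \<le> ennreal T * b k"
          unfolding b_def using elim(1) k t' by (intro gate_drift_le) auto
        show "gate K \<psi> t \<omega> * ennreal ((I k t \<omega>)\<^sup>2) \<le> U k \<omega>"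
          unfolding U_def by (rule SUP_upper[OF t])
      qed auto
      also have "3 * (ennreal T * b k) = ennreal (3 * T) * b k"
        using T by (simp add: ennreal_mult mult.assoc)
      finally show "gate K \<psi> t \<omega> * ennreal ((Z k t \<omega>)\<^sup>2) \<le> ennreal (3 * (z k)\<^sup>2) + ennreal (3 * T) * b k + 3 * U k \<omega>" .
    qed
    have "(\<Sum>k\<in>A. b k) = energy (\<lambda>r \<omega>'. \<Sum>k\<in>A. gate K \<psi> r \<omega>' * ennreal ((\<beta> k r \<omega>)\<^sup>2)) T \<omega>"
      unfolding b_def
    proof (rule energy_sum[symmetric])
      fix k assume k: "k \<in> A"
      have "(\<lambda>r. indicator {0..T} r *\<^sub>R \<beta> k r \<omega>) \<in> borel_measurable lborel"
        using elim(1) k unfolding set_integrable_def by (auto dest: borel_measurable_integrable)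
      then have "(\<lambda>r. ennreal ((indicator {0..T} r *\<^sub>R \<beta> k r \<omega>)\<^sup>2)) \<in> borel_measurable lborel"
        by (intro measurable_compose[OF _ measurable_ennreal] borel_measurable_power)
      also have "(\<lambda>r. ennreal ((indicator {0..T} r *\<^sub>R \<beta> k r \<omega>)\<^sup>2)) = (\<lambda>r. ennreal ((\<beta> k r \<omega>)\<^sup>2) * indicator {0..T} r)"
        by (auto simp: indicator_def)
      finally have "path_meas T (\<lambda>r \<omega>'. ennreal ((\<beta> k r \<omega>)\<^sup>2)) \<omega>" by (simp add: path_meas_def)
      then show "path_meas T (\<lambda>r \<omega>'. gate K \<psi> r \<omega>' * ennreal ((\<beta> k r \<omega>)\<^sup>2)) \<omega>"
        by (rule path_meas_mult[OF progressive_path_meas[OF gp T elim(4)]])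
    qed
    also have "\<dots> \<le> G \<omega>"
      unfolding G_def sum_distrib_left[symmetric]
      by (rule energy_mono_fun) (use elim(3) in \<open>auto intro: mult_left_mono\<close>)
    finally have bG: "(\<Sum>k\<in>A. b k) \<le> G \<omega>" .
    have "(\<Sum>k\<in>A. SUP t\<in>Q. gate K \<psi> t \<omega> * ennreal ((Z k t \<omega>)\<^sup>2))
      \<le> (\<Sum>k\<in>A. ennreal (3 * (z k)\<^sup>2) + ennreal (3 * T) * b k + 3 * U k \<omega>)"
      by (rule sum_mono) (rule k1)
    also have "\<dots> = (\<Sum>k\<in>A. ennreal (3 * (z k)\<^sup>2)) + ennreal (3 * T) * (\<Sum>k\<in>A. b k) + 3 * (\<Sum>k\<in>A. U k \<omega>)"
      by (simp add: sum.distrib sum_distrib_left)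
    also have "(\<Sum>k\<in>A. ennreal (3 * (z k)\<^sup>2)) = ennreal (3 * (\<Sum>k\<in>A. (z k)\<^sup>2))"
      unfolding sum_distrib_left by (rule sum_ennreal) simp
    also have "ennreal (3 * (\<Sum>k\<in>A. (z k)\<^sup>2)) + ennreal (3 * T) * (\<Sum>k\<in>A. b k) + 3 * (\<Sum>k\<in>A. U k \<omega>)
      \<le> ennreal (3 * (\<Sum>k\<in>A. (z k)\<^sup>2)) + ennreal (3 * T) * G \<omega> + 3 * (\<Sum>k\<in>A. U k \<omega>)"
      by (intro add_mono mult_left_mono bG order_refl) auto
    finally show ?case .
  qed
  have sq: "progressive F T (\<lambda>r \<omega>. ennreal ((norm (\<phi> k r \<omega>))\<^sup>2))" if "k \<in> A" for k
    by (rule progressive_compose[OF real_itoD(2)[OF Z[OF that]]]) measurable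
  have gsq: "progressive F T (\<lambda>r \<omega>. gate K \<psi> r \<omega> * ennreal ((norm (\<phi> k r \<omega>))\<^sup>2))" if "k \<in> A" for k
    by (rule progressive_mult_ennreal[OF gp sq[OF that]])
  have "(\<Sum>k\<in>A. \<integral>\<^sup>+\<omega>. U k \<omega> \<partial>M) \<le> (\<Sum>k\<in>A. 8 * (\<integral>\<^sup>+\<omega>. energy (\<lambda>r \<omega>. gate K \<psi> r \<omega> * ennreal ((norm (\<phi> k r \<omega>))\<^sup>2)) T \<omega> \<partial>M))"
    unfolding U_def energy_def
    by (intro sum_mono ito_maximal[OF T Q real_itoD(1)[OF Z] real_itoD(2)[OF Z] \<psi> real_itoD(3)[OF Z]])
  also have "\<dots> = 8 * (\<integral>\<^sup>+\<omega>. (\<Sum>k\<in>A. energy (\<lambda>r \<omega>. gate K \<psi> r \<omega> * ennreal ((norm (\<phi> k r \<omega>))\<^sup>2)) T \<omega>) \<partial>M)"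
    using energy_measurableM[OF gsq T] by (simp add: nn_integral_sum sum_distrib_left)
  also have "(\<integral>\<^sup>+\<omega>. (\<Sum>k\<in>A. energy (\<lambda>r \<omega>. gate K \<psi> r \<omega> * ennreal ((norm (\<phi> k r \<omega>))\<^sup>2)) T \<omega>) \<partial>M) \<le> (\<integral>\<^sup>+\<omega>. G \<omega> \<partial>M)"
  proof (rule nn_integral_mono_AE)
    show "AE \<omega> in M. (\<Sum>k\<in>A. energy (\<lambda>r \<omega>. gate K \<psi> r \<omega> * ennreal ((norm (\<phi> k r \<omega>))\<^sup>2)) T \<omega>) \<le> G \<omega>"
      using f\<kappa> AE_space
    proof eventually_elim
      case (elim \<omega>)
      have "(\<Sum>k\<in>A. energy (\<lambda>r \<omega>. gate K \<psi> r \<omega> * ennreal ((norm (\<phi> k r \<omega>))\<^sup>2)) T \<omega>)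
        = energy (\<lambda>r \<omega>. \<Sum>k\<in>A. gate K \<psi> r \<omega> * ennreal ((norm (\<phi> k r \<omega>))\<^sup>2)) T \<omega>"
        by (rule energy_sum[symmetric]) (rule progressive_path_meas[OF gsq T elim(2)])
      also have "\<dots> \<le> G \<omega>"
        unfolding G_def sum_distrib_left[symmetric]
        by (rule energy_mono_fun) (use elim(1) in \<open>auto intro: mult_left_mono\<close>)
      finally show ?case .
    qed
  qed
  finally have UG: "(\<Sum>k\<in>A. \<integral>\<^sup>+\<omega>. U k \<omega> \<partial>M) \<le> 8 * (\<integral>\<^sup>+\<omega>. G \<omega> \<partial>M)" by (simp add: mult_left_mono)
  have "(\<integral>\<^sup>+\<omega>. (\<Sum>k\<in>A. SUP t\<in>Q. gate K \<psi> t \<omega> * ennreal ((Z k t \<omega>)\<^sup>2)) \<partial>M)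
    \<le> (\<integral>\<^sup>+\<omega>. ennreal (3 * (\<Sum>k\<in>A. (z k)\<^sup>2)) + ennreal (3 * T) * G \<omega> + 3 * (\<Sum>k\<in>A. U k \<omega>) \<partial>M)"
    by (rule nn_integral_mono_AE[OF path])
  also have "\<dots> = ennreal (3 * (\<Sum>k\<in>A. (z k)\<^sup>2)) + ennreal (3 * T) * (\<integral>\<^sup>+\<omega>. G \<omega> \<partial>M) + 3 * (\<Sum>k\<in>A. \<integral>\<^sup>+\<omega>. U k \<omega> \<partial>M)"
    using Um by (simp add: nn_integral_add nn_integral_cmult nn_integral_sum emeasure_space_1)
  also have "\<dots> \<le> ennreal (3 * (\<Sum>k\<in>A. (z k)\<^sup>2)) + ennreal (3 * T) * (\<integral>\<^sup>+\<omega>. G \<omega> \<partial>M) + 3 * (8 * (\<integral>\<^sup>+\<omega>. G \<omega> \<partial>M))"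
    by (intro add_left_mono mult_left_mono UG) auto
  also have "\<dots> = ennreal (3 * (\<Sum>k\<in>A. (z k)\<^sup>2)) + ennreal (3 * T + 24) * (\<integral>\<^sup>+\<omega>. G \<omega> \<partial>M)"
    using T by (simp add: ennreal_plus distrib_right mult.assoc[symmetric] add.assoc)
  finally show ?thesis unfolding G_def .
qed

end

section \<open>The product rule with deterministic factors\<close>

lemma sum_by_parts:
  fixes v y :: "nat \<Rightarrow> real"
  shows "(\<Sum>i<n. v i * (y (Suc i) - y i)) = v n * y n - v 0 * y 0 - (\<Sum>i<n. y (Suc i) * (v (Suc i) - v i))"
  by (induction n) (simp_all add: algebra_simps)

text \<open>The modulus is the supremum of the oscillations of \<open>f\<close> over distances up to
  t/(n+1). A single null sequence bounds the error on all cells of the n-th grid at once.\<close>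

lemma uniform_modulus:
  fixes f :: "real \<Rightarrow> real"
  assumes f: "continuous_on {0..t} f" and t: "0 \<le> t"
  obtains \<mu> where "\<mu> \<longlonglongrightarrow> 0" "\<And>n. 0 \<le> \<mu> n"
    "\<And>n x y. x \<in> {0..t} \<Longrightarrow> y \<in> {0..t} \<Longrightarrow> \<bar>x - y\<bar> \<le> t * (1 / real (Suc n)) \<Longrightarrow> \<bar>f x - f y\<bar> \<le> \<mu> n"
proof -
  define D where "D = (\<lambda>n. (\<lambda>(x, y). \<bar>f x - f y\<bar>) ` {(x, y). x \<in> {0..t} \<and> y \<in> {0..t} \<and> \<bar>x - y\<bar> \<le> t * (1 / real (Suc n))})"
  define \<mu> where "\<mu> = (\<lambda>n. Sup (D n))"
  obtain C where C: "\<forall>r\<in>{0..t}. \<bar>f r\<bar> \<le> C"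
    using compact_imp_bounded[OF compact_continuous_image[OF f]] by (auto simp: bounded_iff)
  have bdd: "bdd_above (D n)" for n
  proof (rule bdd_aboveI[of _ "C + C"])
    fix z assume "z \<in> D n"
    then obtain x y where "x \<in> {0..t}" "y \<in> {0..t}" "z = \<bar>f x - f y\<bar>" by (auto simp: D_def)
    with C[rule_format, of x] C[rule_format, of y] show "z \<le> C + C" by linarith
  qed
  have D0: "0 \<in> D n" for n
    unfolding D_def using t by (intro image_eqI[of _ _ "(0, 0)"]) auto
  have up: "\<bar>f x - f y\<bar> \<le> \<mu> n" if "x \<in> {0..t}" "y \<in> {0..t}" "\<bar>x - y\<bar> \<le> t * (1 / real (Suc n))" for n x y
    unfolding \<mu>_def by (rule cSup_upper[OF _ bdd]) (unfold D_def, rule image_eqI[of _ _ "(x, y)"], use that in auto)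
  have nn: "0 \<le> \<mu> n" for n unfolding \<mu>_def by (rule cSup_upper[OF D0 bdd])
  have "\<mu> \<longlonglongrightarrow> 0"
  proof (rule LIMSEQ_I)
    fix \<epsilon> :: real assume e: "0 < \<epsilon>"
    have "uniformly_continuous_on {0..t} f" using compact_uniformly_continuous[OF f] by simp
    then obtain \<delta> where d: "0 < \<delta>" "\<And>x y. x \<in> {0..t} \<Longrightarrow> y \<in> {0..t} \<Longrightarrow> dist x y < \<delta> \<Longrightarrow> dist (f x) (f y) < \<epsilon> / 2"
      using e unfolding uniformly_continuous_on_def by (metis half_gt_zero)
    have "(\<lambda>n. t * (1 / real (Suc n))) \<longlonglongrightarrow> t * 0"
      by (intro tendsto_intros LIMSEQ_Suc[OF lim_1_over_n])
    then have "eventually (\<lambda>n. t * (1 / real (Suc n)) < \<delta>) sequentially"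
      using order_tendstoD(2)[of _ "t * 0" sequentially \<delta>] d(1) by simp
    then obtain N where N: "\<And>n. n \<ge> N \<Longrightarrow> t * (1 / real (Suc n)) < \<delta>"
      by (auto simp: eventually_sequentially)
    have "\<mu> n \<le> \<epsilon> / 2" if n: "n \<ge> N" for n
      unfolding \<mu>_def
    proof (rule cSup_least)
      show "D n \<noteq> {}" using D0 by blast
      fix z assume "z \<in> D n"
      then obtain x y where xy: "x \<in> {0..t}" "y \<in> {0..t}" "\<bar>x - y\<bar> \<le> t * (1 / real (Suc n))" "z = \<bar>f x - f y\<bar>"
        by (auto simp: D_def)
      have "dist x y < \<delta>" unfolding dist_real_def using le_less_trans[OF xy(3) N[OF n]] .
      from d(2)[OF xy(1,2) this] show "z \<le> \<epsilon> / 2" unfolding xy(4) dist_real_def by simp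
    qed
    then show "\<exists>N. \<forall>n\<ge>N. norm (\<mu> n - 0) < \<epsilon>"
      using nn e by (intro exI[of _ N] allI impI) (fastforce simp: abs_of_nonneg)
  qed
  then show ?thesis using nn up by (rule that)
qed

context brownian
begin

lemma ito_approx_at_0:
  assumes "ito_approx T Q \<phi> I" "0 \<in> Q" shows "AE \<omega> in M. I 0 \<omega> = 0"
proof -
  obtain \<eta> J where st: "\<And>k::nat. step_integrand (\<eta> k) (J k)"
    and lim: "AE \<omega> in M. (\<lambda>k. \<integral>\<^sup>+r\<in>{0..T}. ennreal ((norm (\<eta> k r \<omega> - \<phi> r \<omega>))\<^sup>2) \<partial>lborel) \<longlonglongrightarrow> 0 \<and>
        (\<forall>t\<in>Q. (\<lambda>k. J k t \<omega>) \<longlonglongrightarrow> I t \<omega>)"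
    using assms(1) unfolding ito_approx_def by auto
  from lim show ?thesis
  proof eventually_elim
    case (elim \<omega>)
    have "J k 0 \<omega> = 0" for k using st[of k] by (auto simp: step_integrand_def)
    then have "(\<lambda>k. 0) \<longlonglongrightarrow> I 0 \<omega>" using elim assms(2) by force
    then show ?case by (simp add: LIMSEQ_const_iff)
  qed
qed

text \<open>No cross variation appears because the \<open>v k\<close> have finite variation: summation by parts on a
  uniform grid leaves a Riemann--Stieltjes sum and the stochastic integral of $v - v^{(n)}$, where
  $v^{(n)}$ is piecewise constant; the latter vanishes by \<open>ito_maximal\<close>.\<close>

lemma ito_product_rule:
  fixes v w :: "'k \<Rightarrow> real \<Rightarrow> real"
  assumes T: "0 \<le> T" and A: "finite A"
    and v: "\<And>k. k \<in> A \<Longrightarrow> continuous_on {0..T} (v k)"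
    and w: "\<And>k. k \<in> A \<Longrightarrow> set_integrable lborel {0..T} (w k)"
    and vw: "\<And>k s u. k \<in> A \<Longrightarrow> 0 \<le> s \<Longrightarrow> s \<le> u \<Longrightarrow> u \<le> T \<Longrightarrow> v k u - v k s = (LINT r:{s..u}|lborel. w k r)"
    and Y: "\<And>k Q. k \<in> A \<Longrightarrow> finite Q \<Longrightarrow> Q \<subseteq> {0..T} \<Longrightarrow> real_ito T Q (z k) (\<beta> k) (\<phi> k) (I k) (Y k)"
    and Yc: "\<And>k. k \<in> A \<Longrightarrow> AE \<omega> in M. continuous_on {0..T} (\<lambda>t. Y k t \<omega>)"
    and Y0: "\<And>Q. finite Q \<Longrightarrow> Q \<subseteq> {0..T} \<Longrightarrow> real_ito T Q z0
        (\<lambda>r \<omega>. (\<Sum>k\<in>A. w k r * Y k r \<omega>) + (\<Sum>k\<in>A. v k r * \<beta> k r \<omega>))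
        (\<lambda>r \<omega>. \<Sum>k\<in>A. v k r *\<^sub>R \<phi> k r \<omega>) I0 Y0"
    and t: "t \<in> {0..T}"
  shows "AE \<omega> in M. Y0 t \<omega> = z0 - (\<Sum>k\<in>A. v k 0 * z k) + (\<Sum>k\<in>A. v k t * Y k t \<omega>)"
proof -
  have t0: "0 \<le> t" "t \<le> T" using t by auto
  define s where "s = (\<lambda>n i. real i * t / real (Suc n))"
  have s0: "s n 0 = 0" and sn: "s n (Suc n) = t" for n by (simp_all add: s_def)
  have s_Suc: "s n i \<le> s n (Suc i)" for n i
    using t0 by (simp add: s_def divide_right_mono mult_right_mono)
  have s_mono: "s n i \<le> s n j" if "i \<le> j" for n i j
    by (rule lift_Suc_mono_le[of "s n", OF s_Suc that])
  have s_in: "s n i \<in> {0..t}" if "i \<le> Suc n" for n i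
    using s_mono[of 0 i n] s_mono[OF that, of n] by (simp add: s0 sn)
  define Q where "Q = (\<lambda>n. s n ` {..Suc n})"
  have Q: "finite (Q n)" "Q n \<subseteq> {0..t}" "0 \<in> Q n" "t \<in> Q n" "s n i \<in> Q n" if "i \<le> Suc n" for n i
  proof -
    show "Q n \<subseteq> {0..t}" using s_in by (auto simp: Q_def)
    show "0 \<in> Q n" unfolding Q_def by (rule image_eqI[where f="s n" and x=0, OF s0[symmetric]]) simp
    show "t \<in> Q n" unfolding Q_def by (rule image_eqI[where f="s n" and x="Suc n", OF sn[symmetric]]) simp
    show "s n i \<in> Q n" unfolding Q_def by (rule imageI) (use that in simp)
  qed (simp add: Q_def)
  have QT: "Q n \<subseteq> {0..T}" for n using Q(2)[of 0 n] t0 by auto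
  have fQ: "finite (Q n)" for n by (simp add: Q_def)
  note Yn = Y[OF _ fQ QT] and Y0n = Y0[OF fQ QT]
  have I0m: "I0 t \<in> borel_measurable M" using real_itoD(4)[OF Y0n Q(4)[of 0]] by simp
  have Im: "I k (s n i) \<in> borel_measurable M" if "k \<in> A" "i \<le> Suc n" for k n i
    using real_itoD(4)[OF Yn[OF that(1)] Q(5)[OF that(2)]] .
  have \<phi>p: "progressive F t (\<phi> k)" if "k \<in> A" for k
    using progressive_mono[OF real_itoD(2)[OF Yn[OF that]] t0(2)] .
  \<comment> \<open>The energy that drives the gate: no moments of the integrands are assumed, only
    almost surely finite energy.\<close>
  define \<psi> where "\<psi> = (\<lambda>r \<omega>. \<Sum>k\<in>A. ennreal ((norm (\<phi> k r \<omega>))\<^sup>2))"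
  have sq: "progressive F t (\<lambda>r \<omega>. ennreal ((norm (\<phi> k r \<omega>))\<^sup>2))" if "k \<in> A" for k
    by (rule progressive_compose[OF \<phi>p[OF that]]) measurable
  have \<psi>: "progressive F t \<psi>" unfolding \<psi>_def by (rule progressive_sum[OF sq])
  have fin: "AE \<omega> in M. energy \<psi> t \<omega> < \<infinity>"
  proof -
    have "AE \<omega> in M. \<forall>k\<in>A. energy (\<lambda>r \<omega>. ennreal ((norm (\<phi> k r \<omega>))\<^sup>2)) T \<omega> < \<infinity>"
      using A real_itoD(3)[OF Yn] by (simp add: AE_finite_all)
    then show ?thesis using AE_space
    proof eventually_elim
      case (elim \<omega>)
      have "energy \<psi> t \<omega> = (\<Sum>k\<in>A. energy (\<lambda>r \<omega>. ennreal ((norm (\<phi> k r \<omega>))\<^sup>2)) t \<omega>)"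
        unfolding \<psi>_def by (rule energy_sum) (rule progressive_path_meas[OF sq t0(1) elim(2)])
      also have "\<dots> < \<infinity>"
        using elim(1) A by (auto intro: le_less_trans[OF energy_mono[OF t0(2)]])
      finally show ?case .
    qed
  qed
  \<comment> \<open>\<open>\<theta> n\<close> is what remains of the integrand after each
    \<open>v k\<close> is replaced by its value at the left end of the cell; \<open>R n\<close> is
    the corresponding integral up to \<open>t\<close>, a finite expression in values of the given
    integrals.\<close>
  define \<theta> where "\<theta> = (\<lambda>n r \<omega>. (\<Sum>k\<in>A. v k r *\<^sub>R \<phi> k r \<omega>) - (\<Sum>k\<in>A. \<Sum>i<Suc n. (v k (s n i) * indicator {s n i<..s n (Suc i)} r) *\<^sub>R \<phi> k r \<omega>))"
  define R where "R = (\<lambda>n \<omega>. I0 t \<omega> - (\<Sum>k\<in>A. \<Sum>i<Suc n. v k (s n i) * (I k (s n (Suc i)) \<omega> - I k (s n i) \<omega>)))"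
  have Rm[measurable]: "R n \<in> borel_measurable M" for n
    unfolding R_def using Im by (intro borel_measurable_diff I0m borel_measurable_sum borel_measurable_times borel_measurable_const) auto
  have tp: "progressive F t (\<lambda>r \<omega>. (c * indicator {a<..b} r) *\<^sub>R \<phi> k r \<omega>)" if "k \<in> A" for a b c k
    by (rule progressive_scaleR[OF progressive_borel \<phi>p[OF that]]) measurable
  have vp: "progressive F t (\<lambda>r \<omega>. \<Sum>k\<in>A. v k r *\<^sub>R \<phi> k r \<omega>)"
    using progressive_mono[OF real_itoD(2)[OF Y0n] t0(2)] .
  have \<theta>p: "progressive F t (\<theta> n)" for n
    unfolding \<theta>_def by (intro progressive_diff vp progressive_sum tp)
  have ap: "ito_approx t {t} (\<theta> n) (\<lambda>_. R n)" for n
  proof -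
    have "ito_approx t {t} (\<lambda>r \<omega>. \<Sum>k\<in>A. \<Sum>i<Suc n. (v k (s n i) * indicator {s n i<..s n (Suc i)} r) *\<^sub>R \<phi> k r \<omega>)
       (\<lambda>u \<omega>. \<Sum>k\<in>A. \<Sum>i<Suc n. v k (s n i) * (I k (min u (s n (Suc i))) \<omega> - I k (min u (s n i)) \<omega>))"
    proof (intro ito_approx_sum A t0(1) finite_lessThan progressive_sum tp)
      fix k i assume k: "k \<in> A" and i: "i \<in> {..<Suc n}"
      show "ito_approx t {t} (\<lambda>r \<omega>. (v k (s n i) * indicat_real {s n i<..s n (Suc i)} r) *\<^sub>R \<phi> k r \<omega>)
          (\<lambda>u \<omega>. v k (s n i) * (I k (min u (s n (Suc i))) \<omega> - I k (min u (s n i)) \<omega>))"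
      proof (rule ito_approx_restrict[OF ito_approx_subset[OF real_itoD(1)[OF Yn[OF k]] t0(2) order_refl] \<phi>p[OF k] t0(1) _ s_Suc])
        show "0 \<le> s n i" using s_in[of i n] i by simp
        fix u assume "u \<in> {t}"
        then have "min u (s n i) = s n i" "min u (s n (Suc i)) = s n (Suc i)"
          using s_in[of i n] s_in[of "Suc i" n] i by auto
        then show "min u (s n i) \<in> Q n \<and> min u (s n (Suc i)) \<in> Q n"
          using Q(5)[of i n] Q(5)[of "Suc i" n] i by simp
      qed
    qed
    moreover have "ito_approx t {t} (\<lambda>r \<omega>. \<Sum>k\<in>A. v k r *\<^sub>R \<phi> k r \<omega>) I0"
      by (rule ito_approx_subset[OF real_itoD(1)[OF Y0n[of n]] t0(2)]) (use Q(4)[of 0 n] in simp)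
    ultimately have "ito_approx t {t} (\<theta> n) (\<lambda>u \<omega>. I0 u \<omega> - (\<Sum>k\<in>A. \<Sum>i<Suc n. v k (s n i) * (I k (min u (s n (Suc i))) \<omega> - I k (min u (s n i)) \<omega>)))"
      unfolding \<theta>_def by (intro ito_approx_diff t0(1) vp progressive_sum tp)
    moreover have "(I0 t \<omega> - (\<Sum>k\<in>A. \<Sum>i<Suc n. v k (s n i) * (I k (min t (s n (Suc i))) \<omega> - I k (min t (s n i)) \<omega>))) = R n \<omega>" for \<omega>
      unfolding R_def
    proof (intro arg_cong2[where f="(-)"] sum.cong refl)
      fix k i assume "i \<in> {..<Suc n}"
      then have "min t (s n i) = s n i" "min t (s n (Suc i)) = s n (Suc i)"
        using s_in[of i n] s_in[of "Suc i" n] by auto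
      then show "v k (s n i) * (I k (min t (s n (Suc i))) \<omega> - I k (min t (s n i)) \<omega>) = v k (s n i) * (I k (s n (Suc i)) \<omega> - I k (s n i) \<omega>)"
        by simp
    qed
    ultimately show ?thesis unfolding ito_approx_def by (simp del: sum.lessThan_Suc)
  qed
  have "\<forall>k\<in>A. \<exists>\<mu>. \<mu> \<longlonglongrightarrow> 0 \<and> (\<forall>n. 0 \<le> \<mu> n) \<and> (\<forall>n. \<forall>x\<in>{0..t}. \<forall>y\<in>{0..t}. \<bar>x - y\<bar> \<le> t * (1 / real (Suc n)) \<longrightarrow> \<bar>v k x - v k y\<bar> \<le> \<mu> n)"
  proof
    fix k assume k: "k \<in> A"
    have c: "continuous_on {0..t} (v k)" by (rule continuous_on_subset[OF v[OF k]]) (use t0 in auto)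
    show "\<exists>\<mu>. \<mu> \<longlonglongrightarrow> 0 \<and> (\<forall>n. 0 \<le> \<mu> n) \<and> (\<forall>n. \<forall>x\<in>{0..t}. \<forall>y\<in>{0..t}. \<bar>x - y\<bar> \<le> t * (1 / real (Suc n)) \<longrightarrow> \<bar>v k x - v k y\<bar> \<le> \<mu> n)"
      by (rule uniform_modulus[OF c t0(1)]) (intro exI conjI allI ballI impI, assumption+)
  qed
  from bchoice[OF this] obtain m where
    m': "\<forall>k\<in>A. m k \<longlonglongrightarrow> 0 \<and> (\<forall>n. 0 \<le> m k n) \<and> (\<forall>n. \<forall>x\<in>{0..t}. \<forall>y\<in>{0..t}. \<bar>x - y\<bar> \<le> t * (1 / real (Suc n)) \<longrightarrow> \<bar>v k x - v k y\<bar> \<le> m k n)" ..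
  have m: "m k \<longlonglongrightarrow> 0" "0 \<le> m k n"
    "x \<in> {0..t} \<Longrightarrow> y \<in> {0..t} \<Longrightarrow> \<bar>x - y\<bar> \<le> t * (1 / real (Suc n)) \<Longrightarrow> \<bar>v k x - v k y\<bar> \<le> m k n" if "k \<in> A" for k n x y
    using m'[rule_format, OF that] by blast+
  define \<mu> where "\<mu> = (\<lambda>n. \<Sum>k\<in>A. m k n)"
  have \<mu>1: "\<mu> \<longlonglongrightarrow> 0"
    unfolding \<mu>_def using tendsto_sum[of A "\<lambda>k n. m k n" "\<lambda>_. 0" sequentially] m(1) by simp
  have \<mu>2: "\<bar>v k r - v k (s n i)\<bar> \<le> \<mu> n" if k: "k \<in> A" and i: "i \<le> n" and r: "s n i < r" "r \<le> s n (Suc i)" for n k r i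
  proof -
    have in1: "s n i \<in> {0..t}" "s n (Suc i) \<in> {0..t}" using s_in[of i n] s_in[of "Suc i" n] i by auto
    have "s n (Suc i) = s n i + t * (1 / real (Suc n))"
      unfolding s_def of_nat_Suc[of i] distrib_right add_divide_distrib by simp
    then have "\<bar>r - s n i\<bar> \<le> t * (1 / real (Suc n))" using r unfolding abs_le_iff by (simp only:) linarith
    moreover have "r \<in> {0..t}" using in1 r by simp
    ultimately have "\<bar>v k r - v k (s n i)\<bar> \<le> m k n" using in1(1) by (intro m(3)[OF k])
    also have "\<dots> \<le> \<mu> n" unfolding \<mu>_def by (rule member_le_sum[OF k]) (use m(2) A in auto)
    finally show ?thesis .
  qed
  have \<mu>3: "0 \<le> \<mu> n" for n unfolding \<mu>_def by (intro sum_nonneg m(2))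
  note \<mu> = \<mu>1 \<mu>2 \<mu>3
  \<comment> \<open>Each weight is off by at most \<open>\<mu> n\<close>; Cauchy-Schwarz over
    \<open>A\<close> costs its cardinality.\<close>
  have \<theta>_le: "ennreal ((norm (\<theta> n r \<omega>))\<^sup>2) \<le> ennreal ((\<mu> n)\<^sup>2 * real (card A)) * \<psi> r \<omega>" if r: "r \<in> {0<..t}" for n r \<omega>
  proof -
    have ex: "\<exists>i\<le>n. s n i < r \<and> r \<le> s n (Suc i)"
    proof -
      define i where "i = (LEAST i. r \<le> s n (Suc i))"
      have *: "r \<le> s n (Suc n)" using r by (simp add: sn)
      have 1: "r \<le> s n (Suc i)" unfolding i_def by (rule LeastI[of "\<lambda>i. r \<le> s n (Suc i)", OF *])
      have 2: "i \<le> n" unfolding i_def by (rule Least_le[of "\<lambda>i. r \<le> s n (Suc i)", OF *])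
      have "s n i < r"
      proof (cases i)
        case 0
        then show ?thesis using r by (simp add: s0)
      next
        case (Suc j)
        have "\<not> r \<le> s n (Suc j)" using not_less_Least[of j "\<lambda>i. r \<le> s n (Suc i)"] Suc by (simp add: i_def)
        then show ?thesis using Suc by simp
      qed
      then show ?thesis using 1 2 by blast
    qed
    then obtain i where i: "i \<le> n" "s n i < r" "r \<le> s n (Suc i)" by blast
    have ind: "indicat_real {s n j<..s n (Suc j)} r = (if j = i then 1 else 0)" for j
    proof (cases j i rule: linorder_cases)
      case less
      then have "s n (Suc j) \<le> s n i" by (intro s_mono) simp
      then show ?thesis using less i by simp
    next
      case greater
      then have "s n (Suc i) \<le> s n j" by (intro s_mono) simp
      then show ?thesis using greater i by simp
    qed (use i in simp)
    have "(\<Sum>j<Suc n. (v k (s n j) * indicat_real {s n j<..s n (Suc j)} r) *\<^sub>R \<phi> k r \<omega>) = v k (s n i) *\<^sub>R \<phi> k r \<omega>" for k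
    proof -
      have "(\<Sum>j<Suc n. (v k (s n j) * indicat_real {s n j<..s n (Suc j)} r) *\<^sub>R \<phi> k r \<omega>) = (\<Sum>j<Suc n. if j = i then v k (s n i) *\<^sub>R \<phi> k r \<omega> else 0)"
        by (intro sum.cong refl) (simp add: ind)
      also have "\<dots> = v k (s n i) *\<^sub>R \<phi> k r \<omega>" using i by (subst sum.delta) auto
      finally show ?thesis .
    qed
    then have "\<theta> n r \<omega> = (\<Sum>k\<in>A. (v k r - v k (s n i)) *\<^sub>R \<phi> k r \<omega>)"
      by (simp add: \<theta>_def sum_subtractf scaleR_diff_left)
    also have "norm \<dots> \<le> (\<Sum>k\<in>A. \<mu> n * norm (\<phi> k r \<omega>))"
      by (rule sum_norm_le) (use \<mu>(2)[OF _ i] in \<open>auto intro: mult_right_mono\<close>)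
    finally have "norm (\<theta> n r \<omega>) \<le> \<mu> n * (\<Sum>k\<in>A. norm (\<phi> k r \<omega>))" by (simp add: sum_distrib_left)
    then have "(norm (\<theta> n r \<omega>))\<^sup>2 \<le> (\<mu> n * (\<Sum>k\<in>A. norm (\<phi> k r \<omega>)))\<^sup>2" by (rule power_mono) simp
    also have "\<dots> = (\<mu> n)\<^sup>2 * (\<Sum>k\<in>A. 1 * norm (\<phi> k r \<omega>))\<^sup>2" by (simp add: power_mult_distrib)
    also have "\<dots> \<le> (\<mu> n)\<^sup>2 * ((\<Sum>k\<in>A. 1\<^sup>2) * (\<Sum>k\<in>A. (norm (\<phi> k r \<omega>))\<^sup>2))"
      by (intro mult_left_mono Cauchy_Schwarz_ineq_sum) auto
    finally have "(norm (\<theta> n r \<omega>))\<^sup>2 \<le> ((\<mu> n)\<^sup>2 * real (card A)) * (\<Sum>k\<in>A. (norm (\<phi> k r \<omega>))\<^sup>2)" by (simp add: mult.assoc)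
    then have "ennreal ((norm (\<theta> n r \<omega>))\<^sup>2) \<le> ennreal (((\<mu> n)\<^sup>2 * real (card A)) * (\<Sum>k\<in>A. (norm (\<phi> k r \<omega>))\<^sup>2))" by (rule ennreal_leI)
    also have "\<dots> = ennreal ((\<mu> n)\<^sup>2 * real (card A)) * ennreal (\<Sum>k\<in>A. (norm (\<phi> k r \<omega>))\<^sup>2)"
      by (rule ennreal_mult) (auto intro: sum_nonneg)
    also have "ennreal (\<Sum>k\<in>A. (norm (\<phi> k r \<omega>))\<^sup>2) = \<psi> r \<omega>" unfolding \<psi>_def by (rule sum_ennreal[symmetric]) simp
    finally show ?thesis .
  qed
  \<comment> \<open>For fixed \<open>N\<close> the gated second moment of \<open>R n\<close> is of
    order \<open>\<mu> n\<close> squared. Fatou's lemma yields only a vanishing lower limit, which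
    is enough because the pathwise limit of \<open>R n\<close> is shown to exist separately.\<close>
  have RN: "AE \<omega> in M. liminf (\<lambda>n. gate (of_nat N) \<psi> t \<omega> * ennreal ((R n \<omega>)\<^sup>2)) = 0" for N :: nat
  proof -
    have gm: "gate (of_nat N) \<psi> t \<in> borel_measurable M"
      using measurable_F_M[OF progressive_section[OF progressive_gate[OF \<psi>]]] t0 by auto
    have fm: "(\<lambda>\<omega>. gate (of_nat N) \<psi> t \<omega> * ennreal ((R n \<omega>)\<^sup>2)) \<in> borel_measurable M" for n
      by (rule borel_measurable_times_ennreal[OF gm]) measurable
    have En: "(\<integral>\<^sup>+\<omega>. gate (of_nat N) \<psi> t \<omega> * ennreal ((R n \<omega>)\<^sup>2) \<partial>M) \<le> ennreal (8 * real N * real (card A) * (\<mu> n)\<^sup>2)" for n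
    proof -
      let ?c = "ennreal ((\<mu> n)\<^sup>2 * real (card A))"
      have e1: "energy (\<lambda>r \<omega>. gate (of_nat N) \<psi> r \<omega> * ennreal ((norm (\<theta> n r \<omega>))\<^sup>2)) t \<omega> \<le> ?c * of_nat N" if \<omega>: "\<omega> \<in> space M" for \<omega>
      proof -
        have "energy (\<lambda>r \<omega>. gate (of_nat N) \<psi> r \<omega> * ennreal ((norm (\<theta> n r \<omega>))\<^sup>2)) t \<omega> \<le> energy (\<lambda>r \<omega>. ?c * (gate (of_nat N) \<psi> r \<omega> * \<psi> r \<omega>)) t \<omega>"
          unfolding energy_def
        proof (rule nn_integral_mono_AE)
          have "AE r in lborel. r \<noteq> (0::real)" by (rule AE_lborel_singleton)
          then show "AE r in lborel. gate (of_nat N) \<psi> r \<omega> * ennreal ((norm (\<theta> n r \<omega>))\<^sup>2) * indicator {0..t} r \<le> ?c * (gate (of_nat N) \<psi> r \<omega> * \<psi> r \<omega>) * indicator {0..t} r"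
          proof eventually_elim
            case (elim r)
            show ?case
            proof (cases "r \<in> {0..t}")
              case True
              then have "r \<in> {0<..t}" using elim by auto
              from mult_left_mono[OF \<theta>_le[OF this, of n \<omega>], of "gate (of_nat N) \<psi> r \<omega>"] True show ?thesis
                by (simp add: mult.left_commute)
            qed simp
          qed
        qed
        also have "\<dots> = ?c * energy (\<lambda>r \<omega>. gate (of_nat N) \<psi> r \<omega> * \<psi> r \<omega>) t \<omega>"
          by (rule energy_cmult[OF progressive_path_meas[OF progressive_mult_ennreal[OF progressive_gate[OF \<psi>] \<psi>] t0(1) \<omega>]])
        also have "\<dots> \<le> ?c * of_nat N"
          by (intro mult_left_mono energy_gate_le progressive_path_meas[OF \<psi> t0(1) \<omega>]) simp
        finally show ?thesis .
      qed
      have chifin: "AE \<omega> in M. energy (\<lambda>r \<omega>. ennreal ((norm (\<theta> n r \<omega>))\<^sup>2)) t \<omega> < \<infinity>"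
        using fin AE_space
      proof eventually_elim
        case (elim \<omega>)
        have "energy (\<lambda>r \<omega>. ennreal ((norm (\<theta> n r \<omega>))\<^sup>2)) t \<omega> \<le> energy (\<lambda>r \<omega>. ?c * \<psi> r \<omega>) t \<omega>"
          unfolding energy_def
        proof (rule nn_integral_mono_AE)
          have "AE r in lborel. r \<noteq> (0::real)" by (rule AE_lborel_singleton)
          then show "AE r in lborel. ennreal ((norm (\<theta> n r \<omega>))\<^sup>2) * indicator {0..t} r \<le> ?c * \<psi> r \<omega> * indicator {0..t} r"
          proof eventually_elim
            case (elim r)
            then show ?case using \<theta>_le[of r n \<omega>] by (cases "r \<in> {0..t}") auto
          qed
        qed
        also have "\<dots> = ?c * energy \<psi> t \<omega>"
          by (rule energy_cmult[OF progressive_path_meas[OF \<psi> t0(1) elim(2)]])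
        also have "\<dots> < \<infinity>" using elim(1) by (simp add: ennreal_mult_less_top)
        finally show ?case .
      qed
      have "(\<integral>\<^sup>+\<omega>. gate (of_nat N) \<psi> t \<omega> * ennreal ((R n \<omega>)\<^sup>2) \<partial>M) = (\<integral>\<^sup>+\<omega>. (SUP u\<in>{t}. gate (of_nat N) \<psi> u \<omega> * ennreal ((R n \<omega>)\<^sup>2)) \<partial>M)"
        by simp
      also have "\<dots> \<le> 8 * (\<integral>\<^sup>+\<omega>. energy (\<lambda>r \<omega>. gate (of_nat N) \<psi> r \<omega> * ennreal ((norm (\<theta> n r \<omega>))\<^sup>2)) t \<omega> \<partial>M)"
        unfolding energy_def by (rule ito_maximal[OF t0(1) _ _ ap \<theta>p \<psi> chifin]) (use t0 in auto)
      also have "\<dots> \<le> 8 * (\<integral>\<^sup>+\<omega>. ?c * of_nat N \<partial>M)"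
        by (intro mult_left_mono nn_integral_mono e1) auto
      also have "\<dots> = ennreal (8 * real N * real (card A) * (\<mu> n)\<^sup>2)"
        by (simp add: emeasure_space_1 ennreal_of_nat_eq_real_of_nat ennreal_mult[symmetric] mult_ac flip: ennreal_numeral)
      finally show ?thesis .
    qed
    have "(\<integral>\<^sup>+\<omega>. liminf (\<lambda>n. gate (of_nat N) \<psi> t \<omega> * ennreal ((R n \<omega>)\<^sup>2)) \<partial>M)
       \<le> liminf (\<lambda>n. \<integral>\<^sup>+\<omega>. gate (of_nat N) \<psi> t \<omega> * ennreal ((R n \<omega>)\<^sup>2) \<partial>M)"
      by (rule nn_integral_liminf[OF fm])
    also have "\<dots> \<le> liminf (\<lambda>n. ennreal (8 * real N * real (card A) * (\<mu> n)\<^sup>2))"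
      by (intro Liminf_mono always_eventually allI En)
    also have "\<dots> = 0"
    proof -
      have "(\<lambda>n. ennreal (8 * real N * real (card A) * (\<mu> n)\<^sup>2)) \<longlonglongrightarrow> ennreal (8 * real N * real (card A) * 0\<^sup>2)"
        by (intro tendsto_ennrealI tendsto_mult tendsto_const tendsto_power \<mu>(1))
      then show ?thesis by (simp add: lim_imp_Liminf)
    qed
    finally have "(\<integral>\<^sup>+\<omega>. liminf (\<lambda>n. gate (of_nat N) \<psi> t \<omega> * ennreal ((R n \<omega>)\<^sup>2)) \<partial>M) = 0" by simp
    then show ?thesis
      using fm by (subst (asm) nn_integral_0_iff_AE) auto
  qed
  have RN': "AE \<omega> in M. \<forall>N::nat. liminf (\<lambda>n. gate (of_nat N) \<psi> t \<omega> * ennreal ((R n \<omega>)\<^sup>2)) = 0"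
    using RN by (simp add: AE_all_countable)
  have Yb: "AE \<omega> in M. \<forall>k\<in>A. set_integrable lborel {0..T} (\<lambda>r. \<beta> k r \<omega>)"
    using A real_itoD(5)[OF Yn] by (simp add: AE_finite_all)
  have Ycc: "AE \<omega> in M. \<forall>k\<in>A. continuous_on {0..T} (\<lambda>t. Y k t \<omega>)"
    using A Yc by (simp add: AE_finite_all)
  have Yeq: "AE \<omega> in M. \<forall>n. \<forall>k\<in>A. \<forall>u\<in>Q n. Y k u \<omega> = z k + (LINT r:{0..u}|lborel. \<beta> k r \<omega>) + I k u \<omega>"
    using A fQ real_itoD(6)[OF Yn] by (simp add: AE_finite_all AE_all_countable)
  have I00: "AE \<omega> in M. \<forall>k\<in>A. I k 0 \<omega> = 0"
    using A ito_approx_at_0[OF real_itoD(1)[OF Yn] Q(3)[of 0]] by (simp add: AE_finite_all)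
  have Y0eq: "AE \<omega> in M. Y0 t \<omega> = z0 + (LINT r:{0..t}|lborel. (\<Sum>k\<in>A. w k r * Y k r \<omega>) + (\<Sum>k\<in>A. v k r * \<beta> k r \<omega>)) + I0 t \<omega>"
    using real_itoD(6)[OF Y0n Q(4)[of 0]] by simp
  show ?thesis
    using RN' Yb Ycc Yeq I00 Y0eq fin
  proof eventually_elim
    case (elim \<omega>)
    have sub: "{0..t} \<subseteq> {0..T}" using t0 by auto
    have bi: "set_integrable lborel {0..t} (\<lambda>r. \<beta> k r \<omega>)" if "k \<in> A" for k
      by (rule set_integrable_subset[OF elim(2)[rule_format, OF that] _ sub]) simp
    have wi: "set_integrable lborel {0..t} (w k)" if "k \<in> A" for k
      by (rule set_integrable_subset[OF w[OF that] _ sub]) simp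
    have vc: "continuous_on {0..t} (v k)" if "k \<in> A" for k
      using continuous_on_subset[OF v[OF that] sub] .
    have Ycont: "continuous_on {0..t} (\<lambda>t. Y k t \<omega>)" if "k \<in> A" for k
      using continuous_on_subset[OF elim(3)[rule_format, OF that] sub] .
    have lim1: "(\<lambda>n. \<Sum>i<Suc n. v k (s n i) * (LINT r:{s n i..s n (Suc i)}|lborel. \<beta> k r \<omega>)) \<longlonglongrightarrow> (LINT r:{0..t}|lborel. v k r * \<beta> k r \<omega>)" if k: "k \<in> A" for k
      unfolding s_def
      by (rule riemann_stieltjes_limit[OF t0(1) vc[OF k] bi[OF k]]) (simp only: atLeastAtMost_iff order_refl s_Suc[unfolded s_def] simp_thms)
    have lim2: "(\<lambda>n. \<Sum>i<Suc n. Y k (s n (Suc i)) \<omega> * (LINT r:{s n i..s n (Suc i)}|lborel. w k r)) \<longlonglongrightarrow> (LINT r:{0..t}|lborel. Y k r \<omega> * w k r)" if k: "k \<in> A" for k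
      unfolding s_def
      by (rule riemann_stieltjes_limit[OF t0(1) Ycont[OF k] wi[OF k]]) (simp only: atLeastAtMost_iff order_refl s_Suc[unfolded s_def] simp_thms)
    have Y00: "Y k 0 \<omega> = z k" if k: "k \<in> A" for k
    proof -
      have "Y k 0 \<omega> = z k + (LINT r:{0..0}|lborel. \<beta> k r \<omega>) + I k 0 \<omega>"
        using elim(4) k Q(3)[of 0 0] by simp
      moreover have "(LINT r:{0..0}|lborel. \<beta> k r \<omega>) = 0"
        unfolding set_integral_cc_oc by (simp add: set_lebesgue_integral_def)
      moreover have "I k 0 \<omega> = 0" using elim(5) k by blast
      ultimately show ?thesis by (simp only: add_0_right)
    qed
    \<comment> \<open>On each cell the increment of the integral is that of \<open>Y k\<close> minus
      the drift. Summation by parts moves the differences onto \<open>v k\<close>, where they are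
      integrals of \<open>w k\<close>.\<close>
    have dI: "(\<Sum>i<Suc n. v k (s n i) * (I k (s n (Suc i)) \<omega> - I k (s n i) \<omega>)) =
       v k t * Y k t \<omega> - v k 0 * z k - (\<Sum>i<Suc n. Y k (s n (Suc i)) \<omega> * (LINT r:{s n i..s n (Suc i)}|lborel. w k r))
       - (\<Sum>i<Suc n. v k (s n i) * (LINT r:{s n i..s n (Suc i)}|lborel. \<beta> k r \<omega>))" if k: "k \<in> A" for k n
    proof -
      have "v k (s n i) * (I k (s n (Suc i)) \<omega> - I k (s n i) \<omega>) = v k (s n i) * (Y k (s n (Suc i)) \<omega> - Y k (s n i) \<omega>)
          - v k (s n i) * (LINT r:{s n i..s n (Suc i)}|lborel. \<beta> k r \<omega>)" if i: "i < Suc n" for i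
      proof -
        have ii: "s n i \<in> {0..t}" "s n (Suc i) \<in> {0..t}" using s_in[of i n] s_in[of "Suc i" n] i by auto
        have "set_integrable lborel {0..s n (Suc i)} (\<lambda>r. \<beta> k r \<omega>)"
          by (rule set_integrable_subset[OF bi[OF k]]) (use ii in auto)
        then have "(LINT r:{0..s n (Suc i)}|lborel. \<beta> k r \<omega>) = (LINT r:{0..s n i}|lborel. \<beta> k r \<omega>) + (LINT r:{s n i..s n (Suc i)}|lborel. \<beta> k r \<omega>)"
          using ii s_Suc by (intro set_integral_split) auto
        moreover have "Y k (s n i) \<omega> = z k + (LINT r:{0..s n i}|lborel. \<beta> k r \<omega>) + I k (s n i) \<omega>"
          using elim(4) k Q(5)[of i n] i by simp
        moreover have "Y k (s n (Suc i)) \<omega> = z k + (LINT r:{0..s n (Suc i)}|lborel. \<beta> k r \<omega>) + I k (s n (Suc i)) \<omega>"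
          using elim(4) k Q(5)[of "Suc i" n] i by simp
        ultimately show ?thesis by (simp add: algebra_simps)
      qed
      then have "(\<Sum>i<Suc n. v k (s n i) * (I k (s n (Suc i)) \<omega> - I k (s n i) \<omega>)) =
        (\<Sum>i<Suc n. v k (s n i) * (Y k (s n (Suc i)) \<omega> - Y k (s n i) \<omega>)) - (\<Sum>i<Suc n. v k (s n i) * (LINT r:{s n i..s n (Suc i)}|lborel. \<beta> k r \<omega>))"
        unfolding sum_subtractf[symmetric] by (intro sum.cong) auto
      also have "(\<Sum>i<Suc n. v k (s n i) * (Y k (s n (Suc i)) \<omega> - Y k (s n i) \<omega>)) = v k t * Y k t \<omega> - v k 0 * z k - (\<Sum>i<Suc n. Y k (s n (Suc i)) \<omega> * (v k (s n (Suc i)) - v k (s n i)))"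
        using sum_by_parts[of "\<lambda>i. v k (s n i)" "\<lambda>i. Y k (s n i) \<omega>" "Suc n"] unfolding s0 sn Y00[OF k] .
      also have "(\<Sum>i<Suc n. Y k (s n (Suc i)) \<omega> * (v k (s n (Suc i)) - v k (s n i))) = (\<Sum>i<Suc n. Y k (s n (Suc i)) \<omega> * (LINT r:{s n i..s n (Suc i)}|lborel. w k r))"
      proof (intro sum.cong refl)
        fix i assume i: "i \<in> {..<Suc n}"
        have "v k (s n (Suc i)) - v k (s n i) = (LINT r:{s n i..s n (Suc i)}|lborel. w k r)"
          using s_in[of i n] s_in[of "Suc i" n] i t0 by (intro vw[OF k _ s_Suc]) auto
        then show "Y k (s n (Suc i)) \<omega> * (v k (s n (Suc i)) - v k (s n i)) = Y k (s n (Suc i)) \<omega> * (LINT r:{s n i..s n (Suc i)}|lborel. w k r)" by simp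
      qed
      finally show ?thesis .
    qed
    \<comment> \<open>The pathwise limit of \<open>R n\<close>, with left tags in the sums against
      \<beta> and right tags in those against \<open>w\<close>. Once \<open>L = 0\<close> is known,
      \<open>I0 t\<close> is expressed by the remaining terms.\<close>
    define L where "L = I0 t \<omega> - (\<Sum>k\<in>A. v k t * Y k t \<omega> - v k 0 * z k - (LINT r:{0..t}|lborel. Y k r \<omega> * w k r) - (LINT r:{0..t}|lborel. v k r * \<beta> k r \<omega>))"
    have "(\<lambda>n. R n \<omega>) \<longlonglongrightarrow> L"
    proof -
      have "R n \<omega> = I0 t \<omega> - (\<Sum>k\<in>A. v k t * Y k t \<omega> - v k 0 * z k - (\<Sum>i<Suc n. Y k (s n (Suc i)) \<omega> * (LINT r:{s n i..s n (Suc i)}|lborel. w k r))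
       - (\<Sum>i<Suc n. v k (s n i) * (LINT r:{s n i..s n (Suc i)}|lborel. \<beta> k r \<omega>)))" for n
        unfolding R_def by (intro arg_cong2[where f="(-)"] sum.cong refl dI)
      then show ?thesis unfolding L_def
        by (simp only:) (intro tendsto_diff tendsto_sum tendsto_const lim1 lim2)
    qed
    then have Llim: "(\<lambda>n. ennreal ((R n \<omega>)\<^sup>2)) \<longlonglongrightarrow> ennreal (L\<^sup>2)" by (intro tendsto_ennrealI tendsto_power)
    obtain N :: nat where "energy \<psi> t \<omega> < of_nat N" using elim(7) ennreal_Ex_less_of_nat by auto
    then have g1: "gate (of_nat N) \<psi> t \<omega> = 1" by (simp add: gate_def)
    have "ennreal (L\<^sup>2) = liminf (\<lambda>n. ennreal ((R n \<omega>)\<^sup>2))"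
      by (rule lim_imp_Liminf[OF _ Llim, symmetric]) simp
    also have "\<dots> = 0" using elim(1)[rule_format, of N] by (simp add: g1)
    finally have L0: "L = 0" by simp
    have fi1: "set_integrable lborel {0..t} (\<lambda>r. Y k r \<omega> * w k r)" "set_integrable lborel {0..t} (\<lambda>r. v k r * \<beta> k r \<omega>)" if k: "k \<in> A" for k
      by (rule set_integrable_cont_mult[OF Ycont[OF k] wi[OF k]], rule set_integrable_cont_mult[OF vc[OF k] bi[OF k]])
    have drift: "(LINT r:{0..t}|lborel. (\<Sum>k\<in>A. w k r * Y k r \<omega>) + (\<Sum>k\<in>A. v k r * \<beta> k r \<omega>)) =
      (\<Sum>k\<in>A. (LINT r:{0..t}|lborel. Y k r \<omega> * w k r) + (LINT r:{0..t}|lborel. v k r * \<beta> k r \<omega>))"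
    proof -
      have "(LINT r:{0..t}|lborel. (\<Sum>k\<in>A. w k r * Y k r \<omega>) + (\<Sum>k\<in>A. v k r * \<beta> k r \<omega>)) =
        (LINT r|lborel. (\<Sum>k\<in>A. indicator {0..t} r *\<^sub>R (Y k r \<omega> * w k r) + indicator {0..t} r *\<^sub>R (v k r * \<beta> k r \<omega>)))"
        unfolding set_lebesgue_integral_def
        by (intro Bochner_Integration.integral_cong refl) (simp add: sum.distrib sum_distrib_left distrib_left mult_ac)
      also have "\<dots> = (\<Sum>k\<in>A. LINT r|lborel. indicator {0..t} r *\<^sub>R (Y k r \<omega> * w k r) + indicator {0..t} r *\<^sub>R (v k r * \<beta> k r \<omega>))"
        using fi1 unfolding set_integrable_def by (intro Bochner_Integration.integral_sum Bochner_Integration.integrable_add)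
      also have "\<dots> = (\<Sum>k\<in>A. (LINT r:{0..t}|lborel. Y k r \<omega> * w k r) + (LINT r:{0..t}|lborel. v k r * \<beta> k r \<omega>))"
        using fi1 unfolding set_integrable_def set_lebesgue_integral_def by (intro sum.cong refl Bochner_Integration.integral_add)
      finally show ?thesis .
    qed
    have "I0 t \<omega> = (\<Sum>k\<in>A. v k t * Y k t \<omega> - v k 0 * z k - (LINT r:{0..t}|lborel. Y k r \<omega> * w k r) - (LINT r:{0..t}|lborel. v k r * \<beta> k r \<omega>))"
      using L0 by (simp add: L_def)
    also have "\<dots> = (\<Sum>k\<in>A. v k t * Y k t \<omega>) - (\<Sum>k\<in>A. v k 0 * z k)
      - (\<Sum>k\<in>A. (LINT r:{0..t}|lborel. Y k r \<omega> * w k r) + (LINT r:{0..t}|lborel. v k r * \<beta> k r \<omega>))"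
      by (simp add: sum_subtractf sum.distrib)
    finally show ?case using elim(6) drift by linarith
  qed
qed

end

section \<open>Estimates along dyadic times\<close>

text \<open>Pairing with \<open>v t\<close> agrees with \<open>val\<close> only for times in [0, T],
  so weak derivatives have to be transported along equality on that interval.\<close>

lemma weak_deriv_cong:
  assumes "\<And>t. t \<in> {0..T} \<Longrightarrow> f t = f' t"
  shows "weak_deriv T f g \<longleftrightarrow> weak_deriv T f' g"
proof -
  have "(LINT t:{0..T}|lborel. f t * deriv \<phi> t) = (LINT t:{0..T}|lborel. f' t * deriv \<phi> t)" for \<phi>
    using assms by (intro set_lebesgue_integral_cong) auto
  then show ?thesis by (simp add: weak_deriv_def)
qed

lemma to_sobolev_val:
  assumes H: "sobolev_model T val" and f: "f \<in> sobolev T" and t: "t \<in> {0..T}"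
  shows "val (to_sobolev T val f) t = f t"
proof -
  have "\<exists>!h. \<forall>t\<in>{0..T}. val h t = f t" using H f by (simp add: sobolev_model_def)
  from theI'[OF this] show ?thesis using t by (simp add: to_sobolev_def)
qed

lemma bounded_linear_app_op: "bounded_linear (app_op (S :: 'h::real_normed_vector ^ 'd))"
proof -
  have "linear (app_op S)"
    by (intro linearI) (simp_all add: app_op_def scaleR_left_distrib sum.distrib scaleR_sum_right)
  then show ?thesis by (rule linear_conv_bounded_linear[THEN iffD1])
qed

text \<open>The coefficients are bounded in operator norm, whereas the Ito integral sees the
  Hilbert-Schmidt norm. Each column is the image of a unit vector, so the exchange costs the
  dimension of the Brownian motion.\<close>

lemma power2_norm_vec_le_onorm:
  fixes S :: "'h::real_inner ^ 'd"
  shows "(norm S)\<^sup>2 \<le> real CARD('d) * (onorm (app_op S))\<^sup>2"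
proof -
  have "(norm (S $ j))\<^sup>2 \<le> (onorm (app_op S))\<^sup>2" for j
  proof (rule power_mono)
    have "app_op S (axis j 1) = (\<Sum>i\<in>UNIV. if i = j then S $ j else 0)"
      unfolding app_op_def by (intro sum.cong) (auto simp: axis_def)
    then have "S $ j = app_op S (axis j 1)" by simp
    then show "norm (S $ j) \<le> onorm (app_op S)"
      using onorm[OF bounded_linear_app_op, of S "axis j 1"] by simp
  qed simp
  then have "(\<Sum>j\<in>UNIV. (norm (S $ j))\<^sup>2) \<le> (\<Sum>j\<in>(UNIV::'d set). (onorm (app_op S))\<^sup>2)"
    by (intro sum_mono)
  then show ?thesis by (simp add: power2_norm_vec)
qed

text \<open>Bessel's inequality column by column, after exchanging the sums.\<close>

lemma sum_norm_coord_le: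
  assumes e: "orthonormal_basis e"
  shows "(\<Sum>k=1..m. (norm (coord (e k) S))\<^sup>2) \<le> (norm S)\<^sup>2"
proof -
  have "(\<Sum>k=1..m. (norm (coord (e k) S))\<^sup>2) = (\<Sum>j\<in>UNIV. \<Sum>k=1..m. (inner (S $ j) (e k))\<^sup>2)"
    unfolding power2_norm_vec by (subst sum.swap) (simp add: coord_def)
  also have "\<dots> \<le> (\<Sum>j\<in>UNIV. (norm (S $ j))\<^sup>2)" by (intro sum_mono bessel[OF e])
  finally show ?thesis by (simp add: power2_norm_vec)
qed

lemma coord_one [simp]: "coord (1::real) S = S"
  by (simp add: coord_def vec_eq_iff)

lemma progressive_LIMSEQ:
  fixes Y :: "real \<Rightarrow> 'w \<Rightarrow> real"
  assumes "\<And>m::nat. progressive G T (U m)" "\<And>t \<omega>. t \<in> {0..T} \<Longrightarrow> (\<lambda>m. U m t \<omega>) \<longlonglongrightarrow> Y t \<omega>"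
  shows "progressive G T Y"
  unfolding progressive_def
proof
  fix t assume t: "t \<in> {0..T}"
  show "(\<lambda>(s, \<omega>). Y s \<omega>) \<in> borel_measurable (restrict_space borel {0..t} \<Otimes>\<^sub>M G t)"
  proof (rule borel_measurable_LIMSEQ_real)
    show "(\<lambda>(s, \<omega>). U m s \<omega>) \<in> borel_measurable (restrict_space borel {0..t} \<Otimes>\<^sub>M G t)" for m
      using assms(1)[of m] t by (simp add: progressive_def)
    fix x assume "x \<in> space (restrict_space borel {0..t} \<Otimes>\<^sub>M G t)"
    then have "fst x \<in> {0..T}" using t by (auto simp: space_pair_measure space_restrict_space)
    then show "(\<lambda>m. case x of (s, \<omega>) \<Rightarrow> U m s \<omega>) \<longlonglongrightarrow> (case x of (s, \<omega>) \<Rightarrow> Y s \<omega>)"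
      using assms(2) by (simp add: split_beta')
  qed
qed

lemma continuous_on_norm_bound:
  fixes f :: "real \<Rightarrow> 'b::real_normed_vector"
  assumes "continuous_on {0..T} f"
  obtains K where "0 \<le> K" "\<And>t. t \<in> {0..T} \<Longrightarrow> norm (f t) \<le> K"
proof -
  have "bounded (f ` {0..T})" by (intro compact_imp_bounded compact_continuous_image assms) simp
  then obtain K where K: "\<forall>x\<in>f ` {0..T}. norm x \<le> K" unfolding bounded_iff by blast
  show ?thesis
  proof (rule that[of "\<bar>K\<bar>"])
    fix t assume "t \<in> {0..T}"
    then have "norm (f t) \<le> K" using K by blast
    then show "norm (f t) \<le> \<bar>K\<bar>" by simp
  qed simp
qed

lemma nn_integral_limit_le:
  fixes u :: "nat \<Rightarrow> 'w \<Rightarrow> ennreal"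
  assumes u: "\<And>m. u m \<in> borel_measurable M" and l: "\<And>\<omega>. (\<lambda>m. u m \<omega>) \<longlonglongrightarrow> f \<omega>"
    and b: "\<And>m. (\<integral>\<^sup>+\<omega>. u m \<omega> \<partial>M) \<le> C"
  shows "(\<integral>\<^sup>+\<omega>. f \<omega> \<partial>M) \<le> C"
proof -
  have "(\<integral>\<^sup>+\<omega>. f \<omega> \<partial>M) = (\<integral>\<^sup>+\<omega>. liminf (\<lambda>m. u m \<omega>) \<partial>M)"
    using lim_imp_Liminf[OF sequentially_bot l] by simp
  also have "\<dots> \<le> liminf (\<lambda>m. \<integral>\<^sup>+\<omega>. u m \<omega> \<partial>M)" by (rule nn_integral_liminf[OF u])
  also have "\<dots> \<le> C" by (rule Liminf_le) (use b in simp_all)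
  finally show ?thesis .
qed

text \<open>Finite, so that the estimates at finitely many times apply, and nested in
  \<open>n\<close>, so that suprema increase and monotone convergence reaches the whole
  interval.\<close>

definition dyadic :: "real \<Rightarrow> nat \<Rightarrow> real set" where
  "dyadic T n = (\<lambda>i. real i * T / 2 ^ n) ` {..2 ^ n}"

lemma dyadic_finite [simp]: "finite (dyadic T n)"
  by (simp add: dyadic_def)

lemma dyadic_subset:
  assumes "0 \<le> T" shows "dyadic T n \<subseteq> {0..T}"
proof
  fix x assume "x \<in> dyadic T n"
  then obtain i where i: "i \<le> 2 ^ n" "x = real i * T / 2 ^ n" by (auto simp: dyadic_def)
  have "real i \<le> 2 ^ n" using i(1) by (metis of_nat_le_iff of_nat_numeral of_nat_power)
  then have "real i * T \<le> 2 ^ n * T" using assms by (rule mult_right_mono)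
  then show "x \<in> {0..T}" unfolding i(2) using assms by (simp add: divide_le_eq mult.commute)
qed

lemma dyadic_mono: "dyadic T n \<subseteq> dyadic T (Suc n)"
proof
  fix x assume "x \<in> dyadic T n"
  then obtain i where i: "i \<le> 2 ^ n" "x = real i * T / 2 ^ n" by (auto simp: dyadic_def)
  then have "x = real (2 * i) * T / 2 ^ Suc n" by simp
  moreover have "2 * i \<in> {..2 ^ Suc n}" using i(1) by simp
  ultimately show "x \<in> dyadic T (Suc n)" unfolding dyadic_def by (rule image_eqI)
qed

lemma dyadic_dense:
  assumes T: "0 < T" and t: "t \<in> {0..T}"
  obtains d where "\<And>n. d n \<in> dyadic T n" "d \<longlonglongrightarrow> t"
proof -
  define i where "i = (\<lambda>n. nat \<lfloor>t / T * 2 ^ n\<rfloor>)"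
  define d where "d = (\<lambda>n. real (i n) * T / 2 ^ n)"
  have tT: "0 \<le> t / T" "t / T \<le> 1" using T t by auto
  have fl: "real (i n) = of_int \<lfloor>t / T * 2 ^ n\<rfloor>" for n
  proof -
    have "0 \<le> t / T * 2 ^ n" using tT by (intro mult_nonneg_nonneg) auto
    then have "0 \<le> \<lfloor>t / T * 2 ^ n\<rfloor>" by (simp only: zero_le_floor)
    then show ?thesis unfolding i_def by (rule of_nat_nat)
  qed
  have b: "real (i n) \<le> t / T * 2 ^ n" "t / T * 2 ^ n \<le> real (i n) + 1" for n
    unfolding fl by (rule of_int_floor_le, rule real_of_int_floor_add_one_ge)
  have "i n \<le> 2 ^ n" for n
  proof -
    have "t / T * 2 ^ n \<le> 1 * 2 ^ n" using tT by (intro mult_right_mono) auto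
    with b(1)[of n] have "real (i n) \<le> 1 * 2 ^ n" by (rule order_trans)
    also have "\<dots> = real (2 ^ n)" by simp
    finally show ?thesis by (simp only: of_nat_le_iff)
  qed
  then have 1: "d n \<in> dyadic T n" for n unfolding dyadic_def d_def by (intro imageI) simp
  have 2: "\<bar>d n - t\<bar> \<le> T * (1 / 2) ^ n" for n
  proof -
    have p: "(0::real) < 2 ^ n" by simp
    have "real (i n) * T \<le> t / T * 2 ^ n * T" "t / T * 2 ^ n * T \<le> (real (i n) + 1) * T"
      using b[of n] T by (intro mult_right_mono; simp)+
    then have "real (i n) * T \<le> t * 2 ^ n" "t * 2 ^ n \<le> real (i n) * T + T"
      using T by (simp_all add: distrib_right)
    then have "d n \<le> t" "t \<le> d n + T / 2 ^ n"
      using p unfolding d_def by (simp_all add: divide_le_eq add_divide_distrib[symmetric] le_divide_eq)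
    then show ?thesis by (simp add: power_one_over)
  qed
  have "d \<longlonglongrightarrow> t"
  proof (rule LIM_zero_cancel, rule Lim_null_comparison)
    show "eventually (\<lambda>n. norm (d n - t) \<le> T * (1 / 2) ^ n) sequentially" using 2 by simp
    have "(\<lambda>n. T * (1 / 2) ^ n) \<longlonglongrightarrow> T * 0" by (intro tendsto_intros) auto
    then show "(\<lambda>n. T * (1 / 2) ^ n) \<longlonglongrightarrow> 0" by simp
  qed
  with 1 that show ?thesis by blast
qed

lemma continuous_dyadic_limit:
  fixes f :: "real \<Rightarrow> 'b::topological_space"
  assumes f: "continuous_on {0..T} f" and T: "0 < T" and t: "t \<in> {0..T}"
  obtains d where "\<And>n. d n \<in> dyadic T n" "(\<lambda>n. f (d n)) \<longlonglongrightarrow> f t"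
proof -
  obtain d where d: "\<And>n. d n \<in> dyadic T n" "d \<longlonglongrightarrow> t" by (rule dyadic_dense[OF T t], rule that, assumption+)
  have "(\<lambda>n. f (d n)) \<longlonglongrightarrow> f t"
    by (rule continuous_on_tendsto_compose[OF f d(2) t])
       (intro always_eventually allI subsetD[OF dyadic_subset[OF less_imp_le[OF T]] d(1)])
  with d(1) that show ?thesis by blast
qed

context brownian
begin

text \<open>Almost sure statements at the countably many dyadic times hold simultaneously, and
  continuity of the path fills in the rest.\<close>

lemma AE_all_times:
  fixes f :: "real \<Rightarrow> 'w \<Rightarrow> real"
  assumes T: "0 < T" and c: "AE \<omega> in M. continuous_on {0..T} (\<lambda>t. f t \<omega>)"
    and z: "\<And>t. t \<in> {0..T} \<Longrightarrow> AE \<omega> in M. f t \<omega> = 0"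
  shows "AE \<omega> in M. \<forall>t\<in>{0..T}. f t \<omega> = 0"
proof -
  have "AE \<omega> in M. \<forall>t\<in>dyadic T n. f t \<omega> = 0" for n
  proof -
    have "\<forall>t\<in>dyadic T n. AE \<omega> in M. f t \<omega> = 0" using z dyadic_subset[of T n] T by auto
    then show ?thesis by (simp add: AE_finite_all)
  qed
  then have "AE \<omega> in M. \<forall>n. \<forall>t\<in>dyadic T n. f t \<omega> = 0" by (simp add: AE_all_countable)
  with c show ?thesis
  proof eventually_elim
    case (elim \<omega>)
    show ?case
    proof
      fix t assume t: "t \<in> {0..T}"
      obtain d where d: "\<And>n. d n \<in> dyadic T n" "(\<lambda>n. f (d n) \<omega>) \<longlonglongrightarrow> f t \<omega>"
        by (rule continuous_dyadic_limit[OF elim(1) T t], rule that, assumption+)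
      have "f (d n) \<omega> = 0" for n using elim(2) d(1)[of n] by blast
      then have "(\<lambda>n. f (d n) \<omega>) \<longlonglongrightarrow> 0" by simp
      from LIMSEQ_unique[OF d(2) this] show "f t \<omega> = 0" .
    qed
  qed
qed

text \<open>By continuity the supremum over the interval is almost surely at most the limit of the
  increasing dyadic ones. The functions in the monotone limit are suprema over finite sets, hence
  measurable.\<close>

lemma sup_dyadic_le:
  fixes f :: "real \<Rightarrow> 'w \<Rightarrow> real"
  assumes T: "0 < T" and c: "AE \<omega> in M. continuous_on {0..T} (\<lambda>t. f t \<omega>)"
    and m: "\<And>t. t \<in> {0..T} \<Longrightarrow> f t \<in> borel_measurable M"
    and b: "\<And>n. (\<integral>\<^sup>+\<omega>. (SUP t\<in>dyadic T n. ennreal (f t \<omega>)) \<partial>M) \<le> C"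
  shows "(\<integral>\<^sup>+\<omega>. (SUP t\<in>{0..T}. ennreal (f t \<omega>)) \<partial>M) \<le> C"
proof -
  define g where "g = (\<lambda>n \<omega>. SUP t\<in>dyadic T n. ennreal (f t \<omega>))"
  have "(\<integral>\<^sup>+\<omega>. (SUP t\<in>{0..T}. ennreal (f t \<omega>)) \<partial>M) \<le> (\<integral>\<^sup>+\<omega>. (SUP n. g n \<omega>) \<partial>M)"
  proof (rule nn_integral_mono_AE)
    show "AE \<omega> in M. (SUP t\<in>{0..T}. ennreal (f t \<omega>)) \<le> (SUP n. g n \<omega>)"
      using c
    proof eventually_elim
      case (elim \<omega>)
      show ?case
      proof (rule SUP_least)
        fix t assume t: "t \<in> {0..T}"
        obtain d where d: "\<And>n. d n \<in> dyadic T n" "(\<lambda>n. f (d n) \<omega>) \<longlonglongrightarrow> f t \<omega>"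
          by (rule continuous_dyadic_limit[OF elim T t], rule that, assumption+)
        show "ennreal (f t \<omega>) \<le> (SUP n. g n \<omega>)"
        proof (rule LIMSEQ_le_const2[OF tendsto_ennrealI[OF d(2)]], intro exI allI impI)
          fix n :: nat
          have "ennreal (f (d n) \<omega>) \<le> g n \<omega>" unfolding g_def by (rule SUP_upper[OF d(1)])
          also have "\<dots> \<le> (SUP n. g n \<omega>)" by (rule SUP_upper) simp
          finally show "ennreal (f (d n) \<omega>) \<le> (SUP n. g n \<omega>)" .
        qed
      qed
    qed
  qed
  also have "\<dots> = (SUP n. \<integral>\<^sup>+\<omega>. g n \<omega> \<partial>M)"
  proof (rule nn_integral_monotone_convergence_SUP)
    show "incseq g"
      unfolding g_def by (intro incseq_SucI le_funI SUP_subset_mono dyadic_mono) simp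
    show "g n \<in> borel_measurable M" for n
      unfolding g_def
    proof (rule borel_measurable_SUP)
      fix t assume "t \<in> dyadic T n"
      then have "f t \<in> borel_measurable M" using dyadic_subset[of T n] T by (intro m) auto
      then show "(\<lambda>\<omega>. ennreal (f t \<omega>)) \<in> borel_measurable M" by measurable
    qed (simp add: countable_finite)
  qed
  also have "\<dots> \<le> C" by (rule SUP_least) (use b in \<open>simp add: g_def\<close>)
  finally show ?thesis .
qed

lemma energy_bounded_finite:
  assumes "\<And>r. r \<in> {0..T} \<Longrightarrow> f r \<omega> \<le> ennreal C"
  shows "energy f T \<omega> < \<infinity>"
proof -
  have "energy f T \<omega> \<le> (\<integral>\<^sup>+r. ennreal C * indicator {0..T} r \<partial>lborel)"
    unfolding energy_def using assms by (intro nn_integral_mono) (auto simp: indicator_def)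
  also have "\<dots> = ennreal C * emeasure lborel {0..T}" by (simp add: nn_integral_cmult_indicator)
  also have "\<dots> < \<infinity>" by (cases "0 \<le> T") (simp_all add: ennreal_mult_less_top)
  finally show ?thesis .
qed

text \<open>The gate is at most 1, so it is dropped from the forcing \<zeta>, whose expected energy
  is at most \<open>p\<close>, but kept on \<delta>. This brings the estimate into the form of
  \<open>gated_gronwall\<close> with constants a + cp and cq.\<close>

lemma gronwall_estimate:
  assumes \<delta>: "progressive F T \<delta>" and \<zeta>: "progressive F T \<zeta>" and T: "0 \<le> T" and a: "0 \<le> a" and c: "0 < c" and q: "0 < q"
    and fin: "AE \<omega> in M. energy \<delta> T \<omega> < \<infinity>"
    and p: "0 \<le> p" "(\<integral>\<^sup>+\<omega>. energy \<zeta> T \<omega> \<partial>M) \<le> ennreal p"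
    and est: "\<And>(N::nat) t. t \<in> {0..T} \<Longrightarrow> (\<integral>\<^sup>+\<omega>. gate (of_nat N) \<delta> t \<omega> * \<delta> t \<omega> \<partial>M)
       \<le> ennreal a + ennreal c * (\<integral>\<^sup>+\<omega>. energy (\<lambda>r \<omega>. gate (of_nat N) \<delta> r \<omega> * (\<zeta> r \<omega> + ennreal q * \<delta> r \<omega>)) t \<omega> \<partial>M)"
    and t: "t \<in> {0..T}"
  shows "(\<integral>\<^sup>+\<omega>. \<delta> t \<omega> \<partial>M) \<le> ennreal (2 * (a + c * p) * exp (2 * (c * q) * T))"
proof (rule gated_gronwall[OF \<delta> T _ _ fin _ t])
  show "0 \<le> a + c * p" using a c p by simp
  show "0 < c * q" using c q by simp
  fix N :: nat and t assume t: "t \<in> {0..T}"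
  have t0: "0 \<le> t" using t by simp
  have \<delta>t: "progressive F t \<delta>" and \<zeta>t: "progressive F t \<zeta>" using \<delta> \<zeta> t by (auto intro: progressive_mono)
  let ?g = "\<lambda>r \<omega>. gate (of_nat N) \<delta> r \<omega> * \<delta> r \<omega>"
  have gp: "progressive F t ?g" by (rule progressive_mult_ennreal[OF progressive_gate[OF \<delta>t] \<delta>t])
  have "(\<integral>\<^sup>+\<omega>. energy (\<lambda>r \<omega>. gate (of_nat N) \<delta> r \<omega> * (\<zeta> r \<omega> + ennreal q * \<delta> r \<omega>)) t \<omega> \<partial>M)
    \<le> (\<integral>\<^sup>+\<omega>. energy \<zeta> T \<omega> + ennreal q * energy ?g t \<omega> \<partial>M)"
  proof (rule nn_integral_mono)
    fix \<omega> assume \<omega>: "\<omega> \<in> space M"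
    have "path_meas t (\<lambda>_ _. ennreal q) \<omega>" by (simp add: path_meas_def)
    note pm = progressive_path_meas[OF \<zeta>t t0 \<omega>] progressive_path_meas[OF gp t0 \<omega>] this
    have "energy (\<lambda>r \<omega>. gate (of_nat N) \<delta> r \<omega> * (\<zeta> r \<omega> + ennreal q * \<delta> r \<omega>)) t \<omega> \<le> energy (\<lambda>r \<omega>. \<zeta> r \<omega> + ennreal q * ?g r \<omega>) t \<omega>"
    proof (rule energy_mono_fun)
      fix r show "gate (of_nat N) \<delta> r \<omega> * (\<zeta> r \<omega> + ennreal q * \<delta> r \<omega>) \<le> \<zeta> r \<omega> + ennreal q * ?g r \<omega>"
        by (simp add: gate_def)
    qed
    also have "\<dots> = energy \<zeta> t \<omega> + ennreal q * energy ?g t \<omega>"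
      by (simp add: energy_add[OF pm(1) path_meas_mult[OF pm(3,2)]] energy_cmult[OF pm(2)])
    also have "\<dots> \<le> energy \<zeta> T \<omega> + ennreal q * energy ?g t \<omega>"
      using t by (intro add_right_mono energy_mono) simp
    finally show "energy (\<lambda>r \<omega>. gate (of_nat N) \<delta> r \<omega> * (\<zeta> r \<omega> + ennreal q * \<delta> r \<omega>)) t \<omega> \<le> energy \<zeta> T \<omega> + ennreal q * energy ?g t \<omega>" .
  qed
  also have "\<dots> = (\<integral>\<^sup>+\<omega>. energy \<zeta> T \<omega> \<partial>M) + ennreal q * (\<integral>\<^sup>+\<omega>. energy ?g t \<omega> \<partial>M)"
    using energy_measurableM[OF \<zeta> T] energy_measurableM[OF gp t0] by (simp add: nn_integral_add nn_integral_cmult)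
  also have "\<dots> \<le> ennreal p + ennreal q * (\<integral>\<^sup>+\<omega>. energy ?g t \<omega> \<partial>M)" using p(2) by (rule add_right_mono)
  finally have "ennreal c * (\<integral>\<^sup>+\<omega>. energy (\<lambda>r \<omega>. gate (of_nat N) \<delta> r \<omega> * (\<zeta> r \<omega> + ennreal q * \<delta> r \<omega>)) t \<omega> \<partial>M)
    \<le> ennreal c * (ennreal p + ennreal q * (\<integral>\<^sup>+\<omega>. energy ?g t \<omega> \<partial>M))" by (rule mult_left_mono) simp
  also have "\<dots> = ennreal (c * p) + ennreal (c * q) * (\<integral>\<^sup>+\<omega>. energy ?g t \<omega> \<partial>M)"
    using c p q by (simp add: distrib_left ennreal_mult mult.assoc)
  finally have "ennreal a + ennreal c * (\<integral>\<^sup>+\<omega>. energy (\<lambda>r \<omega>. gate (of_nat N) \<delta> r \<omega> * (\<zeta> r \<omega> + ennreal q * \<delta> r \<omega>)) t \<omega> \<partial>M)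
    \<le> ennreal a + (ennreal (c * p) + ennreal (c * q) * (\<integral>\<^sup>+\<omega>. energy ?g t \<omega> \<partial>M))" by (rule add_left_mono)
  with est[OF t, of N] have "(\<integral>\<^sup>+\<omega>. ?g t \<omega> \<partial>M) \<le> ennreal a + (ennreal (c * p) + ennreal (c * q) * (\<integral>\<^sup>+\<omega>. energy ?g t \<omega> \<partial>M))"
    by (rule order_trans)
  also have "\<dots> = ennreal (a + c * p) + ennreal (c * q) * (\<integral>\<^sup>+\<omega>. energy ?g t \<omega> \<partial>M)"
    using a c p by (simp add: ennreal_plus add.assoc)
  finally show "(\<integral>\<^sup>+\<omega>. ?g t \<omega> \<partial>M) \<le> ennreal (a + c * p) + ennreal (c * q) * (\<integral>\<^sup>+\<omega>. energy ?g t \<omega> \<partial>M)" .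
qed

lemma real_ito_process_real:
  fixes X :: "real \<Rightarrow> 'w \<Rightarrow> real"
  assumes "ito_process M F W T x \<beta> \<phi> X" "0 \<le> T"
  shows "\<exists>I. \<forall>Q. finite Q \<longrightarrow> Q \<subseteq> {0..T} \<longrightarrow> real_ito T Q x \<beta> \<phi> I X"
proof -
  obtain I where "\<And>Q. finite Q \<Longrightarrow> Q \<subseteq> {0..T} \<Longrightarrow>
      real_ito T Q (inner x 1) (\<lambda>r \<omega>. inner (\<beta> r \<omega>) 1) (\<lambda>r \<omega>. coord 1 (\<phi> r \<omega>)) I (\<lambda>t \<omega>. inner (X t \<omega>) 1)"
    by (rule real_ito_process[OF assms, of 1], rule that, assumption+)
  then show ?thesis by auto
qed

text \<open>\<open>ito_estimate\<close> on [0, t] with \<open>t\<close> as the single time.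
  Enlarging 3t + 24 to 3T + 24 makes the constant uniform in \<open>t\<close>, as Gronwall's lemma
  requires.\<close>

lemma ito_estimate_at:
  assumes t: "t \<in> {0..T}" and A: "finite A"
    and Z: "\<And>k. k \<in> A \<Longrightarrow> real_ito t {t} (z k) (\<beta> k) (\<phi> k) (I k) (Z k)"
    and \<kappa>: "progressive F T \<kappa>" and \<psi>: "progressive F T \<psi>"
    and b\<kappa>: "AE \<omega> in M. \<forall>r\<in>{0..t}. ennreal (\<Sum>k\<in>A. (\<beta> k r \<omega>)\<^sup>2) \<le> \<kappa> r \<omega>"
    and f\<kappa>: "AE \<omega> in M. \<forall>r\<in>{0..t}. ennreal (\<Sum>k\<in>A. (norm (\<phi> k r \<omega>))\<^sup>2) \<le> \<kappa> r \<omega>"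
  shows "(\<integral>\<^sup>+\<omega>. gate K \<psi> t \<omega> * ennreal (\<Sum>k\<in>A. (Z k t \<omega>)\<^sup>2) \<partial>M)
    \<le> ennreal (3 * (\<Sum>k\<in>A. (z k)\<^sup>2)) + ennreal (3 * T + 24) * (\<integral>\<^sup>+\<omega>. energy (\<lambda>r \<omega>. gate K \<psi> r \<omega> * \<kappa> r \<omega>) t \<omega> \<partial>M)"
proof -
  have t0: "0 \<le> t" "t \<le> T" using t by auto
  have "(\<integral>\<^sup>+\<omega>. gate K \<psi> t \<omega> * ennreal (\<Sum>k\<in>A. (Z k t \<omega>)\<^sup>2) \<partial>M)
    = (\<integral>\<^sup>+\<omega>. (\<Sum>k\<in>A. SUP t\<in>{t}. gate K \<psi> t \<omega> * ennreal ((Z k t \<omega>)\<^sup>2)) \<partial>M)"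
    by (simp add: sum_distrib_left flip: sum_ennreal)
  also have "\<dots> \<le> ennreal (3 * (\<Sum>k\<in>A. (z k)\<^sup>2)) + ennreal (3 * t + 24) * (\<integral>\<^sup>+\<omega>. energy (\<lambda>r \<omega>. gate K \<psi> r \<omega> * \<kappa> r \<omega>) t \<omega> \<partial>M)"
  proof (rule ito_estimate[OF t0(1) _ _ A Z progressive_mono[OF \<kappa> t0(2)] progressive_mono[OF \<psi> t0(2)]])
    show "AE \<omega> in M. \<forall>r\<in>{0..t}. (\<Sum>k\<in>A. ennreal ((\<beta> k r \<omega>)\<^sup>2)) \<le> \<kappa> r \<omega>" using b\<kappa> by simp
    show "AE \<omega> in M. \<forall>r\<in>{0..t}. (\<Sum>k\<in>A. ennreal ((norm (\<phi> k r \<omega>))\<^sup>2)) \<le> \<kappa> r \<omega>" using f\<kappa> by simp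
  qed (use t0 in simp_all)
  also have "\<dots> \<le> ennreal (3 * (\<Sum>k\<in>A. (z k)\<^sup>2)) + ennreal (3 * T + 24) * (\<integral>\<^sup>+\<omega>. energy (\<lambda>r \<omega>. gate K \<psi> r \<omega> * \<kappa> r \<omega>) t \<omega> \<partial>M)"
    using t0 by (intro add_left_mono mult_right_mono ennreal_leI) auto
  finally show ?thesis .
qed

end

section \<open>The lifted equation and its truncation\<close>

locale volterra_lift = brownian M W
  for M :: "'w measure" and W :: "real \<Rightarrow> 'w \<Rightarrow> real ^ 'd" +
  fixes T x0 :: real
    and val :: "'h::{real_inner, banach, second_countable_topology} \<Rightarrow> real \<Rightarrow> real"
    and b :: "real \<Rightarrow> real \<Rightarrow> real \<Rightarrow> 'a::polish_space \<Rightarrow> real"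
    and \<sigma> :: "real \<Rightarrow> real \<Rightarrow> real \<Rightarrow> 'a \<Rightarrow> real ^ 'd"
    and \<alpha> :: "real \<Rightarrow> 'w \<Rightarrow> 'a"
    and xx :: 'h
    and v :: "real \<Rightarrow> 'h"
    and e :: "nat \<Rightarrow> 'h"
    and X :: "real \<Rightarrow> 'w \<Rightarrow> real"
    and XX :: "real \<Rightarrow> 'w \<Rightarrow> 'h"
    and Xm :: "nat \<Rightarrow> nat \<Rightarrow> real \<Rightarrow> 'w \<Rightarrow> real"
  assumes T_pos: "0 < T"
    and H: "sobolev_model T val"
    and coeffs: "standing_assumption T val b \<sigma>"
    and xx: "\<forall>t\<in>{0..T}. val xx t = x0"
    and X: "volterra_solution M (natural_filtration M W) W T x0 b \<sigma> \<alpha> X"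
    and XX: "ito_process M (natural_filtration M W) W T xx
               (\<lambda>r \<omega>. lift_drift T val b r (val (XX r \<omega>) r) (\<alpha> r \<omega>))
               (\<lambda>r \<omega>. lift_vol T val \<sigma> r (val (XX r \<omega>) r) (\<alpha> r \<omega>)) XX"
    and riesz: "\<forall>t\<in>{0..T}. \<forall>h. inner (v t) h = val h t"
    and basis: "orthonormal_basis e"
    and trunc: "\<forall>m\<ge>1. truncated_system M (natural_filtration M W) W T x0 (\<lambda>k. inner xx (e k))
                  (\<lambda>k t. inner (v t) (e k)) (drift_coeff (lift_drift T val b) e)
                  (vol_coeff (lift_vol T val \<sigma>) e) \<alpha> m (Xm m)"
begin

abbreviation B :: "real \<Rightarrow> real \<Rightarrow> 'a \<Rightarrow> 'h" where "B \<equiv> lift_drift T val b"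
abbreviation S :: "real \<Rightarrow> real \<Rightarrow> 'a \<Rightarrow> 'h ^ 'd" where "S \<equiv> lift_vol T val \<sigma>"
abbreviation vk :: "nat \<Rightarrow> real \<Rightarrow> real" where "vk k t \<equiv> inner (v t) (e k)"
abbreviation xt :: "real \<Rightarrow> 'w \<Rightarrow> real" where "xt r \<omega> \<equiv> val (XX r \<omega>) r"

lemma T_nonneg: "0 \<le> T"
  using T_pos by simp

lemma val_eq: "t \<in> {0..T} \<Longrightarrow> val h t = inner (v t) h"
  using riesz by simp

text \<open>Testing evaluation at \<open>t\<close> with \<open>v t\<close> itself bounds its norm.
  The normalisation by 1 makes the constants built from it positive, as Gronwall's lemma
  asks.\<close>

lemma ex_eval_bound: "\<exists>C\<ge>1. \<forall>t\<in>{0..T}. norm (v t) \<le> C"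
proof -
  obtain C where C: "0 \<le> C" "\<And>t h. t \<in> {0..T} \<Longrightarrow> \<bar>val h t\<bar> \<le> C * norm h"
    by (rule sobolev_model_bound[OF T_pos H], rule that, assumption+)
  have "norm (v t) \<le> C" if t: "t \<in> {0..T}" for t
  proof (cases "v t = 0")
    case False
    have "norm (v t) * norm (v t) = inner (v t) (v t)" by (simp add: power2_norm_eq_inner flip: power2_eq_square)
    also have "\<dots> = val (v t) t" using riesz t by simp
    also have "\<dots> \<le> C * norm (v t)" using C(2)[OF t, of "v t"] by simp
    finally show ?thesis using False by (simp add: mult_le_cancel_right)
  qed (use C in simp)
  then show ?thesis by (intro exI[of _ "max 1 C"]) (simp add: le_max_iff_disj)
qed

definition eval_const :: real where
  "eval_const = (SOME C. 1 \<le> C \<and> (\<forall>t\<in>{0..T}. norm (v t) \<le> C))"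

lemma eval_const: "1 \<le> eval_const" "t \<in> {0..T} \<Longrightarrow> norm (v t) \<le> eval_const"
  using someI_ex[OF ex_eval_bound] unfolding eval_const_def by auto

lemma power2_norm_v_le: "t \<in> {0..T} \<Longrightarrow> (norm (v t))\<^sup>2 \<le> eval_const\<^sup>2"
  using eval_const by (intro power_mono) auto

lemma power2_inner_v_le:
  assumes "t \<in> {0..T}" shows "(inner (v t) h)\<^sup>2 \<le> eval_const\<^sup>2 * (norm h)\<^sup>2"
proof -
  have "(inner (v t) h)\<^sup>2 \<le> (norm (v t))\<^sup>2 * (norm h)\<^sup>2"
    using Cauchy_Schwarz_ineq[of "v t" h] by (simp add: power2_norm_eq_inner)
  also have "\<dots> \<le> eval_const\<^sup>2 * (norm h)\<^sup>2" by (intro mult_right_mono power2_norm_v_le assms) simp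
  finally show ?thesis .
qed

lemma ex_lip_const:
  "\<exists>K>0. \<forall>r\<in>{0..T}. \<forall>a x y.
     (norm (B r x a - B r y a))\<^sup>2 \<le> K * (x - y)\<^sup>2 \<and> (norm (S r x a - S r y a))\<^sup>2 \<le> K * (x - y)\<^sup>2 \<and>
     (norm (B r x a))\<^sup>2 \<le> K * (1 + x\<^sup>2) \<and> (norm (S r x a))\<^sup>2 \<le> K * (1 + x\<^sup>2)"
proof -
  obtain L where L: "\<forall>r\<in>{0..T}. \<forall>a x y.
        norm (B r x a - B r y a) \<le> L * \<bar>x - y\<bar> \<and>
        onorm (app_op (S r x a - S r y a)) \<le> L * \<bar>x - y\<bar> \<and>
        norm (B r x a) \<le> L * (1 + \<bar>x\<bar>) \<and>
        onorm (app_op (S r x a)) \<le> L * (1 + \<bar>x\<bar>)"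
    using coeffs unfolding standing_assumption_def by blast
  define n where "n = real CARD('d)"
  have n1: "1 \<le> n" unfolding n_def using zero_less_card_finite[where 'a='d] by linarith
  \<comment> \<open>\<open>n\<close> pays for passing to the Hilbert-Schmidt norm, 2 comes from (1 +
    |x|)^2 \<le> 2(1 + x^2), and the summand 1 makes \<open>K\<close> positive even if
    \<open>L = 0\<close>.\<close>
  define K where "K = 2 * n * (L\<^sup>2 + 1)"
  have nK: "c * n \<le> K" if "c \<le> 2 * (L\<^sup>2 + 1)" for c
  proof -
    have "c * n \<le> 2 * (L\<^sup>2 + 1) * n" using that n1 by (intro mult_right_mono) auto
    then show ?thesis by (simp add: K_def mult_ac)
  qed
  have lip: "y\<^sup>2 * n \<le> K * d\<^sup>2" if "0 \<le> y" "y \<le> L * \<bar>d\<bar>" for y d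
  proof -
    have "y\<^sup>2 \<le> (L * \<bar>d\<bar>)\<^sup>2" using that by (intro power_mono) auto
    then have "y\<^sup>2 * n \<le> (L\<^sup>2 * d\<^sup>2) * n" using n1 by (intro mult_right_mono) (auto simp: power_mult_distrib)
    also have "\<dots> = (L\<^sup>2 * n) * d\<^sup>2" by simp
    also have "\<dots> \<le> K * d\<^sup>2" by (intro mult_right_mono nK) auto
    finally show ?thesis .
  qed
  have gr: "y\<^sup>2 * n \<le> K * (1 + x\<^sup>2)" if "0 \<le> y" "y \<le> L * (1 + \<bar>x\<bar>)" for y x
  proof -
    have "y\<^sup>2 \<le> (L * (1 + \<bar>x\<bar>))\<^sup>2" using that by (intro power_mono) auto
    also have "\<dots> \<le> L\<^sup>2 * (2 * (1 + x\<^sup>2))"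
      unfolding power_mult_distrib
    proof (intro mult_left_mono)
      show "(1 + \<bar>x\<bar>)\<^sup>2 \<le> 2 * (1 + x\<^sup>2)"
        using sum_squares_bound[of 1 "\<bar>x\<bar>"] by (simp add: power2_sum)
    qed simp
    finally have "y\<^sup>2 * n \<le> (L\<^sup>2 * (2 * (1 + x\<^sup>2))) * n" using n1 by (intro mult_right_mono) auto
    also have "\<dots> = (2 * L\<^sup>2 * n) * (1 + x\<^sup>2)" by simp
    also have "\<dots> \<le> K * (1 + x\<^sup>2)" by (intro mult_right_mono nK) auto
    finally show ?thesis .
  qed
  have o: "0 \<le> onorm (app_op s)" for s :: "'h ^ 'd" by (rule onorm_pos_le[OF bounded_linear_app_op])
  have le: "y\<^sup>2 \<le> y\<^sup>2 * n" for y using mult_left_mono[OF n1, of "y\<^sup>2"] by simp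
  have os: "(norm s)\<^sup>2 \<le> (onorm (app_op s))\<^sup>2 * n" for s :: "'h ^ 'd"
    using power2_norm_vec_le_onorm[of s] by (simp add: n_def mult.commute)
  show ?thesis
  proof (intro exI[of _ K] conjI ballI allI)
    show "0 < K" unfolding K_def using n1 by (intro mult_pos_pos add_nonneg_pos) auto
    fix r a x y assume r: "r \<in> {0..T}"
    show "(norm (B r x a - B r y a))\<^sup>2 \<le> K * (x - y)\<^sup>2"
      by (rule order_trans[OF le lip]) (use L r in auto)
    show "(norm (S r x a - S r y a))\<^sup>2 \<le> K * (x - y)\<^sup>2"
      by (rule order_trans[OF os lip[OF o]]) (use L r in auto)
    show "(norm (B r x a))\<^sup>2 \<le> K * (1 + x\<^sup>2)"
      by (rule order_trans[OF le gr]) (use L r in auto)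
    show "(norm (S r x a))\<^sup>2 \<le> K * (1 + x\<^sup>2)"
      by (rule order_trans[OF os gr[OF o]]) (use L r in auto)
  qed
qed

definition lip_const :: real where
  "lip_const = (SOME K. 0 < K \<and> (\<forall>r\<in>{0..T}. \<forall>a x y.
     (norm (B r x a - B r y a))\<^sup>2 \<le> K * (x - y)\<^sup>2 \<and> (norm (S r x a - S r y a))\<^sup>2 \<le> K * (x - y)\<^sup>2 \<and>
     (norm (B r x a))\<^sup>2 \<le> K * (1 + x\<^sup>2) \<and> (norm (S r x a))\<^sup>2 \<le> K * (1 + x\<^sup>2)))"

lemma lip_const_pos: "0 < lip_const"
  and lip_const:
    "r \<in> {0..T} \<Longrightarrow> (norm (B r x a - B r y a))\<^sup>2 \<le> lip_const * (x - y)\<^sup>2"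
    "r \<in> {0..T} \<Longrightarrow> (norm (S r x a - S r y a))\<^sup>2 \<le> lip_const * (x - y)\<^sup>2"
    "r \<in> {0..T} \<Longrightarrow> (norm (B r x a))\<^sup>2 \<le> lip_const * (1 + x\<^sup>2)"
    "r \<in> {0..T} \<Longrightarrow> (norm (S r x a))\<^sup>2 \<le> lip_const * (1 + x\<^sup>2)"
  using someI_ex[OF ex_lip_const] unfolding lip_const_def by auto

text \<open>The standing assumption places the coefficient in the Sobolev space, so its lift
  represents it and \<open>v t\<close> recovers its value at the second time argument. This links
  the lifted equation with the Volterra equation.\<close>

lemma inner_v_drift:
  assumes r: "r \<in> {0..T}" and t: "t \<in> {0..T}"
  shows "inner (B r x a) (v t) = b r t x a"
proof -
  have "(\<lambda>s. b r s x a) \<in> sobolev T" using coeffs r by (simp add: standing_assumption_def)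
  from to_sobolev_val[OF H this t] show ?thesis
    using t by (simp add: val_eq lift_drift_def inner_commute)
qed

lemma coord_v_vol:
  assumes r: "r \<in> {0..T}" and t: "t \<in> {0..T}"
  shows "coord (v t) (S r x a) = \<sigma> r t x a"
proof -
  have "(\<lambda>s. \<sigma> r s x a $ j) \<in> sobolev T" for j using coeffs r by (simp add: standing_assumption_def)
  from to_sobolev_val[OF H this t] show ?thesis
    using t by (simp add: val_eq lift_vol_def coord_def vec_eq_iff inner_commute)
qed

text \<open>By the Riesz property v^k is, on [0, T], the Sobolev function e_k itself; hence its
  continuity and its weak derivative.\<close>

lemma vk_continuous: "continuous_on {0..T} (vk k)"
  and vk_weak_deriv: "weak_deriv T (vk k) (wderiv T (vk k))"
proof -
  have s: "val (e k) \<in> sobolev T" using H by (simp add: sobolev_model_def)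
  have "continuous_on {0..T} (val (e k))" using s by (simp add: sobolev_def)
  then show "continuous_on {0..T} (vk k)"
    by (rule continuous_on_eq) (simp add: val_eq)
  obtain g where "weak_deriv T (val (e k)) g" using s by (auto simp: sobolev_def)
  then have "weak_deriv T (vk k) g" by (subst weak_deriv_cong[where f'="val (e k)"]) (auto simp: val_eq)
  then show "weak_deriv T (vk k) (wderiv T (vk k))" unfolding wderiv_def by (rule someI[of "weak_deriv T (vk k)"])
qed

section \<open>Measurability and second moment of the lifted process\<close>

lemma XX_progressive: "progressive F T XX"
  using XX by (simp add: ito_process_def continuous_process_def)

lemma XX_continuous: "AE \<omega> in M. continuous_on {0..T} (\<lambda>t. XX t \<omega>)"
  using XX by (simp add: ito_process_def continuous_process_def)

lemma XX_coord_progressive: "progressive F T (\<lambda>t \<omega>. inner (XX t \<omega>) (e k))"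
  by (rule progressive_compose[OF XX_progressive]) measurable

text \<open>Evaluation at the running time is a pointwise limit of finite coordinate sums, each
  progressive because the v^k are continuous.\<close>

lemma xt_progressive: "progressive F T xt"
proof (rule progressive_LIMSEQ)
  show "progressive F T (\<lambda>r \<omega>. \<Sum>k=1..m. vk k r *\<^sub>R inner (XX r \<omega>) (e k))" for m
    by (intro progressive_sum progressive_scaleR progressive_det vk_continuous XX_coord_progressive)
  fix t \<omega> assume t: "t \<in> {0..T}"
  have "(\<lambda>m. inner (v t) (basis_proj e m (XX t \<omega>))) \<longlonglongrightarrow> inner (v t) (XX t \<omega>)"
    by (intro tendsto_intros basis_proj_tendsto basis)
  then show "(\<lambda>m. \<Sum>k=1..m. vk k t *\<^sub>R inner (XX t \<omega>) (e k)) \<longlonglongrightarrow> xt t \<omega>"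
    using t by (simp add: val_eq inner_basis_proj[OF basis])
qed

lemma XX_norm_progressive: "progressive F T (\<lambda>t \<omega>. ennreal ((norm (XX t \<omega>))\<^sup>2))"
  by (rule progressive_compose[OF XX_progressive]) measurable

lemma XX_energy_finite: "AE \<omega> in M. energy (\<lambda>t \<omega>. ennreal ((norm (XX t \<omega>))\<^sup>2)) T \<omega> < \<infinity>"
  using XX_continuous
proof eventually_elim
  case (elim \<omega>)
  obtain K where K: "0 \<le> K" "\<And>t. t \<in> {0..T} \<Longrightarrow> norm (XX t \<omega>) \<le> K"
    by (rule continuous_on_norm_bound[OF elim], rule that, assumption+)
  show ?case
    by (rule energy_bounded_finite[of T _ \<omega> "K\<^sup>2"]) (use K in \<open>auto intro!: ennreal_leI power_mono\<close>)
qed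

text \<open>The constant of \<open>gronwall_estimate\<close> for the squared norm of
  \<open>XX\<close>: initial value three times the squared norm of \<open>xx\<close>, factor 3T + 24
  from the Ito estimate, and the linear growth bound split into its constant part and the part
  multiplying the squared norm.\<close>

definition moment :: real where
  "moment = 2 * (3 * (norm xx)\<^sup>2 + (3 * T + 24) * (lip_const * T)) * exp (2 * ((3 * T + 24) * (lip_const * eval_const\<^sup>2)) * T)"

text \<open>Growth of the coefficients in the evaluated process is growth in the norm, because
  evaluation is bounded. The Ito estimate is applied to the first \<open>m\<close> coordinates with
  bounds free of \<open>m\<close>, and \<open>m\<close> then tends to infinity by Fatou's
  lemma.\<close>

lemma XX_moment:
  assumes t: "t \<in> {0..T}"
  shows "(\<integral>\<^sup>+\<omega>. ennreal ((norm (XX t \<omega>))\<^sup>2) \<partial>M) \<le> ennreal moment"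
  unfolding moment_def
proof (rule gronwall_estimate[OF XX_norm_progressive _ T_nonneg _ _ _ XX_energy_finite _ _ _ t])
  show "progressive F T (\<lambda>_ _. ennreal lip_const)" by (rule progressive_const)
  show "0 < 3 * T + 24" "0 \<le> lip_const * T" "0 \<le> 3 * (norm xx)\<^sup>2" using T_pos lip_const_pos by simp_all
  have "1 \<le> eval_const\<^sup>2" using eval_const(1) by simp
  then show "0 < lip_const * eval_const\<^sup>2" using lip_const_pos by (intro mult_pos_pos) auto
  have "energy (\<lambda>_ _. ennreal lip_const) T \<omega> = ennreal (lip_const * T)" for \<omega> :: 'w
    using T_pos lip_const_pos by (simp add: energy_def nn_integral_cmult_indicator ennreal_mult)
  then show "(\<integral>\<^sup>+\<omega>. energy (\<lambda>_ _. ennreal lip_const) T \<omega> \<partial>M) \<le> ennreal (lip_const * T)"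
    by (simp add: emeasure_space_1)
  fix N :: nat and t assume t: "t \<in> {0..T}"
  have t0: "0 \<le> t" "t \<le> T" using t by auto
  let ?\<delta> = "\<lambda>t \<omega>. ennreal ((norm (XX t \<omega>))\<^sup>2)"
  let ?\<kappa> = "\<lambda>r \<omega>. ennreal lip_const + ennreal (lip_const * eval_const\<^sup>2) * ?\<delta> r \<omega>"
  let ?R = "ennreal (3 * (norm xx)\<^sup>2) + ennreal (3 * T + 24) * (\<integral>\<^sup>+\<omega>. energy (\<lambda>r \<omega>. gate (of_nat N) ?\<delta> r \<omega> * ?\<kappa> r \<omega>) t \<omega> \<partial>M)"
  have \<kappa>: "progressive F T ?\<kappa>"
    by (rule progressive_add[OF progressive_const progressive_mult_ennreal[OF progressive_const XX_norm_progressive]])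
  have lin: "ennreal u \<le> ?\<kappa> r \<omega>" if r: "r \<in> {0..T}" and u: "u \<le> lip_const * (1 + (xt r \<omega>)\<^sup>2)" for u r \<omega>
  proof -
    have "(xt r \<omega>)\<^sup>2 \<le> eval_const\<^sup>2 * (norm (XX r \<omega>))\<^sup>2" using power2_inner_v_le[OF r] by (simp add: val_eq[OF r])
    then have "lip_const * (1 + (xt r \<omega>)\<^sup>2) \<le> lip_const * (1 + eval_const\<^sup>2 * (norm (XX r \<omega>))\<^sup>2)"
      using lip_const_pos by (intro mult_left_mono) auto
    with u have "u \<le> lip_const + lip_const * eval_const\<^sup>2 * (norm (XX r \<omega>))\<^sup>2" by (simp add: algebra_simps)
    then have "ennreal u \<le> ennreal (lip_const + lip_const * eval_const\<^sup>2 * (norm (XX r \<omega>))\<^sup>2)" by (rule ennreal_leI)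
    also have "\<dots> = ?\<kappa> r \<omega>" using lip_const_pos by (simp add: ennreal_plus ennreal_mult)
    finally show ?thesis .
  qed
  let ?P = "\<lambda>k I. \<forall>Q. finite Q \<longrightarrow> Q \<subseteq> {0..T} \<longrightarrow> real_ito T Q (inner xx (e k)) (\<lambda>r \<omega>. inner (B r (xt r \<omega>) (\<alpha> r \<omega>)) (e k))
      (\<lambda>r \<omega>. coord (e k) (S r (xt r \<omega>) (\<alpha> r \<omega>))) I (\<lambda>t \<omega>. inner (XX t \<omega>) (e k))"
  have "\<forall>k. \<exists>I. ?P k I"
  proof
    fix k show "\<exists>I. ?P k I"
      by (rule real_ito_process[OF XX T_nonneg, of "e k"], intro exI allI impI, assumption)
  qed
  then obtain I where "\<forall>k. ?P k (I k)" by (rule choice[THEN exE])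
  then have I: "?P k (I k)" for k by (rule spec)
  have Z: "real_ito t {t} (inner xx (e k)) (\<lambda>r \<omega>. inner (B r (xt r \<omega>) (\<alpha> r \<omega>)) (e k))
      (\<lambda>r \<omega>. coord (e k) (S r (xt r \<omega>) (\<alpha> r \<omega>))) (I k) (\<lambda>t \<omega>. inner (XX t \<omega>) (e k))" for k
    by (rule real_ito_subset[OF I[rule_format, of "{t}"] t0(2)]) (use t in auto)
  have est: "(\<integral>\<^sup>+\<omega>. gate (of_nat N) ?\<delta> t \<omega> * ennreal (\<Sum>k=1..m. (inner (XX t \<omega>) (e k))\<^sup>2) \<partial>M) \<le> ?R" for m
  proof -
    have "(\<integral>\<^sup>+\<omega>. gate (of_nat N) ?\<delta> t \<omega> * ennreal (\<Sum>k=1..m. (inner (XX t \<omega>) (e k))\<^sup>2) \<partial>M)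
      \<le> ennreal (3 * (\<Sum>k=1..m. (inner xx (e k))\<^sup>2)) + ennreal (3 * T + 24) * (\<integral>\<^sup>+\<omega>. energy (\<lambda>r \<omega>. gate (of_nat N) ?\<delta> r \<omega> * ?\<kappa> r \<omega>) t \<omega> \<partial>M)"
    proof (rule ito_estimate_at[OF t finite_atLeastAtMost Z \<kappa> XX_norm_progressive])
      show "AE \<omega> in M. \<forall>r\<in>{0..t}. ennreal (\<Sum>k=1..m. (inner (B r (xt r \<omega>) (\<alpha> r \<omega>)) (e k))\<^sup>2) \<le> ?\<kappa> r \<omega>"
        using t0 by (intro AE_I2 ballI lin order_trans[OF bessel[OF basis] lip_const(3)]) auto
      show "AE \<omega> in M. \<forall>r\<in>{0..t}. ennreal (\<Sum>k=1..m. (norm (coord (e k) (S r (xt r \<omega>) (\<alpha> r \<omega>))))\<^sup>2) \<le> ?\<kappa> r \<omega>"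
        using t0 by (intro AE_I2 ballI lin order_trans[OF sum_norm_coord_le[OF basis] lip_const(4)]) auto
    qed
    also have "\<dots> \<le> ?R" by (intro add_right_mono ennreal_leI mult_left_mono bessel[OF basis]) simp
    finally show ?thesis .
  qed
  show "(\<integral>\<^sup>+\<omega>. gate (of_nat N) ?\<delta> t \<omega> * ?\<delta> t \<omega> \<partial>M) \<le> ?R"
  proof (rule nn_integral_limit_le[OF _ _ est])
    fix m
    have "(\<lambda>\<omega>. ennreal (\<Sum>k=1..m. (inner (XX t \<omega>) (e k))\<^sup>2)) \<in> borel_measurable M"
      by (intro measurable_compose[OF _ measurable_ennreal] borel_measurable_sum borel_measurable_power borel_measurable_inner measurable_F_M[OF progressive_section[OF XX_progressive t]] borel_measurable_const)
    moreover have "gate (of_nat N) ?\<delta> t \<in> borel_measurable M"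
      by (rule measurable_F_M[OF progressive_section[OF progressive_gate[OF XX_norm_progressive] t]])
    ultimately show "(\<lambda>\<omega>. gate (of_nat N) ?\<delta> t \<omega> * ennreal (\<Sum>k=1..m. (inner (XX t \<omega>) (e k))\<^sup>2)) \<in> borel_measurable M"
      by (intro borel_measurable_times_ennreal)
  next
    fix \<omega>
    have "(\<lambda>m. (norm (basis_proj e m (XX t \<omega>)))\<^sup>2) \<longlonglongrightarrow> (norm (XX t \<omega>))\<^sup>2"
      by (intro tendsto_intros basis_proj_tendsto basis)
    then have "(\<lambda>m. \<Sum>k=1..m. (inner (XX t \<omega>) (e k))\<^sup>2) \<longlonglongrightarrow> (norm (XX t \<omega>))\<^sup>2"
      by (simp add: norm_basis_proj[OF basis])
    moreover have "gate (of_nat N) ?\<delta> t \<omega> < \<top>" using gate_le_1 by (rule le_less_trans) simp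
    ultimately show "(\<lambda>m. gate (of_nat N) ?\<delta> t \<omega> * ennreal (\<Sum>k=1..m. (inner (XX t \<omega>) (e k))\<^sup>2)) \<longlonglongrightarrow> gate (of_nat N) ?\<delta> t \<omega> * ?\<delta> t \<omega>"
      by (intro ennreal_tendsto_cmult tendsto_ennrealI)
  qed
qed


section \<open>Identification of the Volterra process with the evaluated lift\<close>

lemma X_progressive: "progressive F T X"
  and X_continuous: "AE \<omega> in M. continuous_on {0..T} (\<lambda>t. X t \<omega>)"
  using X by (simp_all add: volterra_solution_def continuous_process_def)

lemma XX_real_ito:
  obtains I where "\<And>Q. finite Q \<Longrightarrow> Q \<subseteq> {0..T} \<Longrightarrow> real_ito T Q (inner xx h) (\<lambda>r \<omega>. inner (B r (xt r \<omega>) (\<alpha> r \<omega>)) h)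
      (\<lambda>r \<omega>. coord h (S r (xt r \<omega>) (\<alpha> r \<omega>))) I (\<lambda>t \<omega>. inner (XX t \<omega>) h)"
  by (rule real_ito_process[OF XX T_nonneg, of h], rule that, assumption)

text \<open>For a terminal time \<open>t\<close> the Volterra equation is an Ito equation with
  coefficients frozen at \<open>t\<close>, and pairing the lifted equation with \<open>v t\<close>
  yields the same frozen form and the same initial value. The only time is \<open>t\<close>, because
  at earlier times \<open>X\<close> solves equations with other coefficients.\<close>

lemma X_sub_xt_real_ito:
  assumes t: "t \<in> {0..T}"
  obtains I where "real_ito t {t} 0 (\<lambda>r \<omega>. b r t (X r \<omega>) (\<alpha> r \<omega>) - inner (B r (xt r \<omega>) (\<alpha> r \<omega>)) (v t))
    (\<lambda>r \<omega>. \<sigma> r t (X r \<omega>) (\<alpha> r \<omega>) - coord (v t) (S r (xt r \<omega>) (\<alpha> r \<omega>))) I (\<lambda>s \<omega>. X s \<omega> - inner (XX s \<omega>) (v t))"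
proof -
  have t0: "0 \<le> t" "t \<le> T" using t by auto
  obtain I where I: "ito_integral M F W t (\<lambda>r \<omega>. \<sigma> r t (X r \<omega>) (\<alpha> r \<omega>)) I"
    and eq: "AE \<omega> in M. X t \<omega> = x0 + (LINT r:{0..t}|lborel. b r t (X r \<omega>) (\<alpha> r \<omega>)) + I t \<omega>"
    and int: "AE \<omega> in M. set_integrable lborel {0..t} (\<lambda>r. b r t (X r \<omega>) (\<alpha> r \<omega>))"
    using X t unfolding volterra_solution_def by blast
  have "real_ito t {t} x0 (\<lambda>r \<omega>. b r t (X r \<omega>) (\<alpha> r \<omega>)) (\<lambda>r \<omega>. coord 1 (\<sigma> r t (X r \<omega>) (\<alpha> r \<omega>))) (\<lambda>t \<omega>. inner (I t \<omega>) 1) X"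
    by (rule real_ito_integral[OF I t0(1) _ _ int]) (use t0 eq in simp_all)
  then have 1: "real_ito t {t} x0 (\<lambda>r \<omega>. b r t (X r \<omega>) (\<alpha> r \<omega>)) (\<lambda>r \<omega>. \<sigma> r t (X r \<omega>) (\<alpha> r \<omega>)) I X" by simp
  obtain J where J: "\<And>Q. finite Q \<Longrightarrow> Q \<subseteq> {0..T} \<Longrightarrow> real_ito T Q (inner xx (v t)) (\<lambda>r \<omega>. inner (B r (xt r \<omega>) (\<alpha> r \<omega>)) (v t))
      (\<lambda>r \<omega>. coord (v t) (S r (xt r \<omega>) (\<alpha> r \<omega>))) J (\<lambda>s \<omega>. inner (XX s \<omega>) (v t))"
    by (rule XX_real_ito[of "v t"], rule that, assumption+)
  have z: "inner xx (v t) = x0" using xx t by (simp add: val_eq inner_commute)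
  have 2: "real_ito t {t} x0 (\<lambda>r \<omega>. inner (B r (xt r \<omega>) (\<alpha> r \<omega>)) (v t))
      (\<lambda>r \<omega>. coord (v t) (S r (xt r \<omega>) (\<alpha> r \<omega>))) J (\<lambda>s \<omega>. inner (XX s \<omega>) (v t))"
    unfolding z[symmetric] by (rule real_ito_subset[OF J[of "{t}"] t0(2)]) (use t in auto)
  show ?thesis using real_ito_diff[OF 1 2 t0(1)] t0 by (intro that) simp
qed

lemma drift_diff_le:
  assumes r: "r \<in> {0..T}" and t: "t \<in> {0..T}"
  shows "(b r t x a - inner (B r y a) (v t))\<^sup>2 \<le> eval_const\<^sup>2 * lip_const * (x - y)\<^sup>2"
proof -
  have "(b r t x a - inner (B r y a) (v t))\<^sup>2 = (inner (v t) (B r x a - B r y a))\<^sup>2"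
    by (simp add: inner_diff_right inner_commute[of "v t"] inner_v_drift[OF r t])
  also have "\<dots> \<le> eval_const\<^sup>2 * (norm (B r x a - B r y a))\<^sup>2" by (rule power2_inner_v_le[OF t])
  also have "\<dots> \<le> eval_const\<^sup>2 * (lip_const * (x - y)\<^sup>2)" by (intro mult_left_mono lip_const(1)[OF r]) simp
  finally show ?thesis by (simp add: mult.assoc)
qed

lemma vol_diff_le:
  assumes r: "r \<in> {0..T}" and t: "t \<in> {0..T}"
  shows "(norm (\<sigma> r t x a - coord (v t) (S r y a)))\<^sup>2 \<le> eval_const\<^sup>2 * lip_const * (x - y)\<^sup>2"
proof -
  have "(norm (\<sigma> r t x a - coord (v t) (S r y a)))\<^sup>2 = (norm (coord (v t) (S r x a - S r y a)))\<^sup>2"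
    by (simp add: coord_diff coord_v_vol[OF r t])
  also have "\<dots> \<le> (norm (v t))\<^sup>2 * (norm (S r x a - S r y a))\<^sup>2" by (rule power2_norm_coord_le)
  also have "\<dots> \<le> eval_const\<^sup>2 * (lip_const * (x - y)\<^sup>2)"
    by (intro mult_mono lip_const(2)[OF r] power2_norm_v_le[OF t]) simp_all
  finally show ?thesis by (simp add: mult.assoc)
qed

text \<open>Uniqueness: at each \<open>t\<close> the difference starts from 0 and its coefficients
  are Lipschitz in the difference at earlier times, so Gronwall's lemma runs without forcing and
  gives zero. Boundedness of the paths makes the energy of the difference finite.\<close>

lemma X_eq_xt:
  assumes t: "t \<in> {0..T}"
  shows "AE \<omega> in M. X t \<omega> = xt t \<omega>"
proof -
  let ?\<delta> = "\<lambda>t \<omega>. ennreal ((X t \<omega> - xt t \<omega>)\<^sup>2)"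
  define q where "q = eval_const\<^sup>2 * lip_const"
  have "1 \<le> eval_const\<^sup>2" using eval_const(1) by simp
  then have q: "0 < q" unfolding q_def using lip_const_pos by (intro mult_pos_pos) auto
  have \<delta>: "progressive F T ?\<delta>"
    by (rule progressive_compose[OF progressive_diff[OF X_progressive xt_progressive]]) measurable
  have fin: "AE \<omega> in M. energy ?\<delta> T \<omega> < \<infinity>"
    using X_continuous XX_continuous
  proof eventually_elim
    case (elim \<omega>)
    obtain K where K: "0 \<le> K" "\<And>t. t \<in> {0..T} \<Longrightarrow> norm (X t \<omega>) \<le> K"
      by (rule continuous_on_norm_bound[OF elim(1)], rule that, assumption+)
    obtain K' where K': "0 \<le> K'" "\<And>t. t \<in> {0..T} \<Longrightarrow> norm (XX t \<omega>) \<le> K'"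
      by (rule continuous_on_norm_bound[OF elim(2)], rule that, assumption+)
    show ?case
    proof (rule energy_bounded_finite[of T _ \<omega> "(K + eval_const * K')\<^sup>2"], rule ennreal_leI, rule power2_le_iff_abs_le[THEN iffD2])
      fix r assume r: "r \<in> {0..T}"
      have "\<bar>xt r \<omega>\<bar> \<le> norm (v r) * norm (XX r \<omega>)" using Cauchy_Schwarz_ineq2[of "v r" "XX r \<omega>"] by (simp add: val_eq[OF r])
      also have "\<dots> \<le> eval_const * K'" using eval_const r K' by (intro mult_mono) auto
      finally show "\<bar>X r \<omega> - xt r \<omega>\<bar> \<le> K + eval_const * K'" using K(2)[OF r] by simp
    next
      show "0 \<le> K + eval_const * K'" using K(1) K'(1) eval_const(1) by simp
    qed
  qed
  have "(\<integral>\<^sup>+\<omega>. ?\<delta> t \<omega> \<partial>M) \<le> ennreal (2 * (0 + (3 * T + 24) * 0) * exp (2 * ((3 * T + 24) * q) * T))"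
  proof (rule gronwall_estimate[OF \<delta> progressive_const[of _ _ 0] T_nonneg _ _ q fin _ _ _ t])
    show "(\<integral>\<^sup>+\<omega>. energy (\<lambda>t \<omega>. 0) T \<omega> \<partial>M) \<le> ennreal 0" by (simp add: energy_def)
    show "0 < 3 * T + 24" using T_pos by simp
    fix N :: nat and t assume t: "t \<in> {0..T}"
    have t0: "0 \<le> t" "t \<le> T" using t by auto
    obtain I where I: "real_ito t {t} 0 (\<lambda>r \<omega>. b r t (X r \<omega>) (\<alpha> r \<omega>) - inner (B r (xt r \<omega>) (\<alpha> r \<omega>)) (v t))
        (\<lambda>r \<omega>. \<sigma> r t (X r \<omega>) (\<alpha> r \<omega>) - coord (v t) (S r (xt r \<omega>) (\<alpha> r \<omega>))) I (\<lambda>s \<omega>. X s \<omega> - inner (XX s \<omega>) (v t))"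
      by (rule X_sub_xt_real_ito[OF t], rule that, assumption)
    let ?\<kappa> = "\<lambda>r \<omega>. 0 + ennreal q * ?\<delta> r \<omega>"
    have \<kappa>: "progressive F T ?\<kappa>"
      by (rule progressive_add[OF progressive_const progressive_mult_ennreal[OF progressive_const \<delta>]])
    have q\<delta>: "ennreal u \<le> ?\<kappa> r \<omega>" if "u \<le> eval_const\<^sup>2 * lip_const * (X r \<omega> - xt r \<omega>)\<^sup>2" for u r \<omega>
      using ennreal_leI[OF that] q by (simp add: q_def[symmetric] ennreal_mult)
    have "(\<integral>\<^sup>+\<omega>. gate (of_nat N) ?\<delta> t \<omega> * ennreal (\<Sum>k\<in>{()}. (X t \<omega> - inner (XX t \<omega>) (v t))\<^sup>2) \<partial>M)
      \<le> ennreal (3 * (\<Sum>k\<in>{()}. 0\<^sup>2)) + ennreal (3 * T + 24) * (\<integral>\<^sup>+\<omega>. energy (\<lambda>r \<omega>. gate (of_nat N) ?\<delta> r \<omega> * ?\<kappa> r \<omega>) t \<omega> \<partial>M)"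
    \<comment> \<open>A one-point index set, since the estimate is stated for families.\<close>
    proof (rule ito_estimate_at[where A="{()}" and z="\<lambda>_. 0" and I="\<lambda>_. I", OF t _ I \<kappa> \<delta>])
      show "AE \<omega> in M. \<forall>r\<in>{0..t}. ennreal (\<Sum>k\<in>{()}. (b r t (X r \<omega>) (\<alpha> r \<omega>) - inner (B r (xt r \<omega>) (\<alpha> r \<omega>)) (v t))\<^sup>2) \<le> ?\<kappa> r \<omega>"
        by (intro AE_I2 ballI q\<delta>) (use t in \<open>auto intro!: drift_diff_le\<close>)
      show "AE \<omega> in M. \<forall>r\<in>{0..t}. ennreal (\<Sum>k\<in>{()}. (norm (\<sigma> r t (X r \<omega>) (\<alpha> r \<omega>) - coord (v t) (S r (xt r \<omega>) (\<alpha> r \<omega>))))\<^sup>2) \<le> ?\<kappa> r \<omega>"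
        by (intro AE_I2 ballI q\<delta>) (use t in \<open>auto intro!: vol_diff_le\<close>)
    qed simp
    then show "(\<integral>\<^sup>+\<omega>. gate (of_nat N) ?\<delta> t \<omega> * ?\<delta> t \<omega> \<partial>M)
      \<le> ennreal 0 + ennreal (3 * T + 24) * (\<integral>\<^sup>+\<omega>. energy (\<lambda>r \<omega>. gate (of_nat N) ?\<delta> r \<omega> * ?\<kappa> r \<omega>) t \<omega> \<partial>M)"
      by (simp add: val_eq[OF t] inner_commute[of "v t"])
  qed simp_all
  then have "(\<integral>\<^sup>+\<omega>. ?\<delta> t \<omega> \<partial>M) = 0" by simp
  moreover have "?\<delta> t \<in> borel_measurable M" by (rule measurable_F_M[OF progressive_section[OF \<delta> t]])
  ultimately have "AE \<omega> in M. ?\<delta> t \<omega> = 0" by (simp add: nn_integral_0_iff_AE)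
  then show ?thesis by eventually_elim (simp add: ennreal_eq_0_iff)
qed

text \<open>X^{0,m} starts from the exact value \<open>x0\<close>, whereas the coordinate sum starts
  from the evaluation at 0 of the projected initial datum.\<close>

definition init_error :: "nat \<Rightarrow> real" where
  "init_error m = x0 - (\<Sum>k=1..m. vk k 0 * inner xx (e k))"

lemma init_error_tendsto: "init_error \<longlonglongrightarrow> 0"
proof -
  have "(\<lambda>m. inner (v 0) (basis_proj e m xx)) \<longlonglongrightarrow> inner (v 0) xx"
    by (intro tendsto_intros basis_proj_tendsto basis)
  moreover have "inner (v 0) xx = x0" using xx T_pos val_eq[of 0 xx] by simp
  ultimately have "(\<lambda>m. x0 - inner (v 0) (basis_proj e m xx)) \<longlonglongrightarrow> x0 - x0" by (intro tendsto_intros) simp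
  then show ?thesis by (simp add: init_error_def[abs_def] inner_basis_proj[OF basis])
qed

section \<open>The zeroth component of the truncated system in terms of the others\<close>

lemma Xm_ito:
  assumes m: "1 \<le> m"
  shows "k \<in> {1..m} \<Longrightarrow> ito_process M F W T (inner xx (e k)) (\<lambda>r \<omega>. inner (B r (Xm m 0 r \<omega>) (\<alpha> r \<omega>)) (e k))
      (\<lambda>r \<omega>. coord (e k) (S r (Xm m 0 r \<omega>) (\<alpha> r \<omega>))) (Xm m k)"
    and "ito_process M F W T x0
      (\<lambda>r \<omega>. (\<Sum>k=1..m. wderiv T (vk k) r * Xm m k r \<omega>) + (\<Sum>k=1..m. vk k r * inner (B r (Xm m 0 r \<omega>) (\<alpha> r \<omega>)) (e k)))
      (\<lambda>r \<omega>. \<Sum>k=1..m. vk k r *\<^sub>R coord (e k) (S r (Xm m 0 r \<omega>) (\<alpha> r \<omega>))) (Xm m 0)"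
  using trunc m unfolding truncated_system_def drift_coeff_def vol_coeff_def coord_def by blast+

lemma Xm_process:
  assumes "1 \<le> m" "k \<le> m"
  shows "progressive F T (Xm m k)" "AE \<omega> in M. continuous_on {0..T} (\<lambda>t. Xm m k t \<omega>)"
proof -
  have "continuous_process M F T (Xm m k)"
  proof (cases "k = 0")
    case True then show ?thesis using Xm_ito(2)[OF assms(1)] by (simp add: ito_process_def)
  next
    case False then show ?thesis using Xm_ito(1)[OF assms(1), of k] assms by (simp add: ito_process_def)
  qed
  then show "progressive F T (Xm m k)" "AE \<omega> in M. continuous_on {0..T} (\<lambda>t. Xm m k t \<omega>)"
    by (simp_all add: continuous_process_def)
qed

lemma Xm_real_ito:
  assumes m: "1 \<le> m"
  obtains I where "\<And>k Q. k \<in> {1..m} \<Longrightarrow> finite Q \<Longrightarrow> Q \<subseteq> {0..T} \<Longrightarrow> real_ito T Q (inner xx (e k)) (\<lambda>r \<omega>. inner (B r (Xm m 0 r \<omega>) (\<alpha> r \<omega>)) (e k))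
      (\<lambda>r \<omega>. coord (e k) (S r (Xm m 0 r \<omega>) (\<alpha> r \<omega>))) (I k) (Xm m k)"
proof -
  let ?P = "\<lambda>k I. \<forall>Q. finite Q \<longrightarrow> Q \<subseteq> {0..T} \<longrightarrow> real_ito T Q (inner xx (e k)) (\<lambda>r \<omega>. inner (B r (Xm m 0 r \<omega>) (\<alpha> r \<omega>)) (e k))
      (\<lambda>r \<omega>. coord (e k) (S r (Xm m 0 r \<omega>) (\<alpha> r \<omega>))) I (Xm m k)"
  have "\<forall>k\<in>{1..m}. \<exists>I. ?P k I"
    by (intro ballI real_ito_process_real Xm_ito(1)[OF m] T_nonneg)
  then obtain I where I: "\<forall>k\<in>{1..m}. ?P k (I k)" by (rule bchoice[THEN exE])
  show ?thesis
  proof (rule that)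
    fix k Q assume "k \<in> {1..m}" and Q: "finite Q" "Q \<subseteq> {0..T}"
    from I[THEN bspec, OF this(1)] Q
    show "real_ito T Q (inner xx (e k)) (\<lambda>r \<omega>. inner (B r (Xm m 0 r \<omega>) (\<alpha> r \<omega>)) (e k))
      (\<lambda>r \<omega>. coord (e k) (S r (Xm m 0 r \<omega>) (\<alpha> r \<omega>))) (I k) (Xm m k)" by blast
  qed
qed

text \<open>The product rule gives the identity almost surely at each fixed time; continuity of both
  sides gives it at all times simultaneously.\<close>

lemma Xm0_eq:
  assumes m: "1 \<le> m"
  shows "AE \<omega> in M. \<forall>t\<in>{0..T}. Xm m 0 t \<omega> = init_error m + (\<Sum>k=1..m. vk k t * Xm m k t \<omega>)"
proof -
  obtain I where I: "\<And>k Q. k \<in> {1..m} \<Longrightarrow> finite Q \<Longrightarrow> Q \<subseteq> {0..T} \<Longrightarrow> real_ito T Q (inner xx (e k)) (\<lambda>r \<omega>. inner (B r (Xm m 0 r \<omega>) (\<alpha> r \<omega>)) (e k))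
      (\<lambda>r \<omega>. coord (e k) (S r (Xm m 0 r \<omega>) (\<alpha> r \<omega>))) (I k) (Xm m k)"
    by (rule Xm_real_ito[OF m], rule that, assumption+)
  obtain J where J: "\<forall>Q. finite Q \<longrightarrow> Q \<subseteq> {0..T} \<longrightarrow> real_ito T Q x0
      (\<lambda>r \<omega>. (\<Sum>k=1..m. wderiv T (vk k) r * Xm m k r \<omega>) + (\<Sum>k=1..m. vk k r * inner (B r (Xm m 0 r \<omega>) (\<alpha> r \<omega>)) (e k)))
      (\<lambda>r \<omega>. \<Sum>k=1..m. vk k r *\<^sub>R coord (e k) (S r (Xm m 0 r \<omega>) (\<alpha> r \<omega>))) J (Xm m 0)"
    using real_ito_process_real[OF Xm_ito(2)[OF m] T_nonneg] by (rule exE)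
  have pt: "AE \<omega> in M. Xm m 0 t \<omega> = x0 - (\<Sum>k\<in>{1..m}. vk k 0 * inner xx (e k)) + (\<Sum>k\<in>{1..m}. vk k t * Xm m k t \<omega>)"
    if t: "t \<in> {0..T}" for t
  proof (rule ito_product_rule[OF T_nonneg finite_atLeastAtMost vk_continuous weak_deriv_integrable[OF vk_weak_deriv] _ I _ _ t])
    show "vk k u - vk k s = (LINT r:{s..u}|lborel. wderiv T (vk k) r)" if "0 \<le> s" "s \<le> u" "u \<le> T" for k s u
      by (rule weak_deriv_FTC[OF T_pos vk_continuous vk_weak_deriv that])
    show "AE \<omega> in M. continuous_on {0..T} (\<lambda>t. Xm m k t \<omega>)" if "k \<in> {1..m}" for k
      using Xm_process(2)[OF m, of k] that by simp
    fix Q :: "real set" assume "finite Q" "Q \<subseteq> {0..T}"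
    with J show "real_ito T Q x0
      (\<lambda>r \<omega>. (\<Sum>k=1..m. wderiv T (vk k) r * Xm m k r \<omega>) + (\<Sum>k=1..m. vk k r * inner (B r (Xm m 0 r \<omega>) (\<alpha> r \<omega>)) (e k)))
      (\<lambda>r \<omega>. \<Sum>k=1..m. vk k r *\<^sub>R coord (e k) (S r (Xm m 0 r \<omega>) (\<alpha> r \<omega>))) J (Xm m 0)" by blast
  qed
  have "AE \<omega> in M. \<forall>k\<in>{0..m}. continuous_on {0..T} (\<lambda>t. Xm m k t \<omega>)"
    using Xm_process(2)[OF m] by (simp add: AE_finite_all)
  then have "AE \<omega> in M. continuous_on {0..T} (\<lambda>t. Xm m 0 t \<omega> - (init_error m + (\<Sum>k=1..m. vk k t * Xm m k t \<omega>)))"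
    by eventually_elim (intro continuous_intros vk_continuous, simp_all)
  from AE_all_times[OF T_pos this] pt
  have "AE \<omega> in M. \<forall>t\<in>{0..T}. Xm m 0 t \<omega> - (init_error m + (\<Sum>k=1..m. vk k t * Xm m k t \<omega>)) = 0"
    by (simp add: init_error_def)
  then show ?thesis by simp
qed


section \<open>The projection error of the lifted process\<close>

definition proj_err :: "nat \<Rightarrow> real \<Rightarrow> 'w \<Rightarrow> 'h" where
  "proj_err m t \<omega> = XX t \<omega> - basis_proj e m (XX t \<omega>)"

lemma proj_err_le: "ennreal ((norm (proj_err m t \<omega>))\<^sup>2) \<le> ennreal ((norm (XX t \<omega>))\<^sup>2)"
  unfolding proj_err_def by (intro ennreal_leI power_mono norm_diff_basis_proj_le[OF basis]) simp

lemma proj_err_limit: "(\<lambda>m. ennreal ((norm (proj_err m t \<omega>))\<^sup>2)) \<longlonglongrightarrow> 0"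
proof -
  have "(\<lambda>m. (norm (proj_err m t \<omega>))\<^sup>2) \<longlonglongrightarrow> (norm (XX t \<omega> - XX t \<omega>))\<^sup>2"
    unfolding proj_err_def by (intro tendsto_intros basis_proj_tendsto basis)
  then show ?thesis using tendsto_ennrealI by fastforce
qed

lemma proj_err_progressive: "progressive F T (\<lambda>t \<omega>. ennreal ((norm (proj_err m t \<omega>))\<^sup>2))"
proof -
  have "progressive F T (\<lambda>t \<omega>. proj_err m t \<omega>)"
    unfolding proj_err_def basis_proj_def
    by (intro progressive_diff progressive_sum progressive_scaleR XX_progressive XX_coord_progressive progressive_const)
  from progressive_compose[OF this, of "\<lambda>h. ennreal ((norm h)\<^sup>2)"] show ?thesis by measurable
qed

text \<open>Dominated convergence with the squared norm of \<open>XX t\<close>, which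
  \<open>XX_moment\<close> makes integrable.\<close>

lemma proj_err_expectation:
  assumes t: "t \<in> {0..T}"
  shows "(\<lambda>m. \<integral>\<^sup>+\<omega>. ennreal ((norm (proj_err m t \<omega>))\<^sup>2) \<partial>M) \<longlonglongrightarrow> 0"
proof -
  have "(\<lambda>m. \<integral>\<^sup>+\<omega>. ennreal ((norm (proj_err m t \<omega>))\<^sup>2) \<partial>M) \<longlonglongrightarrow> (\<integral>\<^sup>+\<omega>. 0 \<partial>M)"
  proof (rule nn_integral_dominated_convergence[where w="\<lambda>\<omega>. ennreal ((norm (XX t \<omega>))\<^sup>2)"])
    show "(\<lambda>\<omega>. ennreal ((norm (proj_err m t \<omega>))\<^sup>2)) \<in> borel_measurable M" for m
      by (rule measurable_F_M[OF progressive_section[OF proj_err_progressive t]])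
    show "(\<lambda>\<omega>. ennreal ((norm (XX t \<omega>))\<^sup>2)) \<in> borel_measurable M"
      by (rule measurable_F_M[OF progressive_section[OF XX_norm_progressive t]])
    show "(\<integral>\<^sup>+\<omega>. ennreal ((norm (XX t \<omega>))\<^sup>2) \<partial>M) < \<infinity>"
      using XX_moment[OF t] by (rule le_less_trans) simp
  qed (simp_all add: proj_err_le proj_err_limit)
  then show ?thesis by simp
qed

definition proj_energy :: "nat \<Rightarrow> ennreal" where
  "proj_energy m = (\<integral>\<^sup>+\<omega>. energy (\<lambda>t \<omega>. ennreal ((norm (proj_err m t \<omega>))\<^sup>2)) T \<omega> \<partial>M)"

lemma XX_energy_moment: "(\<integral>\<^sup>+\<omega>. energy (\<lambda>t \<omega>. ennreal ((norm (XX t \<omega>))\<^sup>2)) T \<omega> \<partial>M) < \<infinity>"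
proof -
  have "(\<integral>\<^sup>+\<omega>. energy (\<lambda>t \<omega>. ennreal ((norm (XX t \<omega>))\<^sup>2)) T \<omega> \<partial>M) = (\<integral>\<^sup>+r\<in>{0..T}. (\<integral>\<^sup>+\<omega>. ennreal ((norm (XX r \<omega>))\<^sup>2) \<partial>M) \<partial>lborel)"
    by (rule fubini_energy[OF XX_norm_progressive]) (use T_pos in simp)
  also have "\<dots> \<le> (\<integral>\<^sup>+r. ennreal moment * indicator {0..T} r \<partial>lborel)"
    using XX_moment by (intro nn_integral_mono) (auto simp: indicator_def)
  also have "\<dots> < \<infinity>" using T_pos by (simp add: nn_integral_cmult_indicator ennreal_mult_less_top)
  finally show ?thesis .
qed

lemma proj_energy_finite: "proj_energy m < \<infinity>"
  unfolding proj_energy_def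
  by (rule le_less_trans[OF nn_integral_mono XX_energy_moment]) (intro energy_mono_fun proj_err_le)

text \<open>Dominated convergence twice: in time along almost every path, with the squared norm of
  the lifted process as majorant, and in expectation, with its energy.\<close>

lemma proj_energy_tendsto: "proj_energy \<longlonglongrightarrow> 0"
proof -
  let ?e = "\<lambda>m. energy (\<lambda>t \<omega>. ennreal ((norm (proj_err m t \<omega>))\<^sup>2)) T"
  have "(\<lambda>m. \<integral>\<^sup>+\<omega>. ?e m \<omega> \<partial>M) \<longlonglongrightarrow> (\<integral>\<^sup>+\<omega>. 0 \<partial>M)"
  proof (rule nn_integral_dominated_convergence[where w="energy (\<lambda>t \<omega>. ennreal ((norm (XX t \<omega>))\<^sup>2)) T"])
    show "?e m \<in> borel_measurable M" for m by (rule energy_measurableM[OF proj_err_progressive T_nonneg])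
    show "energy (\<lambda>t \<omega>. ennreal ((norm (XX t \<omega>))\<^sup>2)) T \<in> borel_measurable M"
      by (rule energy_measurableM[OF XX_norm_progressive T_nonneg])
    show "AE \<omega> in M. (\<lambda>m. ?e m \<omega>) \<longlonglongrightarrow> 0"
      using XX_energy_finite AE_space
    proof eventually_elim
      case (elim \<omega>)
      have "(\<lambda>m. \<integral>\<^sup>+r. ennreal ((norm (proj_err m r \<omega>))\<^sup>2) * indicator {0..T} r \<partial>lborel) \<longlonglongrightarrow> (\<integral>\<^sup>+(r::real). 0 \<partial>lborel)"
      proof (rule nn_integral_dominated_convergence[where w="\<lambda>r. ennreal ((norm (XX r \<omega>))\<^sup>2) * indicator {0..T} r"])
        show "(\<lambda>r. ennreal ((norm (proj_err m r \<omega>))\<^sup>2) * indicator {0..T} r) \<in> borel_measurable lborel" for m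
          using progressive_path_meas[OF proj_err_progressive T_nonneg elim(2)] by (simp add: path_meas_def)
        show "(\<lambda>r. ennreal ((norm (XX r \<omega>))\<^sup>2) * indicator {0..T} r) \<in> borel_measurable lborel"
          using progressive_path_meas[OF XX_norm_progressive T_nonneg elim(2)] by (simp add: path_meas_def)
        show "AE r in lborel. ennreal ((norm (proj_err m r \<omega>))\<^sup>2) * indicator {0..T} r \<le> ennreal ((norm (XX r \<omega>))\<^sup>2) * indicator {0..T} r" for m
          by (intro AE_I2 mult_right_mono proj_err_le) simp
        show "(\<integral>\<^sup>+r. ennreal ((norm (XX r \<omega>))\<^sup>2) * indicator {0..T} r \<partial>lborel) < \<infinity>"
          using elim(1) by (simp add: energy_def)
        have "(\<lambda>m. ennreal ((norm (proj_err m r \<omega>))\<^sup>2) * indicator {0..T} r) \<longlonglongrightarrow> 0" for r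
          by (cases "r \<in> {0..T}") (simp_all add: proj_err_limit)
        then show "AE r in lborel. (\<lambda>m. ennreal ((norm (proj_err m r \<omega>))\<^sup>2) * indicator {0..T} r) \<longlonglongrightarrow> 0" by simp
      qed simp
      then show ?case by (simp add: energy_def)
    qed
    show "AE \<omega> in M. ?e m \<omega> \<le> energy (\<lambda>t \<omega>. ennreal ((norm (XX t \<omega>))\<^sup>2)) T \<omega>" for m
      by (intro AE_I2 energy_mono_fun proj_err_le)
  qed (use XX_energy_moment in simp_all)
  then show ?thesis by (simp add: proj_energy_def[abs_def])
qed

section \<open>Mean-square bounds for the coordinate errors\<close>

definition coeff_err :: "nat \<Rightarrow> nat \<Rightarrow> real \<Rightarrow> 'w \<Rightarrow> real" where
  "coeff_err m k t \<omega> = Xm m k t \<omega> - inner (XX t \<omega>) (e k)"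

lemma coeff_err_progressive: "1 \<le> m \<Longrightarrow> k \<le> m \<Longrightarrow> progressive F T (coeff_err m k)"
  unfolding coeff_err_def[abs_def] by (intro progressive_diff Xm_process XX_coord_progressive)

lemma coeff_err_real_ito:
  assumes m: "1 \<le> m"
  obtains I where "\<And>k Q. k \<in> {1..m} \<Longrightarrow> finite Q \<Longrightarrow> Q \<subseteq> {0..T} \<Longrightarrow> real_ito T Q 0
      (\<lambda>r \<omega>. inner (B r (Xm m 0 r \<omega>) (\<alpha> r \<omega>)) (e k) - inner (B r (xt r \<omega>) (\<alpha> r \<omega>)) (e k))
      (\<lambda>r \<omega>. coord (e k) (S r (Xm m 0 r \<omega>) (\<alpha> r \<omega>)) - coord (e k) (S r (xt r \<omega>) (\<alpha> r \<omega>))) (I k) (coeff_err m k)"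
proof -
  obtain I where I: "\<And>k Q. k \<in> {1..m} \<Longrightarrow> finite Q \<Longrightarrow> Q \<subseteq> {0..T} \<Longrightarrow> real_ito T Q (inner xx (e k)) (\<lambda>r \<omega>. inner (B r (Xm m 0 r \<omega>) (\<alpha> r \<omega>)) (e k))
      (\<lambda>r \<omega>. coord (e k) (S r (Xm m 0 r \<omega>) (\<alpha> r \<omega>))) (I k) (Xm m k)"
    by (rule Xm_real_ito[OF m], rule that, assumption+)
  let ?P = "\<lambda>k I. \<forall>Q. finite Q \<longrightarrow> Q \<subseteq> {0..T} \<longrightarrow> real_ito T Q (inner xx (e k)) (\<lambda>r \<omega>. inner (B r (xt r \<omega>) (\<alpha> r \<omega>)) (e k))
      (\<lambda>r \<omega>. coord (e k) (S r (xt r \<omega>) (\<alpha> r \<omega>))) I (\<lambda>t \<omega>. inner (XX t \<omega>) (e k))"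
  have "\<forall>k. \<exists>I. ?P k I"
  proof
    fix k show "\<exists>I. ?P k I"
      by (rule XX_real_ito[of "e k"], intro exI allI impI, assumption)
  qed
  then obtain J where "\<forall>k. ?P k (J k)" by (rule choice[THEN exE])
  then have J: "?P k (J k)" for k by (rule spec)
  show ?thesis
  proof (rule that)
    fix k Q assume k: "k \<in> {1..m}" and Q: "finite Q" "Q \<subseteq> {0..T}"
    from real_ito_diff[OF I[OF k Q] J[of k, rule_format, OF Q] T_nonneg Q(2)]
    show "real_ito T Q 0
      (\<lambda>r \<omega>. inner (B r (Xm m 0 r \<omega>) (\<alpha> r \<omega>)) (e k) - inner (B r (xt r \<omega>) (\<alpha> r \<omega>)) (e k))
      (\<lambda>r \<omega>. coord (e k) (S r (Xm m 0 r \<omega>) (\<alpha> r \<omega>)) - coord (e k) (S r (xt r \<omega>) (\<alpha> r \<omega>))) (\<lambda>t \<omega>. I k t \<omega> - J k t \<omega>) (coeff_err m k)"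
      by (simp add: coeff_err_def[abs_def])
  qed
qed

lemma Xm0_sub_xt:
  assumes m: "1 \<le> m"
  shows "AE \<omega> in M. \<forall>t\<in>{0..T}. Xm m 0 t \<omega> - (\<Sum>k=1..m. vk k t * inner (XX t \<omega>) (e k)) = init_error m + (\<Sum>k=1..m. vk k t * coeff_err m k t \<omega>)"
  using Xm0_eq[OF m] by eventually_elim (simp add: coeff_err_def right_diff_distrib sum_subtractf)

lemma trunc_sum_eq:
  assumes "t \<in> {0..T}"
  shows "(\<Sum>k=1..m. vk k t * inner (XX t \<omega>) (e k)) = xt t \<omega> - inner (v t) (proj_err m t \<omega>)"
  unfolding proj_err_def inner_diff_right val_eq[OF assms] by (simp add: inner_basis_proj[OF basis])

text \<open>Feedback constant of the error: the Lipschitz constant times the squared bound on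
  evaluation, with 3 for the square of a sum of three terms.\<close>

definition rate :: real where
  "rate = 3 * lip_const * eval_const\<^sup>2"

text \<open>The part of the bound on the coefficient differences that is free of the coordinate
  errors: initial error and projection error.\<close>

definition forcing :: "nat \<Rightarrow> real \<Rightarrow> 'w \<Rightarrow> ennreal" where
  "forcing m r \<omega> = ennreal (3 * lip_const * (init_error m)\<^sup>2) + ennreal rate * ennreal ((norm (proj_err m r \<omega>))\<^sup>2)"

definition total_err :: "nat \<Rightarrow> real \<Rightarrow> 'w \<Rightarrow> ennreal" where
  "total_err m r \<omega> = ennreal (\<Sum>k=1..m. (coeff_err m k r \<omega>)\<^sup>2)"

text \<open>Bounds the expected energy of \<open>forcing m\<close>. The conversion to a real loses
  nothing by \<open>proj_energy_finite\<close> and permits limits of real sequences.\<close>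

definition input :: "nat \<Rightarrow> real" where
  "input m = 3 * lip_const * (init_error m)\<^sup>2 * T + rate * enn2real (proj_energy m)"

text \<open>The constant of \<open>gronwall_estimate\<close> for the total error. The summand 0 is
  the initial value, since \<open>Xm m k\<close> and the k-th coordinate of \<open>XX\<close> start
  from the same number.\<close>

definition err_bound :: "nat \<Rightarrow> real" where
  "err_bound m = 2 * (0 + (3 * T + 24) * input m) * exp (2 * ((3 * T + 24) * rate) * T)"

lemma rate_pos: "0 < rate"
proof -
  have "1 \<le> eval_const\<^sup>2" using eval_const(1) by simp
  then show ?thesis unfolding rate_def using lip_const_pos by (intro mult_pos_pos) auto
qed

lemma input_nonneg: "0 \<le> input m"
  unfolding input_def using lip_const_pos rate_pos T_pos by (intro add_nonneg_nonneg mult_nonneg_nonneg) auto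

lemma err_bound_nonneg: "0 \<le> err_bound m"
  unfolding err_bound_def using input_nonneg T_pos by (intro mult_nonneg_nonneg add_nonneg_nonneg) auto

lemma input_tendsto: "input \<longlonglongrightarrow> 0"
proof -
  have en: "(\<lambda>m. enn2real (proj_energy m)) \<longlonglongrightarrow> 0"
    by (rule tendsto_enn2real) (use proj_energy_tendsto in simp_all)
  have "input \<longlonglongrightarrow> 3 * lip_const * 0\<^sup>2 * T + rate * 0"
    unfolding input_def[abs_def] by (intro tendsto_add tendsto_mult tendsto_power tendsto_const init_error_tendsto en)
  then show ?thesis by simp
qed

lemma err_bound_tendsto: "err_bound \<longlonglongrightarrow> 0"
proof -
  have "err_bound \<longlonglongrightarrow> 2 * (0 + (3 * T + 24) * 0) * exp (2 * ((3 * T + 24) * rate) * T)"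
    unfolding err_bound_def[abs_def] by (intro tendsto_intros input_tendsto)
  then show ?thesis by simp
qed

lemma forcing_progressive: "progressive F T (forcing m)"
  unfolding forcing_def[abs_def]
  by (intro progressive_add progressive_mult_ennreal progressive_const proj_err_progressive)

lemma total_err_progressive: "1 \<le> m \<Longrightarrow> progressive F T (total_err m)"
  unfolding total_err_def[abs_def]
proof (rule progressive_compose[where f=ennreal])
  assume m: "1 \<le> m"
  show "progressive F T (\<lambda>t \<omega>. \<Sum>k=1..m. (coeff_err m k t \<omega>)\<^sup>2)"
  proof (rule progressive_sum)
    fix k assume "k \<in> {1..m}"
    then have "progressive F T (coeff_err m k)" using m by (intro coeff_err_progressive) auto
    from progressive_compose[OF this, of "\<lambda>x. x\<^sup>2"] show "progressive F T (\<lambda>t \<omega>. (coeff_err m k t \<omega>)\<^sup>2)" by measurable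
  qed
qed measurable

lemma forcing_energy: "(\<integral>\<^sup>+\<omega>. energy (forcing m) T \<omega> \<partial>M) \<le> ennreal (input m)"
proof -
  let ?g = "\<lambda>r \<omega>. ennreal ((norm (proj_err m r \<omega>))\<^sup>2)"
  have "(\<integral>\<^sup>+\<omega>. energy (forcing m) T \<omega> \<partial>M) = (\<integral>\<^sup>+\<omega>. ennreal (3 * lip_const * (init_error m)\<^sup>2 * T) + ennreal rate * energy ?g T \<omega> \<partial>M)"
  proof (rule nn_integral_cong)
    fix \<omega> assume \<omega>: "\<omega> \<in> space M"
    have pc: "path_meas T (\<lambda>_ _. c) \<omega>" for c by (simp add: path_meas_def)
    note pg = progressive_path_meas[OF proj_err_progressive T_nonneg \<omega>, of m]
    have "energy (forcing m) T \<omega> = energy (\<lambda>_ _. ennreal (3 * lip_const * (init_error m)\<^sup>2)) T \<omega> + ennreal rate * energy ?g T \<omega>"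
      unfolding forcing_def[abs_def]
      by (simp add: energy_add[OF pc path_meas_mult[OF pc pg]] energy_cmult[OF pg])
    also have "energy (\<lambda>_ _. ennreal (3 * lip_const * (init_error m)\<^sup>2)) T \<omega> = ennreal (3 * lip_const * (init_error m)\<^sup>2 * T)"
      using T_pos lip_const_pos by (simp add: energy_def nn_integral_cmult_indicator ennreal_mult)
    finally show "energy (forcing m) T \<omega> = ennreal (3 * lip_const * (init_error m)\<^sup>2 * T) + ennreal rate * energy ?g T \<omega>" .
  qed
  also have "\<dots> = ennreal (3 * lip_const * (init_error m)\<^sup>2 * T) + ennreal rate * proj_energy m"
    using energy_measurableM[OF proj_err_progressive T_nonneg]
    by (simp add: nn_integral_add nn_integral_cmult emeasure_space_1 proj_energy_def)
  also have "proj_energy m = ennreal (enn2real (proj_energy m))" using proj_energy_finite[of m] by simp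
  also have "ennreal (3 * lip_const * (init_error m)\<^sup>2 * T) + ennreal rate * ennreal (enn2real (proj_energy m)) = ennreal (input m)"
    unfolding input_def using T_pos lip_const_pos rate_pos by (simp add: ennreal_plus ennreal_mult)
  finally show ?thesis by simp
qed

lemma err_source_le:
  assumes m: "1 \<le> m"
  shows "AE \<omega> in M. \<forall>r\<in>{0..T}. ennreal (lip_const * (Xm m 0 r \<omega> - xt r \<omega>)\<^sup>2) \<le> forcing m r \<omega> + ennreal rate * total_err m r \<omega>"
  using Xm0_sub_xt[OF m]
proof eventually_elim
  case (elim \<omega>)
  show ?case
  proof
    fix r assume r: "r \<in> {0..T}"
    \<comment> \<open>The three sources of error: the initial mismatch \<open>a\<close>, the
      coordinate errors \<open>u\<close> seen through \<open>v r\<close>, and the tail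
      \<open>w\<close> that the truncation omits. Only \<open>u\<close> is fed back into Gronwall's
      lemma, with a factor free of \<open>m\<close>.\<close>
    define a u w where "a = init_error m" and "u = (\<Sum>k=1..m. vk k r * coeff_err m k r \<omega>)" and "w = inner (v r) (proj_err m r \<omega>)"
    have "Xm m 0 r \<omega> - xt r \<omega> = a + u - w"
      using elim[THEN bspec, OF r] unfolding trunc_sum_eq[OF r] by (simp add: a_def u_def w_def)
    moreover have "(a + u - w)\<^sup>2 \<le> 3 * (a\<^sup>2 + u\<^sup>2 + w\<^sup>2)"
    proof -
      have "0 \<le> (a - u)\<^sup>2 + (a + w)\<^sup>2 + (u + w)\<^sup>2" by simp
      then show ?thesis by (simp add: power2_eq_square algebra_simps)
    qed
    moreover have "u\<^sup>2 \<le> eval_const\<^sup>2 * (\<Sum>k=1..m. (coeff_err m k r \<omega>)\<^sup>2)"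
      unfolding u_def by (rule order_trans[OF basis_sum_power2_le[OF basis]], rule mult_right_mono[OF power2_norm_v_le[OF r]]) (simp add: sum_nonneg)
    moreover have "w\<^sup>2 \<le> eval_const\<^sup>2 * (norm (proj_err m r \<omega>))\<^sup>2" unfolding w_def by (rule power2_inner_v_le[OF r])
    ultimately have "(Xm m 0 r \<omega> - xt r \<omega>)\<^sup>2 \<le> 3 * (a\<^sup>2 + eval_const\<^sup>2 * (\<Sum>k=1..m. (coeff_err m k r \<omega>)\<^sup>2) + eval_const\<^sup>2 * (norm (proj_err m r \<omega>))\<^sup>2)"
      by simp
    then have "lip_const * (Xm m 0 r \<omega> - xt r \<omega>)\<^sup>2 \<le> lip_const * (3 * (a\<^sup>2 + eval_const\<^sup>2 * (\<Sum>k=1..m. (coeff_err m k r \<omega>)\<^sup>2) + eval_const\<^sup>2 * (norm (proj_err m r \<omega>))\<^sup>2))"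
      using lip_const_pos by (intro mult_left_mono) auto
    also have "\<dots> = 3 * lip_const * a\<^sup>2 + rate * (norm (proj_err m r \<omega>))\<^sup>2 + rate * (\<Sum>k=1..m. (coeff_err m k r \<omega>)\<^sup>2)"
      by (simp add: rate_def algebra_simps)
    finally have "ennreal (lip_const * (Xm m 0 r \<omega> - xt r \<omega>)\<^sup>2) \<le> ennreal (3 * lip_const * a\<^sup>2 + rate * (norm (proj_err m r \<omega>))\<^sup>2 + rate * (\<Sum>k=1..m. (coeff_err m k r \<omega>)\<^sup>2))"
      by (rule ennreal_leI)
    also have "\<dots> = forcing m r \<omega> + ennreal rate * total_err m r \<omega>"
      using lip_const_pos rate_pos by (simp add: forcing_def total_err_def a_def ennreal_plus ennreal_mult sum_nonneg)
    finally show "ennreal (lip_const * (Xm m 0 r \<omega> - xt r \<omega>)\<^sup>2) \<le> forcing m r \<omega> + ennreal rate * total_err m r \<omega>" .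
  qed
qed

text \<open>Bessel's inequality collapses the sum over coordinates into a norm in the Hilbert space,
  to which the Lipschitz bound applies. Drift and volatility thus share one majorant, and the number
  of coordinates does not enter its constants.\<close>

lemma coeff_err_source:
  assumes m: "1 \<le> m"
  shows "AE \<omega> in M. \<forall>r\<in>{0..T}. ennreal (\<Sum>k=1..m. (inner (B r (Xm m 0 r \<omega>) (\<alpha> r \<omega>)) (e k) - inner (B r (xt r \<omega>) (\<alpha> r \<omega>)) (e k))\<^sup>2)
      \<le> forcing m r \<omega> + ennreal rate * total_err m r \<omega>"
    and "AE \<omega> in M. \<forall>r\<in>{0..T}. ennreal (\<Sum>k=1..m. (norm (coord (e k) (S r (Xm m 0 r \<omega>) (\<alpha> r \<omega>)) - coord (e k) (S r (xt r \<omega>) (\<alpha> r \<omega>))))\<^sup>2)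
      \<le> forcing m r \<omega> + ennreal rate * total_err m r \<omega>"
proof -
  have *: "AE \<omega> in M. \<forall>r\<in>{0..T}. ennreal (f r \<omega>) \<le> forcing m r \<omega> + ennreal rate * total_err m r \<omega>"
    if f: "\<And>r \<omega>. r \<in> {0..T} \<Longrightarrow> f r \<omega> \<le> lip_const * (Xm m 0 r \<omega> - xt r \<omega>)\<^sup>2" for f
    using err_source_le[OF m]
  proof eventually_elim
    case (elim \<omega>)
    show ?case
    proof
      fix r assume r: "r \<in> {0..T}"
      show "ennreal (f r \<omega>) \<le> forcing m r \<omega> + ennreal rate * total_err m r \<omega>"
        by (rule order_trans[OF ennreal_leI[OF f[OF r]] elim[THEN bspec, OF r]])
    qed
  qed
  show "AE \<omega> in M. \<forall>r\<in>{0..T}. ennreal (\<Sum>k=1..m. (inner (B r (Xm m 0 r \<omega>) (\<alpha> r \<omega>)) (e k) - inner (B r (xt r \<omega>) (\<alpha> r \<omega>)) (e k))\<^sup>2)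
      \<le> forcing m r \<omega> + ennreal rate * total_err m r \<omega>"
    by (rule *, unfold inner_diff_left[symmetric]) (rule order_trans[OF bessel[OF basis] lip_const(1)])
  show "AE \<omega> in M. \<forall>r\<in>{0..T}. ennreal (\<Sum>k=1..m. (norm (coord (e k) (S r (Xm m 0 r \<omega>) (\<alpha> r \<omega>)) - coord (e k) (S r (xt r \<omega>) (\<alpha> r \<omega>))))\<^sup>2)
      \<le> forcing m r \<omega> + ennreal rate * total_err m r \<omega>"
    by (rule *, unfold coord_diff[symmetric]) (rule order_trans[OF sum_norm_coord_le[OF basis] lip_const(2)])
qed

lemma source_progressive: "1 \<le> m \<Longrightarrow> progressive F T (\<lambda>r \<omega>. forcing m r \<omega> + ennreal rate * total_err m r \<omega>)"
  by (rule progressive_add[OF forcing_progressive progressive_mult_ennreal[OF progressive_const total_err_progressive]])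

lemma AE_subinterval: "t \<in> {0..T} \<Longrightarrow> AE \<omega> in M. \<forall>r\<in>{0..T}. P r \<omega> \<Longrightarrow> AE \<omega> in M. \<forall>r\<in>{0..t}. P r \<omega>"
  by (erule eventually_mono) auto

lemma total_err_finite:
  assumes m: "1 \<le> m"
  shows "AE \<omega> in M. energy (total_err m) T \<omega> < \<infinity>"
proof -
  have "AE \<omega> in M. \<forall>k\<in>{0..m}. continuous_on {0..T} (\<lambda>t. Xm m k t \<omega>)"
    using Xm_process(2)[OF m] by (simp add: AE_finite_all)
  with XX_continuous have "AE \<omega> in M. continuous_on {0..T} (\<lambda>t. \<Sum>k=1..m. (coeff_err m k t \<omega>)\<^sup>2)"
    unfolding coeff_err_def by eventually_elim (intro continuous_intros, simp_all)
  then show ?thesis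
  proof eventually_elim
    case (elim \<omega>)
    obtain K where K: "0 \<le> K" "\<And>t. t \<in> {0..T} \<Longrightarrow> norm (\<Sum>k=1..m. (coeff_err m k t \<omega>)\<^sup>2) \<le> K"
      by (rule continuous_on_norm_bound[OF elim], rule that, assumption+)
    show ?case
    proof (rule energy_bounded_finite)
      fix r assume r: "r \<in> {0..T}"
      show "total_err m r \<omega> \<le> ennreal K"
        unfolding total_err_def by (rule ennreal_leI[OF order_trans[OF abs_ge_self K(2)[OF r, unfolded real_norm_def]]])
    qed
  qed
qed

text \<open>Gronwall's lemma for the sum of squared coordinate errors: the initial values cancel, so
  only the forcing contributes and the bound inherits its limit 0.\<close>

lemma total_err_le:
  assumes m: "1 \<le> m" and t: "t \<in> {0..T}"
  shows "(\<integral>\<^sup>+\<omega>. total_err m t \<omega> \<partial>M) \<le> ennreal (err_bound m)"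
  unfolding err_bound_def
proof (rule gronwall_estimate[OF total_err_progressive[OF m] forcing_progressive T_nonneg _ _ rate_pos total_err_finite[OF m] input_nonneg forcing_energy _ t])
  show "0 < 3 * T + 24" using T_pos by simp
  fix N :: nat and t assume t: "t \<in> {0..T}"
  have t0: "0 \<le> t" "t \<le> T" using t by auto
  let ?\<kappa> = "\<lambda>r \<omega>. forcing m r \<omega> + ennreal rate * total_err m r \<omega>"
  obtain I where I: "\<And>k Q. k \<in> {1..m} \<Longrightarrow> finite Q \<Longrightarrow> Q \<subseteq> {0..T} \<Longrightarrow> real_ito T Q 0
      (\<lambda>r \<omega>. inner (B r (Xm m 0 r \<omega>) (\<alpha> r \<omega>)) (e k) - inner (B r (xt r \<omega>) (\<alpha> r \<omega>)) (e k))
      (\<lambda>r \<omega>. coord (e k) (S r (Xm m 0 r \<omega>) (\<alpha> r \<omega>)) - coord (e k) (S r (xt r \<omega>) (\<alpha> r \<omega>))) (I k) (coeff_err m k)"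
    by (rule coeff_err_real_ito[OF m], rule that, assumption+)
  have It: "real_ito t {t} 0
      (\<lambda>r \<omega>. inner (B r (Xm m 0 r \<omega>) (\<alpha> r \<omega>)) (e k) - inner (B r (xt r \<omega>) (\<alpha> r \<omega>)) (e k))
      (\<lambda>r \<omega>. coord (e k) (S r (Xm m 0 r \<omega>) (\<alpha> r \<omega>)) - coord (e k) (S r (xt r \<omega>) (\<alpha> r \<omega>))) (I k) (coeff_err m k)"
    if "k \<in> {1..m}" for k
    by (rule real_ito_subset[OF I[OF that, of "{t}"] t0(2)]) (use t in auto)
  have "(\<integral>\<^sup>+\<omega>. gate (of_nat N) (total_err m) t \<omega> * ennreal (\<Sum>k\<in>{1..m}. (coeff_err m k t \<omega>)\<^sup>2) \<partial>M)
    \<le> ennreal (3 * (\<Sum>k\<in>{1..m}. 0\<^sup>2)) + ennreal (3 * T + 24) * (\<integral>\<^sup>+\<omega>. energy (\<lambda>r \<omega>. gate (of_nat N) (total_err m) r \<omega> * ?\<kappa> r \<omega>) t \<omega> \<partial>M)"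
    by (rule ito_estimate_at[where A="{1..m}" and z="\<lambda>_. 0", OF t finite_atLeastAtMost It source_progressive[OF m] total_err_progressive[OF m]
      AE_subinterval[OF t coeff_err_source(1)[OF m]] AE_subinterval[OF t coeff_err_source(2)[OF m]]])
  then show "(\<integral>\<^sup>+\<omega>. gate (of_nat N) (total_err m) t \<omega> * total_err m t \<omega> \<partial>M)
    \<le> ennreal 0 + ennreal (3 * T + 24) * (\<integral>\<^sup>+\<omega>. energy (\<lambda>r \<omega>. gate (of_nat N) (total_err m) r \<omega> * ?\<kappa> r \<omega>) t \<omega> \<partial>M)"
    by (simp add: total_err_def)
qed simp

text \<open>With the expectation of the total error bounded at every time, the majorant of the
  coefficient differences has finite expected energy without a gate. This feeds the estimate that is
  uniform in time.\<close>

lemma source_energy: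
  assumes m: "1 \<le> m"
  shows "(\<integral>\<^sup>+\<omega>. energy (\<lambda>r \<omega>. forcing m r \<omega> + ennreal rate * total_err m r \<omega>) T \<omega> \<partial>M) \<le> ennreal (input m + rate * (err_bound m * T))"
proof -
  note te = total_err_progressive[OF m]
  have "(\<integral>\<^sup>+\<omega>. energy (total_err m) T \<omega> \<partial>M) = (\<integral>\<^sup>+r\<in>{0..T}. (\<integral>\<^sup>+\<omega>. total_err m r \<omega> \<partial>M) \<partial>lborel)"
    by (rule fubini_energy[OF te]) (use T_pos in simp)
  also have "\<dots> \<le> (\<integral>\<^sup>+r. ennreal (err_bound m) * indicator {0..T} r \<partial>lborel)"
    using total_err_le[OF m] by (intro nn_integral_mono) (auto simp: indicator_def)
  also have "\<dots> = ennreal (err_bound m * T)"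
    using T_pos err_bound_nonneg by (simp add: nn_integral_cmult_indicator ennreal_mult)
  finally have b: "(\<integral>\<^sup>+\<omega>. energy (total_err m) T \<omega> \<partial>M) \<le> ennreal (err_bound m * T)" .
  have "(\<integral>\<^sup>+\<omega>. energy (\<lambda>r \<omega>. forcing m r \<omega> + ennreal rate * total_err m r \<omega>) T \<omega> \<partial>M)
    = (\<integral>\<^sup>+\<omega>. energy (forcing m) T \<omega> + ennreal rate * energy (total_err m) T \<omega> \<partial>M)"
  proof (rule nn_integral_cong)
    fix \<omega> assume \<omega>: "\<omega> \<in> space M"
    have pc: "path_meas T (\<lambda>_ _. c) \<omega>" for c by (simp add: path_meas_def)
    note pt = progressive_path_meas[OF te T_nonneg \<omega>]
    note pf = progressive_path_meas[OF forcing_progressive T_nonneg \<omega>, of m]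
    show "energy (\<lambda>r \<omega>. forcing m r \<omega> + ennreal rate * total_err m r \<omega>) T \<omega> = energy (forcing m) T \<omega> + ennreal rate * energy (total_err m) T \<omega>"
      by (simp add: energy_add[OF pf path_meas_mult[OF pc pt]] energy_cmult[OF pt])
  qed
  also have "\<dots> = (\<integral>\<^sup>+\<omega>. energy (forcing m) T \<omega> \<partial>M) + ennreal rate * (\<integral>\<^sup>+\<omega>. energy (total_err m) T \<omega> \<partial>M)"
    using energy_measurableM[OF forcing_progressive T_nonneg] energy_measurableM[OF te T_nonneg]
    by (simp add: nn_integral_add nn_integral_cmult)
  also have "\<dots> \<le> ennreal (input m) + ennreal rate * ennreal (err_bound m * T)"
    by (intro add_mono mult_left_mono forcing_energy b) simp
  also have "\<dots> = ennreal (input m + rate * (err_bound m * T))"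
    using input_nonneg rate_pos err_bound_nonneg T_pos by (simp add: ennreal_plus ennreal_mult)
  finally show ?thesis .
qed

text \<open>From (a + u)^2 \<le> 2a^2 + 2u^2, the bound on evaluation, and the factor 3T + 24 of
  \<open>ito_estimate\<close> applied to the bound of \<open>source_energy\<close>.\<close>

definition sup_bound :: "nat \<Rightarrow> real" where
  "sup_bound m = 2 * (init_error m)\<^sup>2 + 2 * eval_const\<^sup>2 * ((3 * T + 24) * (input m + rate * (err_bound m * T)))"

lemma sup_bound_tendsto: "sup_bound \<longlonglongrightarrow> 0"
proof -
  have "sup_bound \<longlonglongrightarrow> 2 * 0\<^sup>2 + 2 * eval_const\<^sup>2 * ((3 * T + 24) * (0 + rate * (0 * T)))"
    unfolding sup_bound_def[abs_def] by (intro tendsto_intros init_error_tendsto input_tendsto err_bound_tendsto)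
  then show ?thesis by simp
qed

section \<open>The two limits\<close>

definition trunc_gap :: "nat \<Rightarrow> real \<Rightarrow> 'w \<Rightarrow> real" where
  "trunc_gap m t \<omega> = \<bar>Xm m 0 t \<omega> - (\<Sum>k=1..m. vk k t * inner (XX t \<omega>) (e k))\<bar>\<^sup>2"

lemma trunc_gap_measurable:
  assumes m: "1 \<le> m" and t: "t \<in> {0..T}"
  shows "trunc_gap m t \<in> borel_measurable M"
proof -
  have "Xm m 0 t \<in> borel_measurable M" "XX t \<in> borel_measurable M"
    using measurable_F_M[OF progressive_section[OF Xm_process(1)[OF m] t]] measurable_F_M[OF progressive_section[OF XX_progressive t]] by auto
  then show ?thesis
    unfolding trunc_gap_def[abs_def] power2_abs
    by (intro borel_measurable_power borel_measurable_diff borel_measurable_sum borel_measurable_times borel_measurable_inner borel_measurable_const)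
qed

text \<open>A second pass through \<open>ito_estimate\<close>, with suprema over a dyadic level on
  the left and the bounds already obtained on the right. The sum over coordinates of the suprema
  dominates the supremum of the sums, and the bound is the same at every dyadic level.\<close>

lemma sup_trunc_gap_le:
  assumes m: "1 \<le> m"
  shows "(\<integral>\<^sup>+\<omega>. (SUP t\<in>{0..T}. ennreal (trunc_gap m t \<omega>)) \<partial>M) \<le> ennreal (sup_bound m)"
proof (rule sup_dyadic_le[OF T_pos _ trunc_gap_measurable[OF m]])
  show "AE \<omega> in M. continuous_on {0..T} (\<lambda>t. trunc_gap m t \<omega>)"
    using Xm_process(2)[OF m le0] XX_continuous unfolding trunc_gap_def
    by eventually_elim (intro continuous_intros vk_continuous, simp_all)
  fix n
  \<comment> \<open>The level \<top> keeps the gate open; the expectation on the right is known to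
    be finite at this stage.\<close>
  define U where "U = (\<lambda>\<omega>. \<Sum>k\<in>{1..m}. SUP t\<in>dyadic T n. gate \<top> (total_err m) t \<omega> * ennreal ((coeff_err m k t \<omega>)\<^sup>2))"
  have dT: "t \<in> {0..T}" if "t \<in> dyadic T n" for t by (rule subsetD[OF dyadic_subset[OF T_nonneg] that])
  have U: "U \<in> borel_measurable M"
    unfolding U_def gate_top mult_1
  proof (intro borel_measurable_sum borel_measurable_SUP)
    fix k t assume "k \<in> {1..m}" and t: "t \<in> dyadic T n"
    then have "progressive F T (coeff_err m k)" using m by (intro coeff_err_progressive) auto
    from measurable_F_M[OF progressive_section[OF this dT[OF t]]]
    show "(\<lambda>\<omega>. ennreal ((coeff_err m k t \<omega>)\<^sup>2)) \<in> borel_measurable M" by measurable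
  qed (simp add: countable_finite)
  obtain I where I: "\<And>k Q. k \<in> {1..m} \<Longrightarrow> finite Q \<Longrightarrow> Q \<subseteq> {0..T} \<Longrightarrow> real_ito T Q 0
      (\<lambda>r \<omega>. inner (B r (Xm m 0 r \<omega>) (\<alpha> r \<omega>)) (e k) - inner (B r (xt r \<omega>) (\<alpha> r \<omega>)) (e k))
      (\<lambda>r \<omega>. coord (e k) (S r (Xm m 0 r \<omega>) (\<alpha> r \<omega>)) - coord (e k) (S r (xt r \<omega>) (\<alpha> r \<omega>))) (I k) (coeff_err m k)"
    by (rule coeff_err_real_ito[OF m], rule that, assumption+)
  have "(\<integral>\<^sup>+\<omega>. U \<omega> \<partial>M) \<le> ennreal (3 * (\<Sum>k\<in>{1..m}. 0\<^sup>2)) + ennreal (3 * T + 24) * (\<integral>\<^sup>+\<omega>. energy (\<lambda>r \<omega>. gate \<top> (total_err m) r \<omega> * (forcing m r \<omega> + ennreal rate * total_err m r \<omega>)) T \<omega> \<partial>M)"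
    unfolding U_def
  proof (rule ito_estimate[where z="\<lambda>_. 0", OF T_nonneg dyadic_finite dyadic_subset[OF T_nonneg] finite_atLeastAtMost I[OF _ dyadic_finite dyadic_subset[OF T_nonneg]] source_progressive[OF m] total_err_progressive[OF m]])
    show "AE \<omega> in M. \<forall>r\<in>{0..T}. (\<Sum>k\<in>{1..m}. ennreal ((inner (B r (Xm m 0 r \<omega>) (\<alpha> r \<omega>)) (e k) - inner (B r (xt r \<omega>) (\<alpha> r \<omega>)) (e k))\<^sup>2))
      \<le> forcing m r \<omega> + ennreal rate * total_err m r \<omega>" using coeff_err_source(1)[OF m] by simp
    show "AE \<omega> in M. \<forall>r\<in>{0..T}. (\<Sum>k\<in>{1..m}. ennreal ((norm (coord (e k) (S r (Xm m 0 r \<omega>) (\<alpha> r \<omega>)) - coord (e k) (S r (xt r \<omega>) (\<alpha> r \<omega>))))\<^sup>2))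
      \<le> forcing m r \<omega> + ennreal rate * total_err m r \<omega>" using coeff_err_source(2)[OF m] by simp
  qed
  also have "\<dots> \<le> ennreal (3 * T + 24) * ennreal (input m + rate * (err_bound m * T))"
    using mult_left_mono[OF source_energy[OF m], of "ennreal (3 * T + 24)"] by simp
  finally have Ub: "(\<integral>\<^sup>+\<omega>. U \<omega> \<partial>M) \<le> ennreal (3 * T + 24) * ennreal (input m + rate * (err_bound m * T))" .
  have "AE \<omega> in M. (SUP t\<in>dyadic T n. ennreal (trunc_gap m t \<omega>)) \<le> ennreal (2 * (init_error m)\<^sup>2) + ennreal (2 * eval_const\<^sup>2) * U \<omega>"
    using Xm0_sub_xt[OF m]
  proof eventually_elim
    case (elim \<omega>)
    show ?case
    proof (rule SUP_least)
      fix t assume t: "t \<in> dyadic T n"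
      note tT = dT[OF t]
      let ?u = "\<Sum>k=1..m. vk k t * coeff_err m k t \<omega>" and ?s = "\<Sum>k=1..m. (coeff_err m k t \<omega>)\<^sup>2"
      have "trunc_gap m t \<omega> = (init_error m + ?u)\<^sup>2"
        using elim[THEN bspec, OF tT] by (simp add: trunc_gap_def)
      also have "\<dots> \<le> 2 * (init_error m)\<^sup>2 + 2 * ?u\<^sup>2"
        using sum_squares_bound[of "init_error m" ?u] by (simp add: power2_sum)
      also have "?u\<^sup>2 \<le> eval_const\<^sup>2 * ?s"
        by (rule order_trans[OF basis_sum_power2_le[OF basis]], rule mult_right_mono[OF power2_norm_v_le[OF tT]]) (simp add: sum_nonneg)
      finally have "ennreal (trunc_gap m t \<omega>) \<le> ennreal (2 * (init_error m)\<^sup>2 + 2 * eval_const\<^sup>2 * ?s)"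
        by (intro ennreal_leI) simp
      also have "\<dots> = ennreal (2 * (init_error m)\<^sup>2) + ennreal (2 * eval_const\<^sup>2) * (\<Sum>k=1..m. ennreal ((coeff_err m k t \<omega>)\<^sup>2))"
        by (simp add: ennreal_plus ennreal_mult sum_nonneg)
      also have "\<dots> \<le> ennreal (2 * (init_error m)\<^sup>2) + ennreal (2 * eval_const\<^sup>2) * U \<omega>"
        unfolding U_def gate_top mult_1 using t by (intro add_left_mono mult_left_mono sum_mono SUP_upper) auto
      finally show "ennreal (trunc_gap m t \<omega>) \<le> ennreal (2 * (init_error m)\<^sup>2) + ennreal (2 * eval_const\<^sup>2) * U \<omega>" .
    qed
  qed
  then have "(\<integral>\<^sup>+\<omega>. (SUP t\<in>dyadic T n. ennreal (trunc_gap m t \<omega>)) \<partial>M) \<le> (\<integral>\<^sup>+\<omega>. ennreal (2 * (init_error m)\<^sup>2) + ennreal (2 * eval_const\<^sup>2) * U \<omega> \<partial>M)"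
    by (rule nn_integral_mono_AE)
  also have "\<dots> = ennreal (2 * (init_error m)\<^sup>2) + ennreal (2 * eval_const\<^sup>2) * (\<integral>\<^sup>+\<omega>. U \<omega> \<partial>M)"
    using U by (simp add: nn_integral_add nn_integral_cmult emeasure_space_1)
  also have "\<dots> \<le> ennreal (2 * (init_error m)\<^sup>2) + ennreal (2 * eval_const\<^sup>2) * (ennreal (3 * T + 24) * ennreal (input m + rate * (err_bound m * T)))"
    by (intro add_left_mono mult_left_mono Ub) simp
  also have "\<dots> = ennreal (sup_bound m)"
  proof -
    have "0 \<le> input m + rate * (err_bound m * T)"
      using input_nonneg rate_pos err_bound_nonneg T_pos by (intro add_nonneg_nonneg mult_nonneg_nonneg) auto
    then show ?thesis using T_pos unfolding sup_bound_def
      by (subst ennreal_plus, simp, simp) (simp only: ennreal_mult' ennreal_mult'' zero_le_power2 mult_nonneg_nonneg add_nonneg_nonneg zero_le_numeral, simp add: ennreal_mult)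
  qed
  finally show "(\<integral>\<^sup>+\<omega>. (SUP t\<in>dyadic T n. ennreal (trunc_gap m t \<omega>)) \<partial>M) \<le> ennreal (sup_bound m)" .
qed

lemma sup_trunc_gap_tendsto:
  "(\<lambda>m. \<integral>\<^sup>+\<omega>. (SUP t\<in>{0..T}. ennreal (trunc_gap m t \<omega>)) \<partial>M) \<longlonglongrightarrow> 0"
proof (rule tendsto_sandwich[OF always_eventually eventually_sequentiallyI[of 1] tendsto_const])
  show "(\<lambda>m. ennreal (sup_bound m)) \<longlonglongrightarrow> 0" using tendsto_ennrealI[OF sup_bound_tendsto] by simp
qed (simp_all add: sup_trunc_gap_le)

text \<open>The error splits into the gap to the truncated sum and the tail of the lifted process,
  once \<open>X t\<close> is replaced by the evaluated lift outside a null set. The gap is bounded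
  by its supremum in time; the tail is controlled at the fixed time by
  \<open>proj_err_expectation\<close>.\<close>

lemma Xm0_tendsto_X:
  assumes t: "t \<in> {0..T}"
  shows "(\<lambda>m. \<integral>\<^sup>+\<omega>. ennreal (\<bar>Xm m 0 t \<omega> - X t \<omega>\<bar>\<^sup>2) \<partial>M) \<longlonglongrightarrow> 0"
proof -
  let ?g = "\<lambda>m. \<integral>\<^sup>+\<omega>. (SUP t\<in>{0..T}. ennreal (trunc_gap m t \<omega>)) \<partial>M"
  let ?p = "\<lambda>m. \<integral>\<^sup>+\<omega>. ennreal ((norm (proj_err m t \<omega>))\<^sup>2) \<partial>M"
  have le: "(\<integral>\<^sup>+\<omega>. ennreal (\<bar>Xm m 0 t \<omega> - X t \<omega>\<bar>\<^sup>2) \<partial>M) \<le> 2 * ?g m + ennreal (2 * eval_const\<^sup>2) * ?p m" if m: "1 \<le> m" for m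
  proof -
    have "AE \<omega> in M. ennreal (\<bar>Xm m 0 t \<omega> - X t \<omega>\<bar>\<^sup>2) \<le> ennreal 2 * ennreal (trunc_gap m t \<omega>) + ennreal (2 * eval_const\<^sup>2) * ennreal ((norm (proj_err m t \<omega>))\<^sup>2)"
      using X_eq_xt[OF t]
    proof eventually_elim
      case (elim \<omega>)
      define u w where "u = Xm m 0 t \<omega> - (\<Sum>k=1..m. vk k t * inner (XX t \<omega>) (e k))" and "w = inner (v t) (proj_err m t \<omega>)"
      have "Xm m 0 t \<omega> - X t \<omega> = u - w" unfolding u_def w_def trunc_sum_eq[OF t] elim by simp
      moreover have "(u - w)\<^sup>2 \<le> 2 * u\<^sup>2 + 2 * w\<^sup>2"
        using sum_squares_bound[of u "- w"] by (simp add: power2_diff)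
      moreover have "w\<^sup>2 \<le> eval_const\<^sup>2 * (norm (proj_err m t \<omega>))\<^sup>2" unfolding w_def by (rule power2_inner_v_le[OF t])
      ultimately have "\<bar>Xm m 0 t \<omega> - X t \<omega>\<bar>\<^sup>2 \<le> 2 * u\<^sup>2 + 2 * eval_const\<^sup>2 * (norm (proj_err m t \<omega>))\<^sup>2" by simp
      also have "u\<^sup>2 = trunc_gap m t \<omega>" by (simp add: trunc_gap_def u_def)
      finally have "ennreal (\<bar>Xm m 0 t \<omega> - X t \<omega>\<bar>\<^sup>2) \<le> ennreal (2 * trunc_gap m t \<omega> + 2 * eval_const\<^sup>2 * (norm (proj_err m t \<omega>))\<^sup>2)"
        by (rule ennreal_leI)
      also have "\<dots> = ennreal 2 * ennreal (trunc_gap m t \<omega>) + ennreal (2 * eval_const\<^sup>2) * ennreal ((norm (proj_err m t \<omega>))\<^sup>2)"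
      proof -
        have "0 \<le> trunc_gap m t \<omega>" by (simp add: trunc_gap_def)
        then show ?thesis by (subst ennreal_plus) (simp_all add: ennreal_mult)
      qed
      finally show ?case .
    qed
    then have "(\<integral>\<^sup>+\<omega>. ennreal (\<bar>Xm m 0 t \<omega> - X t \<omega>\<bar>\<^sup>2) \<partial>M)
      \<le> (\<integral>\<^sup>+\<omega>. ennreal 2 * ennreal (trunc_gap m t \<omega>) + ennreal (2 * eval_const\<^sup>2) * ennreal ((norm (proj_err m t \<omega>))\<^sup>2) \<partial>M)"
      by (rule nn_integral_mono_AE)
    also have "\<dots> = ennreal 2 * (\<integral>\<^sup>+\<omega>. ennreal (trunc_gap m t \<omega>) \<partial>M) + ennreal (2 * eval_const\<^sup>2) * ?p m"
      using trunc_gap_measurable[OF m t] measurable_F_M[OF progressive_section[OF proj_err_progressive t]]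
      by (simp add: nn_integral_add nn_integral_cmult)
    also have "\<dots> \<le> ennreal 2 * ?g m + ennreal (2 * eval_const\<^sup>2) * ?p m"
      by (intro add_right_mono mult_left_mono nn_integral_mono SUP_upper t) simp
    finally show ?thesis by simp
  qed
  have "(\<lambda>m. ennreal 2 * ?g m + ennreal (2 * eval_const\<^sup>2) * ?p m) \<longlonglongrightarrow> ennreal 2 * 0 + ennreal (2 * eval_const\<^sup>2) * 0"
    by (intro tendsto_add ennreal_tendsto_cmult sup_trunc_gap_tendsto proj_err_expectation t) simp_all
  then have lim: "(\<lambda>m. 2 * ?g m + ennreal (2 * eval_const\<^sup>2) * ?p m) \<longlonglongrightarrow> 0" by simp
  show ?thesis
    by (rule tendsto_sandwich[OF always_eventually eventually_sequentiallyI[of 1] tendsto_const lim]) (use le in simp_all)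
qed

end

theorem proposition5p1:
  fixes T x0 :: real
    and M :: "'w measure"
    and W :: "real \<Rightarrow> 'w \<Rightarrow> real ^ 'd"
    and val :: "'h::{real_inner, banach, second_countable_topology} \<Rightarrow> real \<Rightarrow> real"
    and b :: "real \<Rightarrow> real \<Rightarrow> real \<Rightarrow> 'a::polish_space \<Rightarrow> real"
    and \<sigma> :: "real \<Rightarrow> real \<Rightarrow> real \<Rightarrow> 'a \<Rightarrow> real ^ 'd"
    and \<alpha> :: "real \<Rightarrow> 'w \<Rightarrow> 'a"
    and xx :: 'h
    and v :: "real \<Rightarrow> 'h"
    and e :: "nat \<Rightarrow> 'h"
    and X :: "real \<Rightarrow> 'w \<Rightarrow> real"
    and XX :: "real \<Rightarrow> 'w \<Rightarrow> 'h"
    and Xm :: "nat \<Rightarrow> nat \<Rightarrow> real \<Rightarrow> 'w \<Rightarrow> real"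
  defines "F \<equiv> natural_filtration M W"
    and "B \<equiv> lift_drift T val b"
    and "S \<equiv> lift_vol T val \<sigma>"
    and "vk \<equiv> (\<lambda>k t. inner (v t) (e k))"
  assumes T_pos: "T > 0"
    and H: "sobolev_model T val"
    and coeffs: "standing_assumption T val b \<sigma>"
    and BM: "brownian_motion M W"
    and control: "progressive F T \<alpha>"
    and xx: "\<forall>t\<in>{0..T}. val xx t = x0"
    and X: "volterra_solution M F W T x0 b \<sigma> \<alpha> X"
    and XX: "ito_process M F W T xx
               (\<lambda>r \<omega>. B r (val (XX r \<omega>) r) (\<alpha> r \<omega>))
               (\<lambda>r \<omega>. S r (val (XX r \<omega>) r) (\<alpha> r \<omega>)) XX"
    and riesz: "\<forall>t\<in>{0..T}. \<forall>h. inner (v t) h = val h t"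
    and basis: "orthonormal_basis e"
    and trunc: "\<forall>m\<ge>1. truncated_system M F W T x0 (\<lambda>k. inner xx (e k)) vk
                  (drift_coeff B e) (vol_coeff S e) \<alpha> m (Xm m)"
  shows "((\<lambda>m. \<integral>\<^sup>+ \<omega>. (SUP t\<in>{0..T}.
             ennreal (\<bar>Xm m 0 t \<omega> - (\<Sum>k=1..m. vk k t * inner (XX t \<omega>) (e k))\<bar>\<^sup>2)) \<partial>M)
           \<longlonglongrightarrow> 0) \<and>
         (\<forall>t\<in>{0..T}. (\<lambda>m. \<integral>\<^sup>+ \<omega>. ennreal (\<bar>Xm m 0 t \<omega> - X t \<omega>\<bar>\<^sup>2) \<partial>M) \<longlonglongrightarrow> 0)"
proof -
  interpret volterra_lift M W T x0 val b \<sigma> \<alpha> xx v e X XX Xm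
    using BM T_pos H coeffs xx X XX riesz basis trunc
    unfolding F_def B_def S_def vk_def by unfold_locales
  show ?thesis
    using sup_trunc_gap_tendsto Xm0_tendsto_X by (simp add: trunc_gap_def vk_def)
qed

end
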